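(* Consider the hidden Markov model and its bootstrap particle filter $(\pi^N_k)_{k\ge0}$, $N\ge1$, described in the context. Suppose that the nondegeneracy, ergodicity and continuity assumptions stated in the context hold, and that for any sequence $T_N\nearrow\infty$ the family of probability measures $$\Xi_N(A)=\mathbf E\left[\frac1{T_N}\sum_{k=1}^{T_N}\pi^N_k(A)\right],\qquad N\ge1,$$ on $E$ is tight. Then $$\lim_{N\to\infty}\ \sup_{T\ge1}\ \mathbf E\left[\frac1T\sum_{k=1}^T\|\pi^N_k-\pi_k\|_{\rm BL}\right]=0 .$$
   Context: Model. $E$ and $F$ are Polish spaces with Borel $\sigma$-fields; $P:E\times\mathcal B(E)\to[0,1]$ and $\Phi:E\times\mathcal B(F)\to[0,1]$ are transition probability kernels; $\mu$ is a probability measure on $E$. $(X_k,Y_k)_{k\ge0}$ is a hidden Markov model on $(\Omega,\mathcal F,\mathbf P)$: $(X_k)$ is a Markov chain with initial law $\mu$ and transition kernel $P$, and $(Y_k)$ are conditionally independent given $(X_k)$ with $\mathbf P(Y_n\in A|X_n)=\Phi(X_n,A)$. $\mathcal P(E)$ is the space of probability measures on $E$ with the weak convergence topology and its Borel $\sigma$-field. $d$ is a fixed complete metric generating the topology of $E$; $\|\nu-\nu'\|_{\rm BL}=\sup\{|\int f\,d\nu-\int f\,d\nu'|:\|f\|_\infty\le1,\ f\text{ is }1\text{-Lipschitz}\}$ and $\|\nu-\nu'\|_{\rm TV}=\sup_{\|f\|_\infty\le1}|\int f\,d\nu-\int f\,d\nu'|$. $T_N\nearrow\infty$ means a nondecreasing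 sequence of positive integers tending to infinity. Nondegeneracy assumption: there are a $\sigma$-finite measure $\varphi$ on $F$ and a strictly positive measurable $\Upsilon:E\times F\to(0,\infty)$ with $\Phi(x,A)=\int_A\Upsilon(x,y)\,\varphi(dy)$ for all $x\in E$, $A\in\mathcal B(F)$. Ergodicity assumption: there is a (unique) $P$-invariant $\lambda\in\mathcal P(E)$ such that $\|\nu P^k-\lambda\|_{\rm TV}\to0$ as $k\to\infty$ for every $\nu\in\mathcal P(E)$. Continuity assumption: $P$ is Feller ($x\mapsto P(x,\cdot)$ is weakly continuous), and for every $y\in F$ the map $x\mapsto\Upsilon(x,y)$ is continuous and bounded. Exact filter: for $\pi\in\mathcal P(E)$, $y\in F$, put $\mathsf U(y,\pi)(A)=\int_A\Upsilon(x,y)\,\pi(dx)\big/\int\Upsilon(x,y)\,\pi(dx)$. The nonlinear filter is $\pi_0=\mathsf U(Y_0,\mu)$, $\pi_k=\mathsf U(Y_k,\pi_{k-1}P)$; it is a version of the conditional law of $X_k$ given $Y_0,\dots,Y_k$. Bootstrap particle filter with $N$ particles: sample $x^1_0,\dots,x^N_0$ i.i.d. from $\mu$ and set $\pi^N_0=\mathsf U(Y_0,\frac1N\sum_i\delta_{x^i_0})$; for $k\ge1$, given the past, sample $x^1_k,\dots,x^N_k$ i.i.d. from $\pi^N_{k-1}P$ and set $\pi^N_k=\mathsf U(Y_k,\frac1N\sum_i\delta_{x_k^i})$. The random draws at each step are generated using a countable family of i.i.d. $\mathrm{Unif}(0,1)$ variables independent of $(X_k,Y_k)_{k\ge0}$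 (fresh variables at each step), so that $\pi^N_k$ is measurable with respect to $\sigma\{Y_0,\dots,Y_k\}\vee\mathcal G$, where $\mathcal G$ is the $\sigma$-field generated by these uniform variables. *)

theory Defs
  imports "HOL-Probability.Probability"
begin

section \<open>Distances, weak continuity and tightness on a Polish space\<close>

text \<open>A type of class \<^class>\<open>polish_space\<close> carries a complete metric \<^const>\<open>dist\<close> generating its
  topology; this is the fixed metric in the bounded-Lipschitz norm.\<close>

definition bl_dist :: "'e::polish_space measure \<Rightarrow> 'e measure \<Rightarrow> real" where
  "bl_dist \<nu> \<nu>' = (SUP f \<in> {f :: 'e \<Rightarrow> real. (\<forall>x. \<bar>f x\<bar> \<le> 1) \<and> 1-lipschitz_on UNIV f}.
      \<bar>(\<integral>x. f x \<partial>\<nu>) - (\<integral>x. f x \<partial>\<nu>')\<bar>)"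

definition tv_dist :: "'e::polish_space measure \<Rightarrow> 'e measure \<Rightarrow> real" where
  "tv_dist \<nu> \<nu>' = (SUP f \<in> {f :: 'e \<Rightarrow> real. f \<in> borel_measurable borel \<and> (\<forall>x. \<bar>f x\<bar> \<le> 1)}.
      \<bar>(\<integral>x. f x \<partial>\<nu>) - (\<integral>x. f x \<partial>\<nu>')\<bar>)"

definition tight_family :: "'e::polish_space measure set \<Rightarrow> bool" where
  "tight_family \<N> \<longleftrightarrow> (\<forall>\<epsilon>>0. \<exists>K. compact K \<and> (\<forall>\<nu>\<in>\<N>. measure \<nu> (UNIV - K) \<le> \<epsilon>))"


section \<open>Transition kernels\<close>

definition kernel :: "('e::polish_space \<Rightarrow> 'f::polish_space measure) \<Rightarrow> bool" where
  "kernel K \<longleftrightarrow> K \<in> borel \<rightarrow>\<^sub>M prob_algebra borel"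

text \<open>The measure \<open>\<nu>P\<close> is the monadic composition \<open>\<nu> \<bind> P\<close> (\<^const>\<open>Giry_Monad.bind\<close>).\<close>

definition ergodic_kernel :: "('e::polish_space \<Rightarrow> 'e measure) \<Rightarrow> bool" where
  "ergodic_kernel P \<longleftrightarrow> (\<exists>l \<in> space (prob_algebra borel). l \<bind> P = l \<and>
      (\<forall>\<nu> \<in> space (prob_algebra borel). (\<lambda>k. tv_dist (((\<lambda>m. m \<bind> P) ^^ k) \<nu>) l) \<longlonglongrightarrow> 0))"

definition feller :: "('e::polish_space \<Rightarrow> 'e measure) \<Rightarrow> bool" where
  "feller P \<longleftrightarrow> (\<forall>f :: 'e \<Rightarrow> real. continuous_on UNIV f \<and> bounded (range f) \<longrightarrow>
      continuous_on UNIV (\<lambda>x. \<integral>z. f z \<partial>P x))"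

definition nondegenerate ::
  "('e::polish_space \<Rightarrow> 'f::polish_space measure) \<Rightarrow> 'f measure \<Rightarrow> ('e \<Rightarrow> 'f \<Rightarrow> real) \<Rightarrow> bool" where
  "nondegenerate \<Phi> \<phi> \<Upsilon> \<longleftrightarrow>
     sigma_finite_measure \<phi> \<and> sets \<phi> = sets borel \<and>
     (\<lambda>(x, y). \<Upsilon> x y) \<in> borel_measurable (borel \<Otimes>\<^sub>M borel) \<and>
     (\<forall>x y. 0 < \<Upsilon> x y) \<and>
     (\<forall>x. \<forall>A \<in> sets borel. emeasure (\<Phi> x) A = (\<integral>\<^sup>+y\<in>A. ennreal (\<Upsilon> x y) \<partial>\<phi>))"


section \<open>Hidden Markov model\<close>

definition events :: "'w measure \<Rightarrow> ('i \<Rightarrow> 'w \<Rightarrow> 'b::topological_space) \<Rightarrow> 'i set \<Rightarrow> 'w set set" where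
  "events M Z I = {Z i -` A \<inter> space M | i A. i \<in> I \<and> A \<in> sets borel}"

definition sigma_gen_by ::
  "'w measure \<Rightarrow> ('i \<Rightarrow> 'w \<Rightarrow> 'b::topological_space) \<Rightarrow> 'i set \<Rightarrow> 'w measure" where
  "sigma_gen_by M Z I = sigma (space M) (events M Z I)"

definition cond_prob_given :: "'w measure \<Rightarrow> 'w measure \<Rightarrow> 'w set \<Rightarrow> 'w \<Rightarrow> real" where
  "cond_prob_given M G B = real_cond_exp M G (indicator B)"

definition markov_chain ::
  "'w measure \<Rightarrow> (nat \<Rightarrow> 'w \<Rightarrow> 'e::polish_space) \<Rightarrow> 'e measure \<Rightarrow> ('e \<Rightarrow> 'e measure) \<Rightarrow> bool" where
  "markov_chain M X \<mu> P \<longleftrightarrow>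
     (\<forall>k. X k \<in> borel_measurable M) \<and>
     distr M borel (X 0) = \<mu> \<and>
     (\<forall>n. \<forall>A \<in> sets borel. AE \<omega> in M.
        cond_prob_given M (sigma_gen_by M X {..n}) {\<omega> \<in> space M. X (Suc n) \<omega> \<in> A} \<omega>
          = measure (P (X n \<omega>)) A)"

definition cond_indep_given ::
  "'w measure \<Rightarrow> 'w measure \<Rightarrow> (nat \<Rightarrow> 'w \<Rightarrow> 'f::polish_space) \<Rightarrow> bool" where
  "cond_indep_given M G Y \<longleftrightarrow>
     (\<forall>J A. finite J \<and> (\<forall>j\<in>J. A j \<in> sets borel) \<longrightarrow>
        (AE \<omega> in M. cond_prob_given M G {\<omega> \<in> space M. \<forall>j\<in>J. Y j \<omega> \<in> A j} \<omega>
          = (\<Prod>j\<in>J. cond_prob_given M G {\<omega> \<in> space M. Y j \<omega> \<in> A j} \<omega>)))"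

text \<open>In a hidden Markov model the law of \<open>Y n\<close> given the \<^emph>\<open>whole\<close> signal is \<open>\<Phi> (X n)\<close>. Conditioning
  on \<open>X n\<close> alone in the last clause would also admit models such as \<open>Y n = X (n + 1)\<close>.\<close>

definition hidden_markov_model ::
  "'w measure \<Rightarrow> (nat \<Rightarrow> 'w \<Rightarrow> 'e::polish_space) \<Rightarrow> (nat \<Rightarrow> 'w \<Rightarrow> 'f::polish_space) \<Rightarrow>
   'e measure \<Rightarrow> ('e \<Rightarrow> 'e measure) \<Rightarrow> ('e \<Rightarrow> 'f measure) \<Rightarrow> bool" where
  "hidden_markov_model M X Y \<mu> P \<Phi> \<longleftrightarrow>
     prob_space M \<and> \<mu> \<in> space (prob_algebra borel) \<and> kernel P \<and> kernel \<Phi> \<and>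
     markov_chain M X \<mu> P \<and>
     (\<forall>k. Y k \<in> borel_measurable M) \<and>
     cond_indep_given M (sigma_gen_by M X UNIV) Y \<and>
     (\<forall>n. \<forall>A \<in> sets borel. AE \<omega> in M.
        cond_prob_given M (sigma_gen_by M X UNIV) {\<omega> \<in> space M. Y n \<omega> \<in> A} \<omega>
          = measure (\<Phi> (X n \<omega>)) A)"


section \<open>Exact filter\<close>

definition bayes :: "('e::polish_space \<Rightarrow> 'f \<Rightarrow> real) \<Rightarrow> 'f \<Rightarrow> 'e measure \<Rightarrow> 'e measure" where
  "bayes \<Upsilon> y \<pi> = density \<pi> (\<lambda>x. ennreal (\<Upsilon> x y) / (\<integral>\<^sup>+z. ennreal (\<Upsilon> z y) \<partial>\<pi>))"

lemma emeasure_bayes: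
  assumes "sets \<pi> = sets borel" "(\<lambda>x. \<Upsilon> x y) \<in> borel_measurable borel" "A \<in> sets borel"
  shows "emeasure (bayes \<Upsilon> y \<pi>) A
    = (\<integral>\<^sup>+x\<in>A. ennreal (\<Upsilon> x y) \<partial>\<pi>) / (\<integral>\<^sup>+x. ennreal (\<Upsilon> x y) \<partial>\<pi>)"
proof -
  have [measurable]: "(\<lambda>x. \<Upsilon> x y) \<in> borel_measurable \<pi>" "A \<in> sets \<pi>"
    using assms by (auto cong: measurable_cong_sets)
  have "emeasure (bayes \<Upsilon> y \<pi>) A
      = (\<integral>\<^sup>+x. (ennreal (\<Upsilon> x y) * indicator A x) / (\<integral>\<^sup>+z. ennreal (\<Upsilon> z y) \<partial>\<pi>) \<partial>\<pi>)"
    by (simp add: bayes_def emeasure_density divide_ennreal_def mult_ac)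
  then show ?thesis by (simp add: nn_integral_divide)
qed

primrec nonlinear_filter ::
  "'e measure \<Rightarrow> ('e::polish_space \<Rightarrow> 'e measure) \<Rightarrow> ('e \<Rightarrow> 'f \<Rightarrow> real) \<Rightarrow> (nat \<Rightarrow> 'w \<Rightarrow> 'f) \<Rightarrow>
   nat \<Rightarrow> 'w \<Rightarrow> 'e measure" where
  "nonlinear_filter \<mu> P \<Upsilon> Y 0 \<omega> = bayes \<Upsilon> (Y 0 \<omega>) \<mu>"
| "nonlinear_filter \<mu> P \<Upsilon> Y (Suc k) \<omega>
     = bayes \<Upsilon> (Y (Suc k) \<omega>) (nonlinear_filter \<mu> P \<Upsilon> Y k \<omega> \<bind> P)"


section \<open>Bootstrap particle filter\<close>

definition empirical :: "nat \<Rightarrow> (nat \<Rightarrow> 'e::polish_space) \<Rightarrow> 'e measure" where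
  "empirical N z = distr (uniform_count_measure {..<N}) borel z"

lemma emeasure_empirical:
  assumes "0 < N" "A \<in> sets borel"
  shows "emeasure (empirical N z) A = (\<Sum>i<N. indicator A (z i)) / of_nat N"
proof -
  have "emeasure (empirical N z) A = of_nat (card (z -` A \<inter> {..<N})) / of_nat N"
    using assms
    by (simp add: empirical_def emeasure_distr space_uniform_count_measure
        emeasure_uniform_count_measure ennreal_of_nat_eq_real_of_nat divide_ennreal)
  moreover have "(\<Sum>i<N. indicator A (z i) :: ennreal) = of_nat (card (z -` A \<inter> {..<N}))"
    by (simp add: indicator_def sum.If_cases Int_def vimage_def conj_commute)
  ultimately show ?thesis by simp
qed

text \<open>\<open>x N k i\<close> is the position of particle \<open>i < N\<close> at time \<open>k\<close> in the \<open>N\<close>-particle system, before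
  weighting by the observation \<open>Y k\<close>.\<close>

definition particle_filter ::
  "('e::polish_space \<Rightarrow> 'f \<Rightarrow> real) \<Rightarrow> (nat \<Rightarrow> 'w \<Rightarrow> 'f) \<Rightarrow> (nat \<Rightarrow> nat \<Rightarrow> nat \<Rightarrow> 'w \<Rightarrow> 'e) \<Rightarrow>
   nat \<Rightarrow> nat \<Rightarrow> 'w \<Rightarrow> 'e measure" where
  "particle_filter \<Upsilon> Y x N k \<omega> = bayes \<Upsilon> (Y k \<omega>) (empirical N (\<lambda>i. x N k i \<omega>))"

primrec sampling_law ::
  "'e measure \<Rightarrow> ('e::polish_space \<Rightarrow> 'e measure) \<Rightarrow> ('e \<Rightarrow> 'f \<Rightarrow> real) \<Rightarrow> (nat \<Rightarrow> 'w \<Rightarrow> 'f) \<Rightarrow>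
   (nat \<Rightarrow> nat \<Rightarrow> nat \<Rightarrow> 'w \<Rightarrow> 'e) \<Rightarrow> nat \<Rightarrow> nat \<Rightarrow> 'w \<Rightarrow> 'e measure" where
  "sampling_law \<mu> P \<Upsilon> Y x N 0 \<omega> = \<mu>"
| "sampling_law \<mu> P \<Upsilon> Y x N (Suc k) \<omega> = particle_filter \<Upsilon> Y x N k \<omega> \<bind> P"

text \<open>The random inputs: \<open>\<xi> (k, j)\<close>, \<open>j = 0, 1, \<dots>\<close>, are the uniform variables available at step \<open>k\<close>.\<close>

definition uniform_inputs ::
  "'w measure \<Rightarrow> (nat \<Rightarrow> 'w \<Rightarrow> 'e::polish_space) \<Rightarrow> (nat \<Rightarrow> 'w \<Rightarrow> 'f::polish_space) \<Rightarrow>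
   (nat \<times> nat \<Rightarrow> 'w \<Rightarrow> real) \<Rightarrow> bool" where
  "uniform_inputs M X Y \<xi> \<longleftrightarrow>
     prob_space.indep_vars M (\<lambda>_. borel) \<xi> UNIV \<and>
     (\<forall>p. distr M borel (\<xi> p) = uniform_measure lborel {0<..<1}) \<and>
     prob_space.indep_set M
       (sets (sigma (space M) (events M X UNIV \<union> events M Y UNIV)))
       (sets (sigma_gen_by M \<xi> UNIV))"

definition observed_past ::
  "'w measure \<Rightarrow> (nat \<Rightarrow> 'w \<Rightarrow> 'f::polish_space) \<Rightarrow> (nat \<times> nat \<Rightarrow> 'w \<Rightarrow> real) \<Rightarrow> nat \<Rightarrow> nat \<Rightarrow> 'w measure" where
  "observed_past M Y \<xi> m k = sigma (space M) (events M Y {..<m} \<union> events M \<xi> ({..<k} \<times> UNIV))"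

text \<open>The particles of step \<open>k\<close> are computed from \<open>Y 0, \<dots>, Y (k - 1)\<close> and the uniform variables of
  steps \<open>0, \<dots>, k\<close>; conditionally on the observations and uniform variables of the steps before
  \<open>k\<close>, which determine all earlier particles, they are i.i.d. with law \<^const>\<open>sampling_law\<close>.\<close>

definition bootstrap_particles ::
  "'w measure \<Rightarrow> (nat \<Rightarrow> 'w \<Rightarrow> 'f::polish_space) \<Rightarrow> 'e measure \<Rightarrow> ('e::polish_space \<Rightarrow> 'e measure) \<Rightarrow>
   ('e \<Rightarrow> 'f \<Rightarrow> real) \<Rightarrow> (nat \<times> nat \<Rightarrow> 'w \<Rightarrow> real) \<Rightarrow> (nat \<Rightarrow> nat \<Rightarrow> nat \<Rightarrow> 'w \<Rightarrow> 'e) \<Rightarrow> bool" where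
  "bootstrap_particles M Y \<mu> P \<Upsilon> \<xi> x \<longleftrightarrow> (\<forall>N\<ge>1. \<forall>k.
     (\<forall>i<N. x N k i \<in> observed_past M Y \<xi> k (Suc k) \<rightarrow>\<^sub>M borel) \<and>
     (\<forall>A. (\<forall>i<N. A i \<in> sets borel) \<longrightarrow>
        (AE \<omega> in M. cond_prob_given M (observed_past M Y \<xi> k k)
             {\<omega> \<in> space M. \<forall>i<N. x N k i \<omega> \<in> A i} \<omega>
           = (\<Prod>i<N. measure (sampling_law \<mu> P \<Upsilon> Y x N k \<omega>) (A i)))))"

text \<open>The measure \<open>\<Xi>\<^sub>N\<close>, with \<open>\<pi> k \<omega>\<close> the \<open>N\<close>-particle filter and horizon \<open>T\<close>.\<close>

definition averaged_law ::
  "'w measure \<Rightarrow> (nat \<Rightarrow> 'w \<Rightarrow> 'e::polish_space measure) \<Rightarrow> nat \<Rightarrow> 'e measure" where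
  "averaged_law M \<pi> T = measure_of UNIV (sets borel)
     (\<lambda>A. \<integral>\<^sup>+\<omega>. (\<Sum>k=1..T. emeasure (\<pi> k \<omega>) A) / of_nat T \<partial>M)"

end

theory Submission
  imports Defs
begin

text \<open>
  The pair of exact and particle filter is compared through the functions \<open>Dist r\<close>: \<open>Dist 0\<close> is the
  bounded-Lipschitz distance, and \<open>Dist (Suc r) \<nu> \<nu>'\<close> is the mean of \<open>Dist r\<close> after both \<open>\<nu>\<close> and \<open>\<nu>'\<close>
  have made one exact filtering step driven by the same observation, generated from \<open>\<nu>'\<close>. Hence
  \<open>Dist r \<nu> \<nu>'\<close> is the expected distance after \<open>r\<close> steps between the filter started at the wrong law \<open>\<nu>\<close> and the
  correctly started one, and filter stability says that it tends to \<open>0\<close>.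

  Stability is proved on the chain consisting of the signal and its observation history, started from
  \<open>\<rho> = (\<nu> + \<nu>') / 2\<close>. The densities of its laws under \<open>\<nu>\<close> with respect to those under \<open>\<rho>\<close> have decreasing second
  moments, so they hardly change over \<open>m\<close> further steps. Comparison with a chain of independent
  observations shows that the \<open>m\<close>-step transitions from two typical signal values overlap uniformly in
  the history, because of ergodicity and \<open>\<Upsilon> > 0\<close>. So the densities become independent of the signal value,
  which means that the two filters merge.

  Suppose now that the time-averaged error does not tend to \<open>0\<close> uniformly in the horizon, and consider a
  sequence of particle numbers and horizons along which it stays large. The horizons are unbounded
  by consistency on finite time intervals. The average of \<open>Dist r\<close> along the particle system is
  asymptotically the same for all \<open>r\<close>, since the sampling error vanishes uniformly on tight sets of
  measures by the law of large numbers. A weak limit of the joint law of all the values \<open>Dist r\<close> is therefore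
  concentrated, up to small mass, on sequences that tend to \<open>0\<close>, but all its coordinates have a large mean.
\<close>

section \<open>Weak convergence and the bounded-Lipschitz distance\<close>

text \<open>Ergodicity comes without a rate, so neither filter stability nor the sampling error can
  be iterated with a contraction constant, and errors made at different times could pile up. The
  time average resolves this. Shifting time by one step changes an average over \<open>T\<close>
  steps by at most \<open>2 / T\<close>, so for long horizons the mean of \<open>Dist r\<close>
  cannot depend on \<open>r\<close>, although \<open>Dist r\<close> decays at every fixed pair of
  laws. Compactness turns this pointwise decay into a contradiction; the continuity assumptions make
  every \<open>Dist r\<close> weakly continuous.

  In the stability proof the two initial laws may be mutually singular; the mixture makes both
  absolutely continuous, with densities at most \<open>2\<close>. These densities form a backward
  martingale, whence the monotone second moments. The difficulty is that transitions have to overlap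
  at one and the same observation history. Against independent observations the history carries no
  information on the signal, so there the mixing of the signal alone decides.\<close>

abbreviation PA :: "'e::polish_space measure measure" where
  "PA \<equiv> prob_algebra borel"

text \<open>Weak convergence is used along sequences only, so no topology on the space of measures
  is set up; compactness and continuity below are sequential as well.\<close>

definition wconv :: "(nat \<Rightarrow> 'e::polish_space measure) \<Rightarrow> 'e measure \<Rightarrow> bool" where
  "wconv \<nu> l \<longleftrightarrow> (\<forall>f :: 'e \<Rightarrow> real. continuous_on UNIV f \<and> bounded (range f) \<longrightarrow>
      (\<lambda>n. LINT x|\<nu> n. f x) \<longlonglongrightarrow> (LINT x|l. f x))"

definition BL1 :: "('e::polish_space \<Rightarrow> real) set" where
  "BL1 = {f. (\<forall>x. \<bar>f x\<bar> \<le> 1) \<and> 1-lipschitz_on UNIV f}"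

lemma bl_dist_alt: "bl_dist \<nu> \<nu>' = (SUP f\<in>BL1. \<bar>(LINT x|\<nu>. f x) - (LINT x|\<nu>'. f x)\<bar>)"
  by (simp add: bl_dist_def BL1_def)

lemma PA_D: "\<nu> \<in> space PA \<Longrightarrow> prob_space \<nu>" "\<nu> \<in> space PA \<Longrightarrow> sets \<nu> = sets borel"
  by (auto simp: space_prob_algebra)

lemma PA_space: "\<nu> \<in> space PA \<Longrightarrow> space \<nu> = UNIV"
  using sets_eq_imp_space_eq[of \<nu> borel] by (auto simp: space_prob_algebra)

lemma PA_I: "prob_space \<nu> \<Longrightarrow> sets \<nu> = sets borel \<Longrightarrow> \<nu> \<in> space PA"
  by (auto simp: space_prob_algebra)

lemma PA_measure_mono:
  assumes "\<nu> \<in> space PA" "B \<in> sets borel" "A \<subseteq> B" shows "measure \<nu> A \<le> measure \<nu> B"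
  using assms PA_D(2)[OF assms(1)] PA_D(1)[OF assms(1)]
  by (intro finite_measure.finite_measure_mono) (auto simp: prob_space_def)

lemma PA_measurable: "\<nu> \<in> space PA \<Longrightarrow> f \<in> borel_measurable borel \<Longrightarrow> f \<in> borel_measurable \<nu>"
  by (auto simp: space_prob_algebra cong: measurable_cong_sets)

lemma pa_integrable:
  fixes f :: "_ \<Rightarrow> real"
  assumes "N \<in> space (prob_algebra A)" "f \<in> borel_measurable A" "\<And>x. x \<in> space A \<Longrightarrow> \<bar>f x\<bar> \<le> B"
  shows "integrable N f"
proof -
  interpret prob_space N using assms(1) by (simp add: space_prob_algebra)
  have s: "sets N = sets A" using assms(1) by (simp add: space_prob_algebra)
  then show ?thesis
    using assms sets_eq_imp_space_eq[OF s] by (intro integrable_const_bound[of _ B]) (auto cong: measurable_cong_sets)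
qed

lemma pa_integral_le:
  fixes f :: "_ \<Rightarrow> real"
  assumes N: "N \<in> space (prob_algebra A)" and f: "f \<in> borel_measurable A" "\<And>x. x \<in> space A \<Longrightarrow> \<bar>f x\<bar> \<le> B"
  shows "\<bar>LINT x|N. f x\<bar> \<le> B"
proof -
  interpret prob_space N using N by (simp add: space_prob_algebra)
  have s: "space N = space A" using N by (intro sets_eq_imp_space_eq) (simp add: space_prob_algebra)
  have "\<bar>LINT x|N. f x\<bar> \<le> (LINT x|N. \<bar>f x\<bar>)" by (rule integral_abs_bound)
  also have "\<dots> \<le> B" using pa_integrable[OF N f] f(2) s by (intro integral_le_const) auto
  finally show ?thesis .
qed

lemma pa_integral01:
  fixes f :: "_ \<Rightarrow> real"
  assumes N: "N \<in> space (prob_algebra A)" and f: "f \<in> borel_measurable A" "\<And>x. 0 \<le> f x" "\<And>x. f x \<le> B"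
  shows "0 \<le> (LINT x|N. f x)" "(LINT x|N. f x) \<le> B" "(\<integral>\<^sup>+x. ennreal (f x) \<partial>N) = ennreal (LINT x|N. f x)"
proof -
  have b: "\<bar>f x\<bar> \<le> B" for x using f(2,3)[of x] by simp
  show "0 \<le> (LINT x|N. f x)" using f(2) by (intro integral_nonneg_AE) auto
  show "(LINT x|N. f x) \<le> B" using pa_integral_le[OF N f(1) b] by simp
  show "(\<integral>\<^sup>+x. ennreal (f x) \<partial>N) = ennreal (LINT x|N. f x)"
    using pa_integrable[OF N f(1) b] f(2) by (intro nn_integral_eq_integral) auto
qed

section \<open>Bounded-Lipschitz test functions and their distance\<close>

lemma BL1_cont: "f \<in> BL1 \<Longrightarrow> continuous_on UNIV f"
  by (auto simp: BL1_def intro: lipschitz_on_continuous_on)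

lemma BL1_meas: "f \<in> BL1 \<Longrightarrow> f \<in> borel_measurable borel"
  by (intro borel_measurable_continuous_onI BL1_cont)

lemma BL1_lip: "f \<in> BL1 \<Longrightarrow> \<bar>f x - f y\<bar> \<le> dist x y"
  using lipschitz_onD[of 1 UNIV f x y] by (auto simp: BL1_def dist_real_def)

lemma BL1_zero: "(\<lambda>_. 0) \<in> BL1"
  by (auto simp: BL1_def intro!: lipschitz_onI)

lemma bl_dist_bdd:
  assumes "\<nu> \<in> space PA" "\<nu>' \<in> space PA"
  shows "bdd_above ((\<lambda>f. \<bar>(LINT x|\<nu>. f x) - (LINT x|\<nu>'. f x)\<bar>) ` BL1)"
    and "f \<in> BL1 \<Longrightarrow> \<bar>(LINT x|\<nu>. f x) - (LINT x|\<nu>'. f x)\<bar> \<le> 2"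
proof -
  have *: "\<bar>(LINT x|\<nu>. f x) - (LINT x|\<nu>'. f x)\<bar> \<le> 2" if "f \<in> BL1" for f
    using pa_integral_le[OF assms(1) BL1_meas[OF that], of 1]
      pa_integral_le[OF assms(2) BL1_meas[OF that], of 1] that
    by (auto simp: BL1_def)
  then show "f \<in> BL1 \<Longrightarrow> \<bar>(LINT x|\<nu>. f x) - (LINT x|\<nu>'. f x)\<bar> \<le> 2" .
  show "bdd_above ((\<lambda>f. \<bar>(LINT x|\<nu>. f x) - (LINT x|\<nu>'. f x)\<bar>) ` BL1)"
    using * by (auto intro!: bdd_aboveI2)
qed

lemma bl_dist_upper:
  assumes "\<nu> \<in> space PA" "\<nu>' \<in> space PA" "f \<in> BL1"
  shows "\<bar>(LINT x|\<nu>. f x) - (LINT x|\<nu>'. f x)\<bar> \<le> bl_dist \<nu> \<nu>'"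
  unfolding bl_dist_alt by (rule cSUP_upper[OF assms(3) bl_dist_bdd(1)[OF assms(1,2)]])

lemma bl_dist_least:
  assumes "\<And>f. f \<in> BL1 \<Longrightarrow> \<bar>(LINT x|\<nu>. f x) - (LINT x|\<nu>'. f x)\<bar> \<le> c"
  shows "bl_dist \<nu> \<nu>' \<le> c"
  unfolding bl_dist_alt using BL1_zero by (intro cSUP_least assms) auto

lemma bl_dist_nonneg: "\<nu> \<in> space PA \<Longrightarrow> \<nu>' \<in> space PA \<Longrightarrow> 0 \<le> bl_dist \<nu> \<nu>'"
  using bl_dist_upper[OF _ _ BL1_zero] by fastforce

lemma bl_dist_le2: "\<nu> \<in> space PA \<Longrightarrow> \<nu>' \<in> space PA \<Longrightarrow> bl_dist \<nu> \<nu>' \<le> 2"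
  using bl_dist_bdd(2) by (intro bl_dist_least) auto

lemma bl_dist_self: "bl_dist \<nu> \<nu> = 0"
proof -
  have "(\<lambda>f. \<bar>(LINT x|\<nu>. f x) - (LINT x|\<nu>. f x)\<bar>) ` BL1 = {0::real}"
    using BL1_zero by (auto simp: image_def)
  then show ?thesis unfolding bl_dist_alt by simp
qed

lemma bl_dist_triangle:
  assumes "a \<in> space PA" "b \<in> space PA" "c \<in> space PA"
  shows "bl_dist a c \<le> bl_dist a b + bl_dist b c"
proof (rule bl_dist_least)
  fix f :: "'a \<Rightarrow> real" assume f: "f \<in> BL1"
  show "\<bar>(LINT x|a. f x) - (LINT x|c. f x)\<bar> \<le> bl_dist a b + bl_dist b c"
    using bl_dist_upper[OF assms(1,2) f] bl_dist_upper[OF assms(2,3) f] by linarith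
qed

lemma bl_dist_sym: "bl_dist a b = bl_dist b a"
  unfolding bl_dist_alt by (simp add: abs_minus_commute)

lemma bl_dist_imp_lipschitz:
  fixes f :: "'e::polish_space \<Rightarrow> real" and B L :: real
  assumes \<nu>: "\<And>n. \<nu> n \<in> space PA" and l: "l \<in> space PA"
    and conv: "(\<lambda>n. bl_dist (\<nu> n) l) \<longlonglongrightarrow> 0"
    and f: "\<And>x. \<bar>f x\<bar> \<le> B" "L-lipschitz_on UNIV f"
  shows "(\<lambda>n. LINT x|\<nu> n. f x) \<longlonglongrightarrow> (LINT x|l. f x)"
proof -
  \<comment> \<open>Dividing by \<open>C\<close> brings both the bound and the Lipschitz constant of
    \<open>f\<close> down to at most \<open>1\<close>; the entry \<open>1\<close> keeps the divisor
    positive.\<close>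
  define C where "C = max 1 (max B L)"
  have C: "C \<ge> 1" "B \<le> C" "L \<le> C" by (auto simp: C_def)
  define g where "g x = f x / C" for x
  have "\<bar>g x\<bar> \<le> 1" for x using f(1)[of x] C by (simp add: g_def divide_le_eq)
  moreover have "1-lipschitz_on UNIV g"
  proof (rule lipschitz_onI)
    fix x y :: 'e
    have "dist (g x) (g y) = dist (f x) (f y) / C"
      using C by (simp add: g_def dist_real_def flip: diff_divide_distrib)
    also have "\<dots> \<le> L * dist x y / C"
      using lipschitz_onD[OF f(2)] C by (intro divide_right_mono) auto
    also have "\<dots> \<le> C * dist x y / C" using C by (intro divide_right_mono mult_right_mono) auto
    finally show "dist (g x) (g y) \<le> 1 * dist x y" using C by simp
  qed simp
  ultimately have g: "g \<in> BL1" by (simp add: BL1_def)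
  have "(\<lambda>n. \<bar>(LINT x|\<nu> n. g x) - (LINT x|l. g x)\<bar>) \<longlonglongrightarrow> 0"
    by (rule tendsto_sandwich[OF _ _ tendsto_const conv])
      (auto intro!: always_eventually bl_dist_upper \<nu> l g)
  then have "(\<lambda>n. (LINT x|\<nu> n. g x)) \<longlonglongrightarrow> (LINT x|l. g x)"
    by (simp add: LIM_zero_iff tendsto_rabs_zero_iff)
  then have "(\<lambda>n. C * (LINT x|\<nu> n. g x)) \<longlonglongrightarrow> C * (LINT x|l. g x)" by (intro tendsto_intros)
  moreover have "C * (LINT x|N. g x) = (LINT x|N. f x)" for N
    using C by (simp add: g_def)
  ultimately show ?thesis by simp
qed

text \<open>The largest \<open>k\<close>-Lipschitz minorant of \<open>f\<close>.\<close>

definition inf_conv :: "('e::polish_space \<Rightarrow> real) \<Rightarrow> nat \<Rightarrow> 'e \<Rightarrow> real" where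
  "inf_conv f k x = (INF z. f z + real k * dist x z)"

lemma inf_conv:
  fixes f :: "'e::polish_space \<Rightarrow> real"
  assumes f: "continuous_on UNIV f" "\<And>x. 0 \<le> f x" "\<And>x. f x \<le> B"
  shows "inf_conv f k x \<le> f x" "0 \<le> inf_conv f k x" "(real k)-lipschitz_on UNIV (inf_conv f k)"
    "(\<lambda>k. inf_conv f k x) \<longlonglongrightarrow> f x"
proof -
  have bdd: "bdd_below (range (\<lambda>z. f z + real k * dist x z))" for k x
    using f(2) by (intro bdd_belowI2[of _ 0]) (auto intro: add_nonneg_nonneg)
  have up: "inf_conv f k x \<le> f z + real k * dist x z" for k x z
    unfolding inf_conv_def by (intro cINF_lower bdd) auto
  show le: "inf_conv f k x \<le> f x" for k x using up[of k x x] by simp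
  show "0 \<le> inf_conv f k x"
    unfolding inf_conv_def using f(2) by (intro cINF_greatest) (auto intro: add_nonneg_nonneg)
  have *: "inf_conv f k x \<le> inf_conv f k y + real k * dist x y" for x y
  proof -
    have "inf_conv f k x - real k * dist x y \<le> inf_conv f k y"
      unfolding inf_conv_def[of f k y]
    proof (intro cINF_greatest)
      fix z
      have "real k * dist x z \<le> real k * (dist x y + dist y z)"
        by (intro mult_left_mono dist_triangle) auto
      then show "inf_conv f k x - real k * dist x y \<le> f z + real k * dist y z"
        using up[of k x z] by (simp add: algebra_simps)
    qed auto
    then show ?thesis by simp
  qed
  show "(real k)-lipschitz_on UNIV (inf_conv f k)"
  proof (rule lipschitz_onI)
    fix x y :: 'e
    show "dist (inf_conv f k x) (inf_conv f k y) \<le> real k * dist x y"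
      using *[of x y] *[of y x] by (simp add: dist_real_def dist_commute)
  qed simp
  show "(\<lambda>k. inf_conv f k x) \<longlonglongrightarrow> f x"
  proof (rule LIMSEQ_I)
    fix e :: real assume e: "0 < e"
    have "isCont f x" using f(1) by (simp add: continuous_on_eq_continuous_at)
    then obtain d where d: "d > 0" "\<And>z. dist z x < d \<Longrightarrow> dist (f z) (f x) < e / 2"
      using e unfolding continuous_at_eps_delta by (metis half_gt_zero)
    \<comment> \<open>At distance \<open>d\<close> or more the penalty is then at least
      \<open>B\<close>, hence at least \<open>f x\<close>, so only points near \<open>x\<close> can
      push the infimum below \<open>f x\<close>.\<close>
    obtain K :: nat where K: "real K > B / d" using reals_Archimedean2 by blast
    show "\<exists>no. \<forall>n\<ge>no. norm (inf_conv f n x - f x) < e"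
    proof (intro exI allI impI)
      fix n assume n: "n \<ge> K"
      have "f x - e / 2 \<le> inf_conv f n x"
        unfolding inf_conv_def
      proof (rule cINF_greatest)
        fix z
        show "f x - e / 2 \<le> f z + real n * dist x z"
        proof (cases "dist z x < d")
          case True
          have "0 \<le> real n * dist x z" by simp
          then show ?thesis using d(2)[OF True] unfolding dist_real_def by linarith
        next
          case False
          have "B \<le> real K * d" using K d(1) by (simp add: divide_less_eq)
          also have "\<dots> \<le> real n * dist x z"
            using n False d(1) by (intro mult_mono) (auto simp: dist_commute)
          finally show ?thesis using f(3)[of x] f(2)[of z] e by linarith
        qed
      qed simp
      then show "norm (inf_conv f n x - f x) < e" using le[of n x] e by auto
    qed
  qed
qed

text \<open>Lipschitz minorants converging pointwise to a nonnegative continuous function bound the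
  lower limit of its integrals from below (\<open>low\<close>). Applied to \<open>B + f\<close> and
  \<open>B - f\<close>, this controls the integrals of \<open>f\<close> from both sides.\<close>

lemma bl_dist_imp_wconv:
  assumes \<nu>: "\<And>n. \<nu> n \<in> space PA" and l: "l \<in> space PA"
    and conv: "(\<lambda>n. bl_dist (\<nu> n) l) \<longlonglongrightarrow> 0"
  shows "wconv \<nu> l"
proof -
  have low: "eventually (\<lambda>n. (LINT x|l. f x) - e < (LINT x|\<nu> n. f x)) sequentially"
    if f: "continuous_on UNIV f" "\<And>x. 0 \<le> f x" "\<And>x. f x \<le> B" and e: "e > 0"
    for f :: "'a \<Rightarrow> real" and B e
  proof -
    have fm[measurable]: "f \<in> borel_measurable borel"
      by (intro borel_measurable_continuous_onI f)
    note ic = inf_conv[OF f(1) f(2) f(3), simplified]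
    have im: "inf_conv f k \<in> borel_measurable borel" for k
      by (intro borel_measurable_continuous_onI lipschitz_on_continuous_on[OF ic(3)])
    have ib: "\<bar>inf_conv f k x\<bar> \<le> B" for k x using ic(1,2)[of k x] f(3)[of x] by auto
    have "(\<lambda>k. LINT x|l. inf_conv f k x) \<longlonglongrightarrow> (LINT x|l. f x)"
      using l ib ic(4)
      by (intro integral_dominated_convergence[where w="\<lambda>_. B"])
        (auto intro!: PA_measurable[OF l] im fm pa_integrable[OF l, of _ "\<bar>B\<bar>"])
    then have "eventually (\<lambda>k. (LINT x|l. f x) - e < (LINT x|l. inf_conv f k x)) sequentially"
      using e by (intro order_tendstoD) auto
    then obtain k where k: "(LINT x|l. f x) - e < (LINT x|l. inf_conv f k x)"
      by (auto simp: eventually_sequentially)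
    have "(\<lambda>n. LINT x|\<nu> n. inf_conv f k x) \<longlonglongrightarrow> (LINT x|l. inf_conv f k x)"
      by (rule bl_dist_imp_lipschitz[OF \<nu> l conv ib ic(3)])
    then have "eventually (\<lambda>n. (LINT x|l. f x) - e < (LINT x|\<nu> n. inf_conv f k x)) sequentially"
      using k by (intro order_tendstoD)
    moreover have "(LINT x|\<nu> n. inf_conv f k x) \<le> (LINT x|\<nu> n. f x)" for n
      using ic(1,2) f(2,3)
      by (intro integral_mono pa_integrable[OF \<nu>, of _ B] im fm ib) auto
    ultimately show ?thesis by (auto elim!: eventually_mono intro: less_le_trans)
  qed
  show ?thesis unfolding wconv_def
  proof safe
    fix f :: "'a \<Rightarrow> real" assume f: "continuous_on UNIV f" "bounded (range f)"
    obtain B where "\<forall>z\<in>range f. norm z \<le> B" using f(2) unfolding bounded_iff by blast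
    then have B: "\<bar>f x\<bar> \<le> B" for x by auto
    have B': "0 \<le> B + 1 * f x" "B + 1 * f x \<le> 2 * B" "0 \<le> B + (-1) * f x" "B + (-1) * f x \<le> 2 * B" for x
      using B[of x] by auto
    have fm[measurable]: "f \<in> borel_measurable borel"
      by (intro borel_measurable_continuous_onI f)
    have i: "integrable N f" if "N \<in> space PA" for N by (rule pa_integrable[OF that fm B])
    have c: "(LINT x|N. c + a * f x) = c + a * (LINT x|N. f x)" if N: "N \<in> space PA" for N a c
    proof -
      interpret prob_space N using N by (rule PA_D)
      show ?thesis using i[OF N] by (simp add: prob_space)
    qed
    show "(\<lambda>n. LINT x|\<nu> n. f x) \<longlonglongrightarrow> (LINT x|l. f x)"
    proof (rule order_tendstoI)
      fix a assume "a < (LINT x|l. f x)"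
      then have "eventually (\<lambda>n. (LINT x|l. B + 1 * f x) - ((LINT x|l. f x) - a) < (LINT x|\<nu> n. B + 1 * f x)) sequentially"
        by (intro low[of _ "2 * B"] continuous_intros f(1) B') auto
      then show "eventually (\<lambda>n. a < (LINT x|\<nu> n. f x)) sequentially"
        unfolding c[OF \<nu>] c[OF l] by (auto elim: eventually_mono)
    next
      fix a assume "a > (LINT x|l. f x)"
      then have "eventually (\<lambda>n. (LINT x|l. B + (-1) * f x) - (a - (LINT x|l. f x)) < (LINT x|\<nu> n. B + (-1) * f x)) sequentially"
        by (intro low[of _ "2 * B"] continuous_intros f(1) B') auto
      then show "eventually (\<lambda>n. a > (LINT x|\<nu> n. f x)) sequentially"
        unfolding c[OF \<nu>] c[OF l] by (auto elim: eventually_mono)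
    qed
  qed
qed

section \<open>Partitions of unity along a dense sequence\<close>

definition dseq :: "nat \<Rightarrow> 'e::polish_space" where
  "dseq = from_nat_into (SOME D. countable D \<and> (\<forall>X. open X \<and> X \<noteq> {} \<longrightarrow> (\<exists>d\<in>D. d \<in> X)))"

lemma dseq_dense:
  fixes x :: "'e::polish_space"
  assumes "e > 0"
  shows "\<exists>i. dist x (dseq i) < e"
proof -
  define D :: "'e set" where "D = (SOME D. countable D \<and> (\<forall>X. open X \<and> X \<noteq> {} \<longrightarrow> (\<exists>d\<in>D. d \<in> X)))"
  have ex: "\<exists>D :: 'e set. countable D \<and> (\<forall>X. open X \<and> X \<noteq> {} \<longrightarrow> (\<exists>d\<in>D. d \<in> X))"
    using countable_dense_exists by blast
  have D: "countable D \<and> (\<forall>X. open X \<and> X \<noteq> {} \<longrightarrow> (\<exists>d\<in>D. d \<in> X))"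
    unfolding D_def by (rule someI_ex[OF ex])
  then have "\<exists>d\<in>D. d \<in> ball x e" using assms by (metis open_ball ball_eq_empty not_le)
  then obtain d where d: "d \<in> D" "dist x d < e" by auto
  then obtain i where "from_nat_into D i = d" using D by (metis from_nat_into_to_nat_on)
  then show ?thesis using d unfolding dseq_def D_def by auto
qed

text \<open>A bump equal to \<open>1\<close> on the ball of radius \<open>1 / Suc k\<close> around
  the \<open>i\<close>-th point of the dense sequence and to \<open>0\<close> from radius
  \<open>2 / Suc k\<close> on.\<close>

definition hat :: "nat \<Rightarrow> nat \<Rightarrow> 'e::polish_space \<Rightarrow> real" where
  "hat k i x = max 0 (min 1 (2 - real (Suc k) * dist x (dseq i)))"

text \<open>Running maxima of the bumps increase to \<open>1\<close>, and the increments
  \<open>cover k (Suc i) - cover k i\<close> form a continuous partition of unity whose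
  \<open>i\<close>-th piece is supported near \<open>dseq i\<close>. The integrals of these
  countably many functions will control \<open>bl_dist\<close>.\<close>

primrec cover :: "nat \<Rightarrow> nat \<Rightarrow> 'e::polish_space \<Rightarrow> real" where
  "cover k 0 x = 0"
| "cover k (Suc n) x = max (cover k n x) (hat k n x)"

lemma cover_range: "0 \<le> cover k n x" "cover k n x \<le> 1"
  by (induction n) (auto simp: hat_def)

lemma cover_abs: "\<bar>cover k n x\<bar> \<le> 1"
  using cover_range[of k n x] by simp

lemma cover_cont: "continuous_on UNIV (cover k n)"
  by (induction n) (auto simp: hat_def intro!: continuous_intros)

lemma cover_meas: "cover k n \<in> borel_measurable borel"
  by (intro borel_measurable_continuous_onI cover_cont)

lemma cover_tendsto: "(\<lambda>n. cover k n x) \<longlonglongrightarrow> 1"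
proof -
  obtain i where i: "dist x (dseq i) < 1 / real (Suc k)" using dseq_dense[of "1 / real (Suc k)" x] by auto
  then have h: "hat k i x = 1" by (simp add: hat_def field_simps)
  have one: "cover k n x = 1" if "n \<ge> Suc i" for n
    using that
  proof (induct rule: dec_induct)
    case base
    then show ?case using cover_range[of k "i" x] h by simp
  next
    case (step n)
    then show ?case by (simp add: hat_def)
  qed
  then show ?thesis by (intro tendsto_eventually) (auto simp: eventually_sequentially intro!: exI[of _ "Suc i"])
qed

text \<open>The \<open>i\<close>-th increment is nonzero only where \<open>hat k i\<close> is
  positive, that is within \<open>2 / Suc k\<close> of \<open>dseq i\<close>; there a 1-Lipschitz
  function may be replaced by its value at \<open>dseq i\<close>. The part not yet covered costs no
  more than its mass, as \<open>f\<close> is bounded by \<open>1\<close>.\<close>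

lemma BL1_cover_approx:
  assumes f: "f \<in> BL1"
  shows "\<bar>f x - (\<Sum>i<n. f (dseq i) * (cover k (Suc i) x - cover k i x))\<bar>
    \<le> 2 / real (Suc k) + (1 - cover k n x)"
proof -
  let ?p = "\<lambda>i. cover k (Suc i) x - cover k i x"
  have b: "\<bar>f x\<bar> \<le> 1" and lip: "\<bar>f x - f y\<bar> \<le> dist x y" for y
    using f lipschitz_onD[of 1 UNIV f x y] by (auto simp: BL1_def dist_real_def)
  have tel: "(\<Sum>i<n. ?p i) = cover k n x"
    by (induction n) (auto simp del: cover.simps(2))
  have e1: "(\<Sum>i<n. f x * ?p i) = f x * cover k n x"
    unfolding tel[symmetric] by (rule sum_distrib_left[symmetric])
  have p: "?p i \<ge> 0" for i by simp
  have near: "\<bar>f x - f (dseq i)\<bar> * ?p i \<le> 2 / real (Suc k) * ?p i" for i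
  proof (cases "?p i = 0")
    case False
    then have "hat k i x > 0" using cover_range(1)[of k i x] by (auto simp: max_def split: if_splits)
    then have "dist x (dseq i) < 2 / real (Suc k)" by (auto simp: hat_def field_simps)
    then show ?thesis using lip[of "dseq i"] p[of i] by (intro mult_right_mono) auto
  qed simp
  have "f x - (\<Sum>i<n. f (dseq i) * ?p i) = (\<Sum>i<n. (f x - f (dseq i)) * ?p i) + f x * (1 - cover k n x)"
    unfolding left_diff_distrib sum_subtractf e1 by (simp add: algebra_simps del: cover.simps)
  also have "\<bar>\<dots>\<bar> \<le> (\<Sum>i<n. \<bar>f x - f (dseq i)\<bar> * ?p i) + 1 * (1 - cover k n x)"
  proof (intro order_trans[OF abs_triangle_ineq] add_mono)
    show "\<bar>\<Sum>i<n. (f x - f (dseq i)) * ?p i\<bar> \<le> (\<Sum>i<n. \<bar>f x - f (dseq i)\<bar> * ?p i)"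
      using p by (intro order_trans[OF sum_abs] sum_mono) (simp add: abs_mult del: cover.simps)
    show "\<bar>f x * (1 - cover k n x)\<bar> \<le> 1 * (1 - cover k n x)"
      using b cover_range[of k n x] by (simp add: abs_mult mult_left_le_one_le)
  qed
  also have "(\<Sum>i<n. \<bar>f x - f (dseq i)\<bar> * ?p i) \<le> (\<Sum>i<n. 2 / real (Suc k) * ?p i)"
    by (intro sum_mono near)
  also have "\<dots> = 2 / real (Suc k) * cover k n x"
    unfolding tel[symmetric] by (rule sum_distrib_left[symmetric])
  also have "\<dots> \<le> 2 / real (Suc k) * 1"
    using cover_range[of k n x] by (intro mult_left_mono) auto
  finally show ?thesis by simp
qed

lemma BL1_integral_cover_approx:
  assumes f: "f \<in> BL1" and N: "N \<in> space PA"
  shows "\<bar>(LINT x|N. f x) - (\<Sum>i<n. f (dseq i) * ((LINT x|N. cover k (Suc i) x) - (LINT x|N. cover k i x)))\<bar>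
    \<le> 2 / real (Suc k) + (1 - (LINT x|N. cover k n x))"
proof -
  interpret prob_space N using N by (rule PA_D)
  have fi: "integrable N f" using f by (intro pa_integrable[OF N BL1_meas[OF f], of 1]) (auto simp: BL1_def)
  have ci: "integrable N (cover k i)" for i
    by (rule pa_integrable[OF N cover_meas cover_abs])
  let ?g = "\<lambda>x. f x - (\<Sum>i<n. f (dseq i) * (cover k (Suc i) x - cover k i x))"
  have gi: "integrable N ?g"
    by (intro Bochner_Integration.integrable_diff Bochner_Integration.integrable_sum integrable_mult_right fi ci)
  have "(LINT x|N. f x) - (\<Sum>i<n. f (dseq i) * ((LINT x|N. cover k (Suc i) x) - (LINT x|N. cover k i x))) = (LINT x|N. ?g x)"
    using fi ci by (simp del: cover.simps)
  also have "\<bar>\<dots>\<bar> \<le> (LINT x|N. \<bar>?g x\<bar>)" using integral_abs_bound[of N ?g] by simp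
  also have "\<dots> \<le> (LINT x|N. 2 / real (Suc k) + (1 - cover k n x))"
    by (rule integral_mono[OF integrable_abs[OF gi] _ BL1_cover_approx[OF f]]) (simp add: ci del: cover.simps)
  also have "\<dots> = 2 / real (Suc k) + (1 - (LINT x|N. cover k n x))"
    using ci by (simp add: prob_space del: cover.simps)
  finally show ?thesis .
qed

text \<open>The step approximations cost \<open>2 / Suc k\<close> for each measure, plus the
  uncovered masses. The uncovered mass of \<open>\<nu>\<close> exceeds that of \<open>\<nu>'\<close>
  by at most the sum \<open>D\<close> of the differences, and the two finite sums differ by at most
  \<open>2 * D\<close>, hence the factor \<open>3\<close>. Thus only \<open>\<nu>'\<close> has to be
  nearly covered.\<close>

lemma bl_dist_cover_bound:
  fixes \<nu> \<nu>' :: "'e::polish_space measure"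
  assumes \<nu>: "\<nu> \<in> space PA" and \<nu>': "\<nu>' \<in> space PA"
  shows "bl_dist \<nu> \<nu>' \<le> 4 / real (Suc k) + 2 * (1 - (LINT x|\<nu>'. cover k n x))
     + 3 * (\<Sum>i\<le>n. \<bar>(LINT x|\<nu>. cover k i x) - (LINT x|\<nu>'. cover k i x)\<bar>)"
proof (rule bl_dist_least)
  fix f :: "'e \<Rightarrow> real" assume f: "f \<in> BL1"
  define a where "a i = (LINT x|\<nu>. cover k i x)" for i
  define b where "b i = (LINT x|\<nu>'. cover k i x)" for i
  define D where "D = (\<Sum>i\<le>n. \<bar>a i - b i\<bar>)"
  have D: "\<bar>a n - b n\<bar> \<le> D" unfolding D_def by (rule member_le_sum[of n "{..n}" "\<lambda>i. \<bar>a i - b i\<bar>"]) auto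
  have "(\<Sum>i<n. f (dseq i) * (a (Suc i) - a i)) - (\<Sum>i<n. f (dseq i) * (b (Suc i) - b i))
      = (\<Sum>i<n. f (dseq i) * ((a (Suc i) - b (Suc i)) - (a i - b i)))"
    by (simp add: algebra_simps flip: sum_subtractf)
  also have "\<bar>\<dots>\<bar> \<le> (\<Sum>i<n. \<bar>a (Suc i) - b (Suc i)\<bar> + \<bar>a i - b i\<bar>)"
  proof (intro order_trans[OF sum_abs] sum_mono)
    fix i
    have "\<bar>f (dseq i)\<bar> \<le> 1" using f by (simp add: BL1_def)
    then have "\<bar>f (dseq i) * ((a (Suc i) - b (Suc i)) - (a i - b i))\<bar> \<le> 1 * \<bar>(a (Suc i) - b (Suc i)) - (a i - b i)\<bar>"
      unfolding abs_mult by (intro mult_right_mono) auto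
    also have "1 * \<bar>(a (Suc i) - b (Suc i)) - (a i - b i)\<bar> \<le> \<bar>a (Suc i) - b (Suc i)\<bar> + \<bar>a i - b i\<bar>"
      by (simp add: abs_triangle_ineq4)
    finally show "\<bar>f (dseq i) * ((a (Suc i) - b (Suc i)) - (a i - b i))\<bar> \<le> \<bar>a (Suc i) - b (Suc i)\<bar> + \<bar>a i - b i\<bar>" .
  qed
  also have "\<dots> \<le> D + D"
    unfolding sum.distrib
  proof (rule add_mono)
    have "(\<Sum>i<n. \<bar>a (Suc i) - b (Suc i)\<bar>) = (\<Sum>i\<in>{1..n}. \<bar>a i - b i\<bar>)"
      by (rule sum.reindex_bij_witness[of _ "\<lambda>i. i - 1" Suc]) auto
    also have "\<dots> \<le> D" unfolding D_def by (rule sum_mono2) auto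
    finally show "(\<Sum>i<n. \<bar>a (Suc i) - b (Suc i)\<bar>) \<le> D" .
    show "(\<Sum>i<n. \<bar>a i - b i\<bar>) \<le> D" unfolding D_def by (rule sum_mono2) auto
  qed
  finally have 3: "\<bar>(\<Sum>i<n. f (dseq i) * (a (Suc i) - a i)) - (\<Sum>i<n. f (dseq i) * (b (Suc i) - b i))\<bar> \<le> D + D" .
  note 1 = BL1_integral_cover_approx[where n=n and k=k, OF f \<nu>, folded a_def]
  note 2 = BL1_integral_cover_approx[where n=n and k=k, OF f \<nu>', folded b_def]
  have arith: "\<bar>u - v\<bar> \<le> 2 * r + 2 * (1 - t) + 3 * d"
    if "\<bar>u - p\<bar> \<le> r + (1 - s)" "\<bar>v - q\<bar> \<le> r + (1 - t)" "\<bar>p - q\<bar> \<le> d + d" "\<bar>s - t\<bar> \<le> d"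
    for u v p q s t r d :: real
  proof -
    have "u - p \<le> r + (1 - s)" "p - u \<le> r + (1 - s)" "v - q \<le> r + (1 - t)" "q - v \<le> r + (1 - t)"
      "p - q \<le> d + d" "q - p \<le> d + d" "t - s \<le> d"
      using that by (simp_all add: abs_le_iff)
    then have "u - v \<le> 2 * r + 2 * (1 - t) + 3 * d" "- (u - v) \<le> 2 * r + 2 * (1 - t) + 3 * d" by argo+
    then show ?thesis by (rule abs_leI)
  qed
  have "\<bar>(LINT x|\<nu>. f x) - (LINT x|\<nu>'. f x)\<bar> \<le> 4 / real (Suc k) + 2 * (1 - b n) + 3 * D"
    using arith[OF 1 2 3 D] by simp
  then show "\<bar>(LINT x|\<nu>. f x) - (LINT x|\<nu>'. f x)\<bar> \<le> 4 / real (Suc k) + 2 * (1 - (LINT x|\<nu>'. cover k n x))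
     + 3 * (\<Sum>i\<le>n. \<bar>(LINT x|\<nu>. cover k i x) - (LINT x|\<nu>'. cover k i x)\<bar>)"
    by (simp add: D_def a_def b_def)
qed

text \<open>The choice of \<open>k\<close> and \<open>n\<close> depends on \<open>l\<close> and
  \<open>e\<close> alone: finitely many integrals of continuous functions decide how close any
  \<open>\<nu>\<close> is to \<open>l\<close>. The law of large numbers relies on this uniformity in
  \<open>\<nu>\<close>.\<close>

lemma bl_dist_cover:
  fixes l :: "'e::polish_space measure"
  assumes l: "l \<in> space PA" and e: "e > 0"
  obtains k n where "\<And>\<nu>. \<nu> \<in> space PA \<Longrightarrow>
    bl_dist \<nu> l \<le> e + 3 * (\<Sum>i\<le>n. \<bar>(LINT x|\<nu>. cover k i x) - (LINT x|l. cover k i x)\<bar>)"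
proof -
  interpret L: prob_space l using l by (rule PA_D)
  obtain k where "inverse (real (Suc k)) < e / 8" using reals_Archimedean[of "e / 8"] e by auto
  then have k: "4 / real (Suc k) < e / 2" by (simp add: field_simps)
  have "(\<lambda>n. LINT x|l. cover k n x) \<longlonglongrightarrow> (LINT x|l. 1)"
    by (intro integral_dominated_convergence[where w="\<lambda>_. 1"])
      (auto intro!: PA_measurable[OF l] cover_meas cover_abs cover_tendsto)
  then have "eventually (\<lambda>n. 1 - e / 4 < (LINT x|l. cover k n x)) sequentially"
    using e by (intro order_tendstoD) (auto simp: L.prob_space)
  then obtain n where n: "1 - e / 4 < (LINT x|l. cover k n x)" by (auto simp: eventually_sequentially)
  show thesis
  proof (rule that)
    fix \<nu> :: "'e measure" assume "\<nu> \<in> space PA"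
    from bl_dist_cover_bound[OF this l, of k n] k n
    show "bl_dist \<nu> l \<le> e + 3 * (\<Sum>i\<le>n. \<bar>(LINT x|\<nu>. cover k i x) - (LINT x|l. cover k i x)\<bar>)" by argo
  qed
qed

lemma cover_conv_imp_bl_dist:
  assumes \<nu>: "\<And>n. \<nu> n \<in> space PA" and l: "l \<in> space PA"
    and conv: "\<And>k n. (\<lambda>j. LINT x|\<nu> j. cover k n x) \<longlonglongrightarrow> (LINT x|l. cover k n x)"
  shows "(\<lambda>j. bl_dist (\<nu> j) l) \<longlonglongrightarrow> 0"
proof (rule LIMSEQ_I)
  fix e :: real assume e: "e > 0"
  obtain k n where kn: "\<And>\<nu>. \<nu> \<in> space PA \<Longrightarrow>
      bl_dist \<nu> l \<le> e / 2 + 3 * (\<Sum>i\<le>n. \<bar>(LINT x|\<nu>. cover k i x) - (LINT x|l. cover k i x)\<bar>)"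
    using bl_dist_cover[OF l, of "e / 2"] e by auto
  have "(\<lambda>j. 3 * (\<Sum>i\<le>n. \<bar>(LINT x|\<nu> j. cover k i x) - (LINT x|l. cover k i x)\<bar>))
      \<longlonglongrightarrow> 3 * (\<Sum>i\<le>n. \<bar>(LINT x|l. cover k i x) - (LINT x|l. cover k i x)\<bar>)"
    by (intro tendsto_intros conv)
  then have "eventually (\<lambda>j. 3 * (\<Sum>i\<le>n. \<bar>(LINT x|\<nu> j. cover k i x) - (LINT x|l. cover k i x)\<bar>) < e / 2) sequentially"
    by (rule order_tendstoD(2)) (use e in simp)
  then have "eventually (\<lambda>j. norm (bl_dist (\<nu> j) l - 0) < e) sequentially"
  proof eventually_elim
    case (elim j)
    then show ?case using kn[OF \<nu>[of j]] bl_dist_nonneg[OF \<nu> l, of j] by simp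
  qed
  then show "\<exists>no. \<forall>n\<ge>no. norm (bl_dist (\<nu> n) l - 0) < e" by (auto simp: eventually_sequentially)
qed

lemma wconv_imp_bl_dist:
  assumes \<nu>: "\<And>n. \<nu> n \<in> space PA" and l: "l \<in> space PA" and "wconv \<nu> l"
  shows "(\<lambda>j. bl_dist (\<nu> j) l) \<longlonglongrightarrow> 0"
proof (rule cover_conv_imp_bl_dist[OF \<nu> l])
  fix k n
  show "(\<lambda>j. LINT x|\<nu> j. cover k n x) \<longlonglongrightarrow> (LINT x|l. cover k n x)"
    using assms(3) cover_cont[of k n] unfolding wconv_def
    by (auto simp: bounded_iff intro!: exI[of _ 1] cover_abs)
qed

lemma wconv_subseq: "wconv \<nu> l \<Longrightarrow> strict_mono r \<Longrightarrow> wconv (\<lambda>n. \<nu> (r n)) l"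
  unfolding wconv_def using LIMSEQ_subseq_LIMSEQ unfolding comp_def by fast

lemma bl_dist_tendsto:
  assumes \<nu>: "\<And>n. \<nu> n \<in> space PA" and l: "l \<in> space PA" and \<nu>': "\<And>n. \<nu>' n \<in> space PA" and l': "l' \<in> space PA"
    and "wconv \<nu> l" "wconv \<nu>' l'"
  shows "(\<lambda>j. bl_dist (\<nu> j) (\<nu>' j)) \<longlonglongrightarrow> bl_dist l l'"
proof -
  have "(\<lambda>j. bl_dist (\<nu> j) l + bl_dist (\<nu>' j) l') \<longlonglongrightarrow> 0 + 0"
    using \<nu> l \<nu>' l' assms(5,6) by (intro tendsto_add) (auto intro: wconv_imp_bl_dist)
  then have t: "(\<lambda>j. bl_dist (\<nu> j) l + bl_dist (\<nu>' j) l') \<longlonglongrightarrow> 0" by simp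
  have b: "\<bar>bl_dist (\<nu> j) (\<nu>' j) - bl_dist l l'\<bar> \<le> bl_dist (\<nu> j) l + bl_dist (\<nu>' j) l'" for j
    using bl_dist_triangle[OF \<nu>[of j] l l'] bl_dist_triangle[OF \<nu>[of j] l' \<nu>'[of j]]
      bl_dist_triangle[OF l \<nu>[of j] \<nu>'[of j]] bl_dist_triangle[OF l \<nu>'[of j] l']
      bl_dist_sym[of l "\<nu> j"] bl_dist_sym[of l' "\<nu>' j"]
    by linarith
  have "(\<lambda>j. \<bar>bl_dist (\<nu> j) (\<nu>' j) - bl_dist l l'\<bar>) \<longlonglongrightarrow> 0"
    by (rule tendsto_sandwich[OF _ _ tendsto_const t]) (use b in \<open>auto intro!: always_eventually\<close>)
  then show ?thesis by (simp add: LIM_zero_iff tendsto_rabs_zero_iff)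
qed

text \<open>A function in \<open>BL1\<close> is determined by its values along \<open>dseq\<close>.
  The resulting set of real sequences is separable, and convergence on a dense set extends to all
  points because the functions share a Lipschitz constant. With a countable set, suprema over
  \<open>BL1\<close> become measurable and exceptional null sets can be united.\<close>

lemma BL1_countable_dense:
  obtains L :: "('e::polish_space \<Rightarrow> real) set"
  where "countable L" "L \<subseteq> BL1" "L \<noteq> {}"
    "\<And>f. f \<in> BL1 \<Longrightarrow> \<exists>g. (\<forall>n. g n \<in> L) \<and> (\<forall>x. (\<lambda>n. g n x) \<longlonglongrightarrow> f x)"
proof -
  define R :: "('e \<Rightarrow> real) \<Rightarrow> nat \<Rightarrow> real" where "R f = (\<lambda>i. f (dseq i))" for f
  obtain T where T: "countable T" "T \<subseteq> R ` BL1" "R ` BL1 \<subseteq> closure T"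
    using separable[of "R ` BL1"] by blast
  define sel where "sel t = (SOME f. f \<in> BL1 \<and> R f = t)" for t
  have sel: "sel t \<in> BL1" "R (sel t) = t" if "t \<in> T" for t
    using someI_ex[of "\<lambda>f. f \<in> BL1 \<and> R f = t"] that T(2) unfolding sel_def by auto
  show thesis
  proof (rule that[of "sel ` T"])
    show "countable (sel ` T)" using T by auto
    show "sel ` T \<subseteq> BL1" using sel by auto
    show "sel ` T \<noteq> {}"
      using T(3) BL1_zero by auto
    fix f :: "'e \<Rightarrow> real" assume f: "f \<in> BL1"
    then obtain t where t: "\<And>n. t n \<in> T" "t \<longlonglongrightarrow> R f"
      using T(3) by (metis closure_sequential image_subset_iff)
    have c: "(\<lambda>n. t n i) \<longlonglongrightarrow> R f i" for i
      by (rule continuous_on_tendsto_compose[OF continuous_on_product_coordinates t(2)]) auto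
    have "(\<lambda>n. sel (t n) x) \<longlonglongrightarrow> f x" for x
    proof (rule LIMSEQ_I)
      fix e :: real assume e: "e > 0"
      obtain i where i: "dist x (dseq i) < e / 3" using dseq_dense[of "e/3" x] e by auto
      obtain no where no: "\<And>n. n \<ge> no \<Longrightarrow> \<bar>t n i - R f i\<bar> < e / 3"
        using LIMSEQ_D[OF c[of i], of "e/3"] e by auto
      have "\<bar>sel (t n) x - f x\<bar> < e" if n: "n \<ge> no" for n
      proof -
        have "\<bar>sel (t n) x - sel (t n) (dseq i)\<bar> \<le> dist x (dseq i)" "\<bar>f x - f (dseq i)\<bar> \<le> dist x (dseq i)"
          using BL1_lip[OF sel(1)[OF t(1)[of n]]] BL1_lip[OF f] by auto
        moreover have "sel (t n) (dseq i) = t n i" using sel(2)[OF t(1)[of n]] by (auto simp: R_def fun_eq_iff)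
        ultimately show ?thesis using no[OF n] i unfolding R_def by linarith
      qed
      then show "\<exists>no. \<forall>n\<ge>no. norm (sel (t n) x - f x) < e" by auto
    qed
    then show "\<exists>g. (\<forall>n. g n \<in> sel ` T) \<and> (\<forall>x. (\<lambda>n. g n x) \<longlonglongrightarrow> f x)"
      using t(1) by (intro exI[of _ "\<lambda>n. sel (t n)"]) auto
  qed
qed

lemma bl_dist_countable:
  assumes L: "L \<subseteq> BL1" "L \<noteq> {}"
    and dense: "\<And>f. f \<in> BL1 \<Longrightarrow> \<exists>g. (\<forall>n. g n \<in> L) \<and> (\<forall>x. (\<lambda>n. g n x) \<longlonglongrightarrow> f x)"
    and \<nu>: "\<nu> \<in> space PA" and \<nu>': "\<nu>' \<in> space PA"
  shows "bl_dist \<nu> \<nu>' = (SUP f\<in>L. \<bar>(LINT x|\<nu>. f x) - (LINT x|\<nu>'. f x)\<bar>)"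
proof (rule antisym)
  have bdd: "bdd_above ((\<lambda>f. \<bar>(LINT x|\<nu>. f x) - (LINT x|\<nu>'. f x)\<bar>) ` L)"
    by (rule bdd_above_mono[OF bl_dist_bdd(1)[OF \<nu> \<nu>']]) (use L in auto)
  show "bl_dist \<nu> \<nu>' \<le> (SUP f\<in>L. \<bar>(LINT x|\<nu>. f x) - (LINT x|\<nu>'. f x)\<bar>)"
  proof (rule bl_dist_least)
    fix f :: "'a \<Rightarrow> real" assume f: "f \<in> BL1"
    obtain g where g: "\<And>n. g n \<in> L" "\<And>x. (\<lambda>n. g n x) \<longlonglongrightarrow> f x" using dense[OF f] by auto
    have gB: "g n \<in> BL1" for n using g(1) L by auto
    have c: "(\<lambda>n. LINT x|N. g n x) \<longlonglongrightarrow> (LINT x|N. f x)" if N: "N \<in> space PA" for N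
    proof -
      interpret prob_space N using N by (rule PA_D)
      show ?thesis using g gB unfolding BL1_def
      by (intro integral_dominated_convergence[where w="\<lambda>_. 1"])
         (auto intro!: PA_measurable[OF N] BL1_meas f simp: BL1_def)
    qed
    have "(\<lambda>n. \<bar>(LINT x|\<nu>. g n x) - (LINT x|\<nu>'. g n x)\<bar>) \<longlonglongrightarrow> \<bar>(LINT x|\<nu>. f x) - (LINT x|\<nu>'. f x)\<bar>"
      by (intro tendsto_intros c \<nu> \<nu>')
    then show "\<bar>(LINT x|\<nu>. f x) - (LINT x|\<nu>'. f x)\<bar> \<le> (SUP f\<in>L. \<bar>(LINT x|\<nu>. f x) - (LINT x|\<nu>'. f x)\<bar>)"
      by (rule LIMSEQ_le_const2) (auto intro!: cSUP_upper[OF g(1) bdd])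
  qed
  show "(SUP f\<in>L. \<bar>(LINT x|\<nu>. f x) - (LINT x|\<nu>'. f x)\<bar>) \<le> bl_dist \<nu> \<nu>'"
    using L by (intro cSUP_least bl_dist_upper[OF \<nu> \<nu>']) auto
qed

lemma integral_measurable_PA[measurable]:
  fixes f :: "'e::polish_space \<Rightarrow> real"
  assumes "f \<in> borel_measurable borel"
  shows "(\<lambda>M. LINT x|M. f x) \<in> borel_measurable PA"
  using assms unfolding prob_algebra_def by (intro measurable_restrict_space1) measurable

lemma bl_dist_measurable[measurable]:
  "(\<lambda>(\<nu>, \<nu>'). bl_dist \<nu> \<nu>') \<in> borel_measurable (PA \<Otimes>\<^sub>M (PA :: 'e::polish_space measure measure))"
proof -
  obtain L :: "('e \<Rightarrow> real) set" where L: "countable L" "L \<subseteq> BL1" "L \<noteq> {}"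
    "\<And>f. f \<in> BL1 \<Longrightarrow> \<exists>g. (\<forall>n. g n \<in> L) \<and> (\<forall>x. (\<lambda>n. g n x) \<longlonglongrightarrow> f x)"
    by (rule BL1_countable_dense) blast
  have "(\<lambda>p. SUP f\<in>L. \<bar>(LINT x|fst p. f x) - (LINT x|snd p. f x)\<bar>) \<in> borel_measurable (PA \<Otimes>\<^sub>M PA)"
  proof (rule borel_measurable_cSUP[OF L(1)])
    fix f :: "'e \<Rightarrow> real" assume "f \<in> L"
    then have [measurable]: "f \<in> borel_measurable borel" using L(2) BL1_meas by auto
    show "(\<lambda>p. \<bar>(LINT x|fst p. f x) - (LINT x|snd p. f x)\<bar>) \<in> borel_measurable (PA \<Otimes>\<^sub>M PA)"
      by measurable
  next
    fix p :: "'e measure \<times> 'e measure" assume "p \<in> space (PA \<Otimes>\<^sub>M PA)"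
    then have "fst p \<in> space PA" "snd p \<in> space PA" by (auto simp: space_pair_measure)
    then show "bdd_above ((\<lambda>f. \<bar>(LINT x|fst p. f x) - (LINT x|snd p. f x)\<bar>) ` L)"
      by (rule bdd_above_mono[OF bl_dist_bdd(1) image_mono[OF L(2)]])
  qed
  also have "?this \<longleftrightarrow> ?thesis"
    using bl_dist_countable[OF L(2,3,4)]
    by (intro measurable_cong) (auto simp: space_pair_measure simp del: SUP_apply)
  finally show ?thesis .
qed

section \<open>Sequential compactness of tight families\<close>

text \<open>Indicators of cells are coded by a point of the Cantor set. Its ternary digits extend to continuous
  functions on the real line, so Helly's theorem yields limits of the joint laws of the indicators.\<close>

definition clamp3 :: "real \<Rightarrow> real" where
  "clamp3 c = max 0 (min 1 (3 * c - 1))"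

text \<open>The argument \<open>3 * c - 2 * clamp3 c\<close> removes the leading ternary digit of a
  Cantor point, because \<open>clamp3\<close> is \<open>0\<close> up to \<open>1 / 3\<close> and
  \<open>1\<close> from \<open>2 / 3\<close> on.\<close>

primrec digit :: "nat \<Rightarrow> real \<Rightarrow> real" where
  "digit 0 c = clamp3 c"
| "digit (Suc n) c = digit n (3 * c - 2 * clamp3 c)"

definition cantor_code :: "(nat \<Rightarrow> real) \<Rightarrow> real" where
  "cantor_code b = (\<Sum>n. 2 * b n / 3 ^ Suc n)"

lemma digit_cont: "continuous_on UNIV (digit n)"
proof (induction n)
  case 0
  show ?case by (auto simp: clamp3_def intro!: continuous_intros)
next
  case (Suc n)
  have "continuous_on UNIV (\<lambda>c. 3 * c - 2 * clamp3 c)"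
    by (auto simp: clamp3_def intro!: continuous_intros)
  from continuous_on_compose2[OF Suc this] show ?case by simp
qed

lemma digit_range: "0 \<le> digit n c" "digit n c \<le> 1"
  by (induction n arbitrary: c) (auto simp: clamp3_def)

lemma digit_meas[measurable]: "digit n \<in> borel_measurable borel"
  by (intro borel_measurable_continuous_onI digit_cont)

lemma cantor_code:
  assumes b: "\<And>n. b n \<in> {0, 1}"
  shows cantor_code_summable: "summable (\<lambda>n. 2 * b n / 3 ^ Suc n)"
    and cantor_code_range: "0 \<le> cantor_code b" "cantor_code b \<le> 1"
proof -
  have b': "0 \<le> b n \<and> b n \<le> 1" for n using b[of n] by auto
  have s: "(\<lambda>n. (2/3) * (1 / 3 :: real) ^ n) sums ((2/3) * (1 / (1 - 1/3)))"
    by (intro sums_mult geometric_sums) auto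
  have le: "2 * b n / 3 ^ Suc n \<le> (2/3) * (1 / 3) ^ n" for n
    using b'[of n] by (simp add: power_divide divide_right_mono)
  show sm: "summable (\<lambda>n. 2 * b n / 3 ^ Suc n)"
    by (rule summable_comparison_test'[OF sums_summable[OF s], of 0]) (use le b' in auto)
  show "0 \<le> cantor_code b"
    unfolding cantor_code_def using b' by (intro suminf_nonneg sm) auto
  have "cantor_code b \<le> (\<Sum>n. (2/3) * (1 / 3 :: real) ^ n)"
    unfolding cantor_code_def by (intro suminf_le le sm sums_summable[OF s])
  also have "\<dots> = 1" using sums_unique[OF s] by simp
  finally show "cantor_code b \<le> 1" .
qed

lemma cantor_code_step:
  assumes b: "\<And>n. b n \<in> {0, 1}"
  shows "cantor_code b = (2 * b 0 + cantor_code (\<lambda>n. b (Suc n))) / 3"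
proof -
  have "cantor_code b = 2 * b 0 / 3 + (\<Sum>n. 2 * b (Suc n) / 3 ^ Suc (Suc n))"
    unfolding cantor_code_def
    using suminf_split_head[OF cantor_code_summable[of b]] b by simp
  also have "(\<Sum>n. 2 * b (Suc n) / 3 ^ Suc (Suc n)) = (\<Sum>n. (2 * b (Suc n) / 3 ^ Suc n) / 3)"
    by (simp add: field_simps)
  also have "\<dots> = cantor_code (\<lambda>n. b (Suc n)) / 3"
    unfolding cantor_code_def by (rule suminf_divide[OF cantor_code_summable]) (use b in auto)
  finally show ?thesis by (simp add: add_divide_distrib)
qed

lemma clamp3_cantor_code:
  assumes b: "\<And>n. b n \<in> {0, 1}"
  shows "clamp3 (cantor_code b) = b 0"
proof -
  have "3 * cantor_code b - 1 = 2 * b 0 + cantor_code (\<lambda>n. b (Suc n)) - 1"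
    using cantor_code_step[of b, OF b] by simp
  moreover have "0 \<le> cantor_code (\<lambda>n. b (Suc n))" "cantor_code (\<lambda>n. b (Suc n)) \<le> 1"
    by (intro cantor_code_range b)+
  moreover have "b 0 = 0 \<or> b 0 = 1" using b[of 0] by simp
  ultimately show ?thesis unfolding clamp3_def by (elim disjE) (simp_all add: max_def min_def)
qed

lemma digit_cantor_code:
  assumes "\<And>n. b n \<in> {0, 1}"
  shows "digit n (cantor_code b) = b n"
  using assms
proof (induction n arbitrary: b)
  case (0 b)
  then show ?case by (simp add: clamp3_cantor_code)
next
  case (Suc n b)
  have "3 * cantor_code b - 2 * clamp3 (cantor_code b) = cantor_code (\<lambda>n. b (Suc n))"
    using cantor_code_step[of b, OF Suc(2)] clamp3_cantor_code[of b, OF Suc(2)] by simp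
  moreover have "digit n (cantor_code (\<lambda>n. b (Suc n))) = b (Suc n)" by (rule Suc.IH) (rule Suc.prems)
  ultimately show ?case by simp
qed

text \<open>The laws of the code live on \<open>[0,1]\<close>, so Helly's theorem applies. Products
  of digits are bounded continuous functions of the code, so all mixed moments of the bits converge;
  testing with \<open>digit n c * (1 - digit n c)\<close> shows that the limit still consists of
  bits.\<close>

lemma bits_subsequence:
  fixes N :: "nat \<Rightarrow> 'a measure" and B :: "nat \<Rightarrow> 'a \<Rightarrow> real"
  assumes N: "\<And>j. prob_space (N j)" and B[measurable]: "\<And>j n. B n \<in> borel_measurable (N j)"
    and B01: "\<And>n x. B n x \<in> {0, 1}"
  obtains r M where "strict_mono (r :: nat \<Rightarrow> nat)" "real_distribution M"
    "\<And>I. finite I \<Longrightarrow> (\<lambda>j. LINT x|N (r j). (\<Prod>n\<in>I. B n x)) \<longlonglongrightarrow> (LINT c|M. (\<Prod>n\<in>I. digit n c))"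
    "AE c in M. \<forall>n. digit n c \<in> {0, 1}"
proof -
  define C where "C x = cantor_code (\<lambda>n. B n x)" for x
  have [measurable]: "C \<in> borel_measurable (N j)" for j
    unfolding C_def cantor_code_def by measurable
  have C: "0 \<le> C x" "C x \<le> 1" for x unfolding C_def by (intro cantor_code_range B01)+
  have dig: "digit n (C x) = B n x" for n x unfolding C_def by (rule digit_cantor_code[OF B01])
  define \<mu> where "\<mu> j = distr (N j) borel C" for j
  have rd: "real_distribution (\<mu> j)" for j
    unfolding \<mu>_def by (intro prob_space.real_distribution_distr N) simp
  have "tight \<mu>"
    unfolding tight_def
  proof safe
    fix e :: real assume "e > 0"
    \<comment> \<open>The interval is open on the left, and \<open>0\<close> is a possible code, so
      it starts at \<open>-1\<close>.\<close>
    have "measure (\<mu> n) {-1<..1} = 1" for n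
    proof -
      interpret prob_space "N n" by (rule N)
      have "measure (\<mu> n) {-1<..1} = prob (C -` {-1<..1} \<inter> space (N n))"
        unfolding \<mu>_def by (rule measure_distr) auto
      also have "C -` {-1<..1} \<inter> space (N n) = space (N n)"
      proof -
        have "-1 < C x" for x using C(1)[of x] by linarith
        then show ?thesis using C(2) by auto
      qed
      finally show ?thesis by (simp add: prob_space)
    qed
    then show "\<exists>a b. a < b \<and> (\<forall>n. 1 - e < measure (\<mu> n) {a<..b})"
      using \<open>e > 0\<close> by (intro exI[of _ "-1"] exI[of _ 1]) auto
  qed (rule rd)
  from tight_imp_convergent_subsubsequence[OF this strict_mono_id] obtain r M
    where r: "strict_mono r" and M: "real_distribution M" and wc: "weak_conv_m (\<mu> \<circ> id \<circ> r) M" by auto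
  have conv: "(\<lambda>j. LINT x|N (r j). g (C x)) \<longlonglongrightarrow> (LINT c|M. g c)"
    if g: "continuous_on UNIV g" "\<And>c. \<bar>g c\<bar> \<le> 1" for g :: "real \<Rightarrow> real"
  proof -
    have [measurable]: "g \<in> borel_measurable borel" by (intro borel_measurable_continuous_onI g)
    have "(\<lambda>j. integral\<^sup>L ((\<mu> \<circ> id \<circ> r) j) g) \<longlonglongrightarrow> integral\<^sup>L M g"
      using g rd by (intro weak_conv_imp_integral_bdd_continuous_conv[OF _ M wc, of g 1])
        (auto simp: continuous_on_eq_continuous_at)
    then show ?thesis by (simp add: \<mu>_def integral_distr)
  qed
  have pr: "0 \<le> (\<Prod>n\<in>I. digit n c)" "(\<Prod>n\<in>I. digit n c) \<le> 1" for I c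
    using digit_range by (auto intro: prod_nonneg prod_le_1)
  interpret M: real_distribution M by (rule M)
  show thesis
  proof (rule that[OF r M])
    fix I :: "nat set" assume "finite I"
    have "(\<lambda>j. LINT x|N (r j). (\<Prod>n\<in>I. digit n (C x))) \<longlonglongrightarrow> (LINT c|M. (\<Prod>n\<in>I. digit n c))"
    proof (rule conv)
      show "continuous_on UNIV (\<lambda>c. \<Prod>n\<in>I. digit n c)" by (intro continuous_intros digit_cont)
      show "\<bar>\<Prod>n\<in>I. digit n c\<bar> \<le> 1" for c using pr[where I=I and c=c] by simp
    qed
    then show "(\<lambda>j. LINT x|N (r j). (\<Prod>n\<in>I. B n x)) \<longlonglongrightarrow> (LINT c|M. (\<Prod>n\<in>I. digit n c))"
      by (simp add: dig)
  next
    have "AE c in M. digit n c \<in> {0, 1}" for n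
    proof -
      let ?g = "\<lambda>c. digit n c * (1 - digit n c)"
      have g: "0 \<le> ?g c" "?g c \<le> 1" for c
        using digit_range[where n=n and c=c] by (auto intro: mult_le_one)
      have "(\<lambda>j. LINT x|N (r j). ?g (C x)) \<longlonglongrightarrow> (LINT c|M. ?g c)"
      proof (rule conv)
        show "continuous_on UNIV ?g" by (intro continuous_intros digit_cont)
        show "\<bar>?g c\<bar> \<le> 1" for c using g[of c] by simp
      qed
      moreover have "?g (C x) = 0" for x using B01[of n x] by (auto simp: dig)
      ultimately have "(LINT c|M. ?g c) = 0" by (simp add: LIMSEQ_const_iff)
      moreover have "integrable M ?g"
        using g by (intro M.integrable_const_bound[of _ 1]) auto
      ultimately have "AE c in M. ?g c = 0"
        using g(1) by (subst (asm) integral_nonneg_eq_0_iff_AE) auto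
      then show ?thesis by eventually_elim auto
    qed
    then show "AE c in M. \<forall>n. digit n c \<in> {0, 1}" by (simp add: AE_all_countable)
  qed
qed

text \<open>Stated for an abstract map \<open>Z\<close> with abstract bits \<open>u\<close>, because
  it is applied both to a point under \<open>\<nu> j\<close> and to the point reconstructed from the
  limit of the codes. The two integrals are then compared through the same finite list of values
  \<open>f (dseq i)\<close>.\<close>

lemma quantize:
  fixes Z :: "'a \<Rightarrow> 'e::polish_space" and u :: "nat \<Rightarrow> 'a \<Rightarrow> real"
  assumes N: "prob_space N" and [measurable]: "Z \<in> borel_measurable N" "\<And>i. u i \<in> borel_measurable N"
    and u: "AE x in N. (\<forall>i. u i x \<in> {0, 1}) \<and> (\<forall>i j. i \<noteq> j \<longrightarrow> u i x * u j x = 0)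
      \<and> (\<forall>i. u i x = 1 \<longrightarrow> dist (Z x) (dseq i) \<le> \<delta>)"
    and u01: "\<And>i x. 0 \<le> u i x \<and> u i x \<le> 1" and \<delta>: "\<delta> \<ge> 0"
    and f: "f \<in> BL1"
  shows "\<bar>(LINT x|N. f (Z x)) - (\<Sum>i<L. f (dseq i) * (LINT x|N. u i x))\<bar> \<le> \<delta> + (1 - (\<Sum>i<L. LINT x|N. u i x))"
proof -
  interpret prob_space N by (rule N)
  have [measurable]: "f \<in> borel_measurable borel" by (rule BL1_meas[OF f])
  have fb: "\<bar>f x\<bar> \<le> 1" for x using f by (auto simp: BL1_def)
  have ui: "integrable N (u i)" for i
    using u01 by (intro integrable_const_bound[of _ 1]) auto
  have fi: "integrable N (\<lambda>x. f (Z x))"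
    using fb by (intro integrable_const_bound[of _ 1]) auto
  let ?g = "\<lambda>x. f (Z x) - (\<Sum>i<L. f (dseq i) * u i x)"
  have gi: "integrable N ?g"
    by (intro Bochner_Integration.integrable_diff Bochner_Integration.integrable_sum integrable_mult_right fi ui)
  have pt: "AE x in N. \<bar>?g x\<bar> \<le> \<delta> + (1 - (\<Sum>i<L. u i x))"
    using u
  proof eventually_elim
    case (elim x)
    have s1: "(\<Sum>i<L. u i x) \<le> 1"
    proof (cases "\<exists>i<L. u i x = 1")
      case True
      then obtain i where i: "i < L" "u i x = 1" by auto
      have "(\<Sum>j<L. u j x) = (\<Sum>j<L. if j = i then 1 else 0)"
      proof (rule sum.cong[OF refl])
        fix j
        show "u j x = (if j = i then 1 else 0)"
          using elim i by (metis mult_cancel_left2 mult.commute zero_neq_one)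
      qed
      then show ?thesis using i by simp
    next
      case False
      then have "(\<Sum>j<L. u j x) = 0" using elim by (intro sum.neutral) auto
      then show ?thesis by simp
    qed
    have s0: "0 \<le> (\<Sum>i<L. u i x)" using u01 by (intro sum_nonneg) auto
    have e1: "(\<Sum>i<L. f (Z x) * u i x) = f (Z x) * (\<Sum>i<L. u i x)" by (rule sum_distrib_left[symmetric])
    have "?g x = (\<Sum>i<L. (f (Z x) - f (dseq i)) * u i x) + f (Z x) * (1 - (\<Sum>i<L. u i x))"
      unfolding left_diff_distrib sum_subtractf e1 by (simp add: algebra_simps)
    also have "\<bar>\<dots>\<bar> \<le> (\<Sum>i<L. \<delta> * u i x) + 1 * (1 - (\<Sum>i<L. u i x))"
    proof (intro order_trans[OF abs_triangle_ineq] add_mono)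
      have "\<bar>(f (Z x) - f (dseq i)) * u i x\<bar> \<le> \<delta> * u i x" for i
      proof (cases "u i x = 0")
        case False
        then have "u i x = 1" using elim by auto
        then show ?thesis using elim BL1_lip[OF f, of "Z x" "dseq i"] by (auto intro: order_trans)
      qed simp
      then show "\<bar>\<Sum>i<L. (f (Z x) - f (dseq i)) * u i x\<bar> \<le> (\<Sum>i<L. \<delta> * u i x)"
        by (intro order_trans[OF sum_abs] sum_mono)
      show "\<bar>f (Z x) * (1 - (\<Sum>i<L. u i x))\<bar> \<le> 1 * (1 - (\<Sum>i<L. u i x))"
        using s1 fb[of "Z x"] by (simp add: abs_mult mult_left_le_one_le)
    qed
    also have "(\<Sum>i<L. \<delta> * u i x) \<le> \<delta> * 1"
      unfolding sum_distrib_left[symmetric] using s1 \<delta> by (rule mult_left_mono)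
    finally show ?case by simp
  qed
  have "(LINT x|N. f (Z x)) - (\<Sum>i<L. f (dseq i) * (LINT x|N. u i x)) = (LINT x|N. ?g x)"
    using fi ui by simp
  also have "\<bar>\<dots>\<bar> \<le> (LINT x|N. \<bar>?g x\<bar>)" using integral_abs_bound[of N ?g] by simp
  also have "\<dots> \<le> (LINT x|N. \<delta> + (1 - (\<Sum>i<L. u i x)))"
    by (rule integral_mono_AE[OF integrable_abs[OF gi] _ pt]) (simp add: ui)
  also have "\<dots> = \<delta> + (1 - (\<Sum>i<L. LINT x|N. u i x))"
    using ui by (simp add: prob_space)
  finally show ?thesis .
qed

section \<open>Cells around a dense sequence and the compactness theorem\<close>

definition cell :: "nat \<Rightarrow> 'e::polish_space \<Rightarrow> nat" where
  "cell k x = (LEAST i. dist x (dseq i) < 1 / 2 ^ k)"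

lemma cell_dist: "dist x (dseq (cell k x)) < 1 / 2 ^ k"
  unfolding cell_def by (rule LeastI_ex) (rule dseq_dense, simp)

lemma cell_measurable[measurable]: "cell k \<in> measurable borel (count_space UNIV)"
  unfolding cell_def by measurable

lemma cell_bounded_on_compact:
  assumes "compact K"
  shows "\<exists>L. \<forall>x\<in>K. cell k x < L"
proof -
  have "\<exists>F\<subseteq>range (\<lambda>i. ball (dseq i) (1 / 2 ^ k)). finite F \<and> K \<subseteq> \<Union>F"
  proof (rule compactE[OF assms])
    show "K \<subseteq> \<Union>(range (\<lambda>i. ball (dseq i) (1 / 2 ^ k)))"
      using dseq_dense[of "1 / 2 ^ k"] by (auto simp: dist_commute)
  qed auto
  then obtain I where I: "finite I" "K \<subseteq> (\<Union>i\<in>I. ball (dseq i) (1 / 2 ^ k))"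
    by (metis finite_subset_image)
  show ?thesis
  proof (intro exI ballI)
    fix x assume "x \<in> K"
    then obtain i where i: "i \<in> I" "dist x (dseq i) < 1 / 2 ^ k" using I by (auto simp: dist_commute)
    have "cell k x \<le> i" unfolding cell_def using i(2) by (rule Least_le)
    also have "i \<le> Max I" using I i by simp
    finally show "cell k x < Suc (Max I)" by simp
  qed
qed

text \<open>The bits record, for every level \<open>k\<close>, in which cell a point lies; taking
  the least admissible index makes the cells of one level disjoint. Under the limit law of the bits
  there is almost surely exactly one cell at each level, since tightness prevents a loss of mass,
  and the centres of successive cells are close. They converge to a random point, whose law is the
  weak limit sought.\<close>

theorem tight_sequence_compact:
  fixes \<nu> :: "nat \<Rightarrow> 'e::polish_space measure"
  assumes \<nu>: "\<And>j. \<nu> j \<in> space PA"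
    and tight: "\<And>e. e > 0 \<Longrightarrow> \<exists>K. compact K \<and> (\<forall>j. measure (\<nu> j) (UNIV - K) \<le> e)"
  obtains r l where "strict_mono (r :: nat \<Rightarrow> nat)" "l \<in> space PA" "wconv (\<lambda>j. \<nu> (r j)) l"
proof -
  define B :: "nat \<Rightarrow> 'e \<Rightarrow> real" where
    "B n x = (if cell (fst (prod_decode n)) x = snd (prod_decode n) then 1 else 0)" for n x
  have Bm[measurable]: "B n \<in> borel_measurable borel" for n unfolding B_def by measurable
  have B01: "B n x \<in> {0, 1}" for n x by (simp add: B_def)
  obtain r M where r: "strict_mono r" and M: "real_distribution M"
    and conv: "\<And>I. finite I \<Longrightarrow> (\<lambda>j. LINT x|\<nu> (r j). (\<Prod>n\<in>I. B n x)) \<longlonglongrightarrow> (LINT c|M. (\<Prod>n\<in>I. digit n c))"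
    and d01: "AE c in M. \<forall>n. digit n c \<in> {0, 1}"
    by (rule bits_subsequence[of \<nu> B, OF PA_D(1)[OF \<nu>] PA_measurable[OF \<nu> Bm] B01]) blast
  interpret M: real_distribution M by (rule M)
  define u :: "nat \<Rightarrow> nat \<Rightarrow> 'e \<Rightarrow> real" where "u k i x = (if cell k x = i then 1 else 0)" for k i x
  have um[measurable]: "u k i \<in> borel_measurable borel" for k i unfolding u_def by measurable
  define w where "w k i = digit (prod_encode (k, i))" for k i
  have wm[measurable]: "w k i \<in> borel_measurable borel" for k i unfolding w_def by measurable
  have w_range: "0 \<le> w k i c" "w k i c \<le> 1" for k i c unfolding w_def by (rule digit_range)+
  have wi: "integrable M (w k i)" for k i
    using w_range by (intro M.integrable_const_bound[of _ 1]) auto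
  have conv1: "(\<lambda>j. LINT x|\<nu> (r j). u k i x) \<longlonglongrightarrow> (LINT c|M. w k i c)" for k i
    using conv[of "{prod_encode (k, i)}"] by (simp add: B_def u_def w_def)
  have conv2: "(\<lambda>j. LINT x|\<nu> (r j). u k i x * u k' i' x) \<longlonglongrightarrow> (LINT c|M. w k i c * w k' i' c)"
    if "(k, i) \<noteq> (k', i')" for k i k' i'
    using conv[of "{prod_encode (k, i), prod_encode (k', i')}"] that
    by (simp add: B_def u_def w_def)
  \<comment> \<open>Incompatible cells have product zero along the sequence; convergence of the
    mixed moments carries this over to the limit.\<close>
  have excl: "AE c in M. w k i c * w k' i' c = 0" if ne: "(k, i) \<noteq> (k', i')"
    and z: "\<And>x. u k i x * u k' i' x = 0" for k i k' i'
  proof -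
    have "(LINT c|M. w k i c * w k' i' c) = 0"
      using conv2[OF ne] unfolding z by (simp add: LIMSEQ_const_iff)
    moreover have "integrable M (\<lambda>c. w k i c * w k' i' c)"
      by (intro M.integrable_const_bound[of _ 1]) (auto simp: abs_mult w_range intro!: mult_le_one)
    ultimately show ?thesis
      using w_range by (subst (asm) integral_nonneg_eq_0_iff_AE) auto
  qed
  have uniq: "AE c in M. \<forall>k i i'. i \<noteq> i' \<longrightarrow> w k i c * w k i' c = 0"
    unfolding AE_all_countable by (intro allI AE_impI excl) (auto simp: u_def)
  \<comment> \<open>Centres of cells of levels \<open>k\<close> and \<open>Suc k\<close> that share
    a point are at distance below \<open>1 / 2 ^ k + 1 / 2 ^ Suc k\<close>.\<close>
  have near: "AE c in M. \<forall>k i i'. dist (dseq i :: 'e) (dseq i') > 2 / 2 ^ k \<longrightarrow> w k i c * w (Suc k) i' c = 0"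
    unfolding AE_all_countable
  proof (intro allI AE_impI excl)
    fix k i i' x assume d: "2 / 2 ^ k < dist (dseq i :: 'e) (dseq i')"
    show "u k i x * u (Suc k) i' x = 0"
    proof (rule ccontr)
      assume "\<not> ?thesis"
      then have "cell k x = i" "cell (Suc k) x = i'" by (auto simp: u_def split: if_splits)
      then have a: "dist x (dseq i) < 1 / 2 ^ k" "dist x (dseq i') < 1 / 2 ^ Suc k"
        using cell_dist by blast+
      have "dist (dseq i :: 'e) (dseq i') \<le> dist x (dseq i) + dist x (dseq i')"
        by (metis dist_commute dist_triangle)
      also have "\<dots> < 1 / 2 ^ k + 1 / 2 ^ Suc k" using a by simp
      also have "\<dots> \<le> 2 / 2 ^ k" by (simp add: field_simps)
      finally show False using d by simp
    qed
  qed simp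
  have usum: "(LINT x|\<nu> j. (\<Sum>i<L. u k i x)) = (\<Sum>i<L. LINT x|\<nu> j. u k i x)" for j k L
    by (intro Bochner_Integration.integral_sum pa_integrable[OF \<nu> um, of _ _ 1]) (simp add: u_def)
  have usum': "(\<Sum>i<L. u k i x) = (if cell k x < L then 1 else 0)" for k L x
    by (simp add: u_def)
  \<comment> \<open>Tightness enters here: a compact set meets only finitely many cells of level
    \<open>k\<close>, so finitely many bits carry nearly all mass, uniformly in \<open>j\<close> and
    hence also in the limit.\<close>
  have sum_w: "\<exists>L. (\<Sum>i<L. LINT c|M. w k i c) \<ge> 1 - e \<and> (\<forall>j. (\<Sum>i<L. LINT x|\<nu> j. u k i x) \<ge> 1 - e)"
    if e: "e > 0" for e k
  proof -
    obtain K where K: "compact K" "\<And>j. measure (\<nu> j) (UNIV - K) \<le> e" using tight[OF e] by auto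
    obtain L where L: "\<And>x. x \<in> K \<Longrightarrow> cell k x < L" using cell_bounded_on_compact[OF K(1)] by blast
    have [measurable]: "K \<in> sets borel" using K(1) by (intro borel_closed compact_imp_closed)
    have 1: "(\<Sum>i<L. LINT x|\<nu> j. u k i x) \<ge> 1 - e" for j
    proof -
      interpret prob_space "\<nu> j" by (rule PA_D[OF \<nu>])
      have Ks: "K \<in> events" using PA_D(2)[OF \<nu>, of j] by simp
      have "1 - e \<le> 1 - prob (UNIV - K)" using K(2)[of j] by simp
      also have "\<dots> = prob K" using prob_compl[OF Ks] PA_space[OF \<nu>, of j] by simp
      also have "\<dots> = (LINT x|\<nu> j. indicator K x)" using Ks by simp
      also have "\<dots> \<le> (LINT x|\<nu> j. (\<Sum>i<L. u k i x))"
      proof (rule integral_mono)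
        show "integrable (\<nu> j) (indicator K :: 'e \<Rightarrow> real)"
          by (rule pa_integrable[OF \<nu>, of _ 1]) (auto simp: indicator_def)
        show "integrable (\<nu> j) (\<lambda>x. \<Sum>i<L. u k i x)"
          by (rule pa_integrable[OF \<nu>, of _ 1]) (auto simp: usum')
        fix x show "indicator K x \<le> (\<Sum>i<L. u k i x)"
          unfolding usum' using L by (auto simp: indicator_def)
      qed
      finally show ?thesis by (simp add: usum)
    qed
    have "(\<lambda>j. (\<Sum>i<L. LINT x|\<nu> (r j). u k i x)) \<longlonglongrightarrow> (\<Sum>i<L. LINT c|M. w k i c)"
      by (intro tendsto_intros conv1)
    then have "(\<Sum>i<L. LINT c|M. w k i c) \<ge> 1 - e"
      by (rule LIMSEQ_le_const) (use 1 in auto)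
    then show ?thesis using 1 by auto
  qed
  have some: "AE c in M. \<forall>k. \<exists>i. w k i c = 1"
    unfolding AE_all_countable
  proof
    fix k
    let ?G = "{c. \<exists>i. w k i c = 1}"
    have [measurable]: "?G \<in> sets borel" by measurable
    have "M.prob ?G \<ge> 1"
    proof (rule field_le_epsilon)
      fix e :: real assume "e > 0"
      then obtain L where L: "(\<Sum>i<L. LINT c|M. w k i c) \<ge> 1 - e" using sum_w by blast
      have "(\<Sum>i<L. LINT c|M. w k i c) = (LINT c|M. (\<Sum>i<L. w k i c))" using wi by simp
      also have "\<dots> \<le> (LINT c|M. indicator ?G c)"
      proof (rule integral_mono_AE)
        show "AE c in M. (\<Sum>i<L. w k i c) \<le> indicator ?G c"
          using d01 uniq
        proof eventually_elim
          case (elim c)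
          show ?case
          proof (cases "\<exists>i. w k i c = 1")
            case True
            then obtain i where i: "w k i c = 1" by auto
            have "(\<Sum>j<L. w k j c) \<le> (\<Sum>j<L. if j = i then 1 else 0)"
            proof (rule sum_mono)
              fix j show "w k j c \<le> (if j = i then 1 else 0)"
              proof (cases "j = i")
                case False
                then have "w k i c * w k j c = 0" using elim(2) by auto
                then show ?thesis using i False by simp
              qed (simp add: w_range)
            qed
            also have "\<dots> \<le> 1" by simp
            finally show ?thesis using True by simp
          next
            case False
            then have "w k i c = 0" for i using elim(1) unfolding w_def by fastforce
            then show ?thesis by simp
          qed
        qed
      qed (use wi in \<open>auto intro!: M.integrable_const_bound[of _ 1]\<close>)
      also have "\<dots> = M.prob ?G" by simp
      finally show "1 \<le> M.prob ?G + e" using L by simp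
    qed
    then have "M.prob ?G = 1" using M.prob_le_1[of ?G] by linarith
    then show "AE c in M. \<exists>i. w k i c = 1"
      using M.prob_eq_1[of ?G] by simp
  qed
  define ind where "ind k c = (LEAST i. w k i c = 1)" for k c
  \<comment> \<open>\<open>G\<close> is the measurable event on which the selection of centres
    works; outside it \<open>Z\<close> is constant in \<open>k\<close>, so that \<open>Z\<close>
    converges everywhere.\<close>
  define G where "G c \<longleftrightarrow> (\<forall>k. \<exists>i. w k i c = 1) \<and>
      (\<forall>k i i'. dist (dseq i :: 'e) (dseq i') > 2 / 2 ^ k \<longrightarrow> w k i c * w (Suc k) i' c = 0)" for c
  have Gm[measurable]: "Measurable.pred borel G" unfolding G_def by measurable
  have AEG: "AE c in M. G c" using some near unfolding G_def by eventually_elim auto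
  have indm[measurable]: "ind k \<in> measurable borel (count_space UNIV)" for k unfolding ind_def by measurable
  define Z :: "nat \<Rightarrow> real \<Rightarrow> 'e" where "Z k c = (if G c then dseq (ind k c) else dseq 0)" for k c
  have Zm[measurable]: "Z k \<in> borel_measurable borel" for k unfolding Z_def by measurable
  have ind1: "w k (ind k c) c = 1" if "G c" for k c
  proof -
    have "\<exists>i. w k i c = 1" using that unfolding G_def by blast
    from LeastI_ex[OF this] show ?thesis unfolding ind_def .
  qed
  have Zstep: "dist (Z k c) (Z (Suc k) c) \<le> 2 / 2 ^ k" for k c
  proof (cases "G c")
    case True
    then have "w k (ind k c) c * w (Suc k) (ind (Suc k) c) c \<noteq> 0" using ind1 by simp
    then have "\<not> dist (dseq (ind k c) :: 'e) (dseq (ind (Suc k) c)) > 2 / 2 ^ k"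
      using True unfolding G_def by blast
    then show ?thesis using True by (simp add: Z_def)
  qed (simp add: Z_def)
  have Zstep': "dist (Z k c) (Z (k + n) c) \<le> 4 / 2 ^ k - 4 / 2 ^ (k + n)" for k n c
  proof (induction n)
    case (Suc n)
    have "dist (Z k c) (Z (k + Suc n) c) \<le> dist (Z k c) (Z (k + n) c) + dist (Z (k + n) c) (Z (Suc (k + n)) c)"
      by (simp add: dist_triangle)
    also have "\<dots> \<le> (4 / 2 ^ k - 4 / 2 ^ (k + n)) + 2 / 2 ^ (k + n)" by (intro add_mono Suc Zstep)
    also have "\<dots> = 4 / 2 ^ k - 4 / 2 ^ (k + Suc n)" by (simp add: field_simps)
    finally show ?case .
  qed simp
  have Zb: "dist (Z k c) (Z (k + n) c) \<le> 4 / 2 ^ k" for k n c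
    by (rule order_trans[OF Zstep']) simp
  have pw: "\<exists>k. 8 / 2 ^ k < e" if "e > 0" for e :: real
  proof -
    have "0 < e / 8" using that by simp
    from real_arch_pow_inv[OF this, of "1/2"] obtain k where "(1/2) ^ k < e / 8" by auto
    then show ?thesis by (intro exI[of _ k]) (simp add: power_divide field_simps)
  qed
  have Cau: "Cauchy (\<lambda>k. Z k c)" for c
    unfolding Cauchy_altdef2
  proof (intro allI impI)
    fix e :: real assume "e > 0"
    then obtain k where "8 / 2 ^ k < e" using pw by blast
    then have "dist (Z n c) (Z k c) < e" if "n \<ge> k" for n
      using Zb[of k c "n - k"] that divide_right_mono[of 4 8 "2 ^ k :: real"] by (simp add: dist_commute)
    then show "\<exists>k. \<forall>n\<ge>k. dist (Z n c) (Z k c) < e" by blast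
  qed
  define D where "D c = lim (\<lambda>k. Z k c)" for c
  have ZD: "(\<lambda>k. Z k c) \<longlonglongrightarrow> D c" for c
    unfolding D_def using Cau Cauchy_convergent convergent_LIMSEQ_iff by blast
  have Dm[measurable]: "D \<in> borel_measurable borel"
    by (rule borel_measurable_LIMSEQ_metric[OF Zm ZD])
  have ZDb: "dist (Z k c) (D c) \<le> 4 / 2 ^ k" for k c
  proof (rule Lim_bounded)
    show "(\<lambda>n. dist (Z k c) (Z (n + k) c)) \<longlonglongrightarrow> dist (Z k c) (D c)"
      by (intro tendsto_intros LIMSEQ_ignore_initial_segment ZD)
    show "\<forall>n\<ge>0. dist (Z k c) (Z (n + k) c) \<le> 4 / 2 ^ k" using Zb[of k c] by (simp add: add.commute)
  qed
  define l where "l = distr M borel D"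
  have l: "l \<in> space PA"
    unfolding l_def by (intro PA_I M.prob_space_distr) auto
  have "(\<lambda>j. bl_dist (\<nu> (r j)) l) \<longlonglongrightarrow> 0"
  proof (rule LIMSEQ_I)
    fix e :: real assume e: "e > 0"
    obtain k where k: "8 / 2 ^ k < e / 2" using pw[of "e/2"] e by auto
    obtain L where L: "(\<Sum>i<L. LINT c|M. w k i c) \<ge> 1 - e/8" "\<And>j. (\<Sum>i<L. LINT x|\<nu> j. u k i x) \<ge> 1 - e/8"
      using sum_w[of "e/8" k] e by auto
    define \<Delta> where "\<Delta> j = (\<Sum>i<L. \<bar>(LINT x|\<nu> (r j). u k i x) - (LINT c|M. w k i c)\<bar>)" for j
    have "\<Delta> \<longlonglongrightarrow> (\<Sum>i<L. \<bar>(LINT c|M. w k i c) - (LINT c|M. w k i c)\<bar>)"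
      unfolding \<Delta>_def by (intro tendsto_intros conv1)
    then have "eventually (\<lambda>j. \<Delta> j < e / 8) sequentially" using e by (intro order_tendstoD) auto
    then have "eventually (\<lambda>j. norm (bl_dist (\<nu> (r j)) l - 0) < e) sequentially"
    proof eventually_elim
      case (elim j)
      \<comment> \<open>Quantisation costs \<open>1 / 2 ^ k\<close> and \<open>4 / 2 ^ k\<close>, in
        total less than \<open>5 * e / 16\<close>; the two uncovered masses and
        \<open>\<Delta> j\<close> add at most \<open>e / 8\<close> each.\<close>
      have "bl_dist (\<nu> (r j)) l \<le> 7 * e / 8"
      proof (rule bl_dist_least)
        fix f :: "'e \<Rightarrow> real" assume f: "f \<in> BL1"
        have fm[measurable]: "f \<in> borel_measurable borel" by (rule BL1_meas[OF f])
        have 1: "\<bar>(LINT x|\<nu> (r j). f x) - (\<Sum>i<L. f (dseq i) * (LINT x|\<nu> (r j). u k i x))\<bar>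
          \<le> 1 / 2 ^ k + (1 - (\<Sum>i<L. LINT x|\<nu> (r j). u k i x))"
        proof (rule quantize[OF PA_D(1)[OF \<nu>] _ _ _ _ _ f])
          show "AE x in \<nu> (r j). (\<forall>i. u k i x \<in> {0, 1}) \<and> (\<forall>i j. i \<noteq> j \<longrightarrow> u k i x * u k j x = 0) \<and>
              (\<forall>i. u k i x = 1 \<longrightarrow> dist x (dseq i) \<le> 1 / 2 ^ k)"
            by (intro always_eventually) (auto simp: u_def intro!: less_imp_le[OF cell_dist])
        qed (auto simp: u_def PA_measurable[OF \<nu>] intro!: PA_measurable[OF \<nu>])
        have 2: "\<bar>(LINT c|M. f (D c)) - (\<Sum>i<L. f (dseq i) * (LINT c|M. w k i c))\<bar>
          \<le> 4 / 2 ^ k + (1 - (\<Sum>i<L. LINT c|M. w k i c))"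
        proof (rule quantize[OF M.prob_space_axioms _ _ _ _ _ f])
          show "AE x in M. (\<forall>i. w k i x \<in> {0, 1}) \<and> (\<forall>i j. i \<noteq> j \<longrightarrow> w k i x * w k j x = 0) \<and>
              (\<forall>i. w k i x = 1 \<longrightarrow> dist (D x) (dseq i) \<le> 4 / 2 ^ k)"
            using d01 uniq AEG
          proof eventually_elim
            case (elim c)
            have "i = ind k c" if "w k i c = 1" for i
            proof (rule ccontr)
              assume "i \<noteq> ind k c"
              then have "w k i c * w k (ind k c) c = 0" using elim(2) by auto
              then show False using that ind1[OF elim(3), of k] by simp
            qed
            then have "dist (D c) (dseq i) \<le> 4 / 2 ^ k" if "w k i c = 1" for i
              using ZDb[of k c] elim(3) that by (simp add: Z_def dist_commute)
            then show ?case using elim(1,2) by (auto simp: w_def)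
          qed
        qed (auto simp: w_range)
        have 3: "(LINT x|l. f x) = (LINT c|M. f (D c))" unfolding l_def by (rule integral_distr) auto
        have "(\<Sum>i<L. f (dseq i) * (LINT x|\<nu> (r j). u k i x)) - (\<Sum>i<L. f (dseq i) * (LINT c|M. w k i c))
          = (\<Sum>i<L. f (dseq i) * ((LINT x|\<nu> (r j). u k i x) - (LINT c|M. w k i c)))"
          by (simp add: sum_subtractf right_diff_distrib)
        also have "\<bar>\<dots>\<bar> \<le> \<Delta> j"
          unfolding \<Delta>_def using f
          by (intro order_trans[OF sum_abs] sum_mono) (simp add: abs_mult BL1_def mult_left_le_one_le)
        finally show "\<bar>(LINT x|\<nu> (r j). f x) - (LINT x|l. f x)\<bar> \<le> 7 * e / 8"
          using 1 2 3 L(1) L(2)[of "r j"] elim k by linarith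
      qed
      then show ?case using bl_dist_nonneg[OF \<nu> l, of "r j"] e by auto
    qed
    then show "\<exists>no. \<forall>n\<ge>no. norm (bl_dist (\<nu> (r n)) l - 0) < e" by (auto simp: eventually_sequentially)
  qed
  then have "wconv (\<lambda>j. \<nu> (r j)) l" by (intro bl_dist_imp_wconv \<nu> l)
  then show thesis using that r l by blast
qed

section \<open>Kernels and the Bayes update\<close>

lemma nn_integral_bind_prob:
  assumes "N \<in> space (prob_algebra A)" "K \<in> A \<rightarrow>\<^sub>M prob_algebra R" "f \<in> borel_measurable R"
  shows "(\<integral>\<^sup>+y. f y \<partial>(N \<bind> K)) = (\<integral>\<^sup>+x. \<integral>\<^sup>+y. f y \<partial>K x \<partial>N)"
proof -
  have "sets N = sets A" using assms(1) by (simp add: space_prob_algebra)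
  then have "K \<in> N \<rightarrow>\<^sub>M prob_algebra R" using assms(2) by (simp cong: measurable_cong_sets)
  from nn_integral_bind[OF assms(3) measurable_prob_algebraD[OF this]] show ?thesis .
qed

lemma integral_bind_prob:
  fixes f :: "_ \<Rightarrow> real"
  assumes "N \<in> space (prob_algebra A)" "K \<in> A \<rightarrow>\<^sub>M prob_algebra R" "f \<in> borel_measurable R"
    and "\<And>y. y \<in> space R \<Longrightarrow> \<bar>f y\<bar> \<le> B"
  shows "(LINT y|(N \<bind> K). f y) = (LINT x|N. LINT y|K x. f y)"
proof -
  have N: "sets N = sets A" "prob_space N" using assms(1) by (simp_all add: space_prob_algebra)
  then have K: "K \<in> N \<rightarrow>\<^sub>M prob_algebra R" using assms(2) by (simp cong: measurable_cong_sets)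
  interpret prob_space N by (rule N)
  show ?thesis
  proof (rule integral_bind[where B'=1])
    show "K \<in> N \<rightarrow>\<^sub>M subprob_algebra R" using K by (rule measurable_prob_algebraD)
    show "AE x in N. emeasure (K x) (space (K x)) \<le> ennreal 1"
      using measurable_space[OF K]
      by (auto simp: space_prob_algebra prob_space.emeasure_space_1 intro!: AE_I2)
    show "finite_measure N" by unfold_locales
  qed (use assms in auto)
qed

lemma kernel_prob: "K \<in> A \<rightarrow>\<^sub>M prob_algebra R \<Longrightarrow> x \<in> space A \<Longrightarrow> K x \<in> space (prob_algebra R)"
  by (rule measurable_space)

lemma bind_prob: "N \<in> space (prob_algebra A) \<Longrightarrow> K \<in> A \<rightarrow>\<^sub>M prob_algebra R \<Longrightarrow> N \<bind> K \<in> space (prob_algebra R)"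
  using prob_space_bind'[of N A K R] sets_bind'[of N A K R] by (simp add: space_prob_algebra)

text \<open>Pushing \<open>K x\<close> forward along \<open>Pair x\<close> moves the dependence of
  the integrand on \<open>x\<close> into the measure, so that measurability of the integral of a
  fixed function applies.\<close>

lemma integral_kernel_measurable:
  fixes f :: "_ \<Rightarrow> _ \<Rightarrow> real"
  assumes f: "(\<lambda>(x, y). f x y) \<in> borel_measurable (A \<Otimes>\<^sub>M R)" and K: "K \<in> A \<rightarrow>\<^sub>M prob_algebra R"
  shows "(\<lambda>x. LINT y|K x. f x y) \<in> borel_measurable A"
proof -
  have K': "K \<in> A \<rightarrow>\<^sub>M subprob_algebra R" using K by (rule measurable_prob_algebraD)
  have "(\<lambda>x. LINT p|distr (K x) (A \<Otimes>\<^sub>M R) (Pair x). f (fst p) (snd p)) \<in> borel_measurable A"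
    using f by (intro measurable_compose[OF measurable_distr2[OF _ K'] integral_measurable_subprob_algebra])
      (auto simp: split_beta')
  also have "?this \<longleftrightarrow> ?thesis"
  proof (rule measurable_cong)
    fix x assume x: "x \<in> space A"
    have s: "sets (K x) = sets R" using kernel_prob[OF K x] by (simp add: space_prob_algebra)
    show "(LINT p|distr (K x) (A \<Otimes>\<^sub>M R) (Pair x). f (fst p) (snd p)) = (LINT y|K x. f x y)"
    proof (subst integral_distr)
      show "Pair x \<in> K x \<rightarrow>\<^sub>M A \<Otimes>\<^sub>M R"
        using x s by (simp cong: measurable_cong_sets)
      show "(\<lambda>p. f (fst p) (snd p)) \<in> borel_measurable (A \<Otimes>\<^sub>M R)" using f by (simp add: split_beta')
    qed simp
  qed
  finally show ?thesis .
qed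

lemma nn_integral_kernel_measurable:
  assumes "(\<lambda>(x, y). f x y) \<in> borel_measurable (A \<Otimes>\<^sub>M R)" and "K \<in> A \<rightarrow>\<^sub>M prob_algebra R"
  shows "(\<lambda>x. \<integral>\<^sup>+y. f x y \<partial>K x) \<in> borel_measurable A"
  using assms by (intro nn_integral_measurable_subprob_algebra2 measurable_prob_algebraD) auto

lemma PA_eqI:
  fixes \<mu> \<nu> :: "'a measure"
  assumes "sets \<mu> = sets A" "sets \<nu> = sets A"
    and "\<And>g :: 'a \<Rightarrow> ennreal. g \<in> borel_measurable A \<Longrightarrow> (\<integral>\<^sup>+x. g x \<partial>\<mu>) = (\<integral>\<^sup>+x. g x \<partial>\<nu>)"
  shows "\<mu> = \<nu>"
proof (rule measure_eqI)
  fix X assume "X \<in> sets \<mu>"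
  then show "emeasure \<mu> X = emeasure \<nu> X"
    using assms(3)[of "indicator X"] assms(1,2) by simp
qed (use assms in simp)

locale filter_model =
  fixes P :: "'e::polish_space \<Rightarrow> 'e measure" and \<Phi> :: "'e \<Rightarrow> 'f::polish_space measure"
    and \<phi> :: "'f measure" and \<Upsilon> :: "'e \<Rightarrow> 'f \<Rightarrow> real"
  assumes kP: "kernel P" and k\<Phi>: "kernel \<Phi>" and nondeg: "nondegenerate \<Phi> \<phi> \<Upsilon>"
    and fellerP: "feller P"
    and \<Upsilon>_cont: "\<And>y. continuous_on UNIV (\<lambda>z. \<Upsilon> z y)"
    and \<Upsilon>_bdd: "\<And>y. bounded (range (\<lambda>z. \<Upsilon> z y))"
begin

section \<open>The Bayes update and the law of an observation\<close>

lemma P_meas[measurable]: "P \<in> borel \<rightarrow>\<^sub>M PA" using kP by (simp add: kernel_def)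
lemma \<Phi>_meas[measurable]: "\<Phi> \<in> borel \<rightarrow>\<^sub>M PA" using k\<Phi> by (simp add: kernel_def)

lemma \<Upsilon>_pos: "0 < \<Upsilon> x y" using nondeg by (simp add: nondegenerate_def)

lemma \<Upsilon>_meas: "(\<lambda>(x, y). \<Upsilon> x y) \<in> borel_measurable (borel \<Otimes>\<^sub>M borel)"
  using nondeg by (simp add: nondegenerate_def)

lemma \<Upsilon>_meas'[measurable (raw)]:
  "f \<in> M \<rightarrow>\<^sub>M borel \<Longrightarrow> g \<in> M \<rightarrow>\<^sub>M borel \<Longrightarrow> (\<lambda>x. \<Upsilon> (f x) (g x)) \<in> borel_measurable M"
  using measurable_compose[OF measurable_Pair \<Upsilon>_meas] by simp

lemma sets_\<phi>[measurable_cong, simp]: "sets \<phi> = sets borel" using nondeg by (simp add: nondegenerate_def)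

sublocale \<phi>: sigma_finite_measure \<phi> using nondeg by (simp add: nondegenerate_def)

lemma space_\<phi>[simp]: "space \<phi> = UNIV" using sets_eq_imp_space_eq[OF sets_\<phi>] by simp

lemma P_PA[simp]: "P x \<in> space PA" using kernel_prob[OF P_meas] by simp
lemma \<Phi>_PA[simp]: "\<Phi> x \<in> space PA" using kernel_prob[OF \<Phi>_meas] by simp
lemma bindP_PA[simp]: "\<nu> \<in> space PA \<Longrightarrow> \<nu> \<bind> P \<in> space PA" by (rule bind_prob[OF _ P_meas])
lemma bind\<Phi>_PA[simp]: "\<nu> \<in> space PA \<Longrightarrow> \<nu> \<bind> \<Phi> \<in> space PA" by (rule bind_prob[OF _ \<Phi>_meas])

lemma \<Phi>_density: "\<Phi> x = density \<phi> (\<lambda>y. ennreal (\<Upsilon> x y))"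
proof (rule measure_eqI)
  show "sets (\<Phi> x) = sets (density \<phi> (\<lambda>y. ennreal (\<Upsilon> x y)))" using PA_D(2)[OF \<Phi>_PA] by simp
  fix A assume "A \<in> sets (\<Phi> x)"
  then have "A \<in> sets borel" using PA_D(2)[OF \<Phi>_PA] by simp
  then show "emeasure (\<Phi> x) A = emeasure (density \<phi> (\<lambda>y. ennreal (\<Upsilon> x y))) A"
    using nondeg by (subst emeasure_density) (auto simp: nondegenerate_def)
qed

text \<open>The evidence: the density with respect to \<open>\<phi>\<close> of the observation law
  when the state has law \<open>\<rho>\<close>, and at the same time the normalising constant of the
  Bayes update.\<close>

definition evid :: "'e measure \<Rightarrow> 'f \<Rightarrow> real" where
  "evid \<rho> y = (LINT x|\<rho>. \<Upsilon> x y)"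

lemma \<Upsilon>_bound: obtains B where "\<And>x. \<bar>\<Upsilon> x y\<bar> \<le> B"
proof -
  obtain B where "\<forall>z\<in>range (\<lambda>z. \<Upsilon> z y). norm z \<le> B" using \<Upsilon>_bdd[of y] unfolding bounded_iff by blast
  then show thesis by (intro that[of B]) auto
qed

lemma \<Upsilon>_integrable: "\<rho> \<in> space PA \<Longrightarrow> integrable \<rho> (\<lambda>x. \<Upsilon> x y)"
  by (rule \<Upsilon>_bound[of y]) (auto intro!: pa_integrable)

lemma evid_nn: "\<rho> \<in> space PA \<Longrightarrow> (\<integral>\<^sup>+x. ennreal (\<Upsilon> x y) \<partial>\<rho>) = ennreal (evid \<rho> y)"
  unfolding evid_def by (intro nn_integral_eq_integral \<Upsilon>_integrable) (auto intro: less_imp_le[OF \<Upsilon>_pos])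

lemma evid_pos: assumes "\<rho> \<in> space PA" shows "0 < evid \<rho> y"
proof -
  interpret prob_space \<rho> by (rule PA_D[OF assms])
  have "evid \<rho> y \<noteq> 0"
  proof
    assume "evid \<rho> y = 0"
    then have "AE x in \<rho>. \<Upsilon> x y = 0"
      using less_imp_le[OF \<Upsilon>_pos] unfolding evid_def
      by (subst (asm) integral_nonneg_eq_0_iff_AE) (auto intro!: \<Upsilon>_integrable assms)
    then have "AE x in \<rho>. False" by eventually_elim (use \<Upsilon>_pos in \<open>metis less_irrefl\<close>)
    then show False by simp
  qed
  moreover have "0 \<le> evid \<rho> y" unfolding evid_def using less_imp_le[OF \<Upsilon>_pos] by (intro integral_nonneg_AE) auto
  ultimately show ?thesis by simp
qed

lemma bayes_density:
  assumes \<rho>: "\<rho> \<in> space PA"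
  shows "bayes \<Upsilon> y \<rho> = density \<rho> (\<lambda>x. ennreal (\<Upsilon> x y / evid \<rho> y))"
  unfolding bayes_def evid_nn[OF \<rho>]
  using evid_pos[OF \<rho>] less_imp_le[OF \<Upsilon>_pos] by (simp add: divide_ennreal)

lemma bayes_PA[simp]: assumes \<rho>: "\<rho> \<in> space PA" shows "bayes \<Upsilon> y \<rho> \<in> space PA"
proof (rule PA_I)
  have [measurable_cong]: "sets \<rho> = sets borel" by (rule PA_D[OF \<rho>])
  show "sets (bayes \<Upsilon> y \<rho>) = sets borel" unfolding bayes_def using PA_D(2)[OF \<rho>] by simp
  show "prob_space (bayes \<Upsilon> y \<rho>)"
  proof
    have "emeasure (bayes \<Upsilon> y \<rho>) UNIV = (\<integral>\<^sup>+x. ennreal (\<Upsilon> x y) \<partial>\<rho>) / (\<integral>\<^sup>+x. ennreal (\<Upsilon> x y) \<partial>\<rho>)"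
      by (subst emeasure_bayes) (use PA_D(2)[OF \<rho>] in simp_all)
    also have "\<dots> = 1" unfolding evid_nn[OF \<rho>] using evid_pos[OF \<rho>, of y] by (simp add: divide_ennreal)
    finally show "emeasure (bayes \<Upsilon> y \<rho>) (space (bayes \<Upsilon> y \<rho>)) = 1"
      by (simp add: bayes_def PA_space[OF \<rho>])
  qed
qed

lemma bayes_integral:
  fixes f :: "'e \<Rightarrow> real"
  assumes \<rho>: "\<rho> \<in> space PA" and [measurable]: "f \<in> borel_measurable borel"
  shows "(LINT x|bayes \<Upsilon> y \<rho>. f x) = (LINT x|\<rho>. \<Upsilon> x y * f x) / evid \<rho> y"
proof -
  have [measurable_cong]: "sets \<rho> = sets borel" by (rule PA_D[OF \<rho>])
  have "(LINT x|bayes \<Upsilon> y \<rho>. f x) = (LINT x|\<rho>. (\<Upsilon> x y / evid \<rho> y) *\<^sub>R f x)"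
    unfolding bayes_density[OF \<rho>]
    using evid_pos[OF \<rho>, of y] less_imp_le[OF \<Upsilon>_pos]
    by (intro integral_density) (auto intro!: divide_nonneg_pos)
  then show ?thesis by simp
qed

lemma bayes_measurable:
  "(\<lambda>(y, \<rho>). bayes \<Upsilon> y \<rho>) \<in> borel \<Otimes>\<^sub>M PA \<rightarrow>\<^sub>M PA"
proof (rule measurable_prob_algebraI)
  fix p :: "'f \<times> 'e measure" assume p: "p \<in> space (borel \<Otimes>\<^sub>M PA)"
  then show "prob_space (case p of (y, \<rho>) \<Rightarrow> bayes \<Upsilon> y \<rho>)"
    using PA_D(1)[OF bayes_PA[of "snd p" "fst p"]] by (auto simp: space_pair_measure split_beta)
next
  show "(\<lambda>(y, \<rho>). bayes \<Upsilon> y \<rho>) \<in> borel \<Otimes>\<^sub>M PA \<rightarrow>\<^sub>M subprob_algebra borel"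
  proof (rule measurable_subprob_algebra)
    fix A :: "'e set" assume A[measurable]: "A \<in> sets borel"
    let ?B = "borel \<Otimes>\<^sub>M PA :: ('f \<times> 'e measure) measure"
    let ?I = "\<lambda>C p. \<integral>\<^sup>+x. ennreal (\<Upsilon> x (fst p)) * indicator C x \<partial>(snd p)"
    have i: "?I C \<in> borel_measurable ?B" if [measurable]: "C \<in> sets borel" for C
      by (rule nn_integral_kernel_measurable[OF _ measurable_snd]) measurable
    have "(\<lambda>p. ?I A p / ?I UNIV p) \<in> borel_measurable ?B"
      by (rule borel_measurable_divide_ennreal[OF i[OF A] i]) simp
    also have "?this \<longleftrightarrow> (\<lambda>a. emeasure (case a of (y, \<rho>) \<Rightarrow> bayes \<Upsilon> y \<rho>) A) \<in> borel_measurable ?B"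
    proof (rule measurable_cong)
      fix p assume "p \<in> space ?B"
      then have "snd p \<in> space PA" by (simp add: space_pair_measure mem_Times_iff)
      then have "sets (snd p) = sets borel" by (rule PA_D(2))
      then show "?I A p / ?I UNIV p = emeasure (case p of (y, \<rho>) \<Rightarrow> bayes \<Upsilon> y \<rho>) A"
        by (simp add: split_beta emeasure_bayes)
    qed
    finally show "(\<lambda>a. emeasure (case a of (y, \<rho>) \<Rightarrow> bayes \<Upsilon> y \<rho>) A) \<in> borel_measurable (borel \<Otimes>\<^sub>M PA)" .
  next
    fix p :: "'f \<times> 'e measure" assume "p \<in> space (borel \<Otimes>\<^sub>M PA)"
    then have "bayes \<Upsilon> (fst p) (snd p) \<in> space PA" by (auto simp: space_pair_measure)
    then show "subprob_space (case p of (y, \<rho>) \<Rightarrow> bayes \<Upsilon> y \<rho>)"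
      "sets (case p of (y, \<rho>) \<Rightarrow> bayes \<Upsilon> y \<rho>) = sets borel"
      by (auto simp: split_beta space_prob_algebra intro: prob_space_imp_subprob_space)
  qed
qed

lemma bayes_measurable'[measurable (raw)]:
  "f \<in> M \<rightarrow>\<^sub>M borel \<Longrightarrow> g \<in> M \<rightarrow>\<^sub>M PA \<Longrightarrow> (\<lambda>x. bayes \<Upsilon> (f x) (g x)) \<in> M \<rightarrow>\<^sub>M PA"
  using measurable_compose[OF measurable_Pair bayes_measurable] by simp

lemma evid_measurable[measurable]:
  assumes "\<rho> \<in> space PA" shows "evid \<rho> \<in> borel_measurable borel"
  unfolding evid_def
  by (rule integral_kernel_measurable[where R=borel]) (use assms in \<open>auto intro!: measurable_const\<close>)

lemma \<rho>_sigma_finite: "\<rho> \<in> space PA \<Longrightarrow> sigma_finite_measure \<rho>"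
  using PA_D(1) prob_space_imp_sigma_finite by blast

lemma nn_integral_bind\<Phi>:
  assumes \<rho>: "\<rho> \<in> space PA" and [measurable]: "g \<in> borel_measurable borel"
  shows "(\<integral>\<^sup>+y. g y \<partial>(\<rho> \<bind> \<Phi>)) = (\<integral>\<^sup>+y. ennreal (evid \<rho> y) * g y \<partial>\<phi>)"
proof -
  have [measurable_cong]: "sets \<rho> = sets borel" by (rule PA_D[OF \<rho>])
  interpret \<rho>: sigma_finite_measure \<rho> by (rule \<rho>_sigma_finite[OF \<rho>])
  interpret p: pair_sigma_finite \<rho> \<phi> ..
  have "(\<integral>\<^sup>+y. g y \<partial>(\<rho> \<bind> \<Phi>)) = (\<integral>\<^sup>+x. \<integral>\<^sup>+y. g y \<partial>\<Phi> x \<partial>\<rho>)"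
    by (rule nn_integral_bind_prob[OF \<rho> \<Phi>_meas]) simp
  also have "\<dots> = (\<integral>\<^sup>+x. \<integral>\<^sup>+y. ennreal (\<Upsilon> x y) * g y \<partial>\<phi> \<partial>\<rho>)"
    unfolding \<Phi>_density by (simp add: nn_integral_density)
  also have "\<dots> = (\<integral>\<^sup>+y. \<integral>\<^sup>+x. ennreal (\<Upsilon> x y) * g y \<partial>\<rho> \<partial>\<phi>)"
    by (rule p.Fubini'[symmetric]) measurable
  also have "\<dots> = (\<integral>\<^sup>+y. ennreal (evid \<rho> y) * g y \<partial>\<phi>)"
    by (simp add: nn_integral_multc evid_nn[OF \<rho>])
  finally show ?thesis .
qed

lemma bind\<Phi>_density:
  assumes \<rho>: "\<rho> \<in> space PA"
  shows "\<rho> \<bind> \<Phi> = density \<phi> (\<lambda>y. ennreal (evid \<rho> y))"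
proof (rule PA_eqI[where A=borel])
  show "sets (\<rho> \<bind> \<Phi>) = sets borel" using PA_D(2)[OF bind\<Phi>_PA[OF \<rho>]] .
  fix g :: "'f \<Rightarrow> ennreal" assume [measurable]: "g \<in> borel_measurable borel"
  show "(\<integral>\<^sup>+y. g y \<partial>(\<rho> \<bind> \<Phi>)) = (\<integral>\<^sup>+y. g y \<partial>density \<phi> (\<lambda>y. ennreal (evid \<rho> y)))"
    using \<rho> by (simp add: nn_integral_bind\<Phi> nn_integral_density)
qed simp

text \<open>The joint law of state and observation, disintegrated in the other order. Both sides
  equal the integral of \<open>\<Upsilon> x y * g x y\<close> against the product of
  \<open>\<rho>\<close> and \<open>\<phi>\<close>; the evidence divides the update and multiplies
  the observation law, so it cancels.\<close>

lemma bayes_disintegration: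
  fixes g :: "'e \<Rightarrow> 'f \<Rightarrow> ennreal"
  assumes \<rho>: "\<rho> \<in> space PA" and [measurable]: "(\<lambda>(x, y). g x y) \<in> borel_measurable (borel \<Otimes>\<^sub>M borel)"
  shows "(\<integral>\<^sup>+x. \<integral>\<^sup>+y. g x y \<partial>\<Phi> x \<partial>\<rho>) = (\<integral>\<^sup>+y. \<integral>\<^sup>+x. g x y \<partial>bayes \<Upsilon> y \<rho> \<partial>(\<rho> \<bind> \<Phi>))"
proof -
  have [measurable_cong]: "sets \<rho> = sets borel" by (rule PA_D[OF \<rho>])
  have gm[measurable]: "(\<lambda>x. g (a x) (b x)) \<in> borel_measurable M" if "a \<in> M \<rightarrow>\<^sub>M borel" "b \<in> M \<rightarrow>\<^sub>M borel" for a b and M :: "'z measure"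
    using measurable_compose[OF measurable_Pair[OF that] assms(2)] by simp
  have g2[measurable]: "(\<lambda>x. g x y) \<in> borel_measurable borel" "(\<lambda>y. g x y) \<in> borel_measurable borel" for x y
    by (intro gm measurable_ident measurable_const; simp)+
  interpret \<rho>: sigma_finite_measure \<rho> by (rule \<rho>_sigma_finite[OF \<rho>])
  interpret p: pair_sigma_finite \<rho> \<phi> ..
  have "(\<integral>\<^sup>+x. \<integral>\<^sup>+y. g x y \<partial>\<Phi> x \<partial>\<rho>) = (\<integral>\<^sup>+x. \<integral>\<^sup>+y. ennreal (\<Upsilon> x y) * g x y \<partial>\<phi> \<partial>\<rho>)"
    unfolding \<Phi>_density by (simp add: nn_integral_density)
  also have "\<dots> = (\<integral>\<^sup>+y. \<integral>\<^sup>+x. ennreal (\<Upsilon> x y) * g x y \<partial>\<rho> \<partial>\<phi>)"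
    by (rule p.Fubini'[symmetric]) measurable
  also have "\<dots> = (\<integral>\<^sup>+y. ennreal (evid \<rho> y) * (\<integral>\<^sup>+x. g x y \<partial>bayes \<Upsilon> y \<rho>) \<partial>\<phi>)"
  proof (rule nn_integral_cong)
    fix y
    have "(\<integral>\<^sup>+x. g x y \<partial>bayes \<Upsilon> y \<rho>) = (\<integral>\<^sup>+x. ennreal (\<Upsilon> x y / evid \<rho> y) * g x y \<partial>\<rho>)"
      unfolding bayes_density[OF \<rho>] by (intro nn_integral_density) measurable
    then have "ennreal (evid \<rho> y) * (\<integral>\<^sup>+x. g x y \<partial>bayes \<Upsilon> y \<rho>) = (\<integral>\<^sup>+x. ennreal (evid \<rho> y) * (ennreal (\<Upsilon> x y / evid \<rho> y) * g x y) \<partial>\<rho>)"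
      by (simp add: nn_integral_cmult)
    also have "\<dots> = (\<integral>\<^sup>+x. ennreal (\<Upsilon> x y) * g x y \<partial>\<rho>)"
    proof (rule nn_integral_cong)
      fix x
      have "ennreal (evid \<rho> y) * ennreal (\<Upsilon> x y / evid \<rho> y) = ennreal (\<Upsilon> x y)"
        using evid_pos[OF \<rho>, of y] \<Upsilon>_pos[of x y] by (simp flip: ennreal_mult)
      then show "ennreal (evid \<rho> y) * (ennreal (\<Upsilon> x y / evid \<rho> y) * g x y) = ennreal (\<Upsilon> x y) * g x y"
        by (simp flip: mult.assoc)
    qed
    finally show "(\<integral>\<^sup>+x. ennreal (\<Upsilon> x y) * g x y \<partial>\<rho>) = ennreal (evid \<rho> y) * (\<integral>\<^sup>+x. g x y \<partial>bayes \<Upsilon> y \<rho>)" by simp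
  qed
  also have "\<dots> = (\<integral>\<^sup>+y. \<integral>\<^sup>+x. g x y \<partial>bayes \<Upsilon> y \<rho> \<partial>(\<rho> \<bind> \<Phi>))"
  proof (rule nn_integral_bind\<Phi>[OF \<rho>, symmetric])
    have k: "(\<lambda>y. bayes \<Upsilon> y \<rho>) \<in> borel \<rightarrow>\<^sub>M PA" using \<rho> by simp
    have "(\<lambda>(y, x). g x y) \<in> borel_measurable (borel \<Otimes>\<^sub>M borel)"
      unfolding split_beta' by (intro gm measurable_fst measurable_snd)
    from nn_integral_kernel_measurable[OF this k] show "(\<lambda>y. \<integral>\<^sup>+x. g x y \<partial>bayes \<Upsilon> y \<rho>) \<in> borel_measurable borel" .
  qed
  finally show ?thesis .
qed

subsection \<open>Weak continuity\<close>

lemma wconv_D: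
  assumes "wconv \<nu> l" "continuous_on UNIV f" "\<And>x. \<bar>f x\<bar> \<le> (B::real)"
  shows "(\<lambda>n. LINT x|\<nu> n. f x) \<longlonglongrightarrow> (LINT x|l. f x)"
  using assms unfolding wconv_def by (auto simp: bounded_iff)

lemma wconv_bindP:
  assumes \<nu>: "\<And>n. \<nu> n \<in> space PA" and l: "l \<in> space PA" and "wconv \<nu> l"
  shows "wconv (\<lambda>n. \<nu> n \<bind> P) (l \<bind> P)"
  unfolding wconv_def
proof safe
  fix f :: "'e \<Rightarrow> real" assume f: "continuous_on UNIV f" "bounded (range f)"
  obtain B where "\<forall>z\<in>range f. norm z \<le> B" using f(2) unfolding bounded_iff by blast
  then have B: "\<bar>f x\<bar> \<le> B" for x by auto
  have fm: "f \<in> borel_measurable borel" by (intro borel_measurable_continuous_onI f)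
  have e: "(LINT x|(N \<bind> P). f x) = (LINT x|N. LINT z|P x. f z)" if "N \<in> space PA" for N
    by (rule integral_bind_prob[OF that P_meas fm B])
  have "continuous_on UNIV (\<lambda>x. LINT z|P x. f z)" using fellerP f unfolding feller_def by blast
  then show "(\<lambda>n. LINT x|(\<nu> n \<bind> P). f x) \<longlonglongrightarrow> (LINT x|(l \<bind> P). f x)"
    unfolding e[OF \<nu>] e[OF l]
    by (intro wconv_D[OF assms(3)]) (auto intro!: pa_integral_le fm B)
qed

lemma evid_tendsto:
  assumes "wconv \<rho> l" shows "(\<lambda>n. evid (\<rho> n) y) \<longlonglongrightarrow> evid l y"
proof -
  obtain B where "\<And>x. \<bar>\<Upsilon> x y\<bar> \<le> B" by (rule \<Upsilon>_bound[of y]) blast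
  then show ?thesis unfolding evid_def by (intro wconv_D[OF assms \<Upsilon>_cont])
qed

text \<open>For fixed \<open>y\<close> the likelihood is itself a bounded continuous test function,
  so numerator and normaliser converge separately, and the limit of the normaliser is
  positive.\<close>

lemma wconv_bayes:
  assumes \<rho>: "\<And>n. \<rho> n \<in> space PA" and l: "l \<in> space PA" and w: "wconv \<rho> l"
  shows "wconv (\<lambda>n. bayes \<Upsilon> y (\<rho> n)) (bayes \<Upsilon> y l)"
  unfolding wconv_def
proof safe
  fix f :: "'e \<Rightarrow> real" assume f: "continuous_on UNIV f" "bounded (range f)"
  obtain B where "\<forall>z\<in>range f. norm z \<le> B" using f(2) unfolding bounded_iff by blast
  then have B: "\<bar>f x\<bar> \<le> B" for x by auto
  obtain C where C: "\<And>x. \<bar>\<Upsilon> x y\<bar> \<le> C" by (rule \<Upsilon>_bound[of y]) blast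
  have "(\<lambda>n. LINT x|\<rho> n. \<Upsilon> x y * f x) \<longlonglongrightarrow> (LINT x|l. \<Upsilon> x y * f x)"
    by (rule wconv_D[OF w, of _ "C * B"])
      (auto intro!: continuous_intros \<Upsilon>_cont f mult_mono B C simp: abs_mult intro: order_trans[OF abs_ge_zero C])
  moreover have "f \<in> borel_measurable borel" by (intro borel_measurable_continuous_onI f)
  moreover have "evid l y \<noteq> 0" using evid_pos[OF l, of y] by simp
  ultimately show "(\<lambda>n. LINT x|bayes \<Upsilon> y (\<rho> n). f x) \<longlonglongrightarrow> (LINT x|bayes \<Upsilon> y l. f x)"
    by (simp add: bayes_integral[OF \<rho>] bayes_integral[OF l] tendsto_divide evid_tendsto[OF w])
qed

lemma evid_integrable:
  assumes "\<rho> \<in> space PA" shows "integrable \<phi> (evid \<rho>)" and "(\<integral>\<^sup>+y. ennreal (evid \<rho> y) \<partial>\<phi>) = 1"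
proof -
  interpret prob_space "\<rho> \<bind> \<Phi>" by (rule PA_D[OF bind\<Phi>_PA[OF assms]])
  have "(\<integral>\<^sup>+y. ennreal (evid \<rho> y) \<partial>\<phi>) = (\<integral>\<^sup>+y. 1 \<partial>(\<rho> \<bind> \<Phi>))"
    using nn_integral_bind\<Phi>[OF assms, of "\<lambda>_. 1"] by simp
  then show 1: "(\<integral>\<^sup>+y. ennreal (evid \<rho> y) \<partial>\<phi>) = 1" by (simp add: emeasure_space_1)
  show "integrable \<phi> (evid \<rho>)"
    using 1 assms less_imp_le[OF evid_pos[OF assms]]
    by (intro integrableI_nonneg) (auto intro: evid_measurable)
qed

text \<open>Scheffe's lemma: the evidences converge pointwise and all are probability densities.
  Weak convergence of the state laws thus yields convergence in total variation of the observation
  laws.\<close>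

lemma evid_L1:
  assumes \<rho>: "\<And>n. \<rho> n \<in> space PA" and l: "l \<in> space PA" and w: "wconv \<rho> l"
  shows "(\<lambda>n. LINT y|\<phi>. \<bar>evid (\<rho> n) y - evid l y\<bar>) \<longlonglongrightarrow> 0"
proof -
  have nn: "0 \<le> evid N y" if "N \<in> space PA" for N y using evid_pos[OF that, of y] by simp
  have "(\<lambda>n. \<integral>\<^sup>+y. norm (evid (\<rho> n) y - evid l y) \<partial>\<phi>) \<longlonglongrightarrow> 0"
  proof (rule Scheffe_lemma1)
    show "AE y in \<phi>. (\<lambda>n. evid (\<rho> n) y) \<longlonglongrightarrow> evid l y"
      by (intro always_eventually allI evid_tendsto w)
    show "limsup (\<lambda>n. \<integral>\<^sup>+y. ennreal (norm (evid (\<rho> n) y)) \<partial>\<phi>) \<le> (\<integral>\<^sup>+y. ennreal (norm (evid l y)) \<partial>\<phi>)"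
      using evid_integrable(2)[OF \<rho>] evid_integrable(2)[OF l] nn[OF \<rho>] nn[OF l] by (simp add: Limsup_const)
  qed (rule evid_integrable \<rho> l)+
  then have "(\<lambda>n. ennreal (LINT y|\<phi>. \<bar>evid (\<rho> n) y - evid l y\<bar>)) \<longlonglongrightarrow> ennreal 0"
    by (subst (asm) nn_integral_eq_integral) (auto intro!: integrable_norm Bochner_Integration.integrable_diff evid_integrable \<rho> l)
  then show ?thesis by (subst (asm) tendsto_ennreal_iff) auto
qed

lemma integral_bind\<Phi>_real:
  fixes g :: "'f \<Rightarrow> real"
  assumes \<rho>: "\<rho> \<in> space PA" and g[measurable]: "g \<in> borel_measurable borel"
  shows "(LINT y|(\<rho> \<bind> \<Phi>). g y) = (LINT y|\<phi>. evid \<rho> y * g y)"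
  unfolding bind\<Phi>_density[OF \<rho>] using less_imp_le[OF evid_pos[OF \<rho>]] evid_measurable[OF \<rho>]
  by (subst integral_density) auto

lemma evid_times_integrable:
  fixes g :: "'f \<Rightarrow> real"
  assumes \<rho>: "\<rho> \<in> space PA" and g[measurable]: "g \<in> borel_measurable borel" and B: "\<And>y. \<bar>g y\<bar> \<le> B"
  shows "integrable \<phi> (\<lambda>y. evid \<rho> y * g y)"
proof (rule Bochner_Integration.integrable_bound[OF integrable_mult_right[OF evid_integrable(1)[OF \<rho>], of B]])
  show "(\<lambda>y. evid \<rho> y * g y) \<in> borel_measurable \<phi>" using evid_measurable[OF \<rho>] by simp
  have "\<bar>evid \<rho> y * g y\<bar> \<le> \<bar>B * evid \<rho> y\<bar>" for y
  proof -
    have "\<bar>g y\<bar> \<le> \<bar>B\<bar>" using B[of y] by linarith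
    then show ?thesis unfolding abs_mult mult.commute[of "\<bar>B\<bar>"] by (intro mult_left_mono) auto
  qed
  then show "AE y in \<phi>. norm (evid \<rho> y * g y) \<le> norm (B * evid \<rho> y)" by simp
qed

text \<open>Because the observation laws converge in total variation, integrands that are merely
  measurable in \<open>y\<close> can be handled: pointwise convergence with a common bound passes to
  the limit although the measure moves too.\<close>

lemma integral_evid_tendsto:
  fixes \<Psi> :: "nat \<Rightarrow> 'f \<Rightarrow> real"
  assumes \<rho>: "\<And>n. \<rho> n \<in> space PA" and l: "l \<in> space PA" and w: "wconv \<rho> l"
    and m: "\<And>n. \<Psi> n \<in> borel_measurable borel" "\<Psi>' \<in> borel_measurable borel"
    and B: "\<And>n y. \<bar>\<Psi> n y\<bar> \<le> B" "\<And>y. \<bar>\<Psi>' y\<bar> \<le> B"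
    and conv: "\<And>y. (\<lambda>n. \<Psi> n y) \<longlonglongrightarrow> \<Psi>' y"
  shows "(\<lambda>n. LINT y|(\<rho> n \<bind> \<Phi>). \<Psi> n y) \<longlonglongrightarrow> (LINT y|(l \<bind> \<Phi>). \<Psi>' y)"
proof -
  have m'[measurable]: "\<Psi> n \<in> borel_measurable borel" "\<Psi>' \<in> borel_measurable borel" for n using m by auto
  interpret L: prob_space "l \<bind> \<Phi>" by (rule PA_D[OF bind\<Phi>_PA[OF l]])
  have B0: "0 \<le> B" using order_trans[OF abs_ge_zero B(2)] .
  have a: "(\<lambda>n. LINT y|(l \<bind> \<Phi>). \<Psi> n y) \<longlonglongrightarrow> (LINT y|(l \<bind> \<Phi>). \<Psi>' y)"
    by (rule integral_dominated_convergence[where w="\<lambda>_. B"])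
      (auto intro!: PA_measurable[OF bind\<Phi>_PA[OF l]] m conv B)
  have d: "integrable \<phi> (\<lambda>y. \<bar>evid (\<rho> n) y - evid l y\<bar>)" for n
    by (intro integrable_abs Bochner_Integration.integrable_diff evid_integrable \<rho> l)
  have b: "\<bar>(LINT y|(\<rho> n \<bind> \<Phi>). \<Psi> n y) - (LINT y|(l \<bind> \<Phi>). \<Psi> n y)\<bar> \<le> B * (LINT y|\<phi>. \<bar>evid (\<rho> n) y - evid l y\<bar>)" for n
  proof -
    have i1: "integrable \<phi> (\<lambda>y. evid (\<rho> n) y * \<Psi> n y)" by (rule evid_times_integrable[OF \<rho> m(1) B(1)])
    have i2: "integrable \<phi> (\<lambda>y. evid l y * \<Psi> n y)" by (rule evid_times_integrable[OF l m(1) B(1)])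
    have "(LINT y|(\<rho> n \<bind> \<Phi>). \<Psi> n y) - (LINT y|(l \<bind> \<Phi>). \<Psi> n y) = (LINT y|\<phi>. evid (\<rho> n) y * \<Psi> n y - evid l y * \<Psi> n y)"
      using i1 i2 by (simp add: integral_bind\<Phi>_real[OF \<rho> m(1)] integral_bind\<Phi>_real[OF l m(1)])
    also have "\<bar>\<dots>\<bar> \<le> (LINT y|\<phi>. \<bar>evid (\<rho> n) y * \<Psi> n y - evid l y * \<Psi> n y\<bar>)"
      by (rule integral_abs_bound)
    also have "\<dots> \<le> (LINT y|\<phi>. B * \<bar>evid (\<rho> n) y - evid l y\<bar>)"
    proof (rule integral_mono)
      show "integrable \<phi> (\<lambda>y. \<bar>evid (\<rho> n) y * \<Psi> n y - evid l y * \<Psi> n y\<bar>)" using i1 i2 by auto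
      show "integrable \<phi> (\<lambda>y. B * \<bar>evid (\<rho> n) y - evid l y\<bar>)" using d by simp
      fix y
      have "\<bar>\<Psi> n y\<bar> * \<bar>evid (\<rho> n) y - evid l y\<bar> \<le> B * \<bar>evid (\<rho> n) y - evid l y\<bar>"
        using B by (intro mult_right_mono) auto
      then show "\<bar>evid (\<rho> n) y * \<Psi> n y - evid l y * \<Psi> n y\<bar> \<le> B * \<bar>evid (\<rho> n) y - evid l y\<bar>"
        unfolding abs_mult[symmetric] by (simp add: algebra_simps)
    qed
    finally show ?thesis by simp
  qed
  have "(\<lambda>n. B * (LINT y|\<phi>. \<bar>evid (\<rho> n) y - evid l y\<bar>)) \<longlonglongrightarrow> B * 0"
    by (intro tendsto_intros evid_L1 \<rho> l w)
  then have c: "(\<lambda>n. B * (LINT y|\<phi>. \<bar>evid (\<rho> n) y - evid l y\<bar>)) \<longlonglongrightarrow> 0" by simp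
  have "(\<lambda>n. (LINT y|(\<rho> n \<bind> \<Phi>). \<Psi> n y) - (LINT y|(l \<bind> \<Phi>). \<Psi> n y)) \<longlonglongrightarrow> 0"
    by (rule Lim_null_comparison[OF _ c]) (use b in \<open>auto intro!: always_eventually\<close>)
  from tendsto_add[OF this a] show ?thesis by simp
qed

subsection \<open>The limiting evolution of a pair of filters\<close>

text \<open>A class of costs on pairs of laws that the evolution preserves. Measurability allows
  integration over random laws, \<open>[0,2]\<close> is the range of \<open>bl_dist\<close>, and
  joint weak sequential continuity is what passes to limits along tight sequences.\<close>

definition good :: "('e measure \<Rightarrow> 'e measure \<Rightarrow> real) \<Rightarrow> bool" where
  "good \<Psi> \<longleftrightarrow> (\<lambda>(\<nu>, \<nu>'). \<Psi> \<nu> \<nu>') \<in> borel_measurable (PA \<Otimes>\<^sub>M PA) \<and>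
    (\<forall>\<nu>\<in>space PA. \<forall>\<nu>'\<in>space PA. 0 \<le> \<Psi> \<nu> \<nu>' \<and> \<Psi> \<nu> \<nu>' \<le> 2) \<and>
    (\<forall>\<nu> \<nu>' l l'. (\<forall>n. \<nu> n \<in> space PA) \<and> (\<forall>n. \<nu>' n \<in> space PA) \<and> l \<in> space PA \<and> l' \<in> space PA \<and>
       wconv \<nu> l \<and> wconv \<nu>' l' \<longrightarrow> (\<lambda>n. \<Psi> (\<nu> n) (\<nu>' n)) \<longlonglongrightarrow> \<Psi> l l')"

lemma good_meas: "good \<Psi> \<Longrightarrow> f \<in> M \<rightarrow>\<^sub>M PA \<Longrightarrow> g \<in> M \<rightarrow>\<^sub>M PA \<Longrightarrow> (\<lambda>x. \<Psi> (f x) (g x)) \<in> borel_measurable M"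
  unfolding good_def using measurable_compose[OF measurable_Pair, of f M PA g PA "\<lambda>(\<nu>, \<nu>'). \<Psi> \<nu> \<nu>'" borel] by simp

lemma good_bound: "good \<Psi> \<Longrightarrow> \<nu> \<in> space PA \<Longrightarrow> \<nu>' \<in> space PA \<Longrightarrow> 0 \<le> \<Psi> \<nu> \<nu>' \<and> \<Psi> \<nu> \<nu>' \<le> 2"
  unfolding good_def by blast

lemma good_conv:
  "good \<Psi> \<Longrightarrow> (\<And>n. \<nu> n \<in> space PA) \<Longrightarrow> (\<And>n. \<nu>' n \<in> space PA) \<Longrightarrow> l \<in> space PA \<Longrightarrow> l' \<in> space PA \<Longrightarrow>
    wconv \<nu> l \<Longrightarrow> wconv \<nu>' l' \<Longrightarrow> (\<lambda>n. \<Psi> (\<nu> n) (\<nu>' n)) \<longlonglongrightarrow> \<Psi> l l'"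
  unfolding good_def by blast

lemma good_bl_dist: "good bl_dist"
  unfolding good_def
  using bl_dist_measurable bl_dist_nonneg bl_dist_le2 bl_dist_tendsto by blast

text \<open>The arguments are laws before the observation is taken in. The observation is drawn
  under \<open>\<rho>'\<close>, the correct one of the two, and both are updated with it.\<close>

definition evol :: "('e measure \<Rightarrow> 'e measure \<Rightarrow> real) \<Rightarrow> 'e measure \<Rightarrow> 'e measure \<Rightarrow> real" where
  "evol \<Psi> \<rho> \<rho>' = (LINT y|(\<rho>' \<bind> \<Phi>). \<Psi> (bayes \<Upsilon> y \<rho>) (bayes \<Upsilon> y \<rho>'))"

lemma evol_integrand_meas:
  "good \<Psi> \<Longrightarrow> \<rho> \<in> space PA \<Longrightarrow> \<rho>' \<in> space PA \<Longrightarrow> (\<lambda>y. \<Psi> (bayes \<Upsilon> y \<rho>) (bayes \<Upsilon> y \<rho>')) \<in> borel_measurable borel"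
  by (rule good_meas) auto

lemma good_evol:
  assumes g: "good \<Psi>"
  shows "good (\<lambda>\<nu> \<nu>'. evol \<Psi> (\<nu> \<bind> P) (\<nu>' \<bind> P))"
  unfolding good_def
proof (intro conjI allI impI ballI; (elim conjE)?)
  have snd: "(\<lambda>p. snd p \<bind> P \<bind> \<Phi>) \<in> (PA \<Otimes>\<^sub>M PA :: ('e measure \<times> 'e measure) measure) \<rightarrow>\<^sub>M PA"
    by (intro measurable_bind_prob_space[OF _ \<Phi>_meas] measurable_bind_prob_space[OF _ P_meas] measurable_snd)
  have b: "(\<lambda>p. p \<bind> P) \<in> (PA :: 'e measure measure) \<rightarrow>\<^sub>M PA"
    by (intro measurable_bind_prob_space[OF _ P_meas] measurable_ident_sets refl)
  have "(\<lambda>p. evol \<Psi> (fst p \<bind> P) (snd p \<bind> P)) \<in> borel_measurable (PA \<Otimes>\<^sub>M PA)"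
    unfolding evol_def
  proof (rule integral_kernel_measurable[where R=borel, OF _ snd])
    show "(\<lambda>(p, y). \<Psi> (bayes \<Upsilon> y (fst p \<bind> P)) (bayes \<Upsilon> y (snd p \<bind> P))) \<in> borel_measurable ((PA \<Otimes>\<^sub>M PA) \<Otimes>\<^sub>M borel)"
      unfolding split_beta'
      by (intro good_meas[OF g] bayes_measurable' measurable_snd measurable_compose[OF _ b]
          measurable_compose[OF measurable_fst measurable_fst] measurable_compose[OF measurable_fst measurable_snd])
  qed
  then show "(\<lambda>(\<nu>, \<nu>'). evol \<Psi> (\<nu> \<bind> P) (\<nu>' \<bind> P)) \<in> borel_measurable (PA \<Otimes>\<^sub>M PA)"
    by (simp add: split_beta')
next
  fix \<nu> \<nu>' :: "'e measure" assume n: "\<nu> \<in> space PA" "\<nu>' \<in> space PA"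
  have b: "0 \<le> \<Psi> (bayes \<Upsilon> y (\<nu> \<bind> P)) (bayes \<Upsilon> y (\<nu>' \<bind> P)) \<and> \<Psi> (bayes \<Upsilon> y (\<nu> \<bind> P)) (bayes \<Upsilon> y (\<nu>' \<bind> P)) \<le> 2" for y
    using n by (intro good_bound[OF g]) auto
  show "0 \<le> evol \<Psi> (\<nu> \<bind> P) (\<nu>' \<bind> P)"
    unfolding evol_def using b by (intro integral_nonneg_AE) auto
  have "\<bar>evol \<Psi> (\<nu> \<bind> P) (\<nu>' \<bind> P)\<bar> \<le> 2"
    unfolding evol_def using b n evol_integrand_meas[OF g]
    by (intro pa_integral_le[where A=borel]) auto
  then show "evol \<Psi> (\<nu> \<bind> P) (\<nu>' \<bind> P) \<le> 2" by simp
next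
  fix \<nu> \<nu>' :: "nat \<Rightarrow> 'e measure" and l l' :: "'e measure"
  assume a: "\<forall>n. \<nu> n \<in> space PA" "\<forall>n. \<nu>' n \<in> space PA" "l \<in> space PA" "l' \<in> space PA" "wconv \<nu> l" "wconv \<nu>' l'"
  have b: "\<bar>\<Psi> (bayes \<Upsilon> y a) (bayes \<Upsilon> y b)\<bar> \<le> 2" if "a \<in> space PA" "b \<in> space PA" for a b y
    using good_bound[OF g, of "bayes \<Upsilon> y a" "bayes \<Upsilon> y b"] that by auto
  show "(\<lambda>n. evol \<Psi> (\<nu> n \<bind> P) (\<nu>' n \<bind> P)) \<longlonglongrightarrow> evol \<Psi> (l \<bind> P) (l' \<bind> P)"
    unfolding evol_def
    using a by (intro integral_evid_tendsto[where B=2] evol_integrand_meas[OF g] wconv_bindP b good_conv[OF g] wconv_bayes) auto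
qed

primrec Dist :: "nat \<Rightarrow> 'e measure \<Rightarrow> 'e measure \<Rightarrow> real" where
  "Dist 0 = bl_dist"
| "Dist (Suc r) = (\<lambda>\<nu> \<nu>'. evol (Dist r) (\<nu> \<bind> P) (\<nu>' \<bind> P))"

lemma good_Dist: "good (Dist r)"
  by (induction r) (auto intro: good_bl_dist good_evol)

end

section \<open>The signal with its observation history\<close>

abbreviation HS :: "'f::polish_space stream measure" where
  "HS \<equiv> stream_space borel"

abbreviation SS :: "('f::polish_space stream \<times> 'e::polish_space) measure" where
  "SS \<equiv> HS \<Otimes>\<^sub>M borel"

lemma space_SS[simp]: "space SS = UNIV" "space HS = UNIV"
  by (auto simp: space_pair_measure space_stream_space)

lemma nn_integral_prob_const: "N \<in> space (prob_algebra A) \<Longrightarrow> (\<integral>\<^sup>+x. c \<partial>N) = c"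
  by (auto simp: space_prob_algebra prob_space.emeasure_space_1)

context filter_model
begin

text \<open>The emission kernel is a parameter because the same chain is run with
  \<open>\<Phi>\<close> and, as a reference, with observations that ignore the state. The newest
  observation becomes the head of the history.\<close>

definition stepK :: "('e \<Rightarrow> 'f measure) \<Rightarrow> 'f stream \<times> 'e \<Rightarrow> ('f stream \<times> 'e) measure" where
  "stepK \<Theta> s = P (snd s) \<bind> (\<lambda>x'. \<Theta> x' \<bind> (\<lambda>y. return SS (y ## fst s, x')))"

primrec iterK :: "('e \<Rightarrow> 'f measure) \<Rightarrow> nat \<Rightarrow> 'f stream \<times> 'e \<Rightarrow> ('f stream \<times> 'e) measure" where
  "iterK \<Theta> 0 = return SS"
| "iterK \<Theta> (Suc m) = (\<lambda>s. stepK \<Theta> s \<bind> iterK \<Theta> m)"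

lemma stepK_meas[measurable]:
  assumes [measurable]: "\<Theta> \<in> borel \<rightarrow>\<^sub>M PA"
  shows "stepK \<Theta> \<in> SS \<rightarrow>\<^sub>M prob_algebra SS"
  unfolding stepK_def by measurable

lemma iterK_meas[measurable]:
  assumes [measurable]: "\<Theta> \<in> borel \<rightarrow>\<^sub>M PA"
  shows "iterK \<Theta> m \<in> SS \<rightarrow>\<^sub>M prob_algebra SS"
proof (induction m)
  case (Suc m)
  then show ?case by (auto intro!: measurable_bind_prob_space[OF stepK_meas] assms)
qed (simp add: measurable_return_prob_space)

lemma nn_integral_stepK:
  assumes \<Theta>[measurable]: "\<Theta> \<in> borel \<rightarrow>\<^sub>M PA" and g[measurable]: "g \<in> borel_measurable SS"
  shows "(\<integral>\<^sup>+s. g s \<partial>stepK \<Theta> (h, x)) = (\<integral>\<^sup>+x'. \<integral>\<^sup>+y. g (y ## h, x') \<partial>\<Theta> x' \<partial>P x)"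
proof -
  have 1: "(\<lambda>x'. \<Theta> x' \<bind> (\<lambda>y. return SS (y ## h, x'))) \<in> borel \<rightarrow>\<^sub>M prob_algebra SS"
    by measurable
  have "(\<integral>\<^sup>+s. g s \<partial>stepK \<Theta> (h, x)) = (\<integral>\<^sup>+x'. \<integral>\<^sup>+s. g s \<partial>(\<Theta> x' \<bind> (\<lambda>y. return SS (y ## h, x'))) \<partial>P x)"
    unfolding stepK_def using nn_integral_bind_prob[OF P_PA 1 g] by simp
  also have "\<dots> = (\<integral>\<^sup>+x'. \<integral>\<^sup>+y. g (y ## h, x') \<partial>\<Theta> x' \<partial>P x)"
  proof (rule nn_integral_cong)
    fix x' :: 'e
    have \<Theta>x: "\<Theta> x' \<in> space PA" using kernel_prob[OF \<Theta>] by simp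
    have "(\<integral>\<^sup>+s. g s \<partial>(\<Theta> x' \<bind> (\<lambda>y. return SS (y ## h, x')))) = (\<integral>\<^sup>+y. \<integral>\<^sup>+s. g s \<partial>return SS (y ## h, x') \<partial>\<Theta> x')"
      by (rule nn_integral_bind_prob[OF \<Theta>x _ g]) measurable
    also have "\<dots> = (\<integral>\<^sup>+y. g (y ## h, x') \<partial>\<Theta> x')" by (simp add: nn_integral_return)
    finally show "(\<integral>\<^sup>+s. g s \<partial>(\<Theta> x' \<bind> (\<lambda>y. return SS (y ## h, x')))) = (\<integral>\<^sup>+y. g (y ## h, x') \<partial>\<Theta> x')" .
  qed
  finally show ?thesis .
qed

lemma iterK_add:
  assumes \<Theta>: "\<Theta> \<in> borel \<rightarrow>\<^sub>M PA"
  shows "iterK \<Theta> (m + k) s = iterK \<Theta> m s \<bind> iterK \<Theta> k"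
proof (induction m arbitrary: s)
  case 0
  have "iterK \<Theta> k \<in> SS \<rightarrow>\<^sub>M subprob_algebra SS" by (intro measurable_prob_algebraD iterK_meas \<Theta>)
  then show ?case by (simp add: bind_return)
next
  case (Suc m)
  have st: "stepK \<Theta> s \<in> space (prob_algebra SS)" using kernel_prob[OF stepK_meas[OF \<Theta>], of s] by simp
  then have ss: "sets (stepK \<Theta> s) = sets SS" by (simp add: space_prob_algebra)
  have m1: "iterK \<Theta> m \<in> stepK \<Theta> s \<rightarrow>\<^sub>M subprob_algebra SS"
    using measurable_prob_algebraD[OF iterK_meas[OF \<Theta>]] ss by (simp cong: measurable_cong_sets)
  have "iterK \<Theta> (Suc m + k) s = stepK \<Theta> s \<bind> (\<lambda>s. iterK \<Theta> m s \<bind> iterK \<Theta> k)"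
    using ext[of "iterK \<Theta> (m + k)", OF Suc.IH] by simp
  also have "\<dots> = (stepK \<Theta> s \<bind> iterK \<Theta> m) \<bind> iterK \<Theta> k"
    by (rule bind_assoc[OF m1 measurable_prob_algebraD[OF iterK_meas[OF \<Theta>]], symmetric])
  finally show ?case by simp
qed

lemma iterK_1:
  assumes \<Theta>: "\<Theta> \<in> borel \<rightarrow>\<^sub>M PA"
  shows "iterK \<Theta> (Suc 0) s = stepK \<Theta> s"
  using kernel_prob[OF stepK_meas[OF \<Theta>], of s] by (simp add: bind_return'' space_prob_algebra)

definition h0 :: "'f stream" where "h0 = sconst undefined"

text \<open>Law of history and signal after \<open>k\<close> steps. No observation belongs to the
  initial state: \<open>\<nu>\<close> plays the role of a filter that is already updated. Streams
  let all times share one state space; beyond its first \<open>k\<close> entries the history is the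
  dummy \<open>h0\<close>.\<close>

definition J :: "'e measure \<Rightarrow> nat \<Rightarrow> ('f stream \<times> 'e) measure" where
  "J \<nu> k = distr \<nu> SS (Pair h0) \<bind> iterK \<Phi> k"

lemma distr_h0:
  assumes \<nu>: "\<nu> \<in> space PA" shows "distr \<nu> SS (Pair h0) \<in> space (prob_algebra SS)"
proof -
  have "Pair h0 \<in> \<nu> \<rightarrow>\<^sub>M SS" using PA_D(2)[OF \<nu>] by (simp cong: measurable_cong_sets)
  then show ?thesis using \<nu> by (simp add: space_prob_algebra prob_space.prob_space_distr)
qed

lemma J_prob[simp]: "\<nu> \<in> space PA \<Longrightarrow> J \<nu> k \<in> space (prob_algebra SS)"
  unfolding J_def by (intro bind_prob[OF distr_h0] iterK_meas \<Phi>_meas)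

lemma J_sets: "\<nu> \<in> space PA \<Longrightarrow> sets (J \<nu> k) = sets SS"
  and J_space: "\<nu> \<in> space PA \<Longrightarrow> space (J \<nu> k) = UNIV"
  and J_prob_space: "\<nu> \<in> space PA \<Longrightarrow> prob_space (J \<nu> k)"
  using J_prob[of \<nu> k] sets_eq_imp_space_eq[of "J \<nu> k" SS] by (auto simp: space_prob_algebra)

lemma J_add:
  assumes \<nu>: "\<nu> \<in> space PA" shows "J \<nu> (k + m) = J \<nu> k \<bind> iterK \<Phi> m"
proof -
  have m: "iterK \<Phi> k \<in> distr \<nu> SS (Pair h0) \<rightarrow>\<^sub>M subprob_algebra SS"
    using measurable_prob_algebraD[OF iterK_meas[OF \<Phi>_meas]] by simp
  show ?thesis
    unfolding J_def iterK_add[OF \<Phi>_meas]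
    by (rule bind_assoc[OF m measurable_prob_algebraD[OF iterK_meas[OF \<Phi>_meas]], symmetric])
qed

lemma nn_integral_J_Suc:
  assumes \<nu>: "\<nu> \<in> space PA" and g[measurable]: "g \<in> borel_measurable SS"
  shows "(\<integral>\<^sup>+s. g s \<partial>J \<nu> (Suc k)) = (\<integral>\<^sup>+s. \<integral>\<^sup>+x'. \<integral>\<^sup>+y. g (y ## fst s, x') \<partial>\<Phi> x' \<partial>P (snd s) \<partial>J \<nu> k)"
proof -
  have "J \<nu> (Suc k) = J \<nu> k \<bind> stepK \<Phi>"
    using J_add[OF \<nu>, of k "Suc 0"] ext[of "iterK \<Phi> (Suc 0)", OF iterK_1[OF \<Phi>_meas]] by (simp del: iterK.simps)
  then have "(\<integral>\<^sup>+s. g s \<partial>J \<nu> (Suc k)) = (\<integral>\<^sup>+s. \<integral>\<^sup>+t. g t \<partial>stepK \<Phi> s \<partial>J \<nu> k)"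
    using nn_integral_bind_prob[OF J_prob[OF \<nu>] stepK_meas[OF \<Phi>_meas] g] by simp
  also have "\<dots> = (\<integral>\<^sup>+s. \<integral>\<^sup>+x'. \<integral>\<^sup>+y. g (y ## fst s, x') \<partial>\<Phi> x' \<partial>P (snd s) \<partial>J \<nu> k)"
    using nn_integral_stepK[OF \<Phi>_meas g] by (metis prod.collapse)
  finally show ?thesis .
qed

lemma nn_integral_J_0:
  assumes \<nu>: "\<nu> \<in> space PA" and g[measurable]: "g \<in> borel_measurable SS"
  shows "(\<integral>\<^sup>+s. g s \<partial>J \<nu> 0) = (\<integral>\<^sup>+x. g (h0, x) \<partial>\<nu>)"
proof -
  have p: "Pair h0 \<in> \<nu> \<rightarrow>\<^sub>M SS" using PA_D(2)[OF \<nu>] by (simp cong: measurable_cong_sets)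
  have "J \<nu> 0 = distr \<nu> SS (Pair h0)" unfolding J_def by (simp add: bind_return'')
  then show ?thesis using p by (simp add: nn_integral_distr)
qed

lemma nn_integral_J:
  assumes \<nu>: "\<nu> \<in> space PA" and g[measurable]: "g \<in> borel_measurable SS"
  shows "(\<integral>\<^sup>+s. g s \<partial>J \<nu> k) = (\<integral>\<^sup>+x. \<integral>\<^sup>+s. g s \<partial>iterK \<Phi> k (h0, x) \<partial>\<nu>)"
proof -
  have p: "Pair h0 \<in> \<nu> \<rightarrow>\<^sub>M SS" using PA_D(2)[OF \<nu>] by (simp cong: measurable_cong_sets)
  have "(\<lambda>s. \<integral>\<^sup>+t. g t \<partial>iterK \<Phi> k s) \<in> borel_measurable SS"
    by (rule nn_integral_kernel_measurable[OF _ iterK_meas[OF \<Phi>_meas]]) measurable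
  then show ?thesis unfolding J_def
    using nn_integral_bind_prob[OF distr_h0[OF \<nu>] iterK_meas[OF \<Phi>_meas] g, of k] p
    by (simp add: nn_integral_distr)
qed

lemma nn_integral_J_signal:
  assumes \<nu>: "\<nu> \<in> space PA" and f[measurable]: "f \<in> borel_measurable borel"
  shows "(\<integral>\<^sup>+s. f (snd s) \<partial>J \<nu> k) = (\<integral>\<^sup>+x. f x \<partial>((\<lambda>m. m \<bind> P) ^^ k) \<nu>)"
  using f
proof (induction k arbitrary: f)
  case 0
  then show ?case using nn_integral_J_0[OF \<nu>, of "\<lambda>s. f (snd s)"] by simp
next
  case (Suc k)
  note [measurable] = Suc.prems
  have \<nu>k: "((\<lambda>m. m \<bind> P) ^^ k) \<nu> \<in> space PA" by (induction k) (auto simp: \<nu>)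
  have m: "(\<lambda>x. \<integral>\<^sup>+x'. f x' \<partial>P x) \<in> borel_measurable borel"
    by (rule nn_integral_kernel_measurable[OF _ P_meas]) measurable
  have "(\<integral>\<^sup>+s. f (snd s) \<partial>J \<nu> (Suc k)) = (\<integral>\<^sup>+s. \<integral>\<^sup>+x'. f x' \<partial>P (snd s) \<partial>J \<nu> k)"
    using nn_integral_J_Suc[OF \<nu>, of "\<lambda>s. f (snd s)"] nn_integral_prob_const[OF \<Phi>_PA] by simp
  also have "\<dots> = (\<integral>\<^sup>+x. \<integral>\<^sup>+x'. f x' \<partial>P x \<partial>((\<lambda>m. m \<bind> P) ^^ k) \<nu>)" by (rule Suc.IH[OF m])
  also have "\<dots> = (\<integral>\<^sup>+x. f x \<partial>((\<lambda>m. m \<bind> P) ^^ Suc k) \<nu>)"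
    using nn_integral_bind_prob[OF \<nu>k P_meas Suc.prems] by simp
  finally show ?case .
qed

text \<open>The head of the history is the latest observation, so the recursion first filters the
  tail.\<close>

primrec Filt :: "'e measure \<Rightarrow> nat \<Rightarrow> 'f stream \<Rightarrow> 'e measure" where
  "Filt \<nu> 0 h = \<nu>"
| "Filt \<nu> (Suc k) h = bayes \<Upsilon> (shd h) (Filt \<nu> k (stl h) \<bind> P)"

lemma Filt_PA[simp]: "\<nu> \<in> space PA \<Longrightarrow> Filt \<nu> k h \<in> space PA"
  by (induction k arbitrary: h) auto

lemma Filt_meas[measurable]: "\<nu> \<in> space PA \<Longrightarrow> Filt \<nu> k \<in> HS \<rightarrow>\<^sub>M PA"
proof (induction k)
  case (Suc k)
  note [measurable] = Suc.IH[OF Suc.prems]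
  have "(\<lambda>h. bayes \<Upsilon> (shd h) (Filt \<nu> k (stl h) \<bind> P)) \<in> HS \<rightarrow>\<^sub>M PA"
    by (intro bayes_measurable' measurable_bind_prob_space[OF _ P_meas]) measurable
  then show ?case by simp
next
  case 0
  have "Filt \<nu> 0 = (\<lambda>_. \<nu>)" by auto
  then show ?case using 0 by simp
qed

section \<open>The recursion computes the conditional law of the signal\<close>

lemma nn_integral_bindP:
  assumes "\<nu> \<in> space PA" "g \<in> borel_measurable borel"
  shows "(\<integral>\<^sup>+x. g x \<partial>(\<nu> \<bind> P)) = (\<integral>\<^sup>+x. \<integral>\<^sup>+x'. g x' \<partial>P x \<partial>\<nu>)"
  by (rule nn_integral_bind_prob[OF assms(1) P_meas assms(2)])

text \<open>Given the history up to time \<open>k\<close> the signal has the filter as its law, so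
  one step consists of \<open>P\<close>, an emission, and a change of the order of disintegration.
  Correctness at time \<open>k\<close> is an assumption, which lets the lemma serve inside the
  induction for \<open>Filt_correct\<close> and again after it.\<close>

lemma Filt_correct_step:
  assumes \<nu>: "\<nu> \<in> space PA" and g[measurable]: "g \<in> borel_measurable SS"
    and IH: "\<And>g. g \<in> borel_measurable SS \<Longrightarrow> (\<integral>\<^sup>+s. g s \<partial>J \<nu> k) = (\<integral>\<^sup>+s. \<integral>\<^sup>+x. g (fst s, x) \<partial>Filt \<nu> k (fst s) \<partial>J \<nu> k)"
  shows "(\<integral>\<^sup>+s. g s \<partial>J \<nu> (Suc k)) =
    (\<integral>\<^sup>+s. \<integral>\<^sup>+y. \<integral>\<^sup>+x. g (y ## fst s, x) \<partial>Filt \<nu> (Suc k) (y ## fst s) \<partial>(Filt \<nu> k (fst s) \<bind> P \<bind> \<Phi>) \<partial>J \<nu> k)"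
proof -
  have m1: "(\<lambda>s. \<integral>\<^sup>+y. g (y ## fst s, snd s) \<partial>\<Phi> (snd s)) \<in> borel_measurable SS"
    by (rule nn_integral_kernel_measurable[where R=borel]) measurable
  have m1': "(\<lambda>x'. \<integral>\<^sup>+y. g (y ## h, x') \<partial>\<Phi> x') \<in> borel_measurable borel" for h
    by (rule nn_integral_kernel_measurable[where R=borel]) measurable
  have m2: "(\<lambda>s. \<integral>\<^sup>+x'. \<integral>\<^sup>+y. g (y ## fst s, x') \<partial>\<Phi> x' \<partial>P (snd s)) \<in> borel_measurable SS"
  proof (rule nn_integral_kernel_measurable[where R=borel])
    show "(\<lambda>(x, y). \<integral>\<^sup>+ ya. g (ya ## fst x, y) \<partial>\<Phi> y) \<in> borel_measurable (SS \<Otimes>\<^sub>M borel)"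
      unfolding split_beta' by (rule nn_integral_kernel_measurable[where R=borel]) measurable
  qed measurable
  have "(\<integral>\<^sup>+s. g s \<partial>J \<nu> (Suc k)) = (\<integral>\<^sup>+s. \<integral>\<^sup>+x'. \<integral>\<^sup>+y. g (y ## fst s, x') \<partial>\<Phi> x' \<partial>P (snd s) \<partial>J \<nu> k)"
    by (rule nn_integral_J_Suc[OF \<nu> g])
  also have "\<dots> = (\<integral>\<^sup>+s. \<integral>\<^sup>+x. \<integral>\<^sup>+x'. \<integral>\<^sup>+y. g (y ## fst s, x') \<partial>\<Phi> x' \<partial>P x \<partial>Filt \<nu> k (fst s) \<partial>J \<nu> k)"
    using IH[OF m2] by simp
  also have "\<dots> = (\<integral>\<^sup>+s. \<integral>\<^sup>+x'. \<integral>\<^sup>+y. g (y ## fst s, x') \<partial>\<Phi> x' \<partial>(Filt \<nu> k (fst s) \<bind> P) \<partial>J \<nu> k)"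
    using \<nu> by (simp add: nn_integral_bindP m1')
  also have "\<dots> = (\<integral>\<^sup>+s. \<integral>\<^sup>+y. \<integral>\<^sup>+x. g (y ## fst s, x) \<partial>bayes \<Upsilon> y (Filt \<nu> k (fst s) \<bind> P) \<partial>(Filt \<nu> k (fst s) \<bind> P \<bind> \<Phi>) \<partial>J \<nu> k)"
  proof (rule nn_integral_cong)
    fix s :: "'f stream \<times> 'e"
    show "(\<integral>\<^sup>+x'. \<integral>\<^sup>+y. g (y ## fst s, x') \<partial>\<Phi> x' \<partial>(Filt \<nu> k (fst s) \<bind> P)) =
      (\<integral>\<^sup>+y. \<integral>\<^sup>+x. g (y ## fst s, x) \<partial>bayes \<Upsilon> y (Filt \<nu> k (fst s) \<bind> P) \<partial>(Filt \<nu> k (fst s) \<bind> P \<bind> \<Phi>))"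
      using \<nu> by (intro bayes_disintegration) (simp, measurable)
  qed
  finally show ?thesis by simp
qed

lemma Filt_correct:
  assumes \<nu>: "\<nu> \<in> space PA" and g: "g \<in> borel_measurable SS"
  shows "(\<integral>\<^sup>+s. g s \<partial>J \<nu> k) = (\<integral>\<^sup>+s. \<integral>\<^sup>+x. g (fst s, x) \<partial>Filt \<nu> k (fst s) \<partial>J \<nu> k)"
  using g
proof (induction k arbitrary: g)
  case (0 g)
  note [measurable] = 0
  have "(\<lambda>s. \<integral>\<^sup>+x. g (fst s, x) \<partial>Filt \<nu> 0 (fst s)) \<in> borel_measurable SS"
    using measurable_const[OF \<nu>] by (intro nn_integral_kernel_measurable[where R=borel]) (simp_all add: split_beta')
  from nn_integral_J_0[OF \<nu> this] show ?case
    using nn_integral_prob_const[OF \<nu>] by (simp add: nn_integral_J_0[OF \<nu> 0])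
next
  case (Suc k g)
  note [measurable] = Suc.prems
  \<comment> \<open>Averaging over the filter is idempotent: the step formula gives the same
    right-hand side for \<open>g\<close> and for its average \<open>G\<close>.\<close>
  define G where "G s = (\<integral>\<^sup>+x. g (fst s, x) \<partial>Filt \<nu> (Suc k) (fst s))" for s :: "'f stream \<times> 'e"
  have fm: "(\<lambda>s. Filt \<nu> (Suc k) (fst s)) \<in> SS \<rightarrow>\<^sub>M PA"
    by (rule measurable_compose[OF measurable_fst Filt_meas[OF \<nu>]])
  have Gm: "G \<in> borel_measurable SS"
    unfolding G_def by (rule nn_integral_kernel_measurable[OF _ fm]) measurable
  have "(\<integral>\<^sup>+s. G s \<partial>J \<nu> (Suc k)) =
    (\<integral>\<^sup>+s. \<integral>\<^sup>+y. \<integral>\<^sup>+x. G (y ## fst s, x) \<partial>Filt \<nu> (Suc k) (y ## fst s) \<partial>(Filt \<nu> k (fst s) \<bind> P \<bind> \<Phi>) \<partial>J \<nu> k)"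
    by (rule Filt_correct_step[OF \<nu> Gm Suc.IH])
  also have "\<dots> = (\<integral>\<^sup>+s. \<integral>\<^sup>+y. \<integral>\<^sup>+x. g (y ## fst s, x) \<partial>Filt \<nu> (Suc k) (y ## fst s) \<partial>(Filt \<nu> k (fst s) \<bind> P \<bind> \<Phi>) \<partial>J \<nu> k)"
    unfolding G_def by (simp only: fst_conv nn_integral_prob_const[OF Filt_PA[OF \<nu>]])
  also have "\<dots> = (\<integral>\<^sup>+s. g s \<partial>J \<nu> (Suc k))" by (rule Filt_correct_step[OF \<nu> Suc.prems Suc.IH, symmetric])
  finally show ?case by (simp add: G_def)
qed

lemma Filt_correct_real:
  fixes g :: "'f stream \<times> 'e \<Rightarrow> real"
  assumes \<nu>: "\<nu> \<in> space PA" and g[measurable]: "g \<in> borel_measurable SS" and B: "\<And>s. \<bar>g s\<bar> \<le> B"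
  shows "(LINT s|J \<nu> k. g s) = (LINT s|J \<nu> k. LINT x|Filt \<nu> k (fst s). g (fst s, x))"
proof -
  have fm[measurable]: "(\<lambda>s. Filt \<nu> k (fst s)) \<in> SS \<rightarrow>\<^sub>M PA"
    by (rule measurable_compose[OF measurable_fst Filt_meas[OF \<nu>]])
  let ?D = "\<lambda>s. distr (Filt \<nu> k (fst s)) SS (Pair (fst s))"
  have Dm: "?D \<in> SS \<rightarrow>\<^sub>M prob_algebra SS" by measurable
  have p: "Pair (fst s) \<in> Filt \<nu> k (fst s) \<rightarrow>\<^sub>M SS" for s :: "'f stream \<times> 'e"
    using PA_D(2)[OF Filt_PA[OF \<nu>]] by (simp cong: measurable_cong_sets)
  \<comment> \<open>Redrawing the signal from the filter leaves the joint law unchanged; as an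
    identity of measures this also covers signed integrands.\<close>
  have "J \<nu> k = J \<nu> k \<bind> ?D"
  proof (rule PA_eqI[where A=SS])
    show "sets (J \<nu> k) = sets SS" by (rule J_sets[OF \<nu>])
    show "sets (J \<nu> k \<bind> ?D) = sets SS" using bind_prob[OF J_prob[OF \<nu>] Dm] by (simp add: space_prob_algebra)
    fix g :: "'f stream \<times> 'e \<Rightarrow> ennreal" assume g: "g \<in> borel_measurable SS"
    show "(\<integral>\<^sup>+s. g s \<partial>J \<nu> k) = (\<integral>\<^sup>+s. g s \<partial>(J \<nu> k \<bind> ?D))"
      unfolding nn_integral_bind_prob[OF J_prob[OF \<nu>] Dm g] Filt_correct[OF \<nu> g]
      using g p by (simp add: nn_integral_distr)
  qed
  then have "(LINT s|J \<nu> k. g s) = (LINT s|(J \<nu> k \<bind> ?D). g s)" by simp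
  also have "\<dots> = (LINT s|J \<nu> k. LINT t|?D s. g t)"
    by (rule integral_bind_prob[OF J_prob[OF \<nu>] Dm g B])
  finally show ?thesis using p by (simp add: integral_distr)
qed

text \<open>Removes the last step. Given the older history, the newest observation has law
  \<open>Filt \<nu>' k (fst s) \<bind> P \<bind> \<Phi>\<close>, which is the law used in
  \<open>evol\<close>, and the integrand does not involve the signal.\<close>

lemma Filt_evol:
  assumes \<nu>: "\<nu> \<in> space PA" and \<nu>': "\<nu>' \<in> space PA" and g: "good \<Psi>"
  shows "(LINT s|J \<nu>' (Suc k). \<Psi> (Filt \<nu> (Suc k) (fst s)) (Filt \<nu>' (Suc k) (fst s))) =
    (LINT s|J \<nu>' k. evol \<Psi> (Filt \<nu> k (fst s) \<bind> P) (Filt \<nu>' k (fst s) \<bind> P))"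
proof -
  let ?G = "\<lambda>s :: 'f stream \<times> 'e. \<Psi> (Filt \<nu> (Suc k) (fst s)) (Filt \<nu>' (Suc k) (fst s))"
  have fm[measurable]: "(\<lambda>s. Filt N k (fst s)) \<in> SS \<rightarrow>\<^sub>M PA" if "N \<in> space PA" for N k
    by (rule measurable_compose[OF measurable_fst Filt_meas[OF that]])
  have Gm: "?G \<in> borel_measurable SS" by (intro good_meas[OF g] fm \<nu> \<nu>')
  have Gb: "0 \<le> ?G s" "?G s \<le> 2" for s using good_bound[OF g Filt_PA[OF \<nu>] Filt_PA[OF \<nu>']] by blast+
  let ?E = "\<lambda>s :: 'f stream \<times> 'e. evol \<Psi> (Filt \<nu> k (fst s) \<bind> P) (Filt \<nu>' k (fst s) \<bind> P)"
  have Em: "?E \<in> borel_measurable SS"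
    using good_meas[OF good_evol[OF g], of "\<lambda>s. Filt \<nu> k (fst s)" SS "\<lambda>s. Filt \<nu>' k (fst s)"] fm \<nu> \<nu>' by simp
  have Eb: "0 \<le> ?E s" for s using good_bound[OF good_evol[OF g] Filt_PA[OF \<nu>] Filt_PA[OF \<nu>']] by blast
  have "(\<integral>\<^sup>+s. ennreal (?G s) \<partial>J \<nu>' (Suc k)) =
     (\<integral>\<^sup>+s. \<integral>\<^sup>+y. \<integral>\<^sup>+x. ennreal (?G (y ## fst s, x)) \<partial>Filt \<nu>' (Suc k) (y ## fst s) \<partial>(Filt \<nu>' k (fst s) \<bind> P \<bind> \<Phi>) \<partial>J \<nu>' k)"
    using Gm by (intro Filt_correct_step[OF \<nu>' _ Filt_correct[OF \<nu>']]) simp_all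
  also have "\<dots> = (\<integral>\<^sup>+s. ennreal (?E s) \<partial>J \<nu>' k)"
  proof (rule nn_integral_cong)
    fix s :: "'f stream \<times> 'e"
    let ?N = "Filt \<nu>' k (fst s) \<bind> P \<bind> \<Phi>"
    have N: "?N \<in> space PA" using \<nu>' by simp
    let ?g = "\<lambda>y. \<Psi> (bayes \<Upsilon> y (Filt \<nu> k (fst s) \<bind> P)) (bayes \<Upsilon> y (Filt \<nu>' k (fst s) \<bind> P))"
    have gm: "?g \<in> borel_measurable borel" using \<nu> \<nu>' by (intro evol_integrand_meas[OF g]) auto
    have gb: "0 \<le> ?g y" "?g y \<le> 2" for y using good_bound[OF g, of "bayes \<Upsilon> y (Filt \<nu> k (fst s) \<bind> P)" "bayes \<Upsilon> y (Filt \<nu>' k (fst s) \<bind> P)"] \<nu> \<nu>' by auto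
    have "(\<integral>\<^sup>+y. \<integral>\<^sup>+x. ennreal (?G (y ## fst s, x)) \<partial>Filt \<nu>' (Suc k) (y ## fst s) \<partial>?N) = (\<integral>\<^sup>+y. ennreal (?g y) \<partial>?N)"
      by (simp only: fst_conv nn_integral_prob_const[OF Filt_PA[OF \<nu>']] Filt.simps stream.sel
          nn_integral_prob_const[OF bayes_PA[OF bindP_PA[OF Filt_PA[OF \<nu>']]]])
    also have "\<dots> = ennreal (?E s)"
      unfolding evol_def using gb by (intro nn_integral_eq_integral pa_integrable[OF N gm, of 2]) auto
    finally show "(\<integral>\<^sup>+y. \<integral>\<^sup>+x. ennreal (?G (y ## fst s, x)) \<partial>Filt \<nu>' (Suc k) (y ## fst s) \<partial>?N) = ennreal (?E s)" .
  qed
  finally have "(\<integral>\<^sup>+s. ennreal (?G s) \<partial>J \<nu>' (Suc k)) = (\<integral>\<^sup>+s. ennreal (?E s) \<partial>J \<nu>' k)" .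
  moreover have "?G \<in> borel_measurable (J \<nu>' (Suc k))" "?E \<in> borel_measurable (J \<nu>' k)"
    using Gm Em J_sets[OF \<nu>'] by (simp_all cong: measurable_cong_sets)
  ultimately show ?thesis using Gb Eb by (simp add: integral_eq_nn_integral)
qed

text \<open>\<open>Dist\<close> unfolds its first step while \<open>Filt_evol\<close> removes the
  last one. Both count powers of the same operator \<open>T\<close> on costs, and the induction is
  over all good costs at once, so it does not matter at which end a step is taken.\<close>

lemma Dist_eq_integral:
  assumes \<nu>: "\<nu> \<in> space PA" and \<nu>': "\<nu>' \<in> space PA"
  shows "Dist k \<nu> \<nu>' = (LINT s|J \<nu>' k. bl_dist (Filt \<nu> k (fst s)) (Filt \<nu>' k (fst s)))"
proof -
  define T where "T \<Psi> = (\<lambda>\<nu> \<nu>'. evol \<Psi> (\<nu> \<bind> P) (\<nu>' \<bind> P))" for \<Psi>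
  have "(LINT s|J \<nu>' k. \<Psi> (Filt \<nu> k (fst s)) (Filt \<nu>' k (fst s))) = (T ^^ k) \<Psi> \<nu> \<nu>'" if "good \<Psi>" for \<Psi>
    using that
  proof (induction k arbitrary: \<Psi>)
    case 0
    interpret prob_space "J \<nu>' 0" by (rule J_prob_space[OF \<nu>'])
    show ?case by (simp add: prob_space)
  next
    case (Suc k)
    have "(LINT s|J \<nu>' (Suc k). \<Psi> (Filt \<nu> (Suc k) (fst s)) (Filt \<nu>' (Suc k) (fst s))) =
      (LINT s|J \<nu>' k. T \<Psi> (Filt \<nu> k (fst s)) (Filt \<nu>' k (fst s)))"
      unfolding T_def by (rule Filt_evol[OF \<nu> \<nu>' Suc.prems])
    also have "\<dots> = (T ^^ k) (T \<Psi>) \<nu> \<nu>'" by (rule Suc.IH) (use good_evol[OF Suc.prems] in \<open>simp add: T_def\<close>)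
    finally show ?case by (simp add: funpow_swap1)
  qed
  moreover have "Dist k = (T ^^ k) bl_dist"
    by (induction k) (auto simp: T_def)
  ultimately show ?thesis using good_bl_dist by simp
qed

end

section \<open>Minorisation by a reference chain\<close>

lemma outer_approx:
  fixes N :: "'e::polish_space measure"
  assumes N: "N \<in> space PA" and A: "A \<in> sets borel" and e: "e > 0"
  obtains U where "open U" "A \<subseteq> U" "measure N U \<le> measure N A + e"
proof -
  interpret prob_space N by (rule PA_D[OF N])
  have "emeasure N A = (INF U \<in> {U. A \<subseteq> U \<and> open U}. emeasure N U)"
    by (rule outer_regular[OF PA_D(2)[OF N] _ A]) simp
  moreover have "emeasure N A < ennreal (measure N A + e)"
    using e by (simp add: emeasure_eq_measure ennreal_lessI)
  ultimately have "(INF U \<in> {U. A \<subseteq> U \<and> open U}. emeasure N U) < ennreal (measure N A + e)" by simp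
  then obtain U where "A \<subseteq> U" "open U" "emeasure N U < ennreal (measure N A + e)"
    unfolding INF_less_iff by blast
  then show thesis using e
    by (intro that[of U]) (auto simp: emeasure_eq_measure ennreal_less_iff simp del: ennreal_plus)
qed

text \<open>Outer regularity of both measures: the intersection of the two approximating open sets
  is open and close to \<open>A\<close> under each of them.\<close>

lemma measure_diff_bound_open:
  fixes \<nu> l :: "'e::polish_space measure"
  assumes \<nu>: "\<nu> \<in> space PA" and l: "l \<in> space PA"
    and op: "\<And>U. open U \<Longrightarrow> \<bar>measure \<nu> U - measure l U\<bar> \<le> \<epsilon>" and A: "A \<in> sets borel"
  shows "\<bar>measure \<nu> A - measure l A\<bar> \<le> \<epsilon>"
proof (rule field_le_epsilon)
  fix e :: real assume e: "e > 0"
  interpret N: prob_space \<nu> by (rule PA_D[OF \<nu>])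
  interpret L: prob_space l by (rule PA_D[OF l])
  obtain U where U: "open U" "A \<subseteq> U" "measure \<nu> U \<le> measure \<nu> A + e" by (rule outer_approx[OF \<nu> A e])
  obtain V where V: "open V" "A \<subseteq> V" "measure l V \<le> measure l A + e" by (rule outer_approx[OF l A e])
  have s: "A \<in> N.events" "U \<inter> V \<in> N.events" "U \<in> N.events" "A \<in> L.events" "U \<inter> V \<in> L.events" "V \<in> L.events"
    using A U V PA_D(2)[OF \<nu>] PA_D(2)[OF l] by auto
  have "measure \<nu> A \<le> measure \<nu> (U \<inter> V)" "measure \<nu> (U \<inter> V) \<le> measure \<nu> U"
    "measure l A \<le> measure l (U \<inter> V)" "measure l (U \<inter> V) \<le> measure l V"
    using U(2) V(2) s by (auto intro!: N.finite_measure_mono L.finite_measure_mono)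
  moreover have "\<bar>measure \<nu> (U \<inter> V) - measure l (U \<inter> V)\<bar> \<le> \<epsilon>" using U V by (intro op) auto
  ultimately show "\<bar>measure \<nu> A - measure l A\<bar> \<le> \<epsilon> + e" using U(3) V(3) by linarith
qed

lemma layer_cake:
  fixes a :: "'e::polish_space \<Rightarrow> real"
  assumes N: "N \<in> space PA" and a[measurable]: "a \<in> borel_measurable borel" and a01: "\<And>x. 0 \<le> a x" "\<And>x. a x \<le> 1"
  shows "(LINT x|N. a x) = (LINT t|uniform_measure lborel {0..1}. measure N {x. t \<le> a x})"
    and "integrable (uniform_measure lborel {0..1}) (\<lambda>t. measure N {x. t \<le> a x})"
proof -
  let ?U = "uniform_measure lborel {0..1::real}" and ?I = "\<lambda>x t. if t \<le> a x then 1 else 0 :: real"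
  interpret N: prob_space N by (rule PA_D[OF N])
  interpret U: prob_space ?U by (rule prob_space_uniform_measure) auto
  interpret pair_prob_space N ?U ..
  have [measurable_cong]: "sets N = sets borel" by (rule PA_D[OF N])
  have i: "integrable (N \<Otimes>\<^sub>M ?U) (\<lambda>(x, t). ?I x t)" by (rule P.integrable_const_bound[of _ 1]) auto
  have "(LINT t|?U. ?I x t) = a x" for x
  proof -
    have "(LINT t|?U. ?I x t) = (LINT t|?U. indicator {..a x} t)" by (intro Bochner_Integration.integral_cong) (auto simp: indicator_def)
    also have "\<dots> = measure lborel ({0..1} \<inter> {..a x})" by (simp add: measure_uniform_measure)
    also have "{0..1} \<inter> {..a x} = {0..a x}" using a01(2)[of x] by auto
    finally show ?thesis using a01(1)[of x] by simp
  qed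
  moreover have "(LINT x|N. ?I x t) = measure N {x. t \<le> a x}" for t
  proof -
    have "(LINT x|N. ?I x t) = (LINT x|N. indicator {x. t \<le> a x} x)" by (intro Bochner_Integration.integral_cong) (auto simp: indicator_def)
    then show ?thesis by simp
  qed
  ultimately show "(LINT x|N. a x) = (LINT t|?U. measure N {x. t \<le> a x})" "integrable ?U (\<lambda>t. measure N {x. t \<le> a x})"
    using Fubini_integral[OF i] integrable_snd[OF i] by simp_all
qed

text \<open>The layer cake formula writes the integral of a function with values in
  \<open>[0,1]\<close> as an average of measures of superlevel sets, so the bound passes over with
  the same \<open>\<epsilon>\<close>.\<close>

lemma integral_diff_bound_sets:
  fixes \<nu> l :: "'e::polish_space measure" and a :: "'e \<Rightarrow> real"
  assumes \<nu>: "\<nu> \<in> space PA" and l: "l \<in> space PA"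
    and bd: "\<And>A. A \<in> sets borel \<Longrightarrow> \<bar>measure \<nu> A - measure l A\<bar> \<le> \<epsilon>"
    and a[measurable]: "a \<in> borel_measurable borel" and a01: "\<And>x. 0 \<le> a x" "\<And>x. a x \<le> 1"
  shows "\<bar>(LINT x|\<nu>. a x) - (LINT x|l. a x)\<bar> \<le> \<epsilon>"
proof -
  let ?U = "uniform_measure lborel {0..1::real}"
  note i = layer_cake(2)[OF \<nu> a a01] layer_cake(2)[OF l a a01]
  have "?U \<in> space (prob_algebra ?U)" by (simp add: space_prob_algebra prob_space_uniform_measure)
  then have "\<bar>LINT t|?U. measure \<nu> {x. t \<le> a x} - measure l {x. t \<le> a x}\<bar> \<le> \<epsilon>"
    using i by (intro pa_integral_le[of _ ?U] bd borel_measurable_diff) (auto dest: borel_measurable_integrable)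
  then show ?thesis using i by (simp add: layer_cake(1)[OF \<nu> a a01] layer_cake(1)[OF l a a01])
qed

text \<open>Finite unions of basic open sets, indexed by lists of numbers, exhaust every open set.
  Closeness in total variation is thereby encoded in countably many conditions, so the set of
  starting points whose transition law is close to the invariant one can be chosen
  measurable.\<close>

lemma countable_total_variation:
  obtains \<G> :: "nat list \<Rightarrow> 'e::polish_space set" where "\<And>n. \<G> n \<in> sets borel"
    "\<And>\<nu> l \<epsilon> a. \<nu> \<in> space PA \<Longrightarrow> l \<in> space PA \<Longrightarrow> (\<And>n. \<bar>measure \<nu> (\<G> n) - measure l (\<G> n)\<bar> \<le> \<epsilon>) \<Longrightarrow>
      a \<in> borel_measurable borel \<Longrightarrow> (\<And>x. 0 \<le> a x) \<Longrightarrow> (\<And>x. a x \<le> (1::real)) \<Longrightarrow>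
      \<bar>(LINT x|\<nu>. a x) - (LINT x|l. a x)\<bar> \<le> \<epsilon>"
proof -
  obtain B :: "'e set set" where B: "countable B" "topological_basis B" using ex_countable_basis by blast
  obtain B' where "B' \<subseteq> B" "\<Union>B' = (UNIV :: 'e set)" using B(2) unfolding topological_basis_def by (metis open_UNIV)
  then have "B \<noteq> {}" by (metis Union_empty empty_not_UNIV subset_empty)
  define b where "b = from_nat_into B"
  have b: "range b = B" unfolding b_def by (rule range_from_nat_into[OF \<open>B \<noteq> {}\<close> B(1)])
  then have bo: "open (b i)" for i using topological_basis_open[OF B(2)] by auto
  define \<G> where "\<G> n = (\<Union>i\<in>set n. b i)" for n
  show thesis
  proof (rule that)
    show "\<G> n \<in> sets borel" for n unfolding \<G>_def using bo by (intro borel_open open_UN) auto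
    fix \<nu> l :: "'e measure" and \<epsilon> :: real and a :: "'e \<Rightarrow> real"
    assume \<nu>: "\<nu> \<in> space PA" and l: "l \<in> space PA" and bd: "\<And>n. \<bar>measure \<nu> (\<G> n) - measure l (\<G> n)\<bar> \<le> \<epsilon>"
    have op: "\<bar>measure \<nu> U - measure l U\<bar> \<le> \<epsilon>" if U: "open U" for U
    proof -
      define G where "G n = (\<Union>i\<in>{i. i < n \<and> b i \<subseteq> U}. b i)" for n
      have G: "G n = \<G> (sorted_list_of_set {i. i < n \<and> b i \<subseteq> U})" for n by (simp add: G_def \<G>_def)
      have "U \<subseteq> (\<Union>n. G n)"
      proof
        fix x assume "x \<in> U"
        then obtain V where "V \<in> B" "x \<in> V" "V \<subseteq> U" using topological_basisE[OF B(2) U] by metis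
        then obtain i where "x \<in> b i" "b i \<subseteq> U" using b by (metis rangeE)
        then have "x \<in> G (Suc i)" unfolding G_def by blast
        then show "x \<in> (\<Union>n. G n)" by blast
      qed
      then have un: "(\<Union>n. G n) = U" unfolding G_def by blast
      have inc: "incseq G" unfolding G_def by (intro monoI UN_mono) auto
      have c: "(\<lambda>n. measure N (G n)) \<longlonglongrightarrow> measure N U" if N: "N \<in> space PA" for N
      proof -
        interpret prob_space N by (rule PA_D[OF N])
        have "range G \<subseteq> events" using bo PA_D(2)[OF N] by (auto simp: G_def)
        from finite_Lim_measure_incseq[OF this inc] show ?thesis unfolding un .
      qed
      have "(\<lambda>n. \<bar>measure \<nu> (G n) - measure l (G n)\<bar>) \<longlonglongrightarrow> \<bar>measure \<nu> U - measure l U\<bar>"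
        by (intro tendsto_intros c \<nu> l)
      then show ?thesis by (rule LIMSEQ_le_const2) (use bd G in auto)
    qed
    assume "a \<in> borel_measurable borel" "\<And>x. 0 \<le> a x" "\<And>x. a x \<le> 1"
    then show "\<bar>(LINT x|\<nu>. a x) - (LINT x|l. a x)\<bar> \<le> \<epsilon>"
      by (intro integral_diff_bound_sets[OF \<nu> l measure_diff_bound_open[OF \<nu> l op]])
  qed
qed

section \<open>Likelihood ratios with respect to the reference chain\<close>

context filter_model
begin

text \<open>The law of the observation given one fixed state serves as a reference probability measure
  equivalent to all other observation laws.\<close>

definition \<phi>\<^sub>0 :: "'f measure" where "\<phi>\<^sub>0 = \<Phi> undefined"

definition \<Upsilon>\<^sub>0 :: "'e \<Rightarrow> 'f \<Rightarrow> real" where "\<Upsilon>\<^sub>0 x y = \<Upsilon> x y / \<Upsilon> undefined y"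

lemma \<phi>\<^sub>0_PA[simp]: "\<phi>\<^sub>0 \<in> space PA" unfolding \<phi>\<^sub>0_def by simp

lemma \<phi>\<^sub>0_kernel[measurable]: "(\<lambda>_. \<phi>\<^sub>0) \<in> M \<rightarrow>\<^sub>M PA" by simp

lemma \<Upsilon>\<^sub>0_pos: "0 < \<Upsilon>\<^sub>0 x y" unfolding \<Upsilon>\<^sub>0_def by (intro divide_pos_pos \<Upsilon>_pos)

lemma \<Upsilon>\<^sub>0_meas[measurable (raw)]:
  "f \<in> M \<rightarrow>\<^sub>M borel \<Longrightarrow> g \<in> M \<rightarrow>\<^sub>M borel \<Longrightarrow> (\<lambda>x. \<Upsilon>\<^sub>0 (f x) (g x)) \<in> borel_measurable M"
  unfolding \<Upsilon>\<^sub>0_def by (intro borel_measurable_divide \<Upsilon>_meas' measurable_const) simp_all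

lemma nn_integral_\<Phi>_ref:
  assumes [measurable]: "g \<in> borel_measurable borel"
  shows "(\<integral>\<^sup>+y. g y \<partial>\<Phi> x) = (\<integral>\<^sup>+y. ennreal (\<Upsilon>\<^sub>0 x y) * g y \<partial>\<phi>\<^sub>0)"
proof -
  have e: "ennreal (\<Upsilon> undefined y) * ennreal (\<Upsilon>\<^sub>0 x y) = ennreal (\<Upsilon> x y)" for y
    using \<Upsilon>_pos[of undefined y] \<Upsilon>_pos[of x y] by (simp add: \<Upsilon>\<^sub>0_def flip: ennreal_mult)
  have "(\<integral>\<^sup>+y. g y \<partial>\<Phi> x) = (\<integral>\<^sup>+y. ennreal (\<Upsilon> x y) * g y \<partial>\<phi>)"
    unfolding \<Phi>_density by (simp add: nn_integral_density)
  also have "\<dots> = (\<integral>\<^sup>+y. ennreal (\<Upsilon> undefined y) * (ennreal (\<Upsilon>\<^sub>0 x y) * g y) \<partial>\<phi>)"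
    by (simp add: e flip: mult.assoc)
  also have "\<dots> = (\<integral>\<^sup>+y. ennreal (\<Upsilon>\<^sub>0 x y) * g y \<partial>\<phi>\<^sub>0)"
    unfolding \<phi>\<^sub>0_def \<Phi>_density[of undefined] by (simp add: nn_integral_density)
  finally show ?thesis .
qed

abbreviation K0 :: "nat \<Rightarrow> 'f stream \<times> 'e \<Rightarrow> ('f stream \<times> 'e) measure" where
  "K0 \<equiv> iterK (\<lambda>_. \<phi>\<^sub>0)"

lemma nn_integral_iterK_meas:
  assumes "\<Theta> \<in> borel \<rightarrow>\<^sub>M PA" "g \<in> borel_measurable SS"
  shows "(\<lambda>s. \<integral>\<^sup>+t. g t \<partial>iterK \<Theta> m s) \<in> borel_measurable SS"
  using assms by (intro nn_integral_kernel_measurable[OF _ iterK_meas]) auto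

lemma iterK_section_meas:
  assumes "\<Theta> \<in> borel \<rightarrow>\<^sub>M PA" "g \<in> borel_measurable SS" "a \<in> M \<rightarrow>\<^sub>M borel" "b \<in> M \<rightarrow>\<^sub>M borel"
  shows "(\<lambda>z. \<integral>\<^sup>+t. g t \<partial>iterK \<Theta> m (b z ## h, a z)) \<in> borel_measurable M"
proof -
  note [measurable] = assms
  have "(\<lambda>z. (b z ## h, a z)) \<in> M \<rightarrow>\<^sub>M SS" by measurable
  from measurable_compose[OF this nn_integral_iterK_meas[OF assms(1,2)]] show ?thesis by simp
qed

lemma iterK_section_int_meas:
  assumes \<Theta>: "\<Theta> \<in> borel \<rightarrow>\<^sub>M PA" and g: "g \<in> borel_measurable SS"
  shows "(\<lambda>x'. \<integral>\<^sup>+y. \<integral>\<^sup>+t. g t \<partial>iterK \<Theta> m (y ## h, x') \<partial>\<Theta> x') \<in> borel_measurable borel"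
  by (rule nn_integral_kernel_measurable[OF _ \<Theta>]) (unfold split_beta', intro iterK_section_meas \<Theta> g measurable_fst measurable_snd)

lemma nn_integral_iterK_Suc:
  assumes \<Theta>: "\<Theta> \<in> borel \<rightarrow>\<^sub>M PA" and g: "g \<in> borel_measurable SS"
  shows "(\<integral>\<^sup>+s. g s \<partial>iterK \<Theta> (Suc m) (h, x)) = (\<integral>\<^sup>+x'. \<integral>\<^sup>+y. \<integral>\<^sup>+s. g s \<partial>iterK \<Theta> m (y ## h, x') \<partial>\<Theta> x' \<partial>P x)"
  using nn_integral_bind_prob[OF kernel_prob[OF stepK_meas[OF \<Theta>]] iterK_meas[OF \<Theta>] g, of "(h, x)"]
    nn_integral_stepK[OF \<Theta> nn_integral_iterK_meas[OF \<Theta> g]] by simp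

lemma iterK_prob[simp]: "\<Theta> \<in> borel \<rightarrow>\<^sub>M PA \<Longrightarrow> iterK \<Theta> m s \<in> space (prob_algebra SS)"
  using kernel_prob[OF iterK_meas, of \<Theta> s m] by simp

lemma nn_integral_iterK_le1:
  assumes "\<Theta> \<in> borel \<rightarrow>\<^sub>M PA" "\<And>s. g s \<le> 1" shows "(\<integral>\<^sup>+t. g t \<partial>iterK \<Theta> m s) \<le> 1"
proof -
  have "(\<integral>\<^sup>+t. g t \<partial>iterK \<Theta> m s) \<le> (\<integral>\<^sup>+t. 1 \<partial>iterK \<Theta> m s)" using assms by (intro nn_integral_mono) auto
  also have "\<dots> = 1" by (rule nn_integral_prob_const[OF iterK_prob[OF assms(1)]])
  finally show ?thesis .
qed

definition bad :: "ennreal \<Rightarrow> 'e \<Rightarrow> 'f \<Rightarrow> ennreal" where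
  "bad c x y = (if ennreal (\<Upsilon>\<^sub>0 x y) < c then 1 else 0)"

text \<open>The expected number of those among the next \<open>m\<close> steps of the reference
  chain at which the likelihood ratio falls below \<open>c\<close>.\<close>

primrec loss :: "ennreal \<Rightarrow> nat \<Rightarrow> 'e \<Rightarrow> ennreal" where
  "loss c 0 x = 0"
| "loss c (Suc m) x = (\<integral>\<^sup>+x'. (\<integral>\<^sup>+y. bad c x' y \<partial>\<phi>\<^sub>0) + loss c m x' \<partial>P x)"

lemma bad_meas[measurable (raw)]:
  "f \<in> M \<rightarrow>\<^sub>M borel \<Longrightarrow> g \<in> M \<rightarrow>\<^sub>M borel \<Longrightarrow> (\<lambda>x. bad c (f x) (g x)) \<in> borel_measurable M"
  unfolding bad_def by measurable

lemma bad_int_meas[measurable]: "(\<lambda>x'. \<integral>\<^sup>+y. bad c x' y \<partial>\<phi>\<^sub>0) \<in> borel_measurable borel"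
  by (rule nn_integral_kernel_measurable[OF _ \<phi>\<^sub>0_kernel]) measurable

lemma loss_meas[measurable]: "loss c m \<in> borel_measurable borel"
proof (induction m)
  case (Suc m)
  note [measurable] = Suc
  have "(\<lambda>x. \<integral>\<^sup>+x'. (\<integral>\<^sup>+y. bad c x' y \<partial>\<phi>\<^sub>0) + loss c m x' \<partial>P x) \<in> borel_measurable borel"
    by (rule nn_integral_kernel_measurable[OF _ P_meas]) measurable
  then show ?case by simp
next
  case 0
  have "loss c 0 = (\<lambda>_. 0)" by auto
  then show ?case by simp
qed

lemma bad_int_le1: "(\<integral>\<^sup>+y. bad c x' y \<partial>\<phi>\<^sub>0) \<le> 1"
proof -
  have "(\<integral>\<^sup>+y. bad c x' y \<partial>\<phi>\<^sub>0) \<le> (\<integral>\<^sup>+y. 1 \<partial>\<phi>\<^sub>0)" by (intro nn_integral_mono) (auto simp: bad_def)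
  also have "\<dots> = 1" by (rule nn_integral_prob_const[OF \<phi>\<^sub>0_PA])
  finally show ?thesis .
qed

lemma loss_le: "loss c m x \<le> of_nat m"
proof (induction m arbitrary: x)
  case (Suc m)
  have "loss c (Suc m) x \<le> (\<integral>\<^sup>+x'. 1 + of_nat m \<partial>P x)"
    unfolding loss.simps by (intro nn_integral_mono add_mono bad_int_le1 Suc)
  also have "\<dots> = 1 + of_nat m" by (rule nn_integral_prob_const[OF P_PA])
  finally show ?case by simp
qed simp

lemma bad_int_tendsto: "(\<lambda>n. \<integral>\<^sup>+y. bad (ennreal (1 / real (Suc n))) x y \<partial>\<phi>\<^sub>0) \<longlonglongrightarrow> 0"
proof -
  have [measurable_cong]: "sets \<phi>\<^sub>0 = sets borel" by (rule PA_D[OF \<phi>\<^sub>0_PA])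
  have "(\<lambda>n. \<integral>\<^sup>+y. bad (ennreal (1 / real (Suc n))) x y \<partial>\<phi>\<^sub>0) \<longlonglongrightarrow> (\<integral>\<^sup>+y. 0 \<partial>\<phi>\<^sub>0)"
  proof (rule nn_integral_dominated_convergence[where w="\<lambda>_. 1"])
    show "(\<integral>\<^sup>+y. 1 \<partial>\<phi>\<^sub>0) < \<infinity>" unfolding nn_integral_prob_const[OF \<phi>\<^sub>0_PA] by simp
    show "AE y in \<phi>\<^sub>0. (\<lambda>n. bad (ennreal (1 / real (Suc n))) x y) \<longlonglongrightarrow> 0"
    proof (rule AE_I2)
      fix y
      have "eventually (\<lambda>n. 1 / real (Suc n) < \<Upsilon>\<^sub>0 x y) sequentially"
        using \<Upsilon>\<^sub>0_pos[of x y] LIMSEQ_inverse_real_of_nat by (intro order_tendstoD) (auto simp: inverse_eq_divide)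
      then have "eventually (\<lambda>n. bad (ennreal (1 / real (Suc n))) x y = 0) sequentially"
      proof eventually_elim
        case (elim n)
        then have "ennreal (1 / real (Suc n)) \<le> ennreal (\<Upsilon>\<^sub>0 x y)" by (intro ennreal_leI) simp
        then show ?case unfolding bad_def by (simp add: not_less)
      qed
      then show "(\<lambda>n. bad (ennreal (1 / real (Suc n))) x y) \<longlonglongrightarrow> 0" by (rule tendsto_eventually)
    qed
    show "AE y in \<phi>\<^sub>0. bad (ennreal (1 / real (Suc n))) x y \<le> 1" for n by (simp add: bad_def)
  qed measurable
  then show ?thesis by simp
qed

lemma loss_int_tendsto:
  assumes N: "N \<in> space PA" and c: "\<And>x. (\<lambda>n. g n x) \<longlonglongrightarrow> 0"
    and m: "\<And>n. g n \<in> borel_measurable borel" and B: "\<And>n x. g n x \<le> (of_nat k :: ennreal)"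
  shows "(\<lambda>n. \<integral>\<^sup>+x. g n x \<partial>N) \<longlonglongrightarrow> 0"
proof -
  have [measurable_cong]: "sets N = sets borel" by (rule PA_D[OF N])
  note [measurable] = m
  have "(\<lambda>n. \<integral>\<^sup>+x. g n x \<partial>N) \<longlonglongrightarrow> (\<integral>\<^sup>+x. 0 \<partial>N)"
  proof (rule nn_integral_dominated_convergence[where w="\<lambda>_. of_nat k"])
    show "(\<integral>\<^sup>+x. of_nat k \<partial>N) < \<infinity>" unfolding nn_integral_prob_const[OF N] by (simp add: of_nat_less_top)
  qed (use B c in auto)
  then show ?thesis by simp
qed

text \<open>Dominated convergence for fixed \<open>m\<close>: the ratio
  \<open>\<Upsilon>\<^sub>0\<close> is strictly positive and the loss is at most \<open>m\<close>.
  There is no lower bound on the ratio that is uniform in state and observation; therefore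
  \<open>c\<close> is chosen later from the mean loss under \<open>l\<close>.\<close>

lemma loss_tendsto: "(\<lambda>n. loss (ennreal (1 / real (Suc n))) m x) \<longlonglongrightarrow> 0"
proof (induction m arbitrary: x)
  case (Suc m)
  have "(\<lambda>n. \<integral>\<^sup>+x'. (\<integral>\<^sup>+y. bad (ennreal (1 / real (Suc n))) x' y \<partial>\<phi>\<^sub>0) + loss (ennreal (1 / real (Suc n))) m x' \<partial>P x) \<longlonglongrightarrow> 0"
  proof (rule loss_int_tendsto[OF P_PA, where k="Suc m"])
    fix x'
    show "(\<lambda>n. (\<integral>\<^sup>+y. bad (ennreal (1 / real (Suc n))) x' y \<partial>\<phi>\<^sub>0) + loss (ennreal (1 / real (Suc n))) m x') \<longlonglongrightarrow> 0"
      using tendsto_add[OF bad_int_tendsto[of x'] Suc[of x']] by simp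
    show "(\<integral>\<^sup>+y. bad (ennreal (1 / real (Suc n))) x' y \<partial>\<phi>\<^sub>0) + loss (ennreal (1 / real (Suc n))) m x' \<le> of_nat (Suc m)" for n
      using add_mono[OF bad_int_le1 loss_le] by simp
  qed measurable
  then show ?case by simp
qed simp

lemma nn_integral_loss_tendsto:
  assumes "N \<in> space PA" shows "(\<lambda>n. \<integral>\<^sup>+x. loss (ennreal (1 / real (Suc n))) m x \<partial>N) \<longlonglongrightarrow> 0"
  by (rule loss_int_tendsto[OF assms loss_tendsto loss_meas loss_le])

text \<open>Each likelihood factor is at least \<open>c\<close> outside a small set; \<open>loss\<close> collects the exceptional mass.\<close>

lemma iterK_lower:
  assumes g: "g \<in> borel_measurable SS" and g1: "\<And>s. g s \<le> 1"
  shows "c ^ m * (\<integral>\<^sup>+t. g t \<partial>K0 m (h, x)) \<le> (\<integral>\<^sup>+t. g t \<partial>iterK \<Phi> m (h, x)) + c ^ m * loss c m x"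
proof (induction m arbitrary: h x)
  case 0
  then show ?case using g by simp
next
  case (Suc m)
  let ?GR = "\<lambda>x' y. \<integral>\<^sup>+t. g t \<partial>K0 m (y ## h, x')" and ?GL = "\<lambda>x' y. \<integral>\<^sup>+t. g t \<partial>iterK \<Phi> m (y ## h, x')"
  note [measurable (raw)] = iterK_section_meas[OF \<phi>\<^sub>0_kernel g] iterK_section_meas[OF \<Phi>_meas g]
  have [measurable_cong]: "sets \<phi>\<^sub>0 = sets borel" "sets (P x) = sets borel" by (rule PA_D; simp)+
  note m1 = iterK_section_int_meas[OF \<phi>\<^sub>0_kernel g] and m2 = iterK_section_int_meas[OF \<Phi>_meas g]
  \<comment> \<open>If the first factor is below \<open>c\<close>, the whole mass, at most
    \<open>1\<close>, is booked as bad; otherwise one factor \<open>c\<close> is replaced by the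
    likelihood ratio and the induction hypothesis handles the remaining \<open>m\<close>
    steps.\<close>
  have pt: "c ^ Suc m * ?GR x' y \<le> ennreal (\<Upsilon>\<^sub>0 x' y) * ?GL x' y + c ^ Suc m * (bad c x' y + loss c m x')" for x' y
  proof (cases "ennreal (\<Upsilon>\<^sub>0 x' y) < c")
    case True
    have "?GR x' y \<le> 1" by (rule nn_integral_iterK_le1[OF \<phi>\<^sub>0_kernel g1])
    then have "?GR x' y \<le> bad c x' y + loss c m x'" using True by (simp add: bad_def add_increasing2)
    then have "c ^ Suc m * ?GR x' y \<le> c ^ Suc m * (bad c x' y + loss c m x')" by (rule mult_left_mono) simp
    then show ?thesis by (rule order_trans) simp
  next
    case False
    have "c ^ Suc m * ?GR x' y = c * (c ^ m * ?GR x' y)" by (simp add: mult_ac)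
    also have "\<dots> \<le> c * (?GL x' y + c ^ m * loss c m x')" by (intro mult_left_mono Suc.IH) simp
    also have "\<dots> = c * ?GL x' y + c ^ Suc m * loss c m x'" by (simp add: distrib_left mult_ac)
    also have "\<dots> \<le> ennreal (\<Upsilon>\<^sub>0 x' y) * ?GL x' y + c ^ Suc m * (bad c x' y + loss c m x')"
      using False by (intro add_mono mult_right_mono mult_left_mono) (auto simp: not_less)
    finally show ?thesis .
  qed
  have "c ^ Suc m * (\<integral>\<^sup>+t. g t \<partial>K0 (Suc m) (h, x)) = c ^ Suc m * (\<integral>\<^sup>+x'. \<integral>\<^sup>+y. ?GR x' y \<partial>\<phi>\<^sub>0 \<partial>P x)"
    unfolding nn_integral_iterK_Suc[OF \<phi>\<^sub>0_kernel g] ..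
  also have "\<dots> = (\<integral>\<^sup>+x'. \<integral>\<^sup>+y. c ^ Suc m * ?GR x' y \<partial>\<phi>\<^sub>0 \<partial>P x)"
    using m1 by (simp add: nn_integral_cmult del: power_Suc)
  also have "\<dots> \<le> (\<integral>\<^sup>+x'. \<integral>\<^sup>+y. ennreal (\<Upsilon>\<^sub>0 x' y) * ?GL x' y + c ^ Suc m * (bad c x' y + loss c m x') \<partial>\<phi>\<^sub>0 \<partial>P x)"
    by (intro nn_integral_mono pt)
  also have "\<dots> = (\<integral>\<^sup>+x'. (\<integral>\<^sup>+y. ennreal (\<Upsilon>\<^sub>0 x' y) * ?GL x' y \<partial>\<phi>\<^sub>0) + c ^ Suc m * ((\<integral>\<^sup>+y. bad c x' y \<partial>\<phi>\<^sub>0) + loss c m x') \<partial>P x)"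
    by (intro nn_integral_cong)
      (simp add: nn_integral_add nn_integral_cmult prob_space.emeasure_space_1[OF PA_D(1)[OF \<phi>\<^sub>0_PA]] del: power_Suc)
  also have "\<dots> = (\<integral>\<^sup>+x'. (\<integral>\<^sup>+y. ?GL x' y \<partial>\<Phi> x') + c ^ Suc m * ((\<integral>\<^sup>+y. bad c x' y \<partial>\<phi>\<^sub>0) + loss c m x') \<partial>P x)"
    by (simp add: nn_integral_\<Phi>_ref del: power_Suc)
  also have "\<dots> = (\<integral>\<^sup>+x'. \<integral>\<^sup>+y. ?GL x' y \<partial>\<Phi> x' \<partial>P x) + c ^ Suc m * (\<integral>\<^sup>+x'. (\<integral>\<^sup>+y. bad c x' y \<partial>\<phi>\<^sub>0) + loss c m x' \<partial>P x)"
    using m2 by (simp add: nn_integral_add nn_integral_cmult del: power_Suc)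
  also have "\<dots> = (\<integral>\<^sup>+t. g t \<partial>iterK \<Phi> (Suc m) (h, x)) + c ^ Suc m * loss c (Suc m) x"
    unfolding nn_integral_iterK_Suc[OF \<Phi>_meas g] by simp
  finally show ?case .
qed

text \<open>Strict positivity of the likelihood ratio: from each starting point the model and the
  reference chain have the same null sets.\<close>

lemma iterK_null_iff:
  assumes g: "g \<in> borel_measurable SS"
  shows "(\<integral>\<^sup>+t. g t \<partial>K0 m (h, x)) = 0 \<longleftrightarrow> (\<integral>\<^sup>+t. g t \<partial>iterK \<Phi> m (h, x)) = 0"
proof (induction m arbitrary: h x)
  case (Suc m)
  let ?GR = "\<lambda>x' y. \<integral>\<^sup>+t. g t \<partial>K0 m (y ## h, x')" and ?GL = "\<lambda>x' y. \<integral>\<^sup>+t. g t \<partial>iterK \<Phi> m (y ## h, x')"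
  note [measurable (raw)] = iterK_section_meas[OF \<phi>\<^sub>0_kernel g] iterK_section_meas[OF \<Phi>_meas g]
  note [measurable] = iterK_section_int_meas[OF \<phi>\<^sub>0_kernel g] iterK_section_int_meas[OF \<Phi>_meas g]
  have [measurable_cong]: "sets \<phi>\<^sub>0 = sets borel" "sets (P x) = sets borel" by (rule PA_D; simp)+
  have "(\<integral>\<^sup>+y. ?GR x' y \<partial>\<phi>\<^sub>0) = 0 \<longleftrightarrow> (\<integral>\<^sup>+y. ?GL x' y \<partial>\<Phi> x') = 0" for x'
    by (simp add: nn_integral_\<Phi>_ref nn_integral_0_iff_AE Suc.IH ennreal_eq_0_iff not_le[THEN iffD2, OF \<Upsilon>\<^sub>0_pos])
  then show ?case
    unfolding nn_integral_iterK_Suc[OF \<phi>\<^sub>0_kernel g] nn_integral_iterK_Suc[OF \<Phi>_meas g] by (simp add: nn_integral_0_iff_AE)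
qed (use g in simp)

subsection \<open>Product structure of the reference chain\<close>

primrec hist :: "nat \<Rightarrow> 'f stream \<Rightarrow> 'f stream measure" where
  "hist 0 = return HS"
| "hist (Suc m) = (\<lambda>h. \<phi>\<^sub>0 \<bind> (\<lambda>y. hist m (y ## h)))"

primrec Pn :: "nat \<Rightarrow> 'e \<Rightarrow> 'e measure" where
  "Pn 0 = return borel"
| "Pn (Suc m) = (\<lambda>x. P x \<bind> Pn m)"

lemma hist_meas[measurable]: "hist m \<in> HS \<rightarrow>\<^sub>M prob_algebra HS"
proof (induction m)
  case (Suc m)
  note [measurable] = Suc
  show ?case by simp
qed (simp add: measurable_return_prob_space)

lemma Pn_meas[measurable]: "Pn m \<in> borel \<rightarrow>\<^sub>M PA"
proof (induction m)
  case (Suc m)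
  then show ?case by (auto intro!: measurable_bind_prob_space[OF P_meas])
qed (simp add: measurable_return_prob_space)

lemma hist_prob[simp]: "hist m h \<in> space (prob_algebra HS)"
  using kernel_prob[OF hist_meas, of h m] by simp

lemma Pn_PA[simp]: "Pn m x \<in> space PA"
  using kernel_prob[OF Pn_meas, of x m] by simp

lemma iterates_PA[simp]: "\<nu> \<in> space PA \<Longrightarrow> ((\<lambda>m. m \<bind> P) ^^ k) \<nu> \<in> space PA"
  by (induction k) simp_all

lemma bind_Pn: "\<nu> \<in> space PA \<Longrightarrow> ((\<lambda>m. m \<bind> P) ^^ k) \<nu> = \<nu> \<bind> Pn k"
proof (induction k arbitrary: \<nu>)
  case 0
  then show ?case using PA_D(2)[OF 0] by (simp add: bind_return'')
next
  case (Suc k)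
  have m: "P \<in> \<nu> \<rightarrow>\<^sub>M subprob_algebra borel"
    using measurable_prob_algebraD[OF P_meas] PA_D(2)[OF Suc.prems] by (simp cong: measurable_cong_sets)
  have "((\<lambda>m. m \<bind> P) ^^ Suc k) \<nu> = ((\<lambda>m. m \<bind> P) ^^ k) (\<nu> \<bind> P)"
    by (simp add: funpow_Suc_right del: funpow.simps)
  also have "\<dots> = (\<nu> \<bind> P) \<bind> Pn k" by (rule Suc.IH) (simp add: Suc.prems)
  also have "\<dots> = \<nu> \<bind> (\<lambda>x. P x \<bind> Pn k)"
    by (rule bind_assoc[OF m measurable_prob_algebraD[OF Pn_meas]])
  finally show ?case by simp
qed

text \<open>In the reference chain the observations ignore the signal, so history and signal are
  independent given the start. The signal part does not see \<open>h\<close> and the history part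
  does not see \<open>x\<close>; this is the source of the uniformity in the history.\<close>

lemma nn_integral_K0:
  assumes g: "g \<in> borel_measurable SS"
  shows "(\<integral>\<^sup>+t. g t \<partial>K0 m (h, x)) = (\<integral>\<^sup>+z. \<integral>\<^sup>+h'. g (h', z) \<partial>hist m h \<partial>Pn m x)"
proof (induction m arbitrary: h x)
  case 0
  note [measurable] = g
  show ?case by (simp add: nn_integral_return)
next
  case (Suc m)
  note [measurable] = g
  have hm: "(\<lambda>p. \<integral>\<^sup>+h'. g (h', snd p) \<partial>hist m (fst p)) \<in> borel_measurable SS"
    by (rule nn_integral_kernel_measurable[where R=HS]) measurable
  have hm'[measurable (raw)]: "(\<lambda>z. \<integral>\<^sup>+h'. g (h', b z) \<partial>hist m (a z)) \<in> borel_measurable M"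
    if "a \<in> M \<rightarrow>\<^sub>M HS" "b \<in> M \<rightarrow>\<^sub>M borel" for a b and M :: "'z measure"
    using measurable_compose[OF measurable_Pair[OF that] hm] by simp
  have [measurable_cong]: "sets \<phi>\<^sub>0 = sets borel" by (rule PA_D[OF \<phi>\<^sub>0_PA])
  have "(\<integral>\<^sup>+t. g t \<partial>K0 (Suc m) (h, x)) = (\<integral>\<^sup>+x'. \<integral>\<^sup>+y. \<integral>\<^sup>+z. \<integral>\<^sup>+h'. g (h', z) \<partial>hist m (y ## h) \<partial>Pn m x' \<partial>\<phi>\<^sub>0 \<partial>P x)"
    unfolding nn_integral_iterK_Suc[OF \<phi>\<^sub>0_kernel g] Suc ..
  also have "\<dots> = (\<integral>\<^sup>+x'. \<integral>\<^sup>+z. \<integral>\<^sup>+y. \<integral>\<^sup>+h'. g (h', z) \<partial>hist m (y ## h) \<partial>\<phi>\<^sub>0 \<partial>Pn m x' \<partial>P x)"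
  proof (rule nn_integral_cong)
    fix x' :: 'e
    interpret a: sigma_finite_measure "Pn m x'" by (rule \<rho>_sigma_finite[OF Pn_PA])
    interpret b: prob_space \<phi>\<^sub>0 by (rule PA_D[OF \<phi>\<^sub>0_PA])
    interpret p: pair_sigma_finite "Pn m x'" \<phi>\<^sub>0 ..
    have [measurable_cong]: "sets (Pn m x') = sets borel" by (rule PA_D[OF Pn_PA])
    show "(\<integral>\<^sup>+y. \<integral>\<^sup>+z. \<integral>\<^sup>+h'. g (h', z) \<partial>hist m (y ## h) \<partial>Pn m x' \<partial>\<phi>\<^sub>0) = (\<integral>\<^sup>+z. \<integral>\<^sup>+y. \<integral>\<^sup>+h'. g (h', z) \<partial>hist m (y ## h) \<partial>\<phi>\<^sub>0 \<partial>Pn m x')"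
      by (rule p.Fubini') (unfold split_beta', measurable)
  qed
  also have "\<dots> = (\<integral>\<^sup>+x'. \<integral>\<^sup>+z. \<integral>\<^sup>+h'. g (h', z) \<partial>hist (Suc m) h \<partial>Pn m x' \<partial>P x)"
  proof (intro nn_integral_cong)
    fix x' z :: 'e
    have "(\<lambda>y. hist m (y ## h)) \<in> borel \<rightarrow>\<^sub>M prob_algebra HS" by measurable
    from nn_integral_bind_prob[OF \<phi>\<^sub>0_PA this, of "\<lambda>h'. g (h', z)"]
    show "(\<integral>\<^sup>+y. \<integral>\<^sup>+h'. g (h', z) \<partial>hist m (y ## h) \<partial>\<phi>\<^sub>0) = (\<integral>\<^sup>+h'. g (h', z) \<partial>hist (Suc m) h)" by simp
  qed
  also have "\<dots> = (\<integral>\<^sup>+z. \<integral>\<^sup>+h'. g (h', z) \<partial>hist (Suc m) h \<partial>Pn (Suc m) x)"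
  proof -
    have "(\<lambda>z. \<integral>\<^sup>+h'. g (h', z) \<partial>hist (Suc m) h) \<in> borel_measurable borel"
      by (rule nn_integral_kernel_measurable[where R=HS, OF _ measurable_const[OF hist_prob]]) measurable
    from nn_integral_bind_prob[OF P_PA Pn_meas this] show ?thesis by simp
  qed
  finally show ?case .
qed

end

section \<open>Overlap of transitions from ergodicity\<close>

locale ergodic_model = filter_model P \<Phi> \<phi> \<Upsilon>
  for P :: "'e::polish_space \<Rightarrow> 'e measure" and \<Phi> :: "'e \<Rightarrow> 'f::polish_space measure" and \<phi> \<Upsilon> +
  fixes l :: "'e measure"
  assumes l_PA[simp]: "l \<in> space PA"
    and ergodic: "\<And>\<nu>. \<nu> \<in> space PA \<Longrightarrow> (\<lambda>k. tv_dist (((\<lambda>m. m \<bind> P) ^^ k) \<nu>) l) \<longlonglongrightarrow> 0"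
begin

lemma tv_dist_upper:
  fixes f :: "'e \<Rightarrow> real"
  assumes "\<nu> \<in> space PA" "\<nu>' \<in> space PA" "f \<in> borel_measurable borel" "\<And>x. \<bar>f x\<bar> \<le> 1"
  shows "\<bar>(LINT x|\<nu>. f x) - (LINT x|\<nu>'. f x)\<bar> \<le> tv_dist \<nu> \<nu>'"
  unfolding tv_dist_def
proof (rule cSUP_upper)
  show "bdd_above ((\<lambda>f. \<bar>(LINT x|\<nu>. f x) - (LINT x|\<nu>'. f x)\<bar>) ` {f :: 'e \<Rightarrow> real. f \<in> borel_measurable borel \<and> (\<forall>x. \<bar>f x\<bar> \<le> 1)})"
  proof (rule bdd_aboveI2[where M=2])
    fix f :: "'e \<Rightarrow> real" assume "f \<in> {f. f \<in> borel_measurable borel \<and> (\<forall>x. \<bar>f x\<bar> \<le> 1)}"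
    then show "\<bar>(LINT x|\<nu>. f x) - (LINT x|\<nu>'. f x)\<bar> \<le> 2"
      using pa_integral_le[OF assms(1), of f 1] pa_integral_le[OF assms(2), of f 1] by auto
  qed
qed (use assms in auto)

lemma Pn_tv:
  assumes \<nu>: "\<nu> \<in> space PA" and e: "e > 0"
  shows "\<exists>k0. \<forall>k\<ge>k0. \<forall>A\<in>sets borel. \<bar>measure (\<nu> \<bind> Pn k) A - measure l A\<bar> < e"
proof -
  have "eventually (\<lambda>k. tv_dist (\<nu> \<bind> Pn k) l < e) sequentially"
    using order_tendstoD(2)[OF ergodic[OF \<nu>] e] unfolding bind_Pn[OF \<nu>] .
  then obtain k0 where k0: "\<And>k. k \<ge> k0 \<Longrightarrow> tv_dist (\<nu> \<bind> Pn k) l < e" by (auto simp: eventually_sequentially)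
  have i: "(LINT x|N. indicator A x) = measure N A" if "N \<in> space PA" "A \<in> sets borel" for N and A :: "'e set"
    using PA_D(2)[OF that(1)] that(2) by simp
  have "\<bar>measure (\<nu> \<bind> Pn k) A - measure l A\<bar> < e" if "k \<ge> k0" "A \<in> sets borel" for k A
    using tv_dist_upper[OF bind_prob[OF \<nu> Pn_meas] l_PA borel_measurable_indicator[OF that(2)], of k] k0[OF that(1)]
    unfolding i[OF bind_prob[OF \<nu> Pn_meas] that(2)] i[OF l_PA that(2)] by (simp add: indicator_def)
  then show ?thesis by blast
qed

text \<open>No test can tell two starting signals in \<open>C\<close> apart with total error below
  \<open>c\<close>, whatever their common history. \<open>C1 m\<close> collects signals whose
  \<open>m\<close>-step law is within \<open>1 / 8\<close> of \<open>l\<close>, and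
  \<open>C2\<close> those with loss at most \<open>1 / 8\<close>. On both, the integral of
  \<open>g\<close> is at least \<open>c ^ m\<close> times its value under the product law minus
  \<open>1 / 4\<close>; adding the bounds for \<open>g\<close> and \<open>1 - g\<close> leaves
  \<open>c ^ m * (1 - 1 / 2)\<close>.\<close>

lemma overlap:
  assumes e: "e > 0"
  obtains m c C where "0 < (c::real)" "C \<in> sets borel" "measure l C \<ge> 1 - e"
    "\<And>h x x' g. x \<in> C \<Longrightarrow> x' \<in> C \<Longrightarrow> g \<in> borel_measurable SS \<Longrightarrow> (\<And>s. 0 \<le> g s) \<Longrightarrow> (\<And>s. g s \<le> 1) \<Longrightarrow>
      c \<le> (LINT s|iterK \<Phi> m (h, x). g s) + (LINT s|iterK \<Phi> m (h, x'). 1 - g s)"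
proof -
  interpret L: prob_space l by (rule PA_D[OF l_PA])
  obtain \<G> :: "nat list \<Rightarrow> 'e set" where \<G>[measurable]: "\<And>n. \<G> n \<in> sets borel"
    and tv: "\<And>\<nu> l \<epsilon> a. \<nu> \<in> space PA \<Longrightarrow> l \<in> space PA \<Longrightarrow> (\<And>n. \<bar>measure \<nu> (\<G> n) - measure l (\<G> n)\<bar> \<le> \<epsilon>) \<Longrightarrow>
      a \<in> borel_measurable borel \<Longrightarrow> (\<And>x. 0 \<le> a x) \<Longrightarrow> (\<And>x. a x \<le> (1::real)) \<Longrightarrow>
      \<bar>(LINT x|\<nu>. a x) - (LINT x|l. a x)\<bar> \<le> \<epsilon>"
    by (rule countable_total_variation) blast
  define C1 where "C1 m = {x. \<forall>n. \<bar>measure (Pn m x) (\<G> n) - measure l (\<G> n)\<bar> \<le> 1 / 8}" for m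
  have meas[measurable]: "(\<lambda>x. measure (Pn m x) (\<G> n)) \<in> borel_measurable borel" for m n
    by (rule measurable_compose[OF Pn_meas measurable_measure_prob_algebra]) simp
  have C1m[measurable]: "C1 m \<in> sets borel" for m unfolding C1_def by measurable
  have ev: "eventually (\<lambda>m. x \<in> C1 m) sequentially" for x
  proof -
    have rx: "return borel x \<in> space PA" by (intro PA_I prob_space_return) auto
    have b: "return borel x \<bind> Pn k = Pn k x" for k
      by (rule bind_return[OF measurable_prob_algebraD[OF Pn_meas]]) simp
    obtain k0 where "\<And>k A. k \<ge> k0 \<Longrightarrow> A \<in> sets borel \<Longrightarrow> \<bar>measure (Pn k x) A - measure l A\<bar> < 1 / 8"
      using Pn_tv[OF rx, of "1 / 8"] unfolding b by auto
    then have "\<bar>measure (Pn k x) (\<G> n) - measure l (\<G> n)\<bar> \<le> 1 / 8" if "k \<ge> k0" for k n using that by (simp add: less_imp_le)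
    then show ?thesis unfolding C1_def eventually_sequentially by auto
  qed
  have "(\<lambda>m. LINT x|l. (indicator (C1 m) x :: real)) \<longlonglongrightarrow> (LINT x|l. 1)"
  proof (rule integral_dominated_convergence[where w="\<lambda>_. 1"])
    show "AE x in l. (\<lambda>m. indicator (C1 m) x :: real) \<longlonglongrightarrow> 1"
    proof (intro AE_I2 tendsto_eventually)
      fix x show "eventually (\<lambda>m. indicator (C1 m) x = (1 :: real)) sequentially"
        using ev[of x] by eventually_elim simp
    qed
  qed (auto intro!: PA_measurable[OF l_PA])
  then have "(\<lambda>m. measure l (C1 m)) \<longlonglongrightarrow> 1" using PA_D(2)[OF l_PA] by (simp add: L.prob_space)
  then have "eventually (\<lambda>m. measure l (C1 m) > 1 - e / 2) sequentially" using e by (intro order_tendstoD) auto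
  then obtain m where m: "measure l (C1 m) > 1 - e / 2" by (auto simp: eventually_sequentially)
  \<comment> \<open>\<open>e / 16\<close> is \<open>1 / 8\<close> times \<open>e / 2\<close>, as
    needed for Markov's inequality at the level \<open>1 / 8\<close> of \<open>C2\<close>.\<close>
  have "eventually (\<lambda>n. (\<integral>\<^sup>+x. loss (ennreal (1 / real (Suc n))) m x \<partial>l) < ennreal (e / 16)) sequentially"
    using e nn_integral_loss_tendsto[OF l_PA, of m] by (intro order_tendstoD) auto
  then obtain n where n: "(\<integral>\<^sup>+x. loss (ennreal (1 / real (Suc n))) m x \<partial>l) < ennreal (e / 16)"
    by (auto simp: eventually_sequentially)
  define c where "c = 1 / real (Suc n)"
  have c: "c > 0" by (simp add: c_def)
  define C2 where "C2 = {x. loss (ennreal c) m x \<le> ennreal (1 / 8)}"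
  have C2m[measurable]: "C2 \<in> sets borel" unfolding C2_def by measurable
  have "measure l (- C2) \<le> e / 2"
  proof -
    have "ennreal (1 / 8) * emeasure l (- C2) = (\<integral>\<^sup>+x. ennreal (1 / 8) * indicator (- C2) x \<partial>l)"
      using PA_D(2)[OF l_PA] by (subst nn_integral_cmult_indicator) auto
    also have "\<dots> \<le> (\<integral>\<^sup>+x. loss (ennreal c) m x \<partial>l)"
      by (intro nn_integral_mono) (auto simp: indicator_def C2_def not_le less_imp_le)
    also have "\<dots> < ennreal (e / 16)" using n by (simp add: c_def)
    finally have "ennreal (1 / 8 * measure l (- C2)) < ennreal (e / 16)"
      by (simp add: L.emeasure_eq_measure flip: ennreal_mult)
    then have "1 / 8 * measure l (- C2) < e / 16" using e by (subst (asm) ennreal_less_iff) auto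
    then show ?thesis by simp
  qed
  moreover have "measure l (C1 m) \<le> measure l (C1 m \<inter> C2) + measure l (- C2)"
  proof -
    have "measure l (C1 m) \<le> measure l ((C1 m \<inter> C2) \<union> - C2)"
      using PA_D(2)[OF l_PA] by (intro L.finite_measure_mono) auto
    also have "\<dots> \<le> measure l (C1 m \<inter> C2) + measure l (- C2)"
      using PA_D(2)[OF l_PA] by (intro measure_Un_le) auto
    finally show ?thesis .
  qed
  ultimately have lC: "measure l (C1 m \<inter> C2) \<ge> 1 - e" using m by linarith
  \<comment> \<open>The history is integrated out under the reference law, leaving a function of the
    final signal with values in \<open>[0,1]\<close>, to which the closeness of
    \<open>Pn m x\<close> and \<open>l\<close> applies.\<close>
  define av :: "('f stream \<times> 'e \<Rightarrow> real) \<Rightarrow> 'f stream \<Rightarrow> 'e \<Rightarrow> real" where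
    "av g h z = (LINT h'|hist m h. g (h', z))" for g h z
  have lower: "c ^ m * ((LINT z|l. av g h z) - 1 / 4) \<le> (LINT s|iterK \<Phi> m (h, x). g s)"
    and avm: "av g h \<in> borel_measurable borel" "\<And>z. 0 \<le> av g h z" "\<And>z. av g h z \<le> 1"
    if x: "x \<in> C1 m \<inter> C2" and g[measurable]: "g \<in> borel_measurable SS" and g01: "\<And>s. 0 \<le> g s" "\<And>s. g s \<le> 1" for g h x
  proof -
    have gz: "(\<lambda>h'. g (h', z)) \<in> borel_measurable HS" for z by measurable
    note hi = pa_integral01[OF hist_prob gz g01]
    show av: "av g h \<in> borel_measurable borel"
      unfolding av_def by (rule integral_kernel_measurable[where R=HS, OF _ measurable_const[OF hist_prob]]) measurable
    show av01: "0 \<le> av g h z" "av g h z \<le> 1" for z unfolding av_def by (rule hi)+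
    note pi = pa_integral01[OF Pn_PA av av01]
    note ki = pa_integral01[OF iterK_prob[OF \<Phi>_meas] g g01, of m "(h, x)"]
    have "ennreal c ^ m * (\<integral>\<^sup>+t. ennreal (g t) \<partial>K0 m (h, x)) \<le>
        (\<integral>\<^sup>+t. ennreal (g t) \<partial>iterK \<Phi> m (h, x)) + ennreal c ^ m * loss (ennreal c) m x"
      by (rule iterK_lower) (use g01 in auto)
    also have "(\<integral>\<^sup>+t. ennreal (g t) \<partial>K0 m (h, x)) = ennreal (LINT z|Pn m x. av g h z)"
    proof -
      have "(\<integral>\<^sup>+t. ennreal (g t) \<partial>K0 m (h, x)) = (\<integral>\<^sup>+z. \<integral>\<^sup>+h'. ennreal (g (h', z)) \<partial>hist m h \<partial>Pn m x)"
        by (rule nn_integral_K0) measurable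
      then show ?thesis using hi(3) pi(3)[of m x] by (simp add: av_def)
    qed
    also have "(\<integral>\<^sup>+t. ennreal (g t) \<partial>iterK \<Phi> m (h, x)) + ennreal c ^ m * loss (ennreal c) m x
      \<le> ennreal (LINT s|iterK \<Phi> m (h, x). g s) + ennreal c ^ m * ennreal (1 / 8)"
      using x ki(3) by (intro add_mono mult_left_mono) (auto simp: C2_def)
    finally have "ennreal c ^ m * ennreal (LINT z|Pn m x. av g h z) \<le>
      ennreal (LINT s|iterK \<Phi> m (h, x). g s) + ennreal c ^ m * ennreal (1 / 8)" .
    moreover have "ennreal (c ^ m * (LINT z|Pn m x. av g h z)) = ennreal c ^ m * ennreal (LINT z|Pn m x. av g h z)"
      using c pi(1)[of m x] by (subst ennreal_mult) (auto simp: ennreal_power)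
    moreover have "ennreal ((LINT s|iterK \<Phi> m (h, x). g s) + c ^ m * (1 / 8)) =
        ennreal (LINT s|iterK \<Phi> m (h, x). g s) + ennreal c ^ m * ennreal (1 / 8)"
      using c ki(1) by (subst ennreal_plus, simp, simp, subst ennreal_mult) (auto simp: ennreal_power)
    ultimately have "ennreal (c ^ m * (LINT z|Pn m x. av g h z)) \<le> ennreal ((LINT s|iterK \<Phi> m (h, x). g s) + c ^ m * (1 / 8))"
      by (simp only:)
    then have 1: "c ^ m * (LINT z|Pn m x. av g h z) \<le> (LINT s|iterK \<Phi> m (h, x). g s) + c ^ m * (1 / 8)"
      using c ki(1) by (subst (asm) ennreal_le_iff) auto
    have "\<bar>(LINT z|Pn m x. av g h z) - (LINT z|l. av g h z)\<bar> \<le> 1 / 8"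
      using x by (intro tv[OF Pn_PA l_PA _ av av01]) (auto simp: C1_def)
    then have "c ^ m * ((LINT z|l. av g h z) - 1 / 8) \<le> c ^ m * (LINT z|Pn m x. av g h z)"
      using c by (intro mult_left_mono) (linarith, simp)
    then show "c ^ m * ((LINT z|l. av g h z) - 1 / 4) \<le> (LINT s|iterK \<Phi> m (h, x). g s)"
      using 1 by (simp add: algebra_simps)
  qed
  show thesis
  proof (rule that[of "c ^ m / 2" "C1 m \<inter> C2" m])
    show "0 < c ^ m / 2" using c by simp
    show "C1 m \<inter> C2 \<in> sets borel" by measurable
    show "1 - e \<le> measure l (C1 m \<inter> C2)" by (rule lC)
    fix h x x' and g :: "'f stream \<times> 'e \<Rightarrow> real"
    assume x: "x \<in> C1 m \<inter> C2" and x': "x' \<in> C1 m \<inter> C2" and g[measurable]: "g \<in> borel_measurable SS"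
      and g01: "\<And>s. 0 \<le> g s" "\<And>s. g s \<le> 1"
    have gz: "(\<lambda>h'. g (h', z)) \<in> borel_measurable HS" for z by measurable
    interpret H: prob_space "hist m h" using hist_prob[of m h] by (simp add: space_prob_algebra)
    have a1: "av (\<lambda>s. 1 - g s) h z = 1 - av g h z" for z
    proof -
      have "integrable (hist m h) (\<lambda>h'. g (h', z))"
        using g01 by (intro pa_integrable[OF hist_prob gz, of _ 1]) auto
      then show ?thesis unfolding av_def by (simp add: H.prob_space)
    qed
    note A = avm[OF x g g01, of h]
    have "integrable l (av g h)" using A(2,3) by (intro pa_integrable[OF l_PA A(1), of 1]) auto
    then have a2: "(LINT z|l. av (\<lambda>s. 1 - g s) h z) = 1 - (LINT z|l. av g h z)"
      unfolding a1 by (simp add: L.prob_space)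
    have "c ^ m * ((LINT z|l. av (\<lambda>s. 1 - g s) h z) - 1 / 4) \<le> (LINT s|iterK \<Phi> m (h, x'). 1 - g s)"
      using g01 by (intro lower[OF x']) auto
    moreover have "c ^ m * ((LINT z|l. av g h z) - 1 / 4) \<le> (LINT s|iterK \<Phi> m (h, x). g s)"
      by (rule lower[OF x g g01])
    ultimately have "c ^ m * ((LINT z|l. av g h z) - 1 / 4) + c ^ m * ((1 - (LINT z|l. av g h z)) - 1 / 4) \<le>
      (LINT s|iterK \<Phi> m (h, x). g s) + (LINT s|iterK \<Phi> m (h, x'). 1 - g s)"
      unfolding a2 by linarith
    then show "c ^ m / 2 \<le> (LINT s|iterK \<Phi> m (h, x). g s) + (LINT s|iterK \<Phi> m (h, x'). 1 - g s)"
      by (simp add: algebra_simps)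
  qed
qed

end

section \<open>Filter stability\<close>

text \<open>A fair coin chooses between the two laws; as a monadic bind the mixture inherits its
  properties from the kernel lemmas.\<close>

definition mix :: "'a measure \<Rightarrow> 'a measure \<Rightarrow> 'a measure" where
  "mix \<nu> \<nu>' = measure_pmf (pmf_of_set (UNIV :: bool set)) \<bind> (\<lambda>b. if b then \<nu> else \<nu>')"

lemma mix:
  assumes \<nu>: "\<nu> \<in> space (prob_algebra A)" and \<nu>': "\<nu>' \<in> space (prob_algebra A)"
  shows mix_prob: "mix \<nu> \<nu>' \<in> space (prob_algebra A)"
    and nn_integral_mix: "f \<in> borel_measurable A \<Longrightarrow> (\<integral>\<^sup>+x. f x \<partial>mix \<nu> \<nu>') = ((\<integral>\<^sup>+x. f x \<partial>\<nu>) + (\<integral>\<^sup>+x. f x \<partial>\<nu>')) / 2"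
proof -
  have k: "(\<lambda>b. if b then \<nu> else \<nu>') \<in> count_space UNIV \<rightarrow>\<^sub>M prob_algebra A" using \<nu> \<nu>' by auto
  have p: "measure_pmf (pmf_of_set (UNIV :: bool set)) \<in> space (prob_algebra (count_space UNIV))"
    by (simp add: space_prob_algebra prob_space_measure_pmf)
  show "mix \<nu> \<nu>' \<in> space (prob_algebra A)" unfolding mix_def by (rule bind_prob[OF p k])
  show "(\<integral>\<^sup>+x. f x \<partial>mix \<nu> \<nu>') = ((\<integral>\<^sup>+x. f x \<partial>\<nu>) + (\<integral>\<^sup>+x. f x \<partial>\<nu>')) / 2" if "f \<in> borel_measurable A"
    unfolding mix_def nn_integral_bind_prob[OF p k that]
    by (subst nn_integral_pmf_of_set) (auto simp: UNIV_bool add.commute)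
qed

text \<open>Radon-Nikodym for both halves. The densities add up to \<open>2\<close> almost
  everywhere, so truncating the first at \<open>2\<close> and taking \<open>2 - p\<close> for the
  second changes nothing almost everywhere and yields bounds valid at every point.\<close>

lemma half_density:
  assumes N: "N \<in> space (prob_algebra A)" and M: "M \<in> space (prob_algebra A)" and M': "M' \<in> space (prob_algebra A)"
    and half: "\<And>g. g \<in> borel_measurable A \<Longrightarrow> (\<integral>\<^sup>+x. g x \<partial>N) = ((\<integral>\<^sup>+x. g x \<partial>M) + (\<integral>\<^sup>+x. g x \<partial>M')) / (2 :: ennreal)"
  obtains p :: "'a \<Rightarrow> real" where "p \<in> borel_measurable A" "\<And>x. 0 \<le> p x" "\<And>x. p x \<le> 2"
    "M = density N (\<lambda>x. ennreal (p x))" "M' = density N (\<lambda>x. ennreal (2 - p x))"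
proof -
  have s: "sets N = sets A" "sets M = sets A" "sets M' = sets A" using N M M' by (auto simp: space_prob_algebra)
  interpret N: prob_space N using N by (simp add: space_prob_algebra)
  interpret M: prob_space M using M by (simp add: space_prob_algebra)
  interpret M': prob_space M' using M' by (simp add: space_prob_algebra)
  have two: "2 * (a / 2) = (a :: ennreal)" for a
    unfolding ennreal_times_divide mult.commute[of 2] by (rule mult_divide_eq_ennreal) auto
  have h: "2 * emeasure N X = emeasure M X + emeasure M' X" if X: "X \<in> sets A" for X
    using half[of "indicator X"] X s two by simp
  have RN: "\<exists>f\<in>borel_measurable N. density N f = K" if K: "K = M \<or> K = M'" for K
  proof (rule N.Radon_Nikodym)
    show "absolutely_continuous N K" unfolding absolutely_continuous_def
    proof
      fix X assume "X \<in> null_sets N"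
      then have "X \<in> sets A" "emeasure N X = 0" using s by auto
      then show "X \<in> null_sets K" using h[of X] K s by auto
    qed
  qed (use K s in auto)
  obtain f where f[measurable]: "f \<in> borel_measurable N" and fM: "density N f = M" using RN by blast
  obtain f' where f'[measurable]: "f' \<in> borel_measurable N" and fM': "density N f' = M'" using RN by blast
  have "density N (\<lambda>x. f x + f' x) = density N (\<lambda>_. 2)"
  proof (rule measure_eqI)
    fix X assume "X \<in> sets (density N (\<lambda>x. f x + f' x))"
    then have X[measurable]: "X \<in> sets N" by simp
    have "emeasure (density N (\<lambda>x. f x + f' x)) X = emeasure M X + emeasure M' X"
      by (simp add: emeasure_density distrib_right nn_integral_add flip: fM fM')
    also have "\<dots> = emeasure (density N (\<lambda>_. 2)) X" using h[of X] s X by (simp add: emeasure_density nn_integral_cmult_indicator)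
    finally show "emeasure (density N (\<lambda>x. f x + f' x)) X = emeasure (density N (\<lambda>_. 2)) X" .
  qed simp
  then have sum: "AE x in N. f x + f' x = 2" by (intro N.density_unique) auto
  define p where "p x = enn2real (min (f x) 2)" for x
  have pe: "ennreal (p x) = min (f x) 2" for x
    unfolding p_def by (subst ennreal_enn2real) (auto simp: min_less_iff_disj)
  have p0: "0 \<le> p x" for x by (simp add: p_def)
  have "ennreal (p x) \<le> ennreal 2" for x unfolding pe by simp
  then have p2: "p x \<le> 2" for x by (subst (asm) ennreal_le_iff) auto
  have pm: "p \<in> borel_measurable N" unfolding p_def by measurable
  have ae: "AE x in N. f x = ennreal (p x) \<and> f' x = ennreal (2 - p x)" using sum
  proof eventually_elim
    case (elim x)
    have "f x \<le> f x + f' x" by simp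
    then have "f x \<le> 2" unfolding elim .
    then have fx: "f x = ennreal (p x)" unfolding pe by (simp add: min_def)
    have "f' x = (f x + f' x) - f x" using fx by (simp add: ennreal_add_diff_cancel_left)
    also have "\<dots> = ennreal (2 - p x)"
      by (simp only: elim) (use fx p0[of x] ennreal_minus[of "p x" 2] in simp)
    finally show ?case using fx by simp
  qed
  have "M = density N (\<lambda>x. ennreal (p x))" "M' = density N (\<lambda>x. ennreal (2 - p x))"
    unfolding fM[symmetric] fM'[symmetric] by (intro density_cong; use ae pm in \<open>auto elim: eventually_mono\<close>)+
  then show thesis using that[of p] pm p0 p2 s by (simp cong: measurable_cong_sets)
qed

lemma SS_Collect: "Measurable.pred SS Q \<Longrightarrow> {u. Q u} \<in> sets SS"
  unfolding pred_def by (simp add: space_SS)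

lemma integral_density_pa:
  fixes f :: "'a \<Rightarrow> real"
  assumes N: "N \<in> space (prob_algebra A)" and M: "M = density N (\<lambda>x. ennreal (p x))"
    and "p \<in> borel_measurable A" "\<And>x. 0 \<le> p x" "f \<in> borel_measurable A"
  shows "(LINT x|M. f x) = (LINT x|N. p x * f x)"
proof -
  have s: "sets N = sets A" using N by (simp add: space_prob_algebra)
  show ?thesis unfolding M using assms s by (subst integral_density) (auto cong: measurable_cong_sets)
qed

section \<open>Densities with respect to the mixture\<close>

context ergodic_model
begin

context
  fixes \<nu> \<nu>' :: "'e measure"
  assumes \<nu>[simp]: "\<nu> \<in> space PA" and \<nu>'[simp]: "\<nu>' \<in> space PA"
begin

definition \<rho> :: "'e measure" where "\<rho> = mix \<nu> \<nu>'"

lemma \<rho>_PA[simp]: "\<rho> \<in> space PA" unfolding \<rho>_def by (intro mix_prob \<nu> \<nu>')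

lemmas Jp = J_prob[OF \<rho>_PA] and Kp = iterK_prob[OF \<Phi>_meas] and Fp = Filt_PA[OF \<rho>_PA]

lemma J_half:
  assumes g: "g \<in> borel_measurable SS"
  shows "(\<integral>\<^sup>+s. g s \<partial>J \<rho> k) = ((\<integral>\<^sup>+s. g s \<partial>J \<nu> k) + (\<integral>\<^sup>+s. g s \<partial>J \<nu>' k)) / 2"
proof -
  have m: "(\<lambda>x. \<integral>\<^sup>+s. g s \<partial>iterK \<Phi> k (h0, x)) \<in> borel_measurable borel"
    by (rule measurable_compose[OF _ nn_integral_iterK_meas[OF \<Phi>_meas g]]) simp
  show ?thesis
    unfolding nn_integral_J[OF \<rho>_PA g] nn_integral_J[OF \<nu> g] nn_integral_J[OF \<nu>' g]
    unfolding \<rho>_def by (rule nn_integral_mix[OF \<nu> \<nu>' m])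
qed

definition dens :: "nat \<Rightarrow> 'f stream \<times> 'e \<Rightarrow> real" where
  "dens k = (SOME p. p \<in> borel_measurable SS \<and> (\<forall>s. 0 \<le> p s) \<and> (\<forall>s. p s \<le> 2) \<and>
     J \<nu> k = density (J \<rho> k) (\<lambda>s. ennreal (p s)) \<and> J \<nu>' k = density (J \<rho> k) (\<lambda>s. ennreal (2 - p s)))"

lemma dens:
  shows dens_meas[measurable]: "dens k \<in> borel_measurable SS"
    and dens_nonneg: "0 \<le> dens k s" and dens_le2: "dens k s \<le> 2"
    and dens_\<nu>: "J \<nu> k = density (J \<rho> k) (\<lambda>s. ennreal (dens k s))"
    and dens_\<nu>': "J \<nu>' k = density (J \<rho> k) (\<lambda>s. ennreal (2 - dens k s))"
proof -
  have "\<exists>p. p \<in> borel_measurable SS \<and> (\<forall>s. 0 \<le> p s) \<and> (\<forall>s. p s \<le> 2) \<and>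
     J \<nu> k = density (J \<rho> k) (\<lambda>s. ennreal (p s)) \<and> J \<nu>' k = density (J \<rho> k) (\<lambda>s. ennreal (2 - p s))"
    by (rule half_density[OF Jp[of k] J_prob[OF \<nu>, of k] J_prob[OF \<nu>', of k] J_half]) auto
  note * = someI_ex[OF this, folded dens_def]
  show "dens k \<in> borel_measurable SS" "J \<nu> k = density (J \<rho> k) (\<lambda>s. ennreal (dens k s))"
    "J \<nu>' k = density (J \<rho> k) (\<lambda>s. ennreal (2 - dens k s))"
    using * by blast+
  have "\<forall>s. 0 \<le> dens k s" "\<forall>s. dens k s \<le> 2" using * by blast+
  then show "0 \<le> dens k s" "dens k s \<le> 2" by blast+
qed

lemma dens_abs: "\<bar>dens k s\<bar> \<le> 2" using dens_nonneg[of k s] dens_le2[of k s] by simp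

lemma dens_diff_abs: "\<bar>dens k s - dens m t\<bar> \<le> 2"
  using dens_nonneg[of k s] dens_le2[of k s] dens_nonneg[of m t] dens_le2[of m t] by simp

lemma integral_\<nu>:
  fixes f :: "'f stream \<times> 'e \<Rightarrow> real"
  assumes "f \<in> borel_measurable SS"
  shows "(LINT s|J \<nu> k. f s) = (LINT s|J \<rho> k. dens k s * f s)"
  by (rule integral_density_pa[OF Jp dens_\<nu> dens_meas dens_nonneg assms])

lemma integral_\<nu>':
  fixes f :: "'f stream \<times> 'e \<Rightarrow> real"
  assumes "f \<in> borel_measurable SS"
  shows "(LINT s|J \<nu>' k. f s) = (LINT s|J \<rho> k. (2 - dens k s) * f s)"
  by (rule integral_density_pa[OF Jp dens_\<nu>']) (use dens_le2 assms in auto)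

lemma integral_J_add:
  fixes f :: "'f stream \<times> 'e \<Rightarrow> real"
  assumes "N \<in> space PA" "f \<in> borel_measurable SS" "\<And>s. \<bar>f s\<bar> \<le> B"
  shows "(LINT s|J N (k + m). f s) = (LINT u|J N k. LINT v|iterK \<Phi> m u. f v)"
  unfolding J_add[OF assms(1)] by (rule integral_bind_prob[OF J_prob[OF assms(1)] iterK_meas[OF \<Phi>_meas] assms(2,3)])

lemma integral_iterK_meas:
  fixes f :: "'f stream \<times> 'e \<Rightarrow> 'f stream \<times> 'e \<Rightarrow> real"
  assumes "(\<lambda>(u, v). f u v) \<in> borel_measurable (SS \<Otimes>\<^sub>M SS)"
  shows "(\<lambda>u. LINT v|iterK \<Phi> m u. f u v) \<in> borel_measurable SS"
  by (rule integral_kernel_measurable[OF assms iterK_meas[OF \<Phi>_meas]])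

definition energy :: "nat \<Rightarrow> real" where "energy k = (LINT s|J \<rho> k. (dens k s)\<^sup>2)"

definition incr :: "nat \<Rightarrow> nat \<Rightarrow> 'f stream \<times> 'e \<Rightarrow> real" where
  "incr m k u = (LINT v|iterK \<Phi> m u. (dens k u - dens (k + m) v)\<^sup>2)"

lemma incr_meas[measurable]: "incr m k \<in> borel_measurable SS"
  unfolding incr_def by (rule integral_iterK_meas) measurable

lemma dens_diff_sq: "(dens k u - dens m v)\<^sup>2 \<le> 4"
  using power_mono[OF dens_diff_abs[of k u m v] abs_ge_zero, of 2] by simp

lemma incr_bound: "0 \<le> incr m k u" "incr m k u \<le> 4"
  unfolding incr_def using pa_integral01(1,2)[OF Kp, of "\<lambda>v. (dens k u - dens (k + m) v)\<^sup>2" 4 m u] dens_diff_sq by simp_all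

lemma incr_integrable: "integrable (J \<rho> k) (incr m k)"
  using incr_bound by (intro pa_integrable[OF Jp, of _ 4]) auto

text \<open>Pythagoras for a backward martingale: under the chain started from \<open>\<rho>\<close>
  the later density is the conditional expectation of the earlier one given the later state. The
  cross term is evaluated by passing to \<open>\<nu>\<close> with the density \<open>?p\<close> at
  time \<open>k\<close> and back to \<open>\<rho>\<close> with the density \<open>?q\<close> at time
  \<open>k + m\<close>.\<close>

lemma energy_diff: "(LINT u|J \<rho> k. incr m k u) = energy k - energy (k + m)"
proof -
  let ?p = "dens k" and ?q = "dens (k + m)"
  define Q where "Q u = (LINT v|iterK \<Phi> m u. ?q v)" for u
  define R where "R u = (LINT v|iterK \<Phi> m u. (?q v)\<^sup>2)" for u
  have sq: "\<bar>(dens i s)\<^sup>2\<bar> \<le> 4" for i s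
    using power_mono[OF dens_le2[of i s] dens_nonneg[of i s], of 2] by simp
  have Qm[measurable]: "Q \<in> borel_measurable SS" and Rm[measurable]: "R \<in> borel_measurable SS"
    unfolding Q_def R_def by (intro integral_iterK_meas; measurable)+
  have Qb: "\<bar>Q u\<bar> \<le> 2" for u unfolding Q_def by (rule pa_integral_le[OF Kp dens_meas dens_abs])
  have Rb: "\<bar>R u\<bar> \<le> 4" for u unfolding R_def by (rule pa_integral_le[OF Kp _ sq]) measurable
  have i1: "integrable (J \<rho> k) (\<lambda>u. (?p u)\<^sup>2)" by (rule pa_integrable[OF Jp _ sq]) measurable
  have "\<bar>?p u * Q u\<bar> \<le> 2 * 2" for u unfolding abs_mult by (intro mult_mono dens_abs Qb) auto
  then have i2: "integrable (J \<rho> k) (\<lambda>u. ?p u * Q u)" by (intro pa_integrable[OF Jp]) auto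
  have i3: "integrable (J \<rho> k) R" by (rule pa_integrable[OF Jp Rm Rb])
  have "incr m k u = (?p u)\<^sup>2 - 2 * (?p u * Q u) + R u" for u
  proof -
    interpret prob_space "iterK \<Phi> m u" using Kp[of m u] by (simp add: space_prob_algebra)
    have a: "integrable (iterK \<Phi> m u) ?q" by (rule pa_integrable[OF Kp dens_meas dens_abs])
    have b: "integrable (iterK \<Phi> m u) (\<lambda>v. (?q v)\<^sup>2)" by (rule pa_integrable[OF Kp _ sq]) measurable
    have "incr m k u = (LINT v|iterK \<Phi> m u. (?p u)\<^sup>2 - (2 * ?p u) * ?q v + (?q v)\<^sup>2)"
      by (simp add: incr_def power2_diff algebra_simps)
    also have "\<dots> = (?p u)\<^sup>2 - (2 * ?p u) * Q u + R u"
      using a b by (simp add: Q_def R_def prob_space)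
    finally show ?thesis by simp
  qed
  then have "(LINT u|J \<rho> k. incr m k u) = energy k - 2 * (LINT u|J \<rho> k. ?p u * Q u) + (LINT u|J \<rho> k. R u)"
    using i1 i2 i3 by (simp add: energy_def)
  also have "(LINT u|J \<rho> k. R u) = energy (k + m)"
    unfolding R_def energy_def by (rule integral_J_add[OF \<rho>_PA _ sq, symmetric]) measurable
  also have "(LINT u|J \<rho> k. ?p u * Q u) = (LINT u|J \<nu> k. Q u)" by (rule integral_\<nu>[OF Qm, symmetric])
  also have "\<dots> = (LINT v|J \<nu> (k + m). ?q v)"
    unfolding Q_def by (rule integral_J_add[OF \<nu> dens_meas dens_abs, symmetric])
  also have "\<dots> = (LINT v|J \<rho> (k + m). ?q v * ?q v)" by (rule integral_\<nu>[OF dens_meas])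
  also have "\<dots> = energy (k + m)" by (simp add: energy_def power2_eq_square)
  finally show ?thesis by simp
qed

text \<open>The energies decrease and are nonnegative, so they converge and their differences over a
  fixed lag \<open>m\<close> vanish.\<close>

lemma incr_tendsto: "(\<lambda>k. LINT u|J \<rho> k. incr m k u) \<longlonglongrightarrow> 0"
proof -
  have "0 \<le> (LINT u|J \<rho> k. incr 1 k u)" for k using incr_bound by (intro integral_nonneg_AE) auto
  then have "decseq energy" unfolding energy_diff by (intro decseq_SucI) simp
  moreover have "0 \<le> energy k" for k unfolding energy_def by (intro integral_nonneg_AE) simp
  ultimately obtain E where E: "energy \<longlonglongrightarrow> E" using decseq_convergent[of energy 0] by metis
  have "(\<lambda>k. energy k - energy (k + m)) \<longlonglongrightarrow> E - E" by (intro tendsto_diff E LIMSEQ_ignore_initial_segment)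
  then show ?thesis unfolding energy_diff by simp
qed

text \<open>The density of the observation history alone, \<open>\<nu>\<close> against
  \<open>\<rho>\<close>: the density of history and signal averaged over the signal given the
  history.\<close>

definition wgt :: "nat \<Rightarrow> 'f stream \<Rightarrow> real" where
  "wgt k h = (LINT x|Filt \<rho> k h. dens k (h, x))"

lemma Filt_fst_meas[measurable]: "N \<in> space PA \<Longrightarrow> (\<lambda>s. Filt N k (fst s)) \<in> SS \<rightarrow>\<^sub>M PA"
  by (rule measurable_compose[OF measurable_fst Filt_meas])

lemma wgt_meas[measurable]: "wgt k \<in> borel_measurable HS"
  unfolding wgt_def by (rule integral_kernel_measurable[OF _ Filt_meas[OF \<rho>_PA]]) measurable

lemma wgt_bound: "0 \<le> wgt k h" "wgt k h \<le> 2"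
proof -
  have m: "(\<lambda>x. dens k (h, x)) \<in> borel_measurable borel" by measurable
  show "0 \<le> wgt k h" "wgt k h \<le> 2"
    unfolding wgt_def using pa_integral01[OF Fp m dens_nonneg dens_le2] by simp_all
qed

text \<open>Measures how much the density still depends on the signal once the history is known. A
  small spread means that reweighting by the density hardly changes the filter.\<close>

definition spread :: "nat \<Rightarrow> real" where
  "spread k = (LINT u|J \<rho> k. \<bar>dens k u - wgt k (fst u)\<bar>)"

lemma dw_bound: "\<bar>dens k u - wgt k h\<bar> \<le> 2"
  using dens_nonneg[of k u] dens_le2[of k u] wgt_bound[of k h] by simp

text \<open>The mutual overlap of the \<open>m\<close>-step transitions bounds the difference of the densities at two
  states by their expected increments: the test that decides to which of the two values \<open>dens (k + m)\<close> is closer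
  separates the two states only with an error of at least \<open>c\<close>.\<close>

lemma dens_diff_incr:
  assumes ov: "\<And>x x' g. x \<in> C \<Longrightarrow> x' \<in> C \<Longrightarrow> g \<in> borel_measurable SS \<Longrightarrow> (\<And>s. 0 \<le> g s) \<Longrightarrow> (\<And>s. g s \<le> 1) \<Longrightarrow>
      c \<le> (LINT s|iterK \<Phi> m (h, x). g s) + (LINT s|iterK \<Phi> m (h, x'). 1 - g s)"
    and x: "x \<in> C" "x' \<in> C"
  shows "c * (dens k (h, x) - dens k (h, x'))\<^sup>2 \<le> 4 * (incr m k (h, x) + incr m k (h, x'))"
proof -
  let ?q = "dens (k + m)"
  define a b where "a = dens k (h, x)" and "b = dens k (h, x')"
  define g where "g v = (if \<bar>b - ?q v\<bar> \<le> \<bar>a - ?q v\<bar> then 1 else 0 :: real)" for v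
  have gm[measurable]: "g \<in> borel_measurable SS" unfolding g_def by measurable
  have sq: "(a - b)\<^sup>2 \<le> 4 * r\<^sup>2" if "\<bar>a - b\<bar> \<le> 2 * \<bar>r\<bar>" for r
    using power_mono[OF that, of 2] by (simp add: power_mult_distrib)
  \<comment> \<open>Where the test decides for one value, the later density is at least half of the
    gap away from the other; squaring gives the factor \<open>4\<close>.\<close>
  have q: "(a - b)\<^sup>2 * g v \<le> 4 * (a - ?q v)\<^sup>2" "(a - b)\<^sup>2 * (1 - g v) \<le> 4 * (b - ?q v)\<^sup>2" for v
    using sq[of "a - ?q v"] sq[of "b - ?q v"] unfolding g_def by (cases "\<bar>b - ?q v\<bar> \<le> \<bar>a - ?q v\<bar>"; simp; argo)+
  have i: "integrable (iterK \<Phi> m s) (\<lambda>v. 4 * (dens k u - ?q v)\<^sup>2)" for s u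
    using dens_diff_sq by (intro integrable_mult_right pa_integrable[OF Kp, where B=4]) auto
  have ig: "integrable (iterK \<Phi> m s) (\<lambda>v. r * g v)" "integrable (iterK \<Phi> m s) (\<lambda>v. r * (1 - g v))" for s r
    by (intro integrable_mult_right pa_integrable[OF Kp, where B=1]; simp add: g_def; measurable)+
  have "c \<le> (LINT s|iterK \<Phi> m (h, x). g s) + (LINT s|iterK \<Phi> m (h, x'). 1 - g s)"
    by (rule ov[OF x gm]) (auto simp: g_def)
  then have "(a - b)\<^sup>2 * c \<le> (a - b)\<^sup>2 * ((LINT s|iterK \<Phi> m (h, x). g s) + (LINT s|iterK \<Phi> m (h, x'). 1 - g s))"
    by (rule mult_left_mono) simp
  also have "\<dots> = (LINT s|iterK \<Phi> m (h, x). (a - b)\<^sup>2 * g s) + (LINT s|iterK \<Phi> m (h, x'). (a - b)\<^sup>2 * (1 - g s))"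
    by (simp add: distrib_left)
  also have "\<dots> \<le> (LINT v|iterK \<Phi> m (h, x). 4 * (a - ?q v)\<^sup>2) + (LINT v|iterK \<Phi> m (h, x'). 4 * (b - ?q v)\<^sup>2)"
    unfolding a_def b_def by (intro add_mono integral_mono ig i q[unfolded a_def b_def])
  also have "\<dots> = 4 * (incr m k (h, x) + incr m k (h, x'))" by (simp add: incr_def a_def b_def)
  finally show ?thesis by (simp add: a_def b_def mult.commute)
qed

text \<open>The signal is compared with one redrawn from the filter. Either their densities differ
  by at most \<open>\<eta>\<close>, or the gap is bounded by its square over \<open>\<eta>\<close>
  and \<open>dens_diff_incr\<close> applies, or one of them lies outside \<open>C\<close> and the
  trivial bound \<open>2\<close> is used. Each bound is split into a term \<open>F\<close> for
  either signal, and the two terms have the same mean, which doubles the constants of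
  \<open>F\<close>.\<close>

lemma spread_bound:
  assumes c: "c > 0" and \<eta>: "\<eta> > 0" and C[measurable]: "C \<in> sets borel"
    and ov: "\<And>h x x' g. x \<in> C \<Longrightarrow> x' \<in> C \<Longrightarrow> g \<in> borel_measurable SS \<Longrightarrow> (\<And>s. 0 \<le> g s) \<Longrightarrow> (\<And>s. g s \<le> 1) \<Longrightarrow>
      c \<le> (LINT s|iterK \<Phi> m (h, x). g s) + (LINT s|iterK \<Phi> m (h, x'). 1 - g s)"
  shows "spread k \<le> 8 / (c * \<eta>) * (LINT u|J \<rho> k. incr m k u) + 4 * measure (\<rho> \<bind> Pn k) (- C) + 2 * \<eta>"
proof -
  define \<kappa> where "\<kappa> = 4 / (c * \<eta>)"
  have \<kappa>: "\<kappa> > 0" using c \<eta> by (simp add: \<kappa>_def)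
  define F where "F u = \<kappa> * incr m k u + 2 * indicator (- C) (snd u) + \<eta>" for u :: "'f stream \<times> 'e"
  have Fm[measurable]: "F \<in> borel_measurable SS" unfolding F_def by measurable
  have F0: "0 \<le> \<kappa> * incr m k u" for u using \<kappa> incr_bound by simp
  have Fb: "\<bar>F u\<bar> \<le> \<kappa> * 4 + 2 * 1 + \<eta>" for u
  proof -
    have "F u \<le> \<kappa> * 4 + 2 * 1 + \<eta>"
      unfolding F_def using \<kappa> incr_bound by (intro add_mono mult_left_mono) (auto simp: indicator_def)
    moreover have "0 \<le> F u" unfolding F_def using F0[of u] \<eta> by (simp add: indicator_def)
    ultimately show ?thesis by simp
  qed
  have pt: "\<bar>dens k (h, x) - dens k (h, x')\<bar> \<le> F (h, x) + F (h, x')" for h x x'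
  proof (cases "x \<in> C \<and> x' \<in> C")
    case True
    let ?t = "dens k (h, x) - dens k (h, x')"
    show ?thesis
    proof (cases "\<bar>?t\<bar> \<le> \<eta>")
      case False
      then have "\<eta> * \<bar>?t\<bar> \<le> \<bar>?t\<bar> * \<bar>?t\<bar>" by (intro mult_right_mono) auto
      then have "c * (\<eta> * \<bar>?t\<bar>) \<le> c * ?t\<^sup>2" using c by (intro mult_left_mono) (auto simp: power2_eq_square)
      also have "\<dots> \<le> 4 * (incr m k (h, x) + incr m k (h, x'))" using True by (intro dens_diff_incr[OF ov]) auto
      finally have "\<bar>?t\<bar> \<le> \<kappa> * (incr m k (h, x) + incr m k (h, x'))"
        using c \<eta> by (simp add: \<kappa>_def pos_le_divide_eq mult_ac)
      then show ?thesis using True \<eta> by (simp add: F_def distrib_left)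
    qed (use F0[of "(h, x)"] F0[of "(h, x')"] True \<eta> in \<open>simp add: F_def\<close>)
  next
    case False
    have "2 \<le> F (h, x) + F (h, x')"
      using F0[of "(h, x)"] F0[of "(h, x')"] \<eta> False unfolding F_def by (auto simp: indicator_def)
    then show ?thesis using dens_diff_abs[of k "(h, x)" k "(h, x')"] by linarith
  qed
  define G where "G u = (LINT x|Filt \<rho> k (fst u). F (fst u, x))" for u :: "'f stream \<times> 'e"
  have Gm[measurable]: "G \<in> borel_measurable SS"
    unfolding G_def by (rule integral_kernel_measurable[OF _ Filt_fst_meas[OF \<rho>_PA]]) measurable
  have Fh: "(\<lambda>x. F (h, x)) \<in> borel_measurable borel" for h by measurable
  have Gb: "\<bar>G u\<bar> \<le> \<kappa> * 4 + 2 * 1 + \<eta>" for u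
    unfolding G_def by (rule pa_integral_le[OF Fp Fh Fb])
  have iF: "integrable (J \<rho> k) F" by (rule pa_integrable[OF Jp Fm Fb])
  have iG: "integrable (J \<rho> k) G" by (rule pa_integrable[OF Jp Gm Gb])
  have w: "\<bar>dens k u - wgt k (fst u)\<bar> \<le> F u + G u" for u
  proof -
    obtain h x where u: "u = (h, x)" by (cases u)
    let ?N = "Filt \<rho> k h"
    interpret prob_space ?N by (rule PA_D[OF Fp])
    have dm: "(\<lambda>x'. dens k (h, x')) \<in> borel_measurable borel" by measurable
    have id: "integrable ?N (\<lambda>x'. dens k (h, x'))"
      by (rule pa_integrable[OF Fp dm dens_abs])
    have iFh: "integrable ?N (\<lambda>x'. F (h, x'))" by (rule pa_integrable[OF Fp Fh Fb])
    have "dens k u - wgt k (fst u) = (LINT x'|?N. dens k (h, x) - dens k (h, x'))"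
      using id by (simp add: u wgt_def prob_space)
    also have "\<bar>\<dots>\<bar> \<le> (LINT x'|?N. \<bar>dens k (h, x) - dens k (h, x')\<bar>)" by (rule integral_abs_bound)
    also have "\<dots> \<le> (LINT x'|?N. F (h, x) + F (h, x'))"
      using id iFh by (intro integral_mono pt) auto
    also have "\<dots> = F u + G u" using iFh by (simp add: u G_def prob_space)
    finally show ?thesis .
  qed
  have wm: "(\<lambda>u. \<bar>dens k u - wgt k (fst u)\<bar>) \<in> borel_measurable SS" by measurable
  have wb: "\<bar>\<bar>dens k u - wgt k (fst u)\<bar>\<bar> \<le> 2" for u using dw_bound by simp
  have "spread k \<le> (LINT u|J \<rho> k. F u + G u)"
    unfolding spread_def using iF iG
    by (intro integral_mono w pa_integrable[OF Jp wm wb]) auto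
  also have "\<dots> = (LINT u|J \<rho> k. F u) + (LINT u|J \<rho> k. G u)" using iF iG by simp
  also have "(LINT u|J \<rho> k. G u) = (LINT u|J \<rho> k. F u)"
    unfolding G_def by (rule Filt_correct_real[OF \<rho>_PA Fm Fb, symmetric])
  also have "(LINT u|J \<rho> k. F u) = \<kappa> * (LINT u|J \<rho> k. incr m k u) + 2 * measure (\<rho> \<bind> Pn k) (- C) + \<eta>"
  proof -
    interpret prob_space "J \<rho> k" by (rule J_prob_space[OF \<rho>_PA])
    have [measurable_cong]: "sets (J \<rho> k) = sets SS" by (rule J_sets[OF \<rho>_PA])
    have "(LINT u|J \<rho> k. indicator (- C) (snd u)) = enn2real (\<integral>\<^sup>+u. indicator (- C) (snd u) \<partial>J \<rho> k)"
      by (subst integral_eq_nn_integral) (auto simp: ennreal_indicator)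
    also have "\<dots> = measure (\<rho> \<bind> Pn k) (- C)"
      using nn_integral_J_signal[OF \<rho>_PA, of "indicator (- C)" k] PA_D(2)[OF bind_prob[OF \<rho>_PA Pn_meas]]
      by (simp add: bind_Pn[OF \<rho>_PA] measure_def)
    finally have e: "(LINT u|J \<rho> k. indicator (- C) (snd u)) = measure (\<rho> \<bind> Pn k) (- C)" .
    have "integrable (J \<rho> k) (\<lambda>u. indicator (- C) (snd u) :: real)"
      by (intro pa_integrable[OF Jp, of _ 1]) (auto simp: indicator_def)
    then show ?thesis unfolding F_def using incr_integrable e by (simp add: prob_space)
  qed
  finally show ?thesis by (simp add: \<kappa>_def field_simps)
qed

lemma Pn_conv:
  assumes "N \<in> space PA" "A \<in> sets borel" shows "(\<lambda>m. measure (N \<bind> Pn m) A) \<longlonglongrightarrow> measure l A"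
  by (rule LIMSEQ_I) (use Pn_tv[OF assms(1)] assms(2) in fastforce)

lemma spread_nonneg: "0 \<le> spread k" unfolding spread_def by (intro integral_nonneg_AE) simp

lemma spread_tendsto: "spread \<longlonglongrightarrow> 0"
proof (rule LIMSEQ_I)
  fix r :: real assume r: "r > 0"
  \<comment> \<open>The limiting bound is at most \<open>4 * \<eta> + 2 * \<eta>\<close>, which is
    below \<open>r\<close>.\<close>
  define \<eta> where "\<eta> = r / 8"
  have \<eta>: "\<eta> > 0" using r by (simp add: \<eta>_def)
  show "\<exists>no. \<forall>k\<ge>no. norm (spread k - 0) < r"
  proof (rule overlap[OF \<eta>])
    fix m c C
    assume c: "0 < (c::real)" and C: "C \<in> sets borel" and lC: "1 - \<eta> \<le> measure l C"
      and ov: "\<And>h x x' g. x \<in> C \<Longrightarrow> x' \<in> C \<Longrightarrow> g \<in> borel_measurable SS \<Longrightarrow> (\<And>s. 0 \<le> g s) \<Longrightarrow> (\<And>s. g s \<le> 1) \<Longrightarrow>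
      c \<le> (LINT s|iterK \<Phi> m (h, x). g s) + (LINT s|iterK \<Phi> m (h, x'). 1 - g s)"
    interpret prob_space l by (rule PA_D[OF l_PA])
    have lim: "(\<lambda>k. 8 / (c * \<eta>) * (LINT u|J \<rho> k. incr m k u) + 4 * measure (\<rho> \<bind> Pn k) (- C) + 2 * \<eta>) \<longlonglongrightarrow> 8 / (c * \<eta>) * 0 + 4 * measure l (- C) + 2 * \<eta>"
      using C by (intro tendsto_intros incr_tendsto Pn_conv) auto
    have "measure l (- C) \<le> \<eta>" using lC prob_compl[of C] C PA_D(2)[OF l_PA] PA_space[OF l_PA] by (simp add: Compl_eq_Diff_UNIV)
    then have "8 / (c * \<eta>) * 0 + 4 * measure l (- C) + 2 * \<eta> < r" using r unfolding \<eta>_def by simp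
    from order_tendstoD(2)[OF lim this] have "eventually (\<lambda>k. norm (spread k - 0) < r) sequentially"
    proof eventually_elim
      case (elim k)
      have "spread k \<le> 8 / (c * \<eta>) * (LINT u|J \<rho> k. incr m k u) + 4 * measure (\<rho> \<bind> Pn k) (- C) + 2 * \<eta>"
        by (rule spread_bound[OF c \<eta> C]) (rule ov)
      then show ?case using elim spread_nonneg[of k] by simp
    qed
    then show ?thesis by (auto simp: eventually_sequentially)
  qed
qed

text \<open>A weight below \<open>c\<close> has probability at most \<open>c\<close> under
  \<open>\<nu>\<close>, since the weight is the density on histories. Where the density at the
  earlier time \<open>m\<close> exceeds \<open>d\<close>, this bounds the probability under
  \<open>\<rho>\<close> by \<open>c / d\<close>; the rest is charged to the set of small density.
  The bound does not depend on \<open>j\<close>.\<close>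

lemma small_weight:
  assumes c: "c > 0" and d: "d > 0"
  shows "measure (J \<rho> (m + j)) {u. wgt (m + j) (fst u) < c} \<le> measure (J \<rho> m) {u. dens m u \<le> d} + c / d"
proof -
  let ?k = "m + j"
  define W where "W = {u :: 'f stream \<times> 'e. wgt ?k (fst u) < c}"
  define Z where "Z = {u. dens m u \<le> d}"
  have Wm[measurable]: "W \<in> sets SS" unfolding W_def by (rule SS_Collect) measurable
  have Zm[measurable]: "Z \<in> sets SS" unfolding Z_def by (rule SS_Collect) measurable
  define \<kappa> where "\<kappa> u = (LINT v|iterK \<Phi> j u. (indicator W v :: real))" for u
  have im: "(indicator W :: 'f stream \<times> 'e \<Rightarrow> real) \<in> borel_measurable SS" by measurable
  have i01: "0 \<le> (indicator W v :: real)" "(indicator W v :: real) \<le> 1" for v by (auto simp: indicator_def)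
  have iabs: "\<bar>indicator W v :: real\<bar> \<le> 1" for v by (auto simp: indicator_def)
  have \<kappa>m[measurable]: "\<kappa> \<in> borel_measurable SS" unfolding \<kappa>_def by (rule integral_iterK_meas) measurable
  have \<kappa>01: "0 \<le> \<kappa> u" "\<kappa> u \<le> 1" for u
    unfolding \<kappa>_def using pa_integral01[OF Kp im i01] by simp_all
  have meas: "measure (J \<rho> k) A = (LINT u|J \<rho> k. indicator A u)" if "A \<in> sets SS" for k and A :: "('f stream \<times> 'e) set"
    using that J_sets[OF \<rho>_PA] by simp
  have "\<bar>dens m u * \<kappa> u\<bar> \<le> 2 * 1" for u
    unfolding abs_mult using \<kappa>01[of u] by (intro mult_mono dens_abs) auto
  then have i1: "integrable (J \<rho> m) (\<lambda>u. dens m u * \<kappa> u)" by (intro pa_integrable[OF Jp]) auto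
  have i2: "integrable (J \<rho> m) (indicator Z :: 'f stream \<times> 'e \<Rightarrow> real)"
    by (intro pa_integrable[OF Jp, of _ 1]) (auto simp: indicator_def)
  have "measure (J \<rho> ?k) W = (LINT u|J \<rho> m. \<kappa> u)"
    unfolding meas[OF Wm] \<kappa>_def by (rule integral_J_add[OF \<rho>_PA im iabs])
  also have "\<dots> \<le> (LINT u|J \<rho> m. indicator Z u + dens m u * \<kappa> u / d)"
  proof (rule integral_mono)
    show "integrable (J \<rho> m) \<kappa>"
      by (rule pa_integrable[OF Jp \<kappa>m, where B=1]) (use \<kappa>01 in auto)
    show "integrable (J \<rho> m) (\<lambda>u. indicator Z u + dens m u * \<kappa> u / d)" using i1 i2 by simp
    fix u
    show "\<kappa> u \<le> indicator Z u + dens m u * \<kappa> u / d"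
    proof (cases "u \<in> Z")
      case True
      have "0 \<le> dens m u * \<kappa> u / d" using \<kappa>01 dens_nonneg d by (intro divide_nonneg_pos mult_nonneg_nonneg) auto
      then show ?thesis using \<kappa>01(2)[of u] True by simp
    next
      case False
      then have "d * \<kappa> u \<le> dens m u * \<kappa> u" using \<kappa>01 by (intro mult_right_mono) (auto simp: Z_def)
      then show ?thesis using d False by (simp add: pos_le_divide_eq mult.commute)
    qed
  qed
  also have "\<dots> = measure (J \<rho> m) Z + (LINT u|J \<rho> m. dens m u * \<kappa> u) / d"
    using i1 i2 by (simp add: meas[OF Zm] del: Bochner_Integration.integral_indicator)
  also have "(LINT u|J \<rho> m. dens m u * \<kappa> u) = (LINT u|J \<nu> m. \<kappa> u)" by (rule integral_\<nu>[OF \<kappa>m, symmetric])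
  also have "\<dots> = (LINT v|J \<nu> ?k. indicator W v)"
    unfolding \<kappa>_def by (rule integral_J_add[OF \<nu> im iabs, symmetric])
  also have "\<dots> = (LINT v|J \<rho> ?k. dens ?k v * indicator W v)" by (rule integral_\<nu>[OF im])
  also have "\<dots> = (LINT u|J \<rho> ?k. LINT x|Filt \<rho> ?k (fst u). dens ?k (fst u, x) * indicator W (fst u, x))"
  proof (rule Filt_correct_real[OF \<rho>_PA])
    show "\<bar>dens ?k s * indicator W s\<bar> \<le> 2" for s using dens_abs[of ?k s] by (simp add: indicator_def)
  qed measurable
  also have "\<dots> = (LINT u|J \<rho> ?k. wgt ?k (fst u) * indicator W u)"
    by (intro Bochner_Integration.integral_cong) (auto simp: W_def wgt_def indicator_def)
  also have "\<dots> \<le> c"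
  proof -
    interpret prob_space "J \<rho> ?k" by (rule J_prob_space[OF \<rho>_PA])
    have "\<bar>wgt ?k (fst u) * indicator W u\<bar> \<le> c" for u
      using wgt_bound[of ?k "fst u"] c by (auto simp: W_def indicator_def)
    then have "\<bar>LINT u|J \<rho> ?k. wgt ?k (fst u) * indicator W u\<bar> \<le> c"
      by (intro pa_integral_le[OF Jp]) auto
    then show ?thesis by simp
  qed
  finally show ?thesis using d by (simp add: W_def Z_def divide_right_mono)
qed

section \<open>States of zero density and small history weights\<close>

lemma bindPn_PA[simp]: "N \<in> space PA \<Longrightarrow> N \<bind> Pn m \<in> space PA"
  by (rule bind_prob[OF _ Pn_meas])

text \<open>Where the density vanishes, the reference chain started from \<open>\<nu>\<close> puts no mass, so the signal
  has to sit in a set that is null for \<open>\<nu>P\<^sup>m\<close>.\<close>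

lemma dens_zero:
  "\<exists>B. B \<in> sets borel \<and> measure (\<nu> \<bind> Pn m) B = 0 \<and> measure (J \<rho> m) {u. dens m u = 0} \<le> measure (\<rho> \<bind> Pn m) B"
proof -
  define N where "N = {u. dens m u = 0}"
  have [measurable]: "N \<in> sets SS" unfolding N_def by (rule SS_Collect) measurable
  have [measurable_cong]: "sets \<nu> = sets borel" "sets \<rho> = sets borel" by (rule PA_D(2); simp)+
  have [measurable_cong]: "sets (J \<rho> m) = sets SS" by (rule J_sets[OF \<rho>_PA])
  define al where "al z = (\<integral>\<^sup>+h'. indicator N (h', z) \<partial>hist m h0)" for z
  have alm[measurable]: "al \<in> borel_measurable borel"
    unfolding al_def by (rule nn_integral_kernel_measurable[where R=HS, OF _ measurable_const[OF hist_prob]]) measurable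
  have m0: "(\<lambda>x. \<integral>\<^sup>+s. f s \<partial>iterK \<Theta> m (h0, x)) \<in> borel_measurable borel"
    if "\<Theta> \<in> borel \<rightarrow>\<^sub>M PA" "f \<in> borel_measurable SS" for \<Theta> f
    by (rule measurable_compose[OF _ nn_integral_iterK_meas[OF that]]) simp
  \<comment> \<open>\<open>B\<close> consists of the final signal values at which the reference law
    of the history charges the section of \<open>N\<close>. As \<open>N\<close> has no mass under
    \<open>J \<nu> m\<close>, equivalence with the reference chain makes \<open>B\<close> null for
    \<open>\<nu> \<bind> Pn m\<close>.\<close>
  define B where "B = {z. al z \<noteq> 0}"
  have B[measurable]: "B \<in> sets borel" unfolding B_def by measurable
  have im: "indicator N \<in> borel_measurable SS" by measurable
  have "(\<integral>\<^sup>+x. \<integral>\<^sup>+s. indicator N s \<partial>iterK \<Phi> m (h0, x) \<partial>\<nu>) = (\<integral>\<^sup>+s. ennreal (dens m s) * indicator N s \<partial>J \<rho> m)"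
    unfolding nn_integral_J[OF \<nu> im, symmetric] unfolding dens_\<nu>[of m] by (intro nn_integral_density) auto
  also have "\<dots> = (\<integral>\<^sup>+s. 0 \<partial>J \<rho> m)" by (intro nn_integral_cong) (auto simp: N_def indicator_def)
  finally have "AE x in \<nu>. (\<integral>\<^sup>+s. indicator N s \<partial>iterK \<Phi> m (h0, x)) = 0"
    using m0[OF \<Phi>_meas im] by (simp add: nn_integral_0_iff_AE)
  then have "(\<integral>\<^sup>+x. \<integral>\<^sup>+s. indicator N s \<partial>K0 m (h0, x) \<partial>\<nu>) = 0"
    using m0[OF \<phi>\<^sub>0_kernel im] by (simp add: nn_integral_0_iff_AE iterK_null_iff[OF im])
  then have "(\<integral>\<^sup>+z. al z \<partial>(\<nu> \<bind> Pn m)) = 0"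
    unfolding nn_integral_K0[OF im] al_def[symmetric] nn_integral_bind_prob[OF \<nu> Pn_meas alm] .
  then have "AE z in \<nu> \<bind> Pn m. z \<notin> B"
    using PA_D(2)[OF bindPn_PA[OF \<nu>, of m]] by (subst (asm) nn_integral_0_iff_AE) (auto simp: B_def cong: measurable_cong_sets)
  then have B0: "measure (\<nu> \<bind> Pn m) B = 0"
    using PA_D(2)[OF bindPn_PA[OF \<nu>, of m]] by (simp add: measure_def AE_iff_null_sets[symmetric] null_setsD1)
  \<comment> \<open>Off \<open>B\<close> the sections of \<open>N\<close> are null for the reference
    history, so this part of \<open>N\<close> is null for the model from every starting point, and
    hence under \<open>J \<rho> m\<close>.\<close>
  let ?g = "\<lambda>u. indicator N u * indicator (- B) (snd u) :: ennreal"
  have gm: "?g \<in> borel_measurable SS" by measurable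
  have "(\<integral>\<^sup>+h'. ?g (h', z) \<partial>hist m h0) = al z * indicator (- B) z" for z by (auto simp: al_def indicator_def)
  then have "(\<integral>\<^sup>+s. ?g s \<partial>K0 m (h0, x)) = 0" for x
    unfolding nn_integral_K0[OF gm] by (auto simp: B_def indicator_def intro!: nn_integral_zero')
  then have "(\<integral>\<^sup>+s. ?g s \<partial>J \<rho> m) = 0" unfolding nn_integral_J[OF \<rho>_PA gm] by (simp add: iterK_null_iff[OF gm])
  moreover have "emeasure (J \<rho> m) N \<le> (\<integral>\<^sup>+s. ?g s + indicator B (snd s) \<partial>J \<rho> m)"
    by (subst nn_integral_indicator[symmetric], measurable, intro nn_integral_mono) (auto simp: indicator_def)
  ultimately have "emeasure (J \<rho> m) N \<le> emeasure (\<rho> \<bind> Pn m) B"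
    using nn_integral_J_signal[OF \<rho>_PA, of "indicator B" m] PA_D(2)[OF bindPn_PA[OF \<rho>_PA, of m]]
    by (subst (asm) nn_integral_add) (auto simp: bind_Pn[OF \<rho>_PA])
  then have "measure (J \<rho> m) N \<le> measure (\<rho> \<bind> Pn m) B"
    unfolding measure_def by (intro enn2real_mono)
      (auto simp: finite_measure.emeasure_eq_measure[OF prob_space.finite_measure[OF PA_D(1)[OF bindPn_PA[OF \<rho>_PA]]]])
  then show ?thesis using B0 B unfolding N_def by blast
qed

text \<open>At a late time the signal laws started from \<open>\<nu>\<close> and
  \<open>\<rho>\<close> are both within \<open>e / 2\<close> of \<open>l\<close> on every Borel set,
  so a set that is null for the first has mass at most \<open>e\<close> under the second.\<close>

lemma dens_zero_small:
  assumes e: "e > 0" shows "\<exists>m. measure (J \<rho> m) {u. dens m u = 0} \<le> e"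
proof -
  have e2: "0 < e / 2" using e by simp
  obtain k1 k2 where k: "\<And>k A. k \<ge> k1 \<Longrightarrow> A \<in> sets borel \<Longrightarrow> \<bar>measure (\<nu> \<bind> Pn k) A - measure l A\<bar> < e / 2"
    "\<And>k A. k \<ge> k2 \<Longrightarrow> A \<in> sets borel \<Longrightarrow> \<bar>measure (\<rho> \<bind> Pn k) A - measure l A\<bar> < e / 2"
    using Pn_tv[OF \<nu> e2] Pn_tv[OF \<rho>_PA e2] by blast
  define m where "m = max k1 k2"
  obtain B where B: "B \<in> sets borel" "measure (\<nu> \<bind> Pn m) B = 0" "measure (J \<rho> m) {u. dens m u = 0} \<le> measure (\<rho> \<bind> Pn m) B"
    using dens_zero by blast
  have m: "k1 \<le> m" "k2 \<le> m" by (auto simp: m_def)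
  have "measure (J \<rho> m) {u. dens m u = 0} \<le> e"
    using k(1)[OF m(1) B(1)] k(2)[OF m(2) B(1)] B(2,3) by linarith
  then show ?thesis by blast
qed

text \<open>The sets of small density at one fixed time \<open>m\<close> decrease to the set of zero
  density, whose mass is already controlled; \<open>small_weight\<close> then carries the estimate
  to all later times.\<close>

lemma small_weight_eventually:
  assumes e: "e > 0"
  shows "\<exists>c>0. \<exists>m. \<forall>k\<ge>m. measure (J \<rho> k) {u. wgt k (fst u) < c} \<le> e"
proof -
  have "0 < e / 3" using e by simp
  from dens_zero_small[OF this] obtain m where m: "measure (J \<rho> m) {u. dens m u = 0} \<le> e / 3" by blast
  interpret prob_space "J \<rho> m" by (rule J_prob_space[OF \<rho>_PA])
  let ?D = "\<lambda>n. {u. dens m u \<le> 1 / real (Suc n)}"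
  have inter: "(\<Inter>n. ?D n) = {u. dens m u = 0}"
  proof safe
    fix h x assume a: "(h, x) \<in> (\<Inter>n. ?D n)"
    have "dens m (h, x) \<le> 0"
    proof (rule LIMSEQ_le_const[OF LIMSEQ_inverse_real_of_nat])
      show "\<exists>N. \<forall>n\<ge>N. dens m (h, x) \<le> inverse (real (Suc n))" using a by (auto simp: inverse_eq_divide)
    qed
    then show "dens m (h, x) = 0" using dens_nonneg[of m "(h, x)"] by simp
  qed simp
  have "decseq ?D"
  proof (rule decseq_SucI, safe)
    fix n h x assume "dens m (h, x) \<le> 1 / real (Suc (Suc n))"
    also have "\<dots> \<le> 1 / real (Suc n)" by (simp add: field_simps)
    finally show "dens m (h, x) \<le> 1 / real (Suc n)" .
  qed
  moreover have "range ?D \<subseteq> events"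
  proof (intro image_subsetI)
    fix n
    have "?D n \<in> sets SS" by (rule SS_Collect) measurable
    then show "?D n \<in> events" using J_sets[OF \<rho>_PA, of m] by simp
  qed
  ultimately have "(\<lambda>n. prob (?D n)) \<longlonglongrightarrow> prob (\<Inter>n. ?D n)" by (intro finite_Lim_measure_decseq) auto
  then have "(\<lambda>n. prob (?D n)) \<longlonglongrightarrow> prob {u. dens m u = 0}" unfolding inter .
  then have "eventually (\<lambda>n. prob (?D n) < 2 * e / 3) sequentially"
    using m e by (intro order_tendstoD) auto
  then obtain n where n: "prob (?D n) < 2 * e / 3" by (auto simp: eventually_sequentially)
  define d where "d = 1 / real (Suc n)"
  \<comment> \<open>This makes \<open>c / d\<close> equal to \<open>e / 3\<close>, complementing the
    bound \<open>2 * e / 3\<close> for the set of small density.\<close>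
  define c where "c = d * e / 3"
  have cd: "d > 0" "c > 0" using e by (auto simp: d_def c_def)
  have "measure (J \<rho> k) {u. wgt k (fst u) < c} \<le> e" if "k \<ge> m" for k
  proof -
    have "measure (J \<rho> k) {u. wgt k (fst u) < c} \<le> prob (?D n) + c / d"
      using small_weight[OF cd(2,1), of m "k - m"] that by (simp add: d_def)
    also have "c / d = e / 3" using cd by (simp add: c_def)
    finally show ?thesis using n by simp
  qed
  then show ?thesis using cd by blast
qed

text \<open>Bayes' formula for a change of the initial law: reweighting the filter of
  \<open>\<rho>\<close> by the density \<open>q\<close> gives, up to normalisation, the filter of
  \<open>N\<close>. Both sides are functions of the history, and integrating their difference
  against its own sign \<open>W\<close> gives zero.\<close>

lemma posterior:
  assumes N: "N \<in> space PA" and q[measurable]: "q \<in> borel_measurable SS" and q02: "\<And>s. 0 \<le> q s" "\<And>s. q s \<le> 2"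
    and Jq: "J N k = density (J \<rho> k) (\<lambda>s. ennreal (q s))"
    and f[measurable]: "f \<in> borel_measurable borel" and f1: "\<And>x. \<bar>f x :: real\<bar> \<le> 1"
  shows "AE u in J \<rho> k. (LINT x|Filt \<rho> k (fst u). q (fst u, x)) * (LINT x|Filt N k (fst u). f x) = (LINT x|Filt \<rho> k (fst u). q (fst u, x) * f x)"
proof -
  have [measurable_cong]: "sets (J \<rho> k) = sets SS" by (rule J_sets[OF \<rho>_PA])
  have qa: "\<bar>q s\<bar> \<le> 2" for s using q02[of s] by simp
  define w where "w h = (LINT x|Filt \<rho> k h. q (h, x))" for h
  define F where "F h = (LINT x|Filt N k h. f x)" for h
  define R where "R h = (LINT x|Filt \<rho> k h. q (h, x) * f x)" for h
  have wm[measurable]: "w \<in> borel_measurable HS" unfolding w_def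
    by (rule integral_kernel_measurable[OF _ Filt_meas[OF \<rho>_PA]]) measurable
  have Fm[measurable]: "F \<in> borel_measurable HS" unfolding F_def
    by (rule integral_kernel_measurable[OF _ Filt_meas[OF N]]) measurable
  have Rm[measurable]: "R \<in> borel_measurable HS" unfolding R_def
    by (rule integral_kernel_measurable[OF _ Filt_meas[OF \<rho>_PA]]) measurable
  have qm: "(\<lambda>x. q (h, x)) \<in> borel_measurable borel" "(\<lambda>x. q (h, x) * f x) \<in> borel_measurable borel" for h by measurable
  have qf: "\<bar>q (h, x) * f x\<bar> \<le> 2 * 1" for h x unfolding abs_mult by (intro mult_mono qa f1) auto
  have wb: "\<bar>w h\<bar> \<le> 2" for h unfolding w_def by (rule pa_integral_le[OF Fp qm(1) qa])
  have Fb: "\<bar>F h\<bar> \<le> 1" for h unfolding F_def by (rule pa_integral_le[OF Filt_PA[OF N] f f1])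
  have Rb: "\<bar>R h\<bar> \<le> 2 * 1" for h unfolding R_def by (rule pa_integral_le[OF Fp qm(2) qf])
  define W where "W h = sgn (w h * F h - R h)" for h
  have Wm[measurable]: "W \<in> borel_measurable HS" unfolding W_def by measurable
  have Wb: "\<bar>W h\<bar> \<le> 1" for h unfolding W_def by (simp add: sgn_real_def)
  have g1: "\<bar>q u * (W (fst u) * F (fst u))\<bar> \<le> 2 * (1 * 1)" for u
    unfolding abs_mult by (intro mult_mono qa Wb Fb) auto
  have g2: "\<bar>W (fst u) * f (snd u)\<bar> \<le> 1 * 1" for u unfolding abs_mult by (intro mult_mono Wb f1) auto
  have g3: "\<bar>q u * (W (fst u) * f (snd u))\<bar> \<le> 2 * (1 * 1)" for u
    unfolding abs_mult by (intro mult_mono qa Wb f1) auto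
  have h1: "\<bar>W (fst u) * (w (fst u) * F (fst u))\<bar> \<le> 1 * (2 * 1)" for u :: "'f stream \<times> 'e"
    unfolding abs_mult by (intro mult_mono wb Wb Fb) auto
  have h2: "\<bar>W (fst u) * R (fst u)\<bar> \<le> 1 * (2 * 1)" for u :: "'f stream \<times> 'e"
    unfolding abs_mult by (intro mult_mono Wb Rb) auto
  have c: "q u * (W h * z) = W h * (q u * z)" for u h z by (rule mult.left_commute)
  have e1: "(LINT u|J \<rho> k. q u * (W (fst u) * F (fst u))) = (LINT u|J \<rho> k. W (fst u) * (w (fst u) * F (fst u)))"
    unfolding w_def by (subst Filt_correct_real[OF \<rho>_PA _ g1]) (measurable, simp add: mult_ac)
  have e2: "(LINT u|J \<rho> k. q u * (W (fst u) * f (snd u))) = (LINT u|J \<rho> k. W (fst u) * R (fst u))"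
    unfolding R_def by (subst Filt_correct_real[OF \<rho>_PA _ g3]) (measurable, simp add: c)
  have d: "(LINT u|J N k. g u) = (LINT u|J \<rho> k. q u * g u)" if "g \<in> borel_measurable SS" for g :: "_ \<Rightarrow> real"
    by (rule integral_density_pa[OF Jp Jq q q02(1) that])
  have "(LINT u|J \<rho> k. W (fst u) * (w (fst u) * F (fst u))) = (LINT u|J N k. W (fst u) * F (fst u))"
    unfolding e1[symmetric] by (rule d[symmetric]) measurable
  also have "\<dots> = (LINT u|J N k. W (fst u) * f (snd u))"
    unfolding F_def by (rule trans[OF _ Filt_correct_real[OF N _ g2, symmetric]]) (simp, measurable)
  also have "\<dots> = (LINT u|J \<rho> k. q u * (W (fst u) * f (snd u)))" by (rule d) measurable
  also have "\<dots> = (LINT u|J \<rho> k. W (fst u) * R (fst u))" by (rule e2)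
  finally have eq: "(LINT u|J \<rho> k. W (fst u) * (w (fst u) * F (fst u))) = (LINT u|J \<rho> k. W (fst u) * R (fst u))" .
  have i1: "integrable (J \<rho> k) (\<lambda>u. W (fst u) * (w (fst u) * F (fst u)))"
    by (rule pa_integrable[OF Jp _ h1]) measurable
  have i2: "integrable (J \<rho> k) (\<lambda>u. W (fst u) * R (fst u))"
    by (rule pa_integrable[OF Jp _ h2]) measurable
  have W_abs: "W h * (w h * F h) - W h * R h = \<bar>w h * F h - R h\<bar>" for h
    unfolding right_diff_distrib[symmetric] W_def abs_sgn by (rule mult.commute)
  have "(LINT u|J \<rho> k. \<bar>w (fst u) * F (fst u) - R (fst u)\<bar>) = 0"
    unfolding W_abs[symmetric] using i1 i2 eq by simp
  moreover have "integrable (J \<rho> k) (\<lambda>u. \<bar>w (fst u) * F (fst u) - R (fst u)\<bar>)"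
    unfolding W_abs[symmetric] using i1 i2 by simp
  ultimately have "AE u in J \<rho> k. \<bar>w (fst u) * F (fst u) - R (fst u)\<bar> = 0"
    by (subst (asm) integral_nonneg_eq_0_iff_AE) auto
  then show ?thesis by eventually_elim (simp add: w_def F_def R_def)
qed

text \<open>By \<open>posterior\<close>, the difference of the integrals of \<open>f\<close> under
  the two filters, times \<open>w * (2 - w)\<close> with \<open>w\<close> the weight of the history,
  is twice the integral of \<open>(dens - w) * f\<close> under the filter of \<open>\<rho>\<close>.
  The expectation is taken under \<open>\<nu>'\<close>, whose density on histories is
  \<open>2 - w\<close>. One factor therefore cancels, and only histories of small weight
  \<open>w\<close> are critical.\<close>

lemma Dist_bound:
  assumes c: "c > 0"
  shows "Dist k \<nu> \<nu>' \<le> 2 / c * spread k + 4 * measure (J \<rho> k) {u. wgt k (fst u) < c}"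
proof -
  obtain L :: "('e \<Rightarrow> real) set" where L: "countable L" "L \<subseteq> BL1" "L \<noteq> {}"
    "\<And>f. f \<in> BL1 \<Longrightarrow> \<exists>g. (\<forall>n. g n \<in> L) \<and> (\<forall>x. (\<lambda>n. g n x) \<longlonglongrightarrow> f x)"
    by (rule BL1_countable_dense) blast
  have [measurable_cong]: "sets (J \<rho> k) = sets SS" by (rule J_sets[OF \<rho>_PA])
  interpret prob_space "J \<rho> k" by (rule J_prob_space[OF \<rho>_PA])
  define V where "V u = (LINT x|Filt \<rho> k (fst u). \<bar>dens k (fst u, x) - wgt k (fst u)\<bar>)" for u :: "'f stream \<times> 'e"
  define bl where "bl u = bl_dist (Filt \<nu> k (fst u)) (Filt \<nu>' k (fst u))" for u :: "'f stream \<times> 'e"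
  have dwm: "(\<lambda>u. \<bar>dens k u - wgt k (fst u)\<bar>) \<in> borel_measurable SS" by measurable
  have dwb': "\<bar>\<bar>dens k u - wgt k (fst u)\<bar>\<bar> \<le> 2" for u using dw_bound by simp
  have Vm[measurable]: "V \<in> borel_measurable SS" unfolding V_def
    by (rule integral_kernel_measurable[OF _ Filt_fst_meas[OF \<rho>_PA]]) measurable
  have dm: "(\<lambda>x. dens k (h, x)) \<in> borel_measurable borel" for h by measurable
  have Vb: "0 \<le> V u" "V u \<le> 2" for u
    unfolding V_def using pa_integral01[OF Fp, of "\<lambda>x. \<bar>dens k (fst u, x) - wgt k (fst u)\<bar>" 2 k "fst u"] dw_bound by auto
  have blm[measurable]: "bl \<in> borel_measurable SS"
    unfolding bl_def by (intro good_meas[OF good_bl_dist] Filt_fst_meas \<nu> \<nu>')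
  have blb: "0 \<le> bl u" "bl u \<le> 2" for u unfolding bl_def by (intro bl_dist_nonneg bl_dist_le2 Filt_PA \<nu> \<nu>')+
  have a1: "AE u in J \<rho> k. \<forall>f\<in>L. wgt k (fst u) * (LINT x|Filt \<nu> k (fst u). f x) = (LINT x|Filt \<rho> k (fst u). dens k (fst u, x) * f x)"
    unfolding AE_ball_countable[OF L(1)] wgt_def
  proof
    fix f assume "f \<in> L"
    then have f: "f \<in> BL1" using L(2) by auto
    show "AE u in J \<rho> k. (LINT x|Filt \<rho> k (fst u). dens k (fst u, x)) * (LINT x|Filt \<nu> k (fst u). f x) = (LINT x|Filt \<rho> k (fst u). dens k (fst u, x) * f x)"
      by (rule posterior[OF \<nu> dens_meas dens_nonneg dens_le2 dens_\<nu> BL1_meas[OF f]]) (use f in \<open>simp add: BL1_def\<close>)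
  qed
  have a2: "AE u in J \<rho> k. \<forall>f\<in>L. (LINT x|Filt \<rho> k (fst u). 2 - dens k (fst u, x)) * (LINT x|Filt \<nu>' k (fst u). f x) = (LINT x|Filt \<rho> k (fst u). (2 - dens k (fst u, x)) * f x)"
    unfolding AE_ball_countable[OF L(1)]
  proof
    fix f assume "f \<in> L"
    then have f: "f \<in> BL1" using L(2) by auto
    have m: "(\<lambda>s. 2 - dens k s) \<in> borel_measurable SS" by measurable
    show "AE u in J \<rho> k. (LINT x|Filt \<rho> k (fst u). 2 - dens k (fst u, x)) * (LINT x|Filt \<nu>' k (fst u). f x) = (LINT x|Filt \<rho> k (fst u). (2 - dens k (fst u, x)) * f x)"
      by (rule posterior[OF \<nu>' m _ _ dens_\<nu>' BL1_meas[OF f]]) (use f dens_le2 dens_nonneg in \<open>auto simp: BL1_def\<close>)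
  qed
  define U where "U = {u :: 'f stream \<times> 'e. wgt k (fst u) < c}"
  have Um[measurable]: "U \<in> sets SS" unfolding U_def by (rule SS_Collect) measurable
  have pt: "AE u in J \<rho> k. (2 - wgt k (fst u)) * bl u \<le> 2 / c * V u + 4 * indicator U u"
    using a1 a2
  proof eventually_elim
    case (elim u)
    let ?h = "fst u" and ?N = "Filt \<rho> k (fst u)"
    define w where "w = wgt k ?h"
    have w: "0 \<le> w" "w \<le> 2" unfolding w_def by (rule wgt_bound)+
    interpret N: prob_space ?N by (rule PA_D[OF Fp])
    have id: "integrable ?N (\<lambda>x. dens k (?h, x))" by (rule pa_integrable[OF Fp dm dens_abs])
    have w2: "(LINT x|?N. 2 - dens k (?h, x)) = 2 - w" using id by (simp add: w_def wgt_def N.prob_space)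
    show ?case
    proof (cases "u \<in> U")
      case True
      have "(2 - w) * bl u \<le> 2 * 2" using w blb[of u] by (intro mult_mono) auto
      moreover have "0 \<le> 2 / c * V u" using c Vb by simp
      ultimately show ?thesis using True by (simp add: w_def)
    next
      case False
      then have wc: "c \<le> w" by (simp add: U_def w_def)
      have each: "w * ((2 - w) * \<bar>(LINT x|Filt \<nu> k ?h. f x) - (LINT x|Filt \<nu>' k ?h. f x)\<bar>) \<le> 2 * V u" if f: "f \<in> L" for f
      proof -
        have fB: "f \<in> BL1" using f L(2) by auto
        have [measurable]: "f \<in> borel_measurable borel" by (rule BL1_meas[OF fB])
        have f1: "\<bar>f x\<bar> \<le> 1" for x using fB by (simp add: BL1_def)
        have fi: "integrable ?N f" by (rule pa_integrable[OF Fp _ f1]) measurable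
        have b: "\<bar>dens k (?h, x) * f x\<bar> \<le> 2 * 1" for x unfolding abs_mult by (intro mult_mono dens_abs f1) auto
        have dfi: "integrable ?N (\<lambda>x. dens k (?h, x) * f x)" by (rule pa_integrable[OF Fp _ b]) measurable
        define A where "A = (LINT x|?N. dens k (?h, x) * f x)"
        define F where "F = (LINT x|?N. f x)"
        define I1 where "I1 = (LINT x|Filt \<nu> k ?h. f x)"
        define I2 where "I2 = (LINT x|Filt \<nu>' k ?h. f x)"
        have r1: "w * I1 = A" using elim(1) f by (simp add: w_def A_def I1_def)
        have "(LINT x|?N. (2 - dens k (?h, x)) * f x) = 2 * F - A"
          using fi dfi by (simp add: left_diff_distrib A_def F_def)
        then have r2: "(2 - w) * I2 = 2 * F - A" using elim(2) f w2 by (simp add: I2_def)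
        have "w * ((2 - w) * (I1 - I2)) = (2 - w) * (w * I1) - w * ((2 - w) * I2)" by (simp add: algebra_simps)
        also have "\<dots> = 2 * (A - w * F)" unfolding r1 r2 by (simp add: algebra_simps)
        also have "A - w * F = (LINT x|?N. (dens k (?h, x) - w) * f x)"
          using fi dfi by (simp add: left_diff_distrib A_def F_def)
        finally have e: "w * ((2 - w) * (I1 - I2)) = 2 * (LINT x|?N. (dens k (?h, x) - w) * f x)" .
        have "\<bar>LINT x|?N. (dens k (?h, x) - w) * f x\<bar> \<le> (LINT x|?N. \<bar>(dens k (?h, x) - w) * f x\<bar>)"
          by (rule integral_abs_bound)
        also have "\<dots> \<le> V u"
          unfolding V_def w_def[symmetric]
        proof (rule integral_mono)
          show "integrable ?N (\<lambda>x. \<bar>(dens k (?h, x) - w) * f x\<bar>)" using fi dfi by (simp add: left_diff_distrib)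
          show "integrable ?N (\<lambda>x. \<bar>dens k (?h, x) - w\<bar>)" using id by simp
          show "\<bar>(dens k (?h, x) - w) * f x\<bar> \<le> \<bar>dens k (?h, x) - w\<bar>" for x
            unfolding abs_mult using f1[of x] by (intro mult_left_le) auto
        qed
        finally have "\<bar>w * ((2 - w) * (I1 - I2))\<bar> \<le> 2 * V u" unfolding e by (simp add: abs_mult)
        then show ?thesis using w by (simp add: abs_mult I1_def I2_def)
      qed
      have "w * (2 - w) * bl u \<le> 2 * V u"
      proof (cases "w * (2 - w) = 0")
        case nz: False
        have bl_eq: "bl u = (SUP f\<in>L. \<bar>(LINT x|Filt \<nu> k ?h. f x) - (LINT x|Filt \<nu>' k ?h. f x)\<bar>)"
          unfolding bl_def by (rule bl_dist_countable[OF L(2,3) _ Filt_PA[OF \<nu>] Filt_PA[OF \<nu>']]) (rule L(4))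
        have pos: "w * (2 - w) > 0" using nz w by (simp add: less_le)
        have "bl u \<le> 2 * V u / (w * (2 - w))" unfolding bl_eq
          by (rule cSUP_least[OF L(3)]) (use each pos in \<open>simp add: pos_le_divide_eq mult_ac\<close>)
        then show ?thesis using pos by (simp add: pos_le_divide_eq mult_ac)
      qed (use Vb[of u] in auto)
      moreover have "c * ((2 - w) * bl u) \<le> w * ((2 - w) * bl u)" using wc w blb by (intro mult_right_mono) auto
      ultimately have "(2 - w) * bl u \<le> 2 / c * V u" using c by (simp add: pos_le_divide_eq mult_ac)
      then show ?thesis using False by (simp add: w_def)
    qed
  qed
  have iV: "integrable (J \<rho> k) V" using Vb by (intro pa_integrable[OF Jp Vm, of 2]) auto
  have iU: "integrable (J \<rho> k) (indicator U :: 'f stream \<times> 'e \<Rightarrow> real)"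
    by (intro pa_integrable[OF Jp, of _ 1]) (auto simp: indicator_def)
  have wbl: "\<bar>(2 - wgt k (fst u)) * bl u\<bar> \<le> 2 * 2" for u
    unfolding abs_mult using wgt_bound[of k "fst u"] blb[of u] by (intro mult_mono) auto
  have dbl: "\<bar>(2 - dens k u) * bl u\<bar> \<le> 2 * 2" for u
    unfolding abs_mult using dens_nonneg[of k u] dens_le2[of k u] blb[of u] by (intro mult_mono) auto
  have "Dist k \<nu> \<nu>' = (LINT u|J \<nu>' k. bl u)" unfolding bl_def by (rule Dist_eq_integral[OF \<nu> \<nu>'])
  also have "\<dots> = (LINT u|J \<rho> k. (2 - dens k u) * bl u)" by (rule integral_\<nu>'[OF blm])
  also have "\<dots> = (LINT u|J \<rho> k. LINT x|Filt \<rho> k (fst u). (2 - dens k (fst u, x)) * bl (fst u, x))"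
    by (rule Filt_correct_real[OF \<rho>_PA _ dbl]) measurable
  also have "\<dots> = (LINT u|J \<rho> k. (2 - wgt k (fst u)) * bl u)"
  proof (rule Bochner_Integration.integral_cong[OF refl])
    fix u :: "'f stream \<times> 'e"
    interpret N: prob_space "Filt \<rho> k (fst u)" by (rule PA_D[OF Fp])
    have id: "integrable (Filt \<rho> k (fst u)) (\<lambda>x. dens k (fst u, x))" by (rule pa_integrable[OF Fp dm dens_abs])
    show "(LINT x|Filt \<rho> k (fst u). (2 - dens k (fst u, x)) * bl (fst u, x)) = (2 - wgt k (fst u)) * bl u"
      using id by (simp add: bl_def wgt_def N.prob_space)
  qed
  also have "\<dots> \<le> (LINT u|J \<rho> k. 2 / c * V u + 4 * indicator U u)"
  proof (rule integral_mono_AE[OF _ _ pt])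
    show "integrable (J \<rho> k) (\<lambda>u. (2 - wgt k (fst u)) * bl u)"
      by (rule pa_integrable[OF Jp _ wbl]) measurable
    show "integrable (J \<rho> k) (\<lambda>u. 2 / c * V u + 4 * indicator U u)" using iV iU by simp
  qed
  also have "\<dots> = 2 / c * (LINT u|J \<rho> k. V u) + 4 * prob U" using iV iU by simp
  also have "(LINT u|J \<rho> k. V u) = spread k"
    unfolding V_def spread_def using Filt_correct_real[OF \<rho>_PA dwm dwb', of k] by simp
  finally show ?thesis by (simp add: U_def)
qed

lemma Dist_tendsto: "(\<lambda>k. Dist k \<nu> \<nu>') \<longlonglongrightarrow> 0"
proof (rule LIMSEQ_I)
  fix e :: real assume e: "e > 0"
  then have "0 < e / 8" by simp
  from small_weight_eventually[OF this] obtain c m where c: "c > 0"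
    and m: "\<And>k. k \<ge> m \<Longrightarrow> measure (J \<rho> k) {u. wgt k (fst u) < c} \<le> e / 8" by blast
  have "(\<lambda>k. 2 / c * spread k) \<longlonglongrightarrow> 2 / c * 0" by (intro tendsto_intros spread_tendsto)
  then have "eventually (\<lambda>k. 2 / c * spread k < e / 2) sequentially" using e by (intro order_tendstoD) auto
  then have "eventually (\<lambda>k. norm (Dist k \<nu> \<nu>' - 0) < e) sequentially"
    using eventually_ge_at_top[of m]
  proof eventually_elim
    case (elim k)
    have "0 \<le> Dist k \<nu> \<nu>'" using good_bound[OF good_Dist \<nu> \<nu>'] by blast
    then show ?case using Dist_bound[OF c, of k] m[OF elim(2)] elim(1) by simp
  qed
  then show "\<exists>no. \<forall>k\<ge>no. norm (Dist k \<nu> \<nu>' - 0) < e" by (auto simp: eventually_sequentially)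
qed

end

end

section \<open>The law of large numbers for the sampling step\<close>

lemma empirical_PA: "0 < N \<Longrightarrow> empirical N z \<in> space PA"
  unfolding empirical_def
  by (intro PA_I prob_space.prob_space_distr prob_space_uniform_count_measure)
    (auto simp: lessThan_empty_iff measurable_def space_uniform_count_measure sets_uniform_count_measure)

lemma integral_empirical:
  fixes f :: "'e::polish_space \<Rightarrow> real"
  assumes "f \<in> borel_measurable borel"
  shows "(LINT x|empirical N z. f x) = (\<Sum>i<N. f (z i)) / real N"
  unfolding empirical_def using assms
  by (subst integral_distr)
    (auto simp: integral_uniform_count_measure measurable_def space_uniform_count_measure sets_uniform_count_measure)

abbreviation samples :: "nat \<Rightarrow> 'e::polish_space measure \<Rightarrow> (nat \<Rightarrow> 'e) measure" where
  "samples N \<rho> \<equiv> PiM {..<N} (\<lambda>_. \<rho>)"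

abbreviation ZS :: "nat \<Rightarrow> (nat \<Rightarrow> 'e::polish_space) measure" where
  "ZS N \<equiv> PiM {..<N} (\<lambda>_. borel)"

lemma empirical_measurable:
  assumes "0 < N"
  shows "empirical N \<in> ZS N \<rightarrow>\<^sub>M (PA :: 'e::polish_space measure measure)"
proof (rule measurable_prob_algebraI)
  show "prob_space (empirical N z)" for z :: "nat \<Rightarrow> 'e" by (rule PA_D[OF empirical_PA[OF assms]])
  show "empirical N \<in> ZS N \<rightarrow>\<^sub>M subprob_algebra (borel :: 'e measure)"
  proof (rule measurable_subprob_algebra)
    fix A :: "'e set" assume [measurable]: "A \<in> sets borel"
    have "(\<lambda>z. (\<Sum>i<N. indicator A (z i)) / of_nat N :: ennreal) \<in> borel_measurable (ZS N)" by measurable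
    then show "(\<lambda>z. emeasure (empirical N z) A) \<in> borel_measurable (ZS N)"
      using assms by (simp add: emeasure_empirical)
  qed (use PA_D[OF empirical_PA[OF assms]] in \<open>auto intro: prob_space_imp_subprob_space\<close>)
qed

lemma samples_prob:
  assumes \<rho>: "\<rho> \<in> space PA" shows "samples N \<rho> \<in> space (prob_algebra (ZS N))"
proof -
  have "prob_space (samples N \<rho>)" by (intro prob_space_PiM PA_D \<rho>)
  moreover have "sets (samples N \<rho>) = sets (ZS N)" by (intro sets_PiM_cong refl PA_D(2)[OF \<rho>])
  ultimately show ?thesis by (simp add: space_prob_algebra)
qed

lemma sets_samples:
  "sets (ZS N :: (nat \<Rightarrow> 'e::polish_space) measure) =
     sigma_sets (Pi\<^sub>E {..<N} (\<lambda>_. UNIV)) {Pi\<^sub>E {..<N} E | E. \<forall>i\<in>{..<N}. E i \<in> sets (borel :: 'e measure)}"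
  unfolding sets_PiM prod_algebra_eq_finite[OF finite_lessThan] by (simp add: Pi_iff)

lemma Int_stable_boxes: "Int_stable {Pi\<^sub>E I E | E. \<forall>i\<in>I. E i \<in> sets M}"
proof (rule Int_stableI)
  fix a b assume "a \<in> {Pi\<^sub>E I E | E. \<forall>i\<in>I. E i \<in> sets M}" "b \<in> {Pi\<^sub>E I E | E. \<forall>i\<in>I. E i \<in> sets M}"
  then obtain E F where "a = Pi\<^sub>E I E" "b = Pi\<^sub>E I F" "\<forall>i\<in>I. E i \<in> sets M" "\<forall>i\<in>I. F i \<in> sets M" by auto
  then show "a \<inter> b \<in> {Pi\<^sub>E I E | E. \<forall>i\<in>I. E i \<in> sets M}"
    by (auto simp: PiE_Int intro!: exI[of _ "\<lambda>i. E i \<inter> F i"])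
qed

lemma samples_kernel:
  assumes K: "K \<in> M \<rightarrow>\<^sub>M PA"
  shows "(\<lambda>x. samples N (K x)) \<in> M \<rightarrow>\<^sub>M prob_algebra (ZS N :: (nat \<Rightarrow> 'e::polish_space) measure)"
proof -
  let ?G = "{Pi\<^sub>E {..<N} E | E. \<forall>i\<in>{..<N}. E i \<in> sets (borel :: 'e measure)}"
  show ?thesis
  proof (rule measurable_prob_algebra_generated)
    show "sets (ZS N :: (nat \<Rightarrow> 'e) measure) = sigma_sets (Pi\<^sub>E {..<N} (\<lambda>_. UNIV)) ?G" by (rule sets_samples)
    show "Int_stable ?G" by (rule Int_stable_boxes)
    show "?G \<subseteq> Pow (Pi\<^sub>E {..<N} (\<lambda>_. UNIV))" by auto
    fix a assume a: "a \<in> space M"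
    then have "K a \<in> space PA" by (rule measurable_space[OF K])
    from samples_prob[OF this] show "prob_space (samples N (K a))" "sets (samples N (K a)) = sets (ZS N)"
      by (simp_all add: space_prob_algebra)
  next
    fix A assume "A \<in> ?G"
    then obtain E where A: "A = Pi\<^sub>E {..<N} E" and E: "\<And>i. i < N \<Longrightarrow> E i \<in> sets borel" by auto
    have "(\<lambda>x. \<Prod>i<N. emeasure (K x) (E i)) \<in> borel_measurable M"
      using E by (intro borel_measurable_prod_ennreal measurable_emeasure_kernel[OF measurable_prob_algebraD[OF K]]) auto
    also have "?this \<longleftrightarrow> (\<lambda>x. emeasure (samples N (K x)) A) \<in> borel_measurable M"
    proof (rule measurable_cong)
      fix x assume "x \<in> space M"
      then have k: "K x \<in> space PA" by (rule measurable_space[OF K])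
      interpret p: prob_space "K x" by (rule PA_D[OF k])
      interpret product_sigma_finite "\<lambda>_. K x" ..
      show "(\<Prod>i<N. emeasure (K x) (E i)) = emeasure (samples N (K x)) A"
        unfolding A using E PA_D(2)[OF k] by (subst emeasure_PiM) auto
    qed
    finally show "(\<lambda>x. emeasure (samples N (K x)) A) \<in> borel_measurable M" .
  qed
qed

text \<open>Off-diagonal terms of the squared sum vanish by independence, and each of the
  \<open>N\<close> diagonal terms is at most \<open>4\<close> because the centred function is
  bounded by \<open>2\<close>. The bound does not depend on \<open>\<rho>\<close>.\<close>

lemma sample_variance:
  fixes f :: "'e::polish_space \<Rightarrow> real"
  assumes \<rho>: "\<rho> \<in> space PA" and f[measurable]: "f \<in> borel_measurable borel" and B: "\<And>x. \<bar>f x\<bar> \<le> 1" and N: "0 < N"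
  shows "(LINT z|samples N \<rho>. ((LINT x|empirical N z. f x) - (LINT x|\<rho>. f x))\<^sup>2) \<le> 4 / real N"
proof -
  interpret p: prob_space \<rho> by (rule PA_D[OF \<rho>])
  interpret S: product_sigma_finite "\<lambda>_::nat. \<rho>" ..
  have [measurable_cong]: "sets \<rho> = sets borel" by (rule PA_D[OF \<rho>])
  define m where "m = (LINT x|\<rho>. f x)"
  define g where "g x = f x - m" for x
  have gm[measurable]: "g \<in> borel_measurable borel" unfolding g_def by measurable
  have m1: "\<bar>m\<bar> \<le> 1" unfolding m_def by (rule pa_integral_le[OF \<rho> f B])
  have gb: "\<bar>g x\<bar> \<le> 2" for x using B[of x] m1 unfolding g_def by linarith
  have fi: "integrable \<rho> f" by (rule pa_integrable[OF \<rho> f B])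
  have gi: "integrable \<rho> g" by (rule pa_integrable[OF \<rho> gm gb])
  have g0: "(LINT x|\<rho>. g x) = 0" using fi by (simp add: g_def m_def p.prob_space)
  have g2b: "\<bar>g x * g y\<bar> \<le> 2 * 2" for x y unfolding abs_mult by (intro mult_mono gb) auto
  interpret P: prob_space "samples N \<rho>" by (intro prob_space_PiM p.prob_space_axioms)
  have pij: "integrable (samples N \<rho>) (\<lambda>z. g (z i) * g (z j))" if "i < N" "j < N" for i j
    using that g2b by (intro P.integrable_const_bound[of _ 4]) (auto intro!: AE_I2)
  have ij: "(LINT z|samples N \<rho>. g (z i) * g (z j)) \<le> (if i = j then 4 else 0)" if "i < N" "j < N" for i j
  proof (cases "i = j")
    case True
    have "\<bar>LINT z|samples N \<rho>. g (z i) * g (z j)\<bar> \<le> 2 * 2"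
      using that by (intro pa_integral_le[where A="samples N \<rho>"] g2b) (auto simp: space_prob_algebra P.prob_space_axioms)
    then show ?thesis using True by simp
  next
    case False
    \<comment> \<open>Writing \<open>g (z i) * g (z j)\<close> as a product over all coordinates,
      with \<open>1\<close> elsewhere, makes the product formula for integrals applicable.\<close>
    define F where "F k = (if k = i \<or> k = j then g else (\<lambda>_. 1))" for k
    have "g (z i) * g (z j) = (\<Prod>k<N. F k (z k))" for z
    proof -
      have "(\<Prod>k<N. F k (z k)) = (\<Prod>k\<in>{i, j}. F k (z k))"
        using that by (intro prod.mono_neutral_right) (auto simp: F_def)
      then show ?thesis using False by (simp add: F_def)
    qed
    then have "(LINT z|samples N \<rho>. g (z i) * g (z j)) = (LINT z|samples N \<rho>. (\<Prod>k<N. F k (z k)))" by simp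
    also have "\<dots> = (\<Prod>k<N. LINT x|\<rho>. F k x)"
      by (rule S.product_integral_prod) (auto simp: F_def gi)
    also have "\<dots> = 0"
    proof (rule prod_zero)
      show "\<exists>k\<in>{..<N}. (LINT x|\<rho>. F k x) = 0" using that g0 by (intro bexI[of _ i]) (auto simp: F_def)
    qed simp
    finally show ?thesis by simp
  qed
  have e: "(LINT x|empirical N z. f x) - m = (\<Sum>i<N. g (z i)) / real N" for z
    using N by (simp add: integral_empirical[OF f] g_def sum_subtractf diff_divide_distrib)
  have "(LINT z|samples N \<rho>. ((LINT x|empirical N z. f x) - m)\<^sup>2) =
     (LINT z|samples N \<rho>. (\<Sum>i<N. \<Sum>j<N. g (z i) * g (z j)) / (real N)\<^sup>2)"
    unfolding e by (simp add: power2_eq_square sum_product)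
  also have "\<dots> = (\<Sum>i<N. \<Sum>j<N. LINT z|samples N \<rho>. g (z i) * g (z j)) / (real N)\<^sup>2"
  proof -
    have "integrable (samples N \<rho>) (\<lambda>z. \<Sum>j<N. g (z i) * g (z j))" if "i < N" for i
      using that by (intro Bochner_Integration.integrable_sum pij) auto
    then have "(LINT z|samples N \<rho>. (\<Sum>i<N. \<Sum>j<N. g (z i) * g (z j))) = (\<Sum>i<N. LINT z|samples N \<rho>. (\<Sum>j<N. g (z i) * g (z j)))"
      by (intro Bochner_Integration.integral_sum) auto
    also have "\<dots> = (\<Sum>i<N. \<Sum>j<N. LINT z|samples N \<rho>. g (z i) * g (z j))"
      by (intro sum.cong refl Bochner_Integration.integral_sum pij) auto
    finally show ?thesis by simp
  qed
  also have "\<dots> \<le> (\<Sum>i<N. \<Sum>j<N. if i = j then 4 else 0) / (real N)\<^sup>2"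
    by (intro divide_right_mono sum_mono ij) auto
  also have "\<dots> = 4 / real N" using N by (simp add: power2_eq_square)
  finally show ?thesis unfolding m_def .
qed

text \<open>Jensen's inequality, in the form that a variance is nonnegative.\<close>

lemma sample_deviation:
  fixes f :: "'e::polish_space \<Rightarrow> real"
  assumes \<rho>: "\<rho> \<in> space PA" and f[measurable]: "f \<in> borel_measurable borel" and B: "\<And>x. \<bar>f x\<bar> \<le> 1" and N: "0 < N"
  shows "(LINT z|samples N \<rho>. \<bar>(LINT x|empirical N z. f x) - (LINT x|\<rho>. f x)\<bar>) \<le> sqrt (4 / real N)"
proof -
  let ?d = "\<lambda>z. (LINT x|empirical N z. f x) - (LINT x|\<rho>. f x)"
  interpret P: prob_space "samples N \<rho>" using samples_prob[OF \<rho>, of N] by (simp add: space_prob_algebra)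
  have dm: "?d \<in> borel_measurable (ZS N)"
    unfolding integral_empirical[OF f] by measurable
  have db: "\<bar>?d z\<bar> \<le> 2" for z
    using pa_integral_le[OF empirical_PA[OF N] f B, of z] pa_integral_le[OF \<rho> f B] by linarith
  have d2b: "\<bar>(?d z)\<^sup>2\<bar> \<le> 4" for z using power_mono[OF db[of z] abs_ge_zero, of 2] by simp
  have i2: "integrable (samples N \<rho>) (\<lambda>z. (?d z)\<^sup>2)"
    using dm by (intro pa_integrable[OF samples_prob[OF \<rho>] _ d2b]) simp
  have i1: "integrable (samples N \<rho>) (\<lambda>z. \<bar>?d z\<bar>)"
    using pa_integrable[OF samples_prob[OF \<rho>] dm db] by simp
  have "(LINT z|samples N \<rho>. \<bar>?d z\<bar>)\<^sup>2 \<le> (LINT z|samples N \<rho>. (?d z)\<^sup>2)"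
    using P.variance_positive[of "\<lambda>z. \<bar>?d z\<bar>"] P.variance_eq[OF i1] i2 by simp
  also have "\<dots> \<le> 4 / real N" by (rule sample_variance[OF \<rho> f B N])
  finally show ?thesis by (rule real_le_rsqrt)
qed

lemma bl_dist_empirical_meas:
  assumes "0 < N" "\<rho> \<in> space PA"
  shows "(\<lambda>z. bl_dist (empirical N z) \<rho>) \<in> borel_measurable (ZS N)"
proof -
  have "(\<lambda>z. (empirical N z, \<rho>)) \<in> ZS N \<rightarrow>\<^sub>M PA \<Otimes>\<^sub>M PA"
    by (rule measurable_Pair[OF empirical_measurable[OF assms(1)] measurable_const[OF assms(2)]])
  from measurable_compose[OF this bl_dist_measurable] show ?thesis by simp
qed

text \<open>The sampled law changes with \<open>j\<close>, so no fixed i.i.d. sequence is involved.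
  The deviation bound is uniform in the law, and \<open>bl_dist_cover\<close> reduces the distance
  to finitely many test functions determined by the limit \<open>l\<close>.\<close>

lemma law_of_large_numbers:
  fixes \<rho> :: "nat \<Rightarrow> 'e::polish_space measure"
  assumes \<rho>: "\<And>j. \<rho> j \<in> space PA" and l: "l \<in> space PA" and w: "wconv \<rho> l"
    and N0: "\<And>j. 0 < N j" and N: "filterlim N at_top sequentially"
  shows "(\<lambda>j. LINT z|samples (N j) (\<rho> j). bl_dist (empirical (N j) z) l) \<longlonglongrightarrow> 0"
proof (rule LIMSEQ_I)
  fix e :: real assume e: "e > 0"
  obtain k n where kn: "\<And>\<nu>. \<nu> \<in> space PA \<Longrightarrow>
      bl_dist \<nu> l \<le> e / 2 + 3 * (\<Sum>i\<le>n. \<bar>(LINT x|\<nu>. cover k i x) - (LINT x|l. cover k i x)\<bar>)"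
    using bl_dist_cover[OF l, of "e / 2"] e by auto
  define D where "D j = 3 * (\<Sum>i\<le>n. sqrt (4 / real (N j)) + \<bar>(LINT x|\<rho> j. cover k i x) - (LINT x|l. cover k i x)\<bar>)" for j
  have "D \<longlonglongrightarrow> 3 * (\<Sum>i\<le>n. sqrt 0 + \<bar>(LINT x|l. cover k i x) - (LINT x|l. cover k i x)\<bar>)"
    unfolding D_def
  proof (intro tendsto_intros)
    show "(\<lambda>j. 4 / real (N j)) \<longlonglongrightarrow> 0"
      by (intro tendsto_divide_0[OF tendsto_const] filterlim_at_top_imp_at_infinity filterlim_compose[OF filterlim_real_sequentially N])
    show "(\<lambda>j. LINT x|\<rho> j. cover k i x) \<longlonglongrightarrow> (LINT x|l. cover k i x)" for i
      using w cover_cont[of k i] unfolding wconv_def by (auto simp: bounded_iff intro!: exI[of _ 1] cover_abs)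
  qed
  then have "eventually (\<lambda>j. D j < e / 2) sequentially" by (rule order_tendstoD(2)) (use e in simp)
  then have "eventually (\<lambda>j. norm ((LINT z|samples (N j) (\<rho> j). bl_dist (empirical (N j) z) l) - 0) < e) sequentially"
  proof eventually_elim
    case (elim j)
    let ?P = "samples (N j) (\<rho> j)"
    interpret P: prob_space ?P using samples_prob[OF \<rho>, of "N j" j] by (simp add: space_prob_algebra)
    define d where "d i z = (LINT x|empirical (N j) z. cover k i x) - (LINT x|\<rho> j. cover k i x)" for i and z :: "nat \<Rightarrow> 'e"
    define b where "b i = \<bar>(LINT x|\<rho> j. cover k i x) - (LINT x|l. cover k i x)\<bar>" for i
    have dm: "d i \<in> borel_measurable (ZS (N j))" for i
      unfolding d_def integral_empirical[OF cover_meas] using cover_meas[of k i] by measurable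
    have db: "\<bar>d i z\<bar> \<le> 2" for i z
      using pa_integral_le[OF empirical_PA[OF N0] cover_meas cover_abs, of j z k i] pa_integral_le[OF \<rho> cover_meas cover_abs, of j k i]
      unfolding d_def by linarith
    have di: "integrable ?P (\<lambda>z. \<bar>d i z\<bar>)" for i using pa_integrable[OF samples_prob[OF \<rho>] dm db] by simp
    have bi: "integrable ?P (\<lambda>z. bl_dist (empirical (N j) z) l)"
      by (rule pa_integrable[OF samples_prob[OF \<rho>] bl_dist_empirical_meas[OF N0 l], of _ 2])
        (use bl_dist_nonneg[OF empirical_PA[OF N0] l] bl_dist_le2[OF empirical_PA[OF N0] l] in auto)
    have "(LINT z|?P. bl_dist (empirical (N j) z) l) \<le> (LINT z|?P. e / 2 + 3 * (\<Sum>i\<le>n. \<bar>d i z\<bar> + b i))"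
    proof (rule integral_mono[OF bi])
      show "integrable ?P (\<lambda>z. e / 2 + 3 * (\<Sum>i\<le>n. \<bar>d i z\<bar> + b i))" using di by simp
      fix z
      have "(\<Sum>i\<le>n. \<bar>(LINT x|empirical (N j) z. cover k i x) - (LINT x|l. cover k i x)\<bar>) \<le> (\<Sum>i\<le>n. \<bar>d i z\<bar> + b i)"
        unfolding d_def b_def by (intro sum_mono) linarith
      then show "bl_dist (empirical (N j) z) l \<le> e / 2 + 3 * (\<Sum>i\<le>n. \<bar>d i z\<bar> + b i)"
        using kn[OF empirical_PA[OF N0], of j z] by linarith
    qed
    also have "\<dots> = e / 2 + 3 * (\<Sum>i\<le>n. (LINT z|?P. \<bar>d i z\<bar>) + b i)"
      using di by (simp add: P.prob_space)
    also have "\<dots> \<le> e / 2 + D j"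
      unfolding D_def d_def b_def
      by (intro add_left_mono mult_left_mono sum_mono add_right_mono sample_deviation[OF \<rho> cover_meas cover_abs N0]) simp
    finally have "(LINT z|?P. bl_dist (empirical (N j) z) l) < e" using elim by argo
    moreover have "0 \<le> (LINT z|?P. bl_dist (empirical (N j) z) l)"
      using bl_dist_nonneg[OF empirical_PA[OF N0] l] by (intro integral_nonneg_AE) auto
    ultimately show ?case by simp
  qed
  then show "\<exists>no. \<forall>j\<ge>no. norm ((LINT z|samples (N j) (\<rho> j). bl_dist (empirical (N j) z) l) - 0) < e"
    by (auto simp: eventually_sequentially)
qed

section \<open>One step of the particle system and its exact limit\<close>

context filter_model
begin

text \<open>The first law is replaced by the empirical measure of \<open>N\<close> draws while the
  second is kept exact; sampling precedes the common update.\<close>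

definition particle_evol :: "nat \<Rightarrow> ('e measure \<Rightarrow> 'e measure \<Rightarrow> real) \<Rightarrow> 'e measure \<Rightarrow> 'e measure \<Rightarrow> real" where
  "particle_evol N \<Psi> \<rho> \<rho>' = (LINT z|samples N \<rho>. evol \<Psi> (empirical N z) \<rho>')"

lemma evol_bound:
  assumes "good \<Psi>" "m \<in> space PA" "\<rho>' \<in> space PA" shows "0 \<le> evol \<Psi> m \<rho>'" "evol \<Psi> m \<rho>' \<le> 2"
proof -
  have b: "0 \<le> \<Psi> (bayes \<Upsilon> y m) (bayes \<Upsilon> y \<rho>')" "\<Psi> (bayes \<Upsilon> y m) (bayes \<Upsilon> y \<rho>') \<le> 2" for y
    using good_bound[OF assms(1) bayes_PA[OF assms(2)] bayes_PA[OF assms(3)]] by blast+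
  show "0 \<le> evol \<Psi> m \<rho>'" "evol \<Psi> m \<rho>' \<le> 2"
    unfolding evol_def
    using pa_integral01[OF bind\<Phi>_PA[OF assms(3)] evol_integrand_meas[OF assms] b] by simp_all
qed

lemma evol_meas:
  assumes g: "good \<Psi>"
  shows "(\<lambda>(m, \<rho>'). evol \<Psi> m \<rho>') \<in> borel_measurable (PA \<Otimes>\<^sub>M PA)"
proof -
  have snd: "(\<lambda>p. snd p \<bind> \<Phi>) \<in> (PA \<Otimes>\<^sub>M PA :: ('e measure \<times> 'e measure) measure) \<rightarrow>\<^sub>M PA"
    by (intro measurable_bind_prob_space[OF _ \<Phi>_meas] measurable_snd)
  have "(\<lambda>p. evol \<Psi> (fst p) (snd p)) \<in> borel_measurable (PA \<Otimes>\<^sub>M PA)"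
    unfolding evol_def
  proof (rule integral_kernel_measurable[where R=borel, OF _ snd])
    show "(\<lambda>(p, y). \<Psi> (bayes \<Upsilon> y (fst p)) (bayes \<Upsilon> y (snd p))) \<in> borel_measurable ((PA \<Otimes>\<^sub>M PA) \<Otimes>\<^sub>M borel)"
      unfolding split_beta'
      by (intro good_meas[OF g] bayes_measurable' measurable_snd
          measurable_compose[OF measurable_fst measurable_fst] measurable_compose[OF measurable_fst measurable_snd])
  qed
  then show ?thesis by (simp add: split_beta')
qed

lemma evol_empirical_meas:
  assumes g: "good \<Psi>" and N: "0 < N" and \<rho>': "\<rho>' \<in> space PA"
  shows "(\<lambda>z. evol \<Psi> (empirical N z) \<rho>') \<in> borel_measurable (ZS N)"
proof -
  have "(\<lambda>z. (empirical N z, \<rho>')) \<in> ZS N \<rightarrow>\<^sub>M PA \<Otimes>\<^sub>M PA"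
    by (rule measurable_Pair[OF empirical_measurable[OF N] measurable_const[OF \<rho>']])
  from measurable_compose[OF this evol_meas[OF g]] show ?thesis by simp
qed

lemma evol_tendsto:
  assumes g: "good \<Psi>" and \<rho>: "\<And>n. \<rho> n \<in> space PA" "l \<in> space PA" "wconv \<rho> l"
    and \<rho>': "\<And>n. \<rho>' n \<in> space PA" "l' \<in> space PA" "wconv \<rho>' l'"
  shows "(\<lambda>n. evol \<Psi> (\<rho> n) (\<rho>' n)) \<longlonglongrightarrow> evol \<Psi> l l'"
proof -
  have b: "\<bar>\<Psi> (bayes \<Upsilon> y a) (bayes \<Upsilon> y b)\<bar> \<le> 2" if "a \<in> space PA" "b \<in> space PA" for a b y
    using good_bound[OF g, of "bayes \<Upsilon> y a" "bayes \<Upsilon> y b"] that by auto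
  show ?thesis
    unfolding evol_def
    using \<rho> \<rho>' by (intro integral_evid_tendsto[where B=2] evol_integrand_meas[OF g] b good_conv[OF g] wconv_bayes) auto
qed

text \<open>Sequential continuity of \<open>evol\<close> turned into a neighbourhood statement:
  counterexamples at the radii \<open>1 / Suc n\<close> would form a sequence converging to
  \<open>l\<close>, against \<open>evol_tendsto\<close>. The neighbourhood works for all late
  \<open>j\<close> and all \<open>m\<close> in it, so that a random empirical measure can be
  inserted for \<open>m\<close>.\<close>

lemma evol_modulus:
  assumes g: "good \<Psi>" and l: "l \<in> space PA"
    and \<rho>': "\<And>n. \<rho>' n \<in> space PA" "l' \<in> space PA" "wconv \<rho>' l'" and e: "e > 0"
  shows "\<exists>\<delta>>0. \<exists>J. \<forall>j\<ge>J. \<forall>m\<in>space PA. bl_dist m l < \<delta> \<longrightarrow> \<bar>evol \<Psi> m (\<rho>' j) - evol \<Psi> l l'\<bar> < e"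
proof (rule ccontr)
  assume neg: "\<not> ?thesis"
  have "\<forall>n. \<exists>j m. j \<ge> n \<and> m \<in> space PA \<and> bl_dist m l < 1 / real (Suc n) \<and> \<not> \<bar>evol \<Psi> m (\<rho>' j) - evol \<Psi> l l'\<bar> < e"
  proof
    fix n
    have "\<not> (\<forall>j\<ge>n. \<forall>m\<in>space PA. bl_dist m l < 1 / real (Suc n) \<longrightarrow> \<bar>evol \<Psi> m (\<rho>' j) - evol \<Psi> l l'\<bar> < e)"
      using neg by (metis of_nat_0_less_iff zero_less_Suc zero_less_divide_1_iff)
    then show "\<exists>j m. j \<ge> n \<and> m \<in> space PA \<and> bl_dist m l < 1 / real (Suc n) \<and> \<not> \<bar>evol \<Psi> m (\<rho>' j) - evol \<Psi> l l'\<bar> < e" by auto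
  qed
  then obtain r where "\<forall>n. \<exists>m. r n \<ge> n \<and> m \<in> space PA \<and> bl_dist m l < 1 / real (Suc n) \<and> \<not> \<bar>evol \<Psi> m (\<rho>' (r n)) - evol \<Psi> l l'\<bar> < e"
    by (simp only: choice_iff) blast
  then obtain m where "\<forall>n. r n \<ge> n \<and> m n \<in> space PA \<and> bl_dist (m n) l < 1 / real (Suc n) \<and> \<not> \<bar>evol \<Psi> (m n) (\<rho>' (r n)) - evol \<Psi> l l'\<bar> < e"
    by (simp only: choice_iff) blast
  then have r: "r n \<ge> n" and m: "m n \<in> space PA" "bl_dist (m n) l < 1 / real (Suc n)"
    "\<not> \<bar>evol \<Psi> (m n) (\<rho>' (r n)) - evol \<Psi> l l'\<bar> < e" for n by blast+
  have "filterlim r at_top sequentially" by (rule filterlim_at_top_mono[OF filterlim_ident]) (use r in auto)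
  then have w: "wconv (\<lambda>n. \<rho>' (r n)) l'" using \<rho>'(3) unfolding wconv_def by (auto intro: filterlim_compose)
  have "(\<lambda>n. bl_dist (m n) l) \<longlonglongrightarrow> 0"
  proof (rule tendsto_sandwich[OF _ _ tendsto_const LIMSEQ_inverse_real_of_nat])
    show "eventually (\<lambda>n. 0 \<le> bl_dist (m n) l) sequentially" by (simp add: bl_dist_nonneg m(1) l)
    show "eventually (\<lambda>n. bl_dist (m n) l \<le> inverse (real (Suc n))) sequentially"
      using m(2) by (auto simp: inverse_eq_divide intro!: always_eventually less_imp_le)
  qed
  then have "wconv m l" by (rule bl_dist_imp_wconv[OF m(1) l])
  then have "(\<lambda>n. evol \<Psi> (m n) (\<rho>' (r n))) \<longlonglongrightarrow> evol \<Psi> l l'"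
    using w by (intro evol_tendsto[OF g] m l \<rho>')
  then obtain n where "\<bar>evol \<Psi> (m n) (\<rho>' (r n)) - evol \<Psi> l l'\<bar> < e"
    using LIMSEQ_D[OF _ e, of "\<lambda>n. evol \<Psi> (m n) (\<rho>' (r n))" "evol \<Psi> l l'"] by auto
  then show False using m(3) by blast
qed

lemma particle_evol_tendsto:
  assumes g: "good \<Psi>" and \<rho>: "\<And>n. \<rho> n \<in> space PA" "l \<in> space PA" "wconv \<rho> l"
    and \<rho>': "\<And>n. \<rho>' n \<in> space PA" "l' \<in> space PA" "wconv \<rho>' l'"
    and N0: "\<And>j. 0 < N j" and N: "filterlim N at_top sequentially"
  shows "(\<lambda>n. particle_evol (N n) \<Psi> (\<rho> n) (\<rho>' n)) \<longlonglongrightarrow> evol \<Psi> l l'"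
proof (rule LIMSEQ_I)
  fix e :: real assume e: "e > 0"
  obtain \<delta> J where \<delta>: "\<delta> > 0" and J: "\<And>j m. j \<ge> J \<Longrightarrow> m \<in> space PA \<Longrightarrow> bl_dist m l < \<delta> \<Longrightarrow> \<bar>evol \<Psi> m (\<rho>' j) - evol \<Psi> l l'\<bar> < e / 2"
    using evol_modulus[OF g \<rho>(2) \<rho>', of "e/2"] e by auto
  have "(\<lambda>j. 2 / \<delta> * (LINT z|samples (N j) (\<rho> j). bl_dist (empirical (N j) z) l)) \<longlonglongrightarrow> 2 / \<delta> * 0"
    by (intro tendsto_mult_left law_of_large_numbers \<rho> N0 N)
  then have "eventually (\<lambda>j. 2 / \<delta> * (LINT z|samples (N j) (\<rho> j). bl_dist (empirical (N j) z) l) < e / 2) sequentially"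
    using e by (intro order_tendstoD) auto
  then have "eventually (\<lambda>j. norm (particle_evol (N j) \<Psi> (\<rho> j) (\<rho>' j) - evol \<Psi> l l') < e) sequentially"
    using eventually_ge_at_top[of J]
  proof eventually_elim
    case (elim j)
    let ?P = "samples (N j) (\<rho> j)"
    interpret P: prob_space ?P using samples_prob[OF \<rho>(1), of "N j" j] by (simp add: space_prob_algebra)
    let ?h = "\<lambda>z. evol \<Psi> (empirical (N j) z) (\<rho>' j)"
    have hb: "0 \<le> ?h z" "?h z \<le> 2" for z by (intro evol_bound g empirical_PA N0 \<rho>')+
    have lb: "0 \<le> evol \<Psi> l l'" "evol \<Psi> l l' \<le> 2" by (intro evol_bound g \<rho> \<rho>')+
    have hm: "?h \<in> borel_measurable (ZS (N j))" by (rule evol_empirical_meas[OF g N0 \<rho>'(1)])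
    have hi: "integrable ?P ?h" by (rule pa_integrable[OF samples_prob[OF \<rho>(1)] hm, of 2]) (use hb in auto)
    have bl0: "0 \<le> bl_dist (empirical (N j) z) l" for z by (intro bl_dist_nonneg empirical_PA N0 \<rho>)
    have bi: "integrable ?P (\<lambda>z. bl_dist (empirical (N j) z) l)"
      by (rule pa_integrable[OF samples_prob[OF \<rho>(1)] bl_dist_empirical_meas[OF N0 \<rho>(2)], of _ 2])
        (use bl0 bl_dist_le2[OF empirical_PA[OF N0] \<rho>(2)] in auto)
    have "\<bar>particle_evol (N j) \<Psi> (\<rho> j) (\<rho>' j) - evol \<Psi> l l'\<bar> = \<bar>LINT z|?P. ?h z - evol \<Psi> l l'\<bar>"
      using hi by (simp add: particle_evol_def P.prob_space)
    also have "\<dots> \<le> (LINT z|?P. \<bar>?h z - evol \<Psi> l l'\<bar>)" by (rule integral_abs_bound)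
    \<comment> \<open>Within distance \<open>\<delta>\<close> of \<open>l\<close> the modulus gives
      \<open>e / 2\<close>; farther away both values lie in \<open>[0,2]\<close>, and their gap is
      dominated by \<open>2 / \<delta>\<close> times the distance.\<close>
    also have "\<dots> \<le> (LINT z|?P. e / 2 + 2 / \<delta> * bl_dist (empirical (N j) z) l)"
    proof (rule integral_mono)
      show "integrable ?P (\<lambda>z. \<bar>?h z - evol \<Psi> l l'\<bar>)" using hi by simp
      show "integrable ?P (\<lambda>z. e / 2 + 2 / \<delta> * bl_dist (empirical (N j) z) l)" using bi by simp
      fix z
      show "\<bar>?h z - evol \<Psi> l l'\<bar> \<le> e / 2 + 2 / \<delta> * bl_dist (empirical (N j) z) l"
      proof (cases "bl_dist (empirical (N j) z) l < \<delta>")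
        case True
        have "0 \<le> 2 / \<delta> * bl_dist (empirical (N j) z) l" using \<delta> bl0 by simp
        then show ?thesis using J[OF elim(2) empirical_PA[OF N0] True] by linarith
      next
        case False
        then have "2 \<le> 2 / \<delta> * bl_dist (empirical (N j) z) l" using \<delta> by (simp add: field_simps)
        then show ?thesis using hb[of z] lb e by auto
      qed
    qed
    also have "\<dots> = e / 2 + 2 / \<delta> * (LINT z|?P. bl_dist (empirical (N j) z) l)" using bi by (simp add: P.prob_space)
    also have "\<dots> < e" using elim(1) by simp
    finally show ?case by simp
  qed
  then show "\<exists>no. \<forall>j\<ge>no. norm (particle_evol (N j) \<Psi> (\<rho> j) (\<rho>' j) - evol \<Psi> l l') < e"
    by (auto simp: eventually_sequentially)
qed

lemma particle_evol_bound:
  assumes "good \<Psi>" "0 < N" "\<rho> \<in> space PA" "\<rho>' \<in> space PA"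
  shows "0 \<le> particle_evol N \<Psi> \<rho> \<rho>'" "particle_evol N \<Psi> \<rho> \<rho>' \<le> 2"
proof -
  have hb: "0 \<le> evol \<Psi> (empirical N z) \<rho>'" "evol \<Psi> (empirical N z) \<rho>' \<le> 2" for z
    by (intro evol_bound assms empirical_PA)+
  show "0 \<le> particle_evol N \<Psi> \<rho> \<rho>'" "particle_evol N \<Psi> \<rho> \<rho>' \<le> 2"
    unfolding particle_evol_def
    using pa_integral01[OF samples_prob[OF assms(3)] evol_empirical_meas[OF assms(1,2,4)] hb] by simp_all
qed

end

section \<open>Disintegration along a filtration\<close>

text \<open>The densities \<open>f\<close> and \<open>g\<close> define measures with the same
  restriction to \<open>G\<close>, hence with the same integrals of all functions measurable with
  respect to \<open>G\<close>.\<close>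

lemma nn_integral_subalgebra_eqI:
  fixes f g :: "'a \<Rightarrow> ennreal"
  assumes sub: "subalgebra M G" and f: "f \<in> borel_measurable M" and g: "g \<in> borel_measurable M"
    and eq: "\<And>A. A \<in> sets G \<Longrightarrow> (\<integral>\<^sup>+x. indicator A x * f x \<partial>M) = (\<integral>\<^sup>+x. indicator A x * g x \<partial>M)"
    and V: "V \<in> borel_measurable G"
  shows "(\<integral>\<^sup>+x. V x * f x \<partial>M) = (\<integral>\<^sup>+x. V x * g x \<partial>M)"
proof -
  have subd: "subalgebra (density M h) G" for h using sub by (simp add: subalgebra_def)
  have em: "emeasure (restr_to_subalg (density M h) G) A = (\<integral>\<^sup>+x. indicator A x * h x \<partial>M)"
    if "A \<in> sets G" "h \<in> borel_measurable M" for A h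
    using emeasure_restr_to_subalg[OF subd that(1)] that sub
    by (auto simp: emeasure_density mult.commute subalgebra_def)
  have "restr_to_subalg (density M f) G = restr_to_subalg (density M g) G"
    by (rule measure_eqI) (simp_all add: sets_restr_to_subalg[OF subd] em f g eq)
  then have "(\<integral>\<^sup>+x. V x \<partial>density M f) = (\<integral>\<^sup>+x. V x \<partial>density M g)"
    by (simp flip: nn_integral_subalgebra2[OF subd V])
  then show ?thesis
    using measurable_from_subalg[OF sub V] f g by (simp add: nn_integral_density mult.commute)
qed

text \<open>A conditional law in integrated form. The joint law of \<open>(x, Z x)\<close> and the
  one built from \<open>\<kappa>\<close> agree on rectangles of generating sets, hence everywhere.
  Working with generators allows the events of the past to be treated one family at a time, and the
  integrand may depend on the past and on \<open>Z\<close> jointly.\<close>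

lemma disintegration:
  fixes g :: "'a \<times> 'z \<Rightarrow> ennreal"
  assumes M: "prob_space M" and sub: "subalgebra M G"
    and gen: "sets G = sigma_sets (space M) \<P>" and stb: "Int_stable \<P>" and top: "space M \<in> \<P>" and PP: "\<P> \<subseteq> Pow (space M)"
    and Z[measurable]: "Z \<in> M \<rightarrow>\<^sub>M N"
    and genN: "sets N = sigma_sets (space N) \<R>" and isN: "Int_stable \<R>" and topN: "space N \<in> \<R>" and RP: "\<R> \<subseteq> Pow (space N)"
    and \<kappa>: "\<kappa> \<in> G \<rightarrow>\<^sub>M prob_algebra N"
    and eq: "\<And>A B. A \<in> \<P> \<Longrightarrow> B \<in> \<R> \<Longrightarrow>
      (\<integral>\<^sup>+x. indicator A x * indicator B (Z x) \<partial>M) = (\<integral>\<^sup>+x. indicator A x * emeasure (\<kappa> x) B \<partial>M)"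
    and g: "g \<in> borel_measurable (G \<Otimes>\<^sub>M N)"
  shows "(\<integral>\<^sup>+x. g (x, Z x) \<partial>M) = (\<integral>\<^sup>+x. \<integral>\<^sup>+z. g (x, z) \<partial>\<kappa> x \<partial>M)"
proof -
  have GM: "sets G \<subseteq> sets M" and sp: "space G = space M" using sub by (auto simp: subalgebra_def)
  have \<kappa>s: "sets (\<kappa> x) = sets N" if "x \<in> space M" for x
    using measurable_space[OF \<kappa>] that sp by (simp add: space_prob_algebra)
  \<comment> \<open>The base measure is restricted to \<open>G\<close> because
    \<open>\<kappa>\<close> is measurable only with respect to \<open>G\<close>.\<close>
  let ?R = "restr_to_subalg M G"
  have Rs: "sets ?R = sets G" by (rule sets_restr_to_subalg[OF sub])
  have Rp: "?R \<in> space (prob_algebra G)" using prob_space_restr_to_subalg[OF sub M] Rs by (simp add: space_prob_algebra)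
  let ?\<mu> = "distr M (G \<Otimes>\<^sub>M N) (\<lambda>x. (x, Z x))"
  let ?K = "\<lambda>x. distr (\<kappa> x) (G \<Otimes>\<^sub>M N) (Pair x)"
  have idG: "(\<lambda>x. x) \<in> M \<rightarrow>\<^sub>M G" using GM sp by (auto simp: measurable_def)
  have pm: "(\<lambda>x. (x, Z x)) \<in> M \<rightarrow>\<^sub>M G \<Otimes>\<^sub>M N" using idG by measurable
  have Km: "?K \<in> G \<rightarrow>\<^sub>M prob_algebra (G \<Otimes>\<^sub>M N)"
    by (rule measurable_distr_prob_space2[OF \<kappa>]) simp
  have Px: "Pair x \<in> \<kappa> x \<rightarrow>\<^sub>M G \<Otimes>\<^sub>M N" if "x \<in> space M" for x
    using \<kappa>s[OF that] that sp by (simp cong: measurable_cong_sets)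
  have int2: "(\<integral>\<^sup>+p. h p \<partial>(?R \<bind> ?K)) = (\<integral>\<^sup>+x. \<integral>\<^sup>+z. h (x, z) \<partial>\<kappa> x \<partial>M)" if h: "h \<in> borel_measurable (G \<Otimes>\<^sub>M N)" for h
  proof -
    have hm: "(\<lambda>x. \<integral>\<^sup>+z. h (x, z) \<partial>\<kappa> x) \<in> borel_measurable G"
      using h by (intro nn_integral_kernel_measurable[OF _ \<kappa>]) simp
    have "(\<integral>\<^sup>+p. h p \<partial>(?R \<bind> ?K)) = (\<integral>\<^sup>+x. \<integral>\<^sup>+p. h p \<partial>?K x \<partial>?R)"
      by (rule nn_integral_bind_prob[OF Rp Km h])
    also have "\<dots> = (\<integral>\<^sup>+x. \<integral>\<^sup>+z. h (x, z) \<partial>\<kappa> x \<partial>?R)"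
      using Px h by (intro nn_integral_cong) (simp add: nn_integral_distr space_restr_to_subalg)
    also have "\<dots> = (\<integral>\<^sup>+x. \<integral>\<^sup>+z. h (x, z) \<partial>\<kappa> x \<partial>M)" by (rule nn_integral_subalgebra2[OF sub hm])
    finally show ?thesis .
  qed
  let ?E = "{a \<times> b |a b. a \<in> \<P> \<and> b \<in> \<R>}"
  have gp: "sets (G \<Otimes>\<^sub>M N) = sigma_sets (space G \<times> space N) ?E"
  proof -
    have "sets (G \<Otimes>\<^sub>M N) = sets (sigma (space G \<times> space N) ?E)"
      by (rule sets_pair_eq[of \<P> G "{space M}" \<R> N "{space N}"]) (use gen genN top topN PP RP sp in auto)
    moreover have "?E \<subseteq> Pow (space G \<times> space N)" using PP RP sp by blast
    ultimately show ?thesis by simp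
  qed
  have "?\<mu> = ?R \<bind> ?K"
  proof (rule measure_eqI_generator_eq[where E="?E" and \<Omega>="space G \<times> space N" and A="\<lambda>_. space G \<times> space N"])
    show "Int_stable ?E"
    proof (rule Int_stableI, clarify)
      fix a b c d assume "a \<in> \<P>" "b \<in> \<R>" "c \<in> \<P>" "d \<in> \<R>"
      then have "a \<inter> c \<in> \<P>" "b \<inter> d \<in> \<R>" using stb isN by (auto intro: Int_stableD)
      then show "\<exists>e f. (a \<times> b) \<inter> (c \<times> d) = e \<times> f \<and> e \<in> \<P> \<and> f \<in> \<R>" by (metis Times_Int_Times)
    qed
    show "?E \<subseteq> Pow (space G \<times> space N)" using PP RP sp by blast
    show "sets ?\<mu> = sigma_sets (space G \<times> space N) ?E" by (simp add: gp)
    show "sets (?R \<bind> ?K) = sigma_sets (space G \<times> space N) ?E"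
      using bind_prob[OF Rp Km] by (simp add: space_prob_algebra gp)
    interpret \<mu>: prob_space ?\<mu> by (rule prob_space.prob_space_distr[OF M pm])
    show "emeasure ?\<mu> (space G \<times> space N) \<noteq> \<infinity>" by simp
    fix X assume "X \<in> ?E"
    then obtain a b where X: "X = a \<times> b" and a: "a \<in> \<P>" and b: "b \<in> \<R>" by blast
    have [measurable]: "X \<in> sets (G \<Otimes>\<^sub>M N)" using \<open>X \<in> ?E\<close> unfolding gp by (rule sigma_sets.Basic)
    have bN: "b \<in> sets N" using b genN by auto
    have ind: "(indicator X (x, z) :: ennreal) = indicator a x * indicator b z" for x z by (simp add: X indicator_def)
    have "emeasure ?\<mu> X = (\<integral>\<^sup>+p. indicator X p \<partial>?\<mu>)" by simp
    also have "\<dots> = (\<integral>\<^sup>+x. indicator a x * indicator b (Z x) \<partial>M)"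
      using pm by (subst nn_integral_distr) (auto simp: ind)
    also have "\<dots> = (\<integral>\<^sup>+x. \<integral>\<^sup>+z. indicator X (x, z) \<partial>\<kappa> x \<partial>M)"
      unfolding eq[OF a b] by (intro nn_integral_cong) (simp add: ind nn_integral_cmult_indicator \<kappa>s bN)
    also have "\<dots> = (\<integral>\<^sup>+p. indicator X p \<partial>(?R \<bind> ?K))" by (intro int2[symmetric]) simp
    also have "\<dots> = emeasure (?R \<bind> ?K) X"
      using bind_prob[OF Rp Km] by (simp add: space_prob_algebra)
    finally show "emeasure ?\<mu> X = emeasure (?R \<bind> ?K) X" .
  qed (use top topN sp in auto)
  then have "(\<integral>\<^sup>+p. g p \<partial>?\<mu>) = (\<integral>\<^sup>+p. g p \<partial>(?R \<bind> ?K))" by simp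
  then show ?thesis using int2[OF g] pm g by (simp add: nn_integral_distr)
qed

text \<open>Conditions on finitely many coordinates at once: unlike the single-coordinate
  \<open>events\<close> they are closed under intersection, and they generate the same
  sigma-algebra.\<close>

definition cyl :: "'w measure \<Rightarrow> ('i \<Rightarrow> 'w \<Rightarrow> 'b::topological_space) \<Rightarrow> 'i set \<Rightarrow> 'w set set" where
  "cyl M Z I = {{w \<in> space M. \<forall>i\<in>J. Z i w \<in> A i} | J A. finite J \<and> J \<subseteq> I \<and> (\<forall>i\<in>J. A i \<in> sets borel)}"

lemma cyl_Int_stable: "Int_stable (cyl M Z I)"
proof (rule Int_stableI)
  fix a b assume "a \<in> cyl M Z I" "b \<in> cyl M Z I"
  then obtain J A K B where a: "a = {w \<in> space M. \<forall>i\<in>J. Z i w \<in> A i}" "finite J" "J \<subseteq> I" "\<forall>i\<in>J. A i \<in> sets borel"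
    and b: "b = {w \<in> space M. \<forall>i\<in>K. Z i w \<in> B i}" "finite K" "K \<subseteq> I" "\<forall>i\<in>K. B i \<in> sets borel"
    unfolding cyl_def by blast
  define C where "C i = (if i \<in> J then A i else UNIV) \<inter> (if i \<in> K then B i else UNIV)" for i
  have "a \<inter> b = {w \<in> space M. \<forall>i\<in>J \<union> K. Z i w \<in> C i}"
    unfolding a(1) b(1) C_def by auto
  moreover have "\<forall>i\<in>J \<union> K. C i \<in> sets borel" using a(4) b(4) unfolding C_def by auto
  ultimately show "a \<inter> b \<in> cyl M Z I"
    unfolding cyl_def using a b by (intro CollectI exI[of _ "J \<union> K"] exI[of _ C]) auto
qed

lemma cyl_space: "space M \<in> cyl M Z I"
  unfolding cyl_def by (intro CollectI exI[of _ "{}"] exI[of _ "\<lambda>_. {}"]) auto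

lemma cyl_Pow: "cyl M Z I \<subseteq> Pow (space M)"
  unfolding cyl_def by auto

lemma events_Pow: "events M Z I \<subseteq> Pow (space M)"
  unfolding events_def by auto

lemma events_subset_cyl: "events M Z I \<subseteq> cyl M Z I"
proof
  fix a assume "a \<in> events M Z I"
  then obtain i A where "a = Z i -` A \<inter> space M" "i \<in> I" "A \<in> sets borel" unfolding events_def by blast
  then show "a \<in> cyl M Z I" unfolding cyl_def
    by (intro CollectI exI[of _ "{i}"] exI[of _ "\<lambda>_. A"]) auto
qed

lemma cyl_sigma: "cyl M Z I \<subseteq> sigma_sets (space M) (events M Z I)"
proof
  fix a assume "a \<in> cyl M Z I"
  then obtain J A where a: "a = {w \<in> space M. \<forall>i\<in>J. Z i w \<in> A i}" and J: "finite J" "J \<subseteq> I" "\<forall>i\<in>J. A i \<in> sets borel"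
    unfolding cyl_def by blast
  interpret sigma_algebra "space M" "sigma_sets (space M) (events M Z I)"
    by (rule sigma_algebra_sigma_sets[OF events_Pow])
  have "{w \<in> space M. \<forall>i\<in>J. Z i w \<in> A i} \<in> sigma_sets (space M) (events M Z I)"
  proof (rule sets_Collect_finite_All[where S=J])
    fix i assume "i \<in> J"
    then have "Z i -` A i \<inter> space M \<in> events M Z I" using J unfolding events_def by blast
    moreover have "Z i -` A i \<inter> space M = {w \<in> space M. Z i w \<in> A i}" by auto
    ultimately show "{w \<in> space M. Z i w \<in> A i} \<in> sigma_sets (space M) (events M Z I)" by auto
  qed (rule J(1))
  then show "a \<in> sigma_sets (space M) (events M Z I)" unfolding a .
qed

lemma Int_stable_combine:
  assumes "Int_stable E" "Int_stable F" shows "Int_stable {a \<inter> b | a b. a \<in> E \<and> b \<in> F}"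
proof (rule Int_stableI)
  fix x y assume "x \<in> {a \<inter> b | a b. a \<in> E \<and> b \<in> F}" "y \<in> {a \<inter> b | a b. a \<in> E \<and> b \<in> F}"
  then obtain a b a' b' where ab: "x = a \<inter> b" "y = a' \<inter> b'" "a \<in> E" "b \<in> F" "a' \<in> E" "b' \<in> F" by blast
  have "x \<inter> y = (a \<inter> a') \<inter> (b \<inter> b')" unfolding ab by auto
  moreover have "a \<inter> a' \<in> E" "b \<inter> b' \<in> F" using assms ab by (auto intro: Int_stableD)
  ultimately show "x \<inter> y \<in> {a \<inter> b | a b. a \<in> E \<and> b \<in> F}" by (intro CollectI exI conjI)
qed

lemma sigma_sets_combine:
  assumes "\<Omega> \<in> E" "\<Omega> \<in> F" "E \<subseteq> Pow \<Omega>" "F \<subseteq> Pow \<Omega>"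
    and E: "sigma_sets \<Omega> E = sigma_sets \<Omega> E'" and F: "sigma_sets \<Omega> F = sigma_sets \<Omega> F'"
    and P: "E' \<subseteq> Pow \<Omega>" "F' \<subseteq> Pow \<Omega>"
  shows "sigma_sets \<Omega> {a \<inter> b | a b. a \<in> E \<and> b \<in> F} = sigma_sets \<Omega> (E' \<union> F')"
proof (rule antisym)
  interpret sigma_algebra \<Omega> "sigma_sets \<Omega> (E' \<union> F')" using P by (intro sigma_algebra_sigma_sets) auto
  have "sigma_sets \<Omega> E \<subseteq> sigma_sets \<Omega> (E' \<union> F')" "sigma_sets \<Omega> F \<subseteq> sigma_sets \<Omega> (E' \<union> F')"
    unfolding E F by (rule sigma_sets_mono'; simp)+
  then show "sigma_sets \<Omega> {a \<inter> b | a b. a \<in> E \<and> b \<in> F} \<subseteq> sigma_sets \<Omega> (E' \<union> F')"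
    by (intro sigma_sets_mono) auto
  let ?S = "sigma_sets \<Omega> {a \<inter> b | a b. a \<in> E \<and> b \<in> F}"
  have "E \<subseteq> ?S" "F \<subseteq> ?S"
  proof safe
    fix a assume "a \<in> E"
    then have "a = a \<inter> \<Omega>" using assms(3) by blast
    then show "a \<in> ?S" using \<open>a \<in> E\<close> assms(2) by (intro sigma_sets.Basic) blast
  next
    fix b assume "b \<in> F"
    then have "b = \<Omega> \<inter> b" using assms(4) by blast
    then show "b \<in> ?S" using \<open>b \<in> F\<close> assms(1) by (intro sigma_sets.Basic) blast
  qed
  then have "sigma_sets \<Omega> E \<subseteq> ?S" "sigma_sets \<Omega> F \<subseteq> ?S" by (simp_all add: sigma_sets_mono)
  then show "sigma_sets \<Omega> (E' \<union> F') \<subseteq> ?S" unfolding E F by (intro sigma_sets_mono) auto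
qed

lemma sigma_cyl: "sigma_sets (space M) (cyl M Z I) = sigma_sets (space M) (events M Z I)"
  using events_subset_cyl[of M Z I] cyl_sigma[of M Z I]
  by (intro antisym sigma_sets_mono) (auto intro: sigma_sets.Basic)

section \<open>The hidden Markov model and its particle filter\<close>

lemma sets_as_generator:
  "sets N = sigma_sets (space N) (sets N)" "Int_stable (sets N)" "space N \<in> sets N" "sets N \<subseteq> Pow (space N)"
  using sets.sigma_sets_eq[of N] sets.space_closed[of N] by (auto simp: Int_stable_def)

lemma disintegration_sets:
  assumes M: "prob_space M" and sub: "subalgebra M G" and Z: "Z \<in> M \<rightarrow>\<^sub>M N"
    and genN: "sets N = sigma_sets (space N) \<R>" and isN: "Int_stable \<R>" and topN: "space N \<in> \<R>" and RP: "\<R> \<subseteq> Pow (space N)"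
    and \<kappa>: "\<kappa> \<in> G \<rightarrow>\<^sub>M prob_algebra N"
    and eq: "\<And>A B. A \<in> sets G \<Longrightarrow> B \<in> \<R> \<Longrightarrow>
      (\<integral>\<^sup>+x. indicator A x * indicator B (Z x) \<partial>M) = (\<integral>\<^sup>+x. indicator A x * emeasure (\<kappa> x) B \<partial>M)"
    and g: "g \<in> borel_measurable (G \<Otimes>\<^sub>M N)"
  shows "(\<integral>\<^sup>+x. g (x, Z x) \<partial>M) = (\<integral>\<^sup>+x. \<integral>\<^sup>+z. g (x, z) \<partial>\<kappa> x \<partial>M)"
proof -
  have "space G = space M" using sub by (simp add: subalgebra_def)
  note G = sets_as_generator[of G, unfolded this]
  show ?thesis by (rule disintegration[OF M sub G(1,2,3,4) Z genN isN topN RP \<kappa> eq g])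
qed

text \<open>Translates an almost sure statement about conditional probabilities into the integral
  identity on which \<open>disintegration\<close> runs.\<close>

lemma cond_prob_indicator:
  fixes p :: "'w \<Rightarrow> real"
  assumes M: "prob_space M" and sub: "subalgebra M G" and B: "B \<in> sets M" and a: "a \<in> sets G"
    and p: "p \<in> borel_measurable M" "\<And>w. 0 \<le> p w" "\<And>w. p w \<le> 1"
    and eq: "AE w in M. cond_prob_given M G B w = p w"
  shows "(\<integral>\<^sup>+w. indicator a w * indicator B w \<partial>M) = (\<integral>\<^sup>+w. indicator a w * ennreal (p w) \<partial>M)"
proof -
  interpret prob_space M by (rule M)
  interpret G: finite_measure_subalgebra M G by unfold_locales (rule sub)
  note [measurable] = p(1) B
  have aM[measurable]: "a \<in> sets M" using a sub by (auto simp: subalgebra_def)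
  have iB: "integrable M (indicator B :: 'w \<Rightarrow> real)" by (simp add: emeasure_eq_measure)
  have "(LINT w|M. indicator a w * indicator B w) = (LINT w|M. indicator a w * real_cond_exp M G (indicator B) w)"
    using G.real_cond_exp_intA[OF iB a] by (simp add: set_lebesgue_integral_def)
  also have "\<dots> = (LINT w|M. indicator a w * p w)"
    using eq by (intro integral_cong_AE) (auto simp: cond_prob_given_def)
  finally have e: "(LINT w|M. indicator a w * indicator B w) = (LINT w|M. indicator a w * p w)" .
  have i1: "integrable M (\<lambda>w. indicator a w * indicator B w :: real)"
    by (rule integrable_const_bound[where B=1]) (auto simp: indicator_def)
  have i2: "integrable M (\<lambda>w. indicator a w * p w)"
    using p(2,3) by (intro integrable_const_bound[where B=1]) (auto simp: indicator_def)
  have "(\<integral>\<^sup>+w. indicator a w * indicator B w \<partial>M) = (\<integral>\<^sup>+w. ennreal (indicator a w * indicator B w) \<partial>M)"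
    by (intro nn_integral_cong) (auto simp: indicator_def)
  also have "\<dots> = ennreal (LINT w|M. indicator a w * indicator B w)"
    by (rule nn_integral_eq_integral[OF i1]) auto
  also have "\<dots> = (\<integral>\<^sup>+w. ennreal (indicator a w * p w) \<partial>M)"
    unfolding e using p(2) by (intro nn_integral_eq_integral[OF i2, symmetric]) auto
  also have "\<dots> = (\<integral>\<^sup>+w. indicator a w * ennreal (p w) \<partial>M)"
    by (intro nn_integral_cong) (auto simp: indicator_def)
  finally show ?thesis .
qed

lemma events_mono: "I \<subseteq> J \<Longrightarrow> events M Z I \<subseteq> events M Z J"
  unfolding events_def by blast

lemma events_sets: "(\<And>i. i \<in> I \<Longrightarrow> Z i \<in> borel_measurable M) \<Longrightarrow> events M Z I \<subseteq> sets M"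
  unfolding events_def by auto

lemma sigma_events_measurable:
  fixes Z :: "'i \<Rightarrow> 'w \<Rightarrow> 'b::topological_space"
  assumes "E \<subseteq> Pow (space M)" "events M Z I \<subseteq> E" "i \<in> I"
  shows "Z i \<in> sigma (space M) E \<rightarrow>\<^sub>M borel"
proof (rule measurableI)
  fix A :: "'b set" assume "A \<in> sets borel"
  then have "Z i -` A \<inter> space M \<in> E" using assms(2,3) unfolding events_def by blast
  then show "Z i -` A \<inter> space (sigma (space M) E) \<in> sets (sigma (space M) E)" using assms(1) by simp
qed simp

lemma subalgebra_sigma: "E \<subseteq> sets M \<Longrightarrow> subalgebra M (sigma (space M) E)"
  using sets.sigma_sets_subset[of E M] sets.space_closed[of M] by (auto simp: subalgebra_def sets_measure_of_conv)

lemma measurable_sigma_mono: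
  assumes "E \<subseteq> E'" "E' \<subseteq> Pow \<Omega>" "f \<in> sigma \<Omega> E \<rightarrow>\<^sub>M N"
  shows "f \<in> sigma \<Omega> E' \<rightarrow>\<^sub>M N"
proof -
  have "subalgebra (sigma \<Omega> E') (sigma \<Omega> E)"
    using assms(1,2) sigma_sets_mono'[OF assms(1), of \<Omega>] by (auto simp: subalgebra_def)
  from measurable_from_subalg[OF this assms(3)] show ?thesis .
qed

lemma sets_sigma_mono: "E \<subseteq> E' \<Longrightarrow> E' \<subseteq> Pow \<Omega> \<Longrightarrow> sets (sigma \<Omega> E) \<subseteq> sets (sigma \<Omega> E')"
  using sigma_sets_mono'[of E E' \<Omega>] by auto

lemma cyl_sets: "E \<subseteq> Pow (space M) \<Longrightarrow> events M Z I \<subseteq> E \<Longrightarrow> cyl M Z I \<subseteq> sets (sigma (space M) E)"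
  using cyl_sigma[of M Z I] sigma_sets_mono'[of "events M Z I" E "space M"] by auto

locale hidden_markov = filter_model P \<Phi> \<phi> \<Upsilon>
  for P :: "'e::polish_space \<Rightarrow> 'e measure" and \<Phi> :: "'e \<Rightarrow> 'f::polish_space measure"
    and \<phi> :: "'f measure" and \<Upsilon> :: "'e \<Rightarrow> 'f \<Rightarrow> real" +
  fixes M :: "'w measure" and X :: "nat \<Rightarrow> 'w \<Rightarrow> 'e" and Y :: "nat \<Rightarrow> 'w \<Rightarrow> 'f" and \<mu> :: "'e measure"
    and \<xi> :: "nat \<times> nat \<Rightarrow> 'w \<Rightarrow> real" and x :: "nat \<Rightarrow> nat \<Rightarrow> nat \<Rightarrow> 'w \<Rightarrow> 'e"
  assumes hmm: "hidden_markov_model M X Y \<mu> P \<Phi>"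
    and inputs: "uniform_inputs M X Y \<xi>"
    and particles: "bootstrap_particles M Y \<mu> P \<Upsilon> \<xi> x"
begin

section \<open>Conditional laws of signal and observations\<close>

lemma M_prob: "prob_space M" using hmm by (simp add: hidden_markov_model_def)

sublocale prob_space M by (rule M_prob)

lemma \<mu>_PA[simp]: "\<mu> \<in> space PA" using hmm by (simp add: hidden_markov_model_def)

lemma X_meas[measurable]: "X k \<in> borel_measurable M"
  and Y_meas[measurable]: "Y k \<in> borel_measurable M"
  using hmm by (auto simp: hidden_markov_model_def markov_chain_def)

lemma \<xi>_meas[measurable]: "\<xi> p \<in> borel_measurable M"
  using inputs by (cases p) (auto simp: uniform_inputs_def indep_vars_def)

lemmas ev_X = events_sets[of _ X M, OF X_meas]
lemmas ev_Y = events_sets[of _ Y M, OF Y_meas]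
lemmas ev_\<xi> = events_sets[of _ \<xi> M, OF \<xi>_meas]
lemmas ev_Pow = events_Pow[of M X] events_Pow[of M Y] events_Pow[of M \<xi>]

abbreviation SX :: "nat set \<Rightarrow> 'w measure" where "SX I \<equiv> sigma (space M) (Defs.events M X I)"

lemma sub_SX: "subalgebra M (SX I)" by (rule subalgebra_sigma[OF ev_X])

lemma X_SX: "i \<in> I \<Longrightarrow> X i \<in> SX I \<rightarrow>\<^sub>M borel"
  by (rule sigma_events_measurable[OF events_Pow order_refl])

text \<open>Conditional independence and the emission laws combine into one integral identity. As
  \<open>V\<close> may depend on the whole signal, observation events can be traded for likelihoods
  and back in \<open>XY_transition\<close>.\<close>

lemma Y_given_X:
  fixes J :: "nat set"
  assumes J: "finite J" "\<And>j. j \<in> J \<Longrightarrow> A j \<in> sets borel" and V: "V \<in> borel_measurable (SX UNIV)"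
  shows "(\<integral>\<^sup>+w. V w * indicator {w \<in> space M. \<forall>j\<in>J. Y j w \<in> A j} w \<partial>M)
     = (\<integral>\<^sup>+w. V w * (\<Prod>j\<in>J. emeasure (\<Phi> (X j w)) (A j)) \<partial>M)"
proof -
  let ?B = "{w \<in> space M. \<forall>j\<in>J. Y j w \<in> A j}"
  note [measurable] = J(2)
  have pm: "prob_space (\<Phi> x)" for x by (rule PA_D[OF \<Phi>_PA])
  have em: "emeasure (\<Phi> (X j w)) (A j) = ennreal (measure (\<Phi> (X j w)) (A j))" for j w
    using pm by (simp add: finite_measure.emeasure_eq_measure prob_space_def)
  have B: "?B \<in> sets M" using J by measurable
  have mm: "(\<lambda>w. measure (\<Phi> (X j w)) (A j)) \<in> borel_measurable M" if "j \<in> J" for j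
    using J(2)[OF that] by measurable
  have "AE w in M. \<forall>j\<in>J. cond_prob_given M (SX UNIV) {w \<in> space M. Y j w \<in> A j} w = measure (\<Phi> (X j w)) (A j)"
    using hmm J unfolding hidden_markov_model_def sigma_gen_by_def
    by (intro AE_finite_allI) auto
  moreover have "AE w in M. cond_prob_given M (SX UNIV) ?B w = (\<Prod>j\<in>J. cond_prob_given M (SX UNIV) {w \<in> space M. Y j w \<in> A j} w)"
    using hmm J unfolding hidden_markov_model_def cond_indep_given_def sigma_gen_by_def by blast
  ultimately have AE: "AE w in M. cond_prob_given M (SX UNIV) ?B w = (\<Prod>j\<in>J. measure (\<Phi> (X j w)) (A j))"
    by eventually_elim simp
  show ?thesis
  proof (rule nn_integral_subalgebra_eqI[OF sub_SX])
    show "(indicator ?B :: 'w \<Rightarrow> ennreal) \<in> borel_measurable M" using B by measurable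
    show "(\<lambda>w. \<Prod>j\<in>J. emeasure (\<Phi> (X j w)) (A j)) \<in> borel_measurable M"
      unfolding em using mm by (intro borel_measurable_prod_ennreal) measurable
    show "V \<in> borel_measurable (SX UNIV)" by (rule V)
    fix a assume a: "a \<in> sets (SX UNIV)"
    have "(\<integral>\<^sup>+w. indicator a w * indicator ?B w \<partial>M) = (\<integral>\<^sup>+w. indicator a w * ennreal (\<Prod>j\<in>J. measure (\<Phi> (X j w)) (A j)) \<partial>M)"
    proof (rule cond_prob_indicator[OF M_prob sub_SX B a _ _ _ AE])
      show "(\<lambda>w. \<Prod>j\<in>J. measure (\<Phi> (X j w)) (A j)) \<in> borel_measurable M"
        using mm by (intro borel_measurable_prod) auto
      show "0 \<le> (\<Prod>j\<in>J. measure (\<Phi> (X j w)) (A j))" for w by (intro prod_nonneg) auto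
      show "(\<Prod>j\<in>J. measure (\<Phi> (X j w)) (A j)) \<le> 1" for w
        by (intro prod_le_1) (auto intro: prob_space.prob_le_1 pm)
    qed
    then show "(\<integral>\<^sup>+w. indicator a w * indicator ?B w \<partial>M) = (\<integral>\<^sup>+w. indicator a w * (\<Prod>j\<in>J. emeasure (\<Phi> (X j w)) (A j)) \<partial>M)"
      unfolding em by (simp add: prod_ennreal)
  qed
qed

text \<open>With \<open>\<mu>\<close> as the transition at time \<open>0\<close>, the initial law
  and the Markov steps are covered by the same statements.\<close>

definition transition :: "nat \<Rightarrow> 'w \<Rightarrow> 'e measure" where
  "transition k w = (case k of 0 \<Rightarrow> \<mu> | Suc n \<Rightarrow> P (X n w))"

lemma transition_meas:
  assumes "\<And>j. j < k \<Longrightarrow> X j \<in> H \<rightarrow>\<^sub>M borel"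
  shows "transition k \<in> H \<rightarrow>\<^sub>M PA"
  using assms unfolding transition_def[abs_def] by (cases k) (auto intro: measurable_compose[OF _ P_meas])

lemma transition_PA[simp]: "transition k w \<in> space PA"
  by (cases k) (simp_all add: transition_def)

lemma X_transition:
  assumes g: "g \<in> borel_measurable (SX {..<k} \<Otimes>\<^sub>M borel)"
  shows "(\<integral>\<^sup>+w. g (w, X k w) \<partial>M) = (\<integral>\<^sup>+w. \<integral>\<^sup>+z. g (w, z) \<partial>transition k w \<partial>M)"
proof (rule disintegration_sets[OF M_prob sub_SX X_meas sets_as_generator _ _ g])
  show "transition k \<in> SX {..<k} \<rightarrow>\<^sub>M PA" by (rule transition_meas) (simp add: X_SX)
  fix A and B :: "'e set" assume A: "A \<in> sets (SX {..<k})" and B[measurable]: "B \<in> sets borel"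
  have AM[measurable]: "A \<in> sets M" using sub_SX A by (auto simp: subalgebra_def)
  have iB: "(indicator B (X k w) :: ennreal) = indicator {w \<in> space M. X k w \<in> B} w" if "w \<in> space M" for w
    using that by (simp add: indicator_def)
  show "(\<integral>\<^sup>+w. indicator A w * indicator B (X k w) \<partial>M) = (\<integral>\<^sup>+w. indicator A w * emeasure (transition k w) B \<partial>M)"
  proof (cases k)
    case 0
    have "A \<in> {{}, space M}" using A 0 by (simp add: events_def sigma_sets_empty_eq)
    moreover have "(\<integral>\<^sup>+w. indicator B (X 0 w) \<partial>M) = emeasure \<mu> B"
    proof -
      have "emeasure \<mu> B = emeasure (distr M borel (X 0)) B"
        using hmm by (simp add: hidden_markov_model_def markov_chain_def)
      also have "\<dots> = (\<integral>\<^sup>+z. indicator B z \<partial>distr M borel (X 0))" by simp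
      also have "\<dots> = (\<integral>\<^sup>+w. indicator B (X 0 w) \<partial>M)" by (subst nn_integral_distr) auto
      finally show ?thesis by simp
    qed
    moreover have "(\<integral>\<^sup>+w. indicator (space M) w * f w \<partial>M) = (\<integral>\<^sup>+w. f w \<partial>M)" for f :: "'w \<Rightarrow> ennreal"
      by (intro nn_integral_cong) simp
    ultimately show ?thesis using 0 by (auto simp: transition_def emeasure_space_1)
  next
    case (Suc n)
    have pm: "prob_space (P x)" for x by (rule PA_D[OF P_PA])
    have em: "emeasure (P (X n w)) B = ennreal (measure (P (X n w)) B)" for w
      using pm by (simp add: finite_measure.emeasure_eq_measure prob_space_def)
    have AE: "AE w in M. cond_prob_given M (SX {..<k}) {w \<in> space M. X k w \<in> B} w = measure (P (X n w)) B"
      using hmm B unfolding hidden_markov_model_def markov_chain_def sigma_gen_by_def Suc lessThan_Suc_atMost by blast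
    have "(\<integral>\<^sup>+w. indicator A w * indicator B (X k w) \<partial>M) = (\<integral>\<^sup>+w. indicator A w * indicator {w \<in> space M. X k w \<in> B} w \<partial>M)"
      by (intro nn_integral_cong) (simp add: iB)
    also have "\<dots> = (\<integral>\<^sup>+w. indicator A w * ennreal (measure (P (X n w)) B) \<partial>M)"
      by (rule cond_prob_indicator[OF M_prob sub_SX _ A _ _ _ AE]) (auto intro: prob_space.prob_le_1 pm)
    finally show ?thesis by (simp add: Suc transition_def em)
  qed
qed

abbreviation SXY :: "'w measure" where "SXY \<equiv> sigma (space M) (Defs.events M X UNIV \<union> Defs.events M Y UNIV)"
abbreviation S\<xi> :: "'w measure" where "S\<xi> \<equiv> sigma (space M) (Defs.events M \<xi> UNIV)"

lemma sub_SXY: "subalgebra M SXY" by (rule subalgebra_sigma) (use ev_X ev_Y in blast)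
lemma sub_S\<xi>: "subalgebra M S\<xi>" by (rule subalgebra_sigma[OF ev_\<xi>])

lemma X_SXY[measurable]: "X i \<in> SXY \<rightarrow>\<^sub>M borel" and Y_SXY[measurable]: "Y i \<in> SXY \<rightarrow>\<^sub>M borel"
  by (rule sigma_events_measurable[where I=UNIV]; use ev_Pow in blast)+

lemma inputs_independent:
  assumes V: "V \<in> borel_measurable SXY" and c: "c \<in> sets S\<xi>"
  shows "(\<integral>\<^sup>+w. V w * indicator c w \<partial>M) = (\<integral>\<^sup>+w. V w * emeasure M c \<partial>M)"
proof (rule nn_integral_subalgebra_eqI[OF sub_SXY])
  have [measurable]: "c \<in> sets M" using c sub_S\<xi> by (auto simp: subalgebra_def)
  show "(indicator c :: 'w \<Rightarrow> ennreal) \<in> borel_measurable M" by measurable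
  show "(\<lambda>_. emeasure M c) \<in> borel_measurable M" by measurable
  show "V \<in> borel_measurable SXY" by (rule V)
  fix a assume a: "a \<in> sets SXY"
  then have [measurable]: "a \<in> sets M" using sub_SXY by (auto simp: subalgebra_def)
  have "prob (a \<inter> c) = prob a * prob c"
    using inputs a c by (intro indep_setD[where A="sets SXY" and B="sets S\<xi>"]) (simp_all add: uniform_inputs_def sigma_gen_by_def)
  moreover have "(\<integral>\<^sup>+w. indicator a w * indicator c w \<partial>M) = emeasure M (a \<inter> c)"
    by (simp add: indicator_inter_arith[symmetric])
  moreover have "(\<integral>\<^sup>+w. indicator a w * emeasure M c \<partial>M) = emeasure M a * emeasure M c"
    by (simp add: nn_integral_multc)
  ultimately show "(\<integral>\<^sup>+w. indicator a w * indicator c w \<partial>M) = (\<integral>\<^sup>+w. indicator a w * emeasure M c \<partial>M)"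
    by (simp add: emeasure_eq_measure ennreal_mult)
qed

definition emission :: "'e \<Rightarrow> ('e \<times> 'f) measure" where
  "emission z = distr (\<Phi> z) (borel \<Otimes>\<^sub>M borel) (Pair z)"

lemma emission_meas: "emission \<in> borel \<rightarrow>\<^sub>M prob_algebra (borel \<Otimes>\<^sub>M borel)"
  unfolding emission_def by (rule measurable_distr_prob_space2[OF \<Phi>_meas]) simp

lemma nn_integral_emission:
  assumes "h \<in> borel_measurable (borel \<Otimes>\<^sub>M borel)"
  shows "(\<integral>\<^sup>+p. h p \<partial>emission z) = (\<integral>\<^sup>+y. h (z, y) \<partial>\<Phi> z)"
proof -
  have "Pair z \<in> \<Phi> z \<rightarrow>\<^sub>M borel \<Otimes>\<^sub>M borel" using PA_D(2)[OF \<Phi>_PA, of z] by (simp cong: measurable_cong_sets)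
  then show ?thesis unfolding emission_def using assms by (simp add: nn_integral_distr)
qed

lemma nn_integral_bind_emission:
  assumes \<rho>: "\<rho> \<in> space PA" and h: "h \<in> borel_measurable (borel \<Otimes>\<^sub>M borel)"
  shows "(\<integral>\<^sup>+p. h p \<partial>(\<rho> \<bind> emission)) = (\<integral>\<^sup>+z. \<integral>\<^sup>+y. h (z, y) \<partial>\<Phi> z \<partial>\<rho>)"
  unfolding nn_integral_bind_prob[OF \<rho> emission_meas h] nn_integral_emission[OF h] ..

text \<open>All random inputs are included, also those of later steps. They are independent of
  signal and observations, so adding them does not change the conditional laws.\<close>

abbreviation past :: "nat \<Rightarrow> 'w measure" where
  "past k \<equiv> sigma (space M) ((Defs.events M X {..<k} \<union> Defs.events M Y {..<k}) \<union> Defs.events M \<xi> UNIV)"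

lemma sub_past: "subalgebra M (past k)" by (rule subalgebra_sigma) (use ev_X ev_Y ev_\<xi> in blast)

lemma past_meas:
  shows "i < k \<Longrightarrow> X i \<in> past k \<rightarrow>\<^sub>M borel" "i < k \<Longrightarrow> Y i \<in> past k \<rightarrow>\<^sub>M borel"
  by (rule sigma_events_measurable[where I="{..<k}"]; use ev_Pow in blast)+

text \<open>On a generating event the observation part is exchanged for a product of emission
  probabilities, the Markov property integrates out the signal at time \<open>k\<close>, and the
  exchange is undone for the past observations. The event of the random inputs factors out by
  independence.\<close>

lemma XY_transition:
  assumes g: "g \<in> borel_measurable (past k \<Otimes>\<^sub>M (borel \<Otimes>\<^sub>M borel))"
  shows "(\<integral>\<^sup>+w. g (w, (X k w, Y k w)) \<partial>M) = (\<integral>\<^sup>+w. \<integral>\<^sup>+z. \<integral>\<^sup>+y. g (w, (z, y)) \<partial>\<Phi> z \<partial>transition k w \<partial>M)"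
proof -
  let ?A = "{a \<inter> b | a b. a \<in> cyl M X {..<k} \<and> b \<in> cyl M Y {..<k}}"
  let ?E = "{a \<inter> b | a b. a \<in> ?A \<and> b \<in> sets S\<xi>}"
  let ?R = "{a \<times> b | a b. a \<in> sets (borel :: 'e measure) \<and> b \<in> sets (borel :: 'f measure)}"
  let ?\<kappa> = "\<lambda>w. transition k w \<bind> emission"
  have AP: "?A \<subseteq> Pow (space M)" using cyl_Pow[of M X "{..<k}"] by blast
  have EP: "?E \<subseteq> Pow (space M)" using AP by blast
  have Atop: "space M \<in> ?A" using cyl_space[of M X "{..<k}"] cyl_space[of M Y "{..<k}"] by blast
  have \<xi>top: "space M \<in> sets S\<xi>" using sets.top[of S\<xi>] by simp
  have Etop: "space M \<in> ?E" using Atop \<xi>top by blast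
  have Ss: "sets S\<xi> = sigma_sets (space M) (Defs.events M \<xi> UNIV)" using ev_Pow by simp
  have gen: "sets (past k) = sigma_sets (space M) ?E"
  proof -
    have "sets (past k) = sigma_sets (space M) ((Defs.events M X {..<k} \<union> Defs.events M Y {..<k}) \<union> Defs.events M \<xi> UNIV)"
      using ev_Pow by (simp add: Un_subset_iff)
    also have "\<dots> = sigma_sets (space M) ?E"
    proof (rule sigma_sets_combine[symmetric, OF Atop \<xi>top AP])
      show "sets S\<xi> \<subseteq> Pow (space M)" using sets_as_generator(4)[of S\<xi>] by (simp add: space_measure_of_conv)
      show "sigma_sets (space M) ?A = sigma_sets (space M) (Defs.events M X {..<k} \<union> Defs.events M Y {..<k})"
        by (rule sigma_sets_combine[OF cyl_space cyl_space cyl_Pow cyl_Pow sigma_cyl sigma_cyl events_Pow events_Pow])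
      show "sigma_sets (space M) (sets S\<xi>) = sigma_sets (space M) (Defs.events M \<xi> UNIV)"
        unfolding Ss by (rule sigma_sets_sigma_sets_eq[OF events_Pow])
      show "Defs.events M X {..<k} \<union> Defs.events M Y {..<k} \<subseteq> Pow (space M)" "Defs.events M \<xi> UNIV \<subseteq> Pow (space M)"
        using ev_Pow by blast+
    qed
    finally show ?thesis .
  qed
  have stable: "Int_stable ?E"
    by (intro Int_stable_combine cyl_Int_stable sets_as_generator)
  have genR: "sets (borel \<Otimes>\<^sub>M borel :: ('e \<times> 'f) measure) = sigma_sets (space (borel \<Otimes>\<^sub>M borel)) ?R"
    by (simp add: sets_pair_measure space_pair_measure)
  have stR: "Int_stable ?R" by (rule Int_stable_pair_measure_generator)
  have topR: "space (borel \<Otimes>\<^sub>M borel :: ('e \<times> 'f) measure) \<in> ?R"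
  proof -
    have "(UNIV :: 'e set) \<times> (UNIV :: 'f set) \<in> ?R" by (intro CollectI exI[of _ UNIV] conjI refl) auto
    then show ?thesis by (simp add: space_pair_measure)
  qed
  have powR: "?R \<subseteq> Pow (space (borel \<Otimes>\<^sub>M borel :: ('e \<times> 'f) measure))" by (simp add: space_pair_measure)
  have tm: "transition k \<in> past k \<rightarrow>\<^sub>M PA" by (intro transition_meas past_meas)
  have \<kappa>: "?\<kappa> \<in> past k \<rightarrow>\<^sub>M prob_algebra (borel \<Otimes>\<^sub>M borel)" by (rule measurable_bind_prob_space[OF tm emission_meas])
  have "(\<integral>\<^sup>+w. g (w, (X k w, Y k w)) \<partial>M) = (\<integral>\<^sup>+w. \<integral>\<^sup>+p. g (w, p) \<partial>?\<kappa> w \<partial>M)"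
  proof (rule disintegration[OF M_prob sub_past gen stable Etop EP _ genR stR topR powR \<kappa> _ g])
    show "(\<lambda>w. (X k w, Y k w)) \<in> M \<rightarrow>\<^sub>M borel \<Otimes>\<^sub>M borel" by measurable
    fix e r assume "e \<in> ?E" "r \<in> ?R"
    then obtain a b c where e: "e = (a \<inter> b) \<inter> c" and a: "a \<in> cyl M X {..<k}" and b: "b \<in> cyl M Y {..<k}" and c: "c \<in> sets S\<xi>"
      by blast
    from \<open>r \<in> ?R\<close> obtain u v where r: "r = u \<times> v" and u[measurable]: "u \<in> sets borel" and v[measurable]: "v \<in> sets borel" by blast
    obtain J B where b': "b = {w \<in> space M. \<forall>i\<in>J. Y i w \<in> B i}" and J: "finite J" "J \<subseteq> {..<k}" "\<And>i. i \<in> J \<Longrightarrow> B i \<in> sets borel"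
      using b unfolding cyl_def by blast
    have aX: "a \<in> sets (SX {..<k})" using a cyl_sets[OF events_Pow order_refl, of M X "{..<k}"] by blast
    have SXm: "sets (SX {..<k}) \<subseteq> sets (SX UNIV)" by (intro sets_sigma_mono events_mono events_Pow) simp
    have SXsub: "subalgebra (SX UNIV) (SX {..<k})" using SXm by (simp add: subalgebra_def space_measure_of_conv)
    have SXY: "subalgebra SXY (SX UNIV)" using sets_sigma_mono[of "Defs.events M X UNIV" "Defs.events M X UNIV \<union> Defs.events M Y UNIV" "space M"] ev_Pow
      by (simp add: subalgebra_def Un_subset_iff space_measure_of_conv)
    have bXY[measurable]: "b \<in> sets SXY"
      using b cyl_sets[of "Defs.events M X UNIV \<union> Defs.events M Y UNIV" M Y "{..<k}"] events_mono[of "{..<k}" UNIV M Y] ev_Pow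
      by blast
    have aXU: "a \<in> sets (SX UNIV)" using aX SXm by blast
    have aXY[measurable]: "a \<in> sets SXY" using aXU SXY by (auto simp: subalgebra_def)
    define h where "h z = (indicator u z * emeasure (\<Phi> z) v :: ennreal)" for z
    have [measurable]: "(\<lambda>z. emeasure (\<Phi> z) v) \<in> borel_measurable borel"
      by (rule measurable_emeasure_kernel[OF measurable_prob_algebraD[OF \<Phi>_meas] v])
    have hm[measurable]: "h \<in> borel_measurable borel" unfolding h_def by measurable
    define W where "W w = (\<integral>\<^sup>+z. h z \<partial>transition k w)" for w
    have Wm: "W \<in> borel_measurable (SX {..<k})" unfolding W_def
      by (rule nn_integral_kernel_measurable[where R=borel]) (auto intro!: transition_meas X_SX)
    have WmU: "W \<in> borel_measurable (SX UNIV)" by (rule measurable_from_subalg[OF SXsub Wm])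
    have WmXY[measurable]: "W \<in> borel_measurable SXY" by (rule measurable_from_subalg[OF SXY WmU])
    define L where "L w = (\<Prod>j\<in>J. emeasure (\<Phi> (X j w)) (B j))" for w
    have Lm: "L \<in> borel_measurable (SX {..<k})"
      unfolding L_def using J by (intro borel_measurable_prod_ennreal measurable_compose[OF X_SX measurable_emeasure_kernel[OF measurable_prob_algebraD[OF \<Phi>_meas]]]) auto
    have kem: "emeasure (?\<kappa> w) r = W w" for w
    proof -
      have rm[measurable]: "r \<in> sets (borel \<Otimes>\<^sub>M borel)" unfolding r by simp
      have "sets (?\<kappa> w) = sets (borel \<Otimes>\<^sub>M borel)"
        using bind_prob[OF transition_PA emission_meas, of k w] by (simp add: space_prob_algebra)
      then have "emeasure (?\<kappa> w) r = (\<integral>\<^sup>+p. indicator r p \<partial>?\<kappa> w)" using rm by simp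
      also have "\<dots> = (\<integral>\<^sup>+z. \<integral>\<^sup>+y. indicator r (z, y) \<partial>\<Phi> z \<partial>transition k w)"
        by (rule nn_integral_bind_emission) auto
      also have "\<dots> = W w"
        unfolding W_def
      proof (rule nn_integral_cong)
        fix z
        have "v \<in> sets (\<Phi> z)" using v PA_D(2)[OF \<Phi>_PA] by simp
        then show "(\<integral>\<^sup>+y. indicator r (z, y) \<partial>\<Phi> z) = h z"
          by (simp add: r h_def indicator_times nn_integral_cmult_indicator)
      qed
      finally show ?thesis .
    qed
    \<comment> \<open>The present observation is added as index \<open>k\<close>, which is not in
      \<open>J\<close> because \<open>J\<close> contains earlier times only; one application of
      \<open>Y_given_X\<close> then covers past and present.\<close>
    define B' where "B' j = (if j = k then v else B j)" for j
    have kJ: "k \<notin> J" using J(2) by auto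
    have B': "B' j \<in> sets borel" if "j \<in> insert k J" for j using that J(3) v by (auto simp: B'_def)
    have prodB': "(\<Prod>j\<in>insert k J. emeasure (\<Phi> (X j w)) (B' j)) = emeasure (\<Phi> (X k w)) v * L w" for w
    proof -
      have "(\<Prod>j\<in>J. emeasure (\<Phi> (X j w)) (B' j)) = L w"
        unfolding L_def using kJ by (intro prod.cong) (auto simp: B'_def)
      then show ?thesis using J(1) kJ by (simp add: B'_def)
    qed
    have V1: "(\<lambda>w. indicator a w * indicator u (X k w) :: ennreal) \<in> borel_measurable (SX UNIV)"
    proof -
      have "X k \<in> SX UNIV \<rightarrow>\<^sub>M borel" by (simp add: X_SX)
      then have "(\<lambda>w. indicator u (X k w) :: ennreal) \<in> borel_measurable (SX UNIV)"
        by (rule measurable_compose[OF _ borel_measurable_indicator[OF u]])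
      then show ?thesis by (intro borel_measurable_times_ennreal borel_measurable_indicator aXU)
    qed
    have V2: "(\<lambda>(w, z). indicator a w * L w * h z) \<in> borel_measurable (SX {..<k} \<Otimes>\<^sub>M borel)"
      using aX Lm by measurable
    have V3: "(\<lambda>w. indicator a w * W w) \<in> borel_measurable (SX UNIV)" using aXU WmU by measurable
    have hs: "h \<in> borel_measurable (transition k w)" for w
      by (rule PA_measurable[OF transition_PA hm])
    have "(\<integral>\<^sup>+w. indicator a w * indicator b w * indicator u (X k w) * indicator v (Y k w) \<partial>M)
      = (\<integral>\<^sup>+w. (indicator a w * indicator u (X k w)) * indicator {w \<in> space M. \<forall>j\<in>insert k J. Y j w \<in> B' j} w \<partial>M)"
    proof (rule nn_integral_cong)
      fix w assume "w \<in> space M"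
      have "(\<forall>j\<in>J. Y j w \<in> B' j) \<longleftrightarrow> (\<forall>j\<in>J. Y j w \<in> B j)" using kJ by (auto simp: B'_def)
      then show "indicator a w * indicator b w * indicator u (X k w) * indicator v (Y k w)
        = (indicator a w * indicator u (X k w)) * (indicator {w \<in> space M. \<forall>j\<in>insert k J. Y j w \<in> B' j} w :: ennreal)"
        using \<open>w \<in> space M\<close> by (auto simp: b' indicator_def B'_def[of k])
    qed
    also have "\<dots> = (\<integral>\<^sup>+w. (indicator a w * indicator u (X k w)) * (\<Prod>j\<in>insert k J. emeasure (\<Phi> (X j w)) (B' j)) \<partial>M)"
      using J(1) by (intro Y_given_X V1 B') auto
    also have "\<dots> = (\<integral>\<^sup>+w. (case (w, X k w) of (w, z) \<Rightarrow> indicator a w * L w * h z) \<partial>M)"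
      by (intro nn_integral_cong) (simp only: prodB' h_def prod.case mult_ac)
    also have "\<dots> = (\<integral>\<^sup>+w. \<integral>\<^sup>+z. indicator a w * L w * h z \<partial>transition k w \<partial>M)"
      by (subst X_transition[OF V2]) simp
    also have "\<dots> = (\<integral>\<^sup>+w. (indicator a w * W w) * L w \<partial>M)"
      by (intro nn_integral_cong) (subst nn_integral_cmult[OF hs], simp only: W_def mult_ac)
    also have "\<dots> = (\<integral>\<^sup>+w. (indicator a w * W w) * indicator b w \<partial>M)"
      unfolding b' L_def by (rule Y_given_X[symmetric, OF J(1,3) V3])
    finally have core: "(\<integral>\<^sup>+w. indicator a w * indicator b w * indicator u (X k w) * indicator v (Y k w) \<partial>M)
      = (\<integral>\<^sup>+w. (indicator a w * W w) * indicator b w \<partial>M)" .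
    have m1: "(\<lambda>w. indicator a w * indicator b w * indicator u (X k w) * indicator v (Y k w) :: ennreal) \<in> borel_measurable SXY" by measurable
    have m2: "(\<lambda>w. (indicator a w * W w) * indicator b w) \<in> borel_measurable SXY" by measurable
    note m1' = measurable_from_subalg[OF sub_SXY m1] and m2' = measurable_from_subalg[OF sub_SXY m2]
    have "(\<integral>\<^sup>+w. indicator e w * indicator r (X k w, Y k w) \<partial>M) =
      (\<integral>\<^sup>+w. (indicator a w * indicator b w * indicator u (X k w) * indicator v (Y k w)) * indicator c w \<partial>M)"
      by (intro nn_integral_cong) (simp add: e r indicator_inter_arith indicator_times mult_ac)
    also have "\<dots> = (\<integral>\<^sup>+w. indicator a w * indicator b w * indicator u (X k w) * indicator v (Y k w) \<partial>M) * emeasure M c"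
      unfolding inputs_independent[OF m1 c] by (rule nn_integral_multc[OF m1'])
    also have "\<dots> = (\<integral>\<^sup>+w. ((indicator a w * W w) * indicator b w) * indicator c w \<partial>M)"
      unfolding core inputs_independent[OF m2 c] by (rule nn_integral_multc[OF m2', symmetric])
    also have "\<dots> = (\<integral>\<^sup>+w. indicator e w * emeasure (?\<kappa> w) r \<partial>M)"
      unfolding kem by (intro nn_integral_cong) (simp add: e indicator_inter_arith mult_ac)
    finally show "(\<integral>\<^sup>+w. indicator e w * indicator r (X k w, Y k w) \<partial>M) = (\<integral>\<^sup>+w. indicator e w * emeasure (?\<kappa> w) r \<partial>M)" .
  qed
  also have "\<dots> = (\<integral>\<^sup>+w. \<integral>\<^sup>+z. \<integral>\<^sup>+y. g (w, (z, y)) \<partial>\<Phi> z \<partial>transition k w \<partial>M)"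
  proof (rule nn_integral_cong)
    fix w assume "w \<in> space M"
    then have "(\<lambda>p. g (w, p)) \<in> borel_measurable (borel \<Otimes>\<^sub>M borel)"
      using g by (intro measurable_compose[OF _ g] measurable_Pair1') (simp add: space_measure_of_conv)
    then show "(\<integral>\<^sup>+p. g (w, p) \<partial>?\<kappa> w) = (\<integral>\<^sup>+z. \<integral>\<^sup>+y. g (w, (z, y)) \<partial>\<Phi> z \<partial>transition k w)"
      by (rule nn_integral_bind_emission[OF transition_PA])
  qed
  finally show ?thesis .
qed

section \<open>The exact filter as a conditional law\<close>

definition predictor :: "nat \<Rightarrow> 'w \<Rightarrow> 'e measure" where
  "predictor k w = (case k of 0 \<Rightarrow> \<mu> | Suc n \<Rightarrow> nonlinear_filter \<mu> P \<Upsilon> Y n w \<bind> P)"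

abbreviation filt :: "nat \<Rightarrow> 'w \<Rightarrow> 'e measure" where "filt \<equiv> nonlinear_filter \<mu> P \<Upsilon> Y"

lemma filt_predictor: "filt k w = bayes \<Upsilon> (Y k w) (predictor k w)"
  by (cases k) (simp_all add: predictor_def)

lemma filt_PA[simp]: "filt k w \<in> space PA" by (induction k) simp_all

lemma predictor_PA[simp]: "predictor k w \<in> space PA" by (cases k) (simp_all add: predictor_def)

lemma filt_meas: "(\<And>j. j \<le> k \<Longrightarrow> Y j \<in> H \<rightarrow>\<^sub>M borel) \<Longrightarrow> filt k \<in> H \<rightarrow>\<^sub>M PA"
proof (induction k)
  case 0
  have "(\<lambda>w. bayes \<Upsilon> (Y 0 w) \<mu>) \<in> H \<rightarrow>\<^sub>M PA" using 0 by (intro bayes_measurable') auto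
  then show ?case by simp
next
  case (Suc k)
  have "(\<lambda>w. bayes \<Upsilon> (Y (Suc k) w) (filt k w \<bind> P)) \<in> H \<rightarrow>\<^sub>M PA"
    using Suc by (intro bayes_measurable' measurable_bind_prob_space[OF _ P_meas]) auto
  then show ?case by simp
qed

lemma predictor_meas:
  assumes "\<And>j. j < k \<Longrightarrow> Y j \<in> H \<rightarrow>\<^sub>M borel" shows "predictor k \<in> H \<rightarrow>\<^sub>M PA"
proof (cases k)
  case (Suc n)
  have "(\<lambda>w. filt n w \<bind> P) \<in> H \<rightarrow>\<^sub>M PA"
    using assms Suc by (intro measurable_bind_prob_space[OF _ P_meas] filt_meas) auto
  then show ?thesis by (simp add: predictor_def[abs_def] Suc)
qed (simp add: predictor_def[abs_def])

text \<open>Observations before \<open>k\<close> and all random inputs, but not the signal. The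
  particles of step \<open>k\<close> are measurable with respect to it, so the filter has to be
  correct even when the inputs are known.\<close>

abbreviation obs :: "nat \<Rightarrow> 'w measure" where
  "obs k \<equiv> sigma (space M) (Defs.events M Y {..<k} \<union> Defs.events M \<xi> UNIV)"

lemma sub_obs: "subalgebra M (obs k)" by (rule subalgebra_sigma) (use ev_Y ev_\<xi> in blast)

lemma obs_meas: "i < k \<Longrightarrow> Y i \<in> obs k \<rightarrow>\<^sub>M borel"
  by (rule sigma_events_measurable[where I="{..<k}"]; use ev_Pow in blast)

lemma measurable_pair_subalgebra:
  assumes "subalgebra A B" "g \<in> B \<Otimes>\<^sub>M N \<rightarrow>\<^sub>M K" shows "g \<in> A \<Otimes>\<^sub>M N \<rightarrow>\<^sub>M K"
proof -
  have id: "(\<lambda>x. x) \<in> A \<rightarrow>\<^sub>M B" using assms(1) by (auto simp: measurable_def subalgebra_def)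
  have "(\<lambda>p. (fst p, snd p)) \<in> A \<Otimes>\<^sub>M N \<rightarrow>\<^sub>M B \<Otimes>\<^sub>M N"
    by (intro measurable_Pair measurable_compose[OF measurable_fst id] measurable_snd)
  from measurable_compose[OF this assms(2)] show ?thesis by simp
qed

lemma sub_obs_past: "subalgebra (past k) (obs k)"
  using ev_Pow sigma_sets_mono'[of "Defs.events M Y {..<k} \<union> Defs.events M \<xi> UNIV" "(Defs.events M X {..<k} \<union> Defs.events M Y {..<k}) \<union> Defs.events M \<xi> UNIV" "space M"]
  by (auto simp: subalgebra_def Un_subset_iff)

text \<open>\<open>bayes_disintegration\<close> replaces the indicator of the signal event by its
  posterior probability. The result depends on the past and the present observation only, so the
  assumed conditional law, used once for \<open>g1\<close>, can be applied backwards for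
  \<open>g2\<close>.\<close>

lemma filter_update:
  assumes P: "\<And>g. g \<in> borel_measurable (obs k \<Otimes>\<^sub>M (borel \<Otimes>\<^sub>M borel)) \<Longrightarrow>
      (\<integral>\<^sup>+w. g (w, (X k w, Y k w)) \<partial>M) = (\<integral>\<^sup>+w. \<integral>\<^sup>+z. \<integral>\<^sup>+y. g (w, (z, y)) \<partial>\<Phi> z \<partial>predictor k w \<partial>M)"
    and g: "g \<in> borel_measurable (obs (Suc k) \<Otimes>\<^sub>M borel)"
  shows "(\<integral>\<^sup>+w. g (w, X k w) \<partial>M) = (\<integral>\<^sup>+w. \<integral>\<^sup>+z. g (w, z) \<partial>filt k w \<partial>M)"
proof -
  let ?E = "{a \<inter> b | a b. a \<in> sets (obs k) \<and> b \<in> cyl M Y {k}}"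
  have otop: "space M \<in> sets (obs k)" and oPow: "sets (obs k) \<subseteq> Pow (space M)"
    using sets.top[of "obs k"] sets.space_closed[of "obs k"] by (simp_all add: space_measure_of_conv)
  have os: "sets (obs m) = sigma_sets (space M) (Defs.events M Y {..<m} \<union> Defs.events M \<xi> UNIV)" for m
    using ev_Pow by (simp add: Un_subset_iff)
  have EP: "?E \<subseteq> Pow (space M)" using oPow by blast
  have Etop: "space M \<in> ?E" using otop cyl_space[of M Y "{k}"] by blast
  have stable: "Int_stable ?E" by (intro Int_stable_combine cyl_Int_stable sets_as_generator)
  have gen: "sets (obs (Suc k)) = sigma_sets (space M) ?E"
  proof -
    have "Defs.events M Y {..<Suc k} \<union> Defs.events M \<xi> UNIV = (Defs.events M Y {..<k} \<union> Defs.events M \<xi> UNIV) \<union> Defs.events M Y {k}"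
      unfolding events_def by (auto simp: less_Suc_eq)
    then have "sets (obs (Suc k)) = sigma_sets (space M) ((Defs.events M Y {..<k} \<union> Defs.events M \<xi> UNIV) \<union> Defs.events M Y {k})"
      unfolding os by simp
    also have "\<dots> = sigma_sets (space M) ?E"
    proof (rule sigma_sets_combine[symmetric, OF otop cyl_space oPow cyl_Pow _ sigma_cyl _ events_Pow])
      show EPow: "Defs.events M Y {..<k} \<union> Defs.events M \<xi> UNIV \<subseteq> Pow (space M)" using ev_Pow by blast
      show "sigma_sets (space M) (sets (obs k)) = sigma_sets (space M) (Defs.events M Y {..<k} \<union> Defs.events M \<xi> UNIV)"
        unfolding os by (rule sigma_sets_sigma_sets_eq[OF EPow])
    qed
    finally show ?thesis .
  qed
  have \<kappa>: "filt k \<in> obs (Suc k) \<rightarrow>\<^sub>M PA" by (intro filt_meas obs_meas) simp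
  have pm: "predictor k \<in> obs k \<rightarrow>\<^sub>M PA" by (intro predictor_meas obs_meas)
  show ?thesis
  proof (rule disintegration[OF M_prob sub_obs gen stable Etop EP X_meas sets_as_generator \<kappa> _ g])
    fix e and C :: "'e set" assume "e \<in> ?E" and C[measurable]: "C \<in> sets borel"
    then obtain a b where e: "e = a \<inter> b" and a[measurable]: "a \<in> sets (obs k)" and b: "b \<in> cyl M Y {k}" by blast
    obtain J B' where b': "b = {w \<in> space M. \<forall>i\<in>J. Y i w \<in> B' i}" "J \<subseteq> {k}" "\<forall>i\<in>J. B' i \<in> sets borel"
      using b unfolding cyl_def by blast
    define B where "B = (if k \<in> J then B' k else UNIV)"
    have B[measurable]: "B \<in> sets borel" using b'(3) by (simp add: B_def)
    have bB: "b = {w \<in> space M. Y k w \<in> B}" using b'(2) unfolding b'(1) B_def by auto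
    define g1 where "g1 p = (indicator a (fst p) * indicator B (snd (snd p)) * indicator C (fst (snd p)) :: ennreal)" for p :: "'w \<times> 'e \<times> 'f"
    have g1: "g1 \<in> borel_measurable (obs k \<Otimes>\<^sub>M (borel \<Otimes>\<^sub>M borel))" unfolding g1_def by measurable
    define g2 where "g2 p = (indicator a (fst p) * indicator B (snd (snd p)) * emeasure (bayes \<Upsilon> (snd (snd p)) (predictor k (fst p))) C :: ennreal)" for p :: "'w \<times> 'e \<times> 'f"
    have bm: "(\<lambda>p. bayes \<Upsilon> (snd (snd p)) (predictor k (fst p))) \<in> obs k \<Otimes>\<^sub>M (borel \<Otimes>\<^sub>M borel :: ('e \<times> 'f) measure) \<rightarrow>\<^sub>M PA"
      by (intro bayes_measurable' measurable_compose[OF measurable_fst pm]) measurable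
    have [measurable]: "(\<lambda>p. emeasure (bayes \<Upsilon> (snd (snd p)) (predictor k (fst p))) C) \<in> borel_measurable (obs k \<Otimes>\<^sub>M (borel \<Otimes>\<^sub>M borel :: ('e \<times> 'f) measure))"
      by (rule measurable_emeasure_kernel[OF measurable_prob_algebraD[OF bm] C])
    have g2: "g2 \<in> borel_measurable (obs k \<Otimes>\<^sub>M (borel \<Otimes>\<^sub>M borel))" unfolding g2_def by measurable
    have "(\<integral>\<^sup>+w. indicator e w * indicator C (X k w) \<partial>M) = (\<integral>\<^sup>+w. g1 (w, (X k w, Y k w)) \<partial>M)"
      by (intro nn_integral_cong) (simp add: e bB g1_def indicator_def)
    also have "\<dots> = (\<integral>\<^sup>+w. \<integral>\<^sup>+z. \<integral>\<^sup>+y. g1 (w, (z, y)) \<partial>\<Phi> z \<partial>predictor k w \<partial>M)" by (rule P[OF g1])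
    also have "\<dots> = (\<integral>\<^sup>+w. \<integral>\<^sup>+z. \<integral>\<^sup>+y. g2 (w, (z, y)) \<partial>\<Phi> z \<partial>predictor k w \<partial>M)"
    proof (rule nn_integral_cong)
      fix w assume w: "w \<in> space M"
      have "Pair w \<in> (borel \<Otimes>\<^sub>M borel :: ('e \<times> 'f) measure) \<rightarrow>\<^sub>M obs k \<Otimes>\<^sub>M (borel \<Otimes>\<^sub>M borel)"
        using w by (intro measurable_Pair1') (simp add: space_measure_of_conv)
      note s = measurable_compose[OF this g1] measurable_compose[OF this g2]
      have "(\<lambda>y. g2 (w, (z, y))) \<in> borel_measurable borel" for z
        using measurable_compose[OF measurable_Pair1' s(2), of z] by simp
      \<comment> \<open>\<open>g2\<close> ignores the signal coordinate; putting
        \<open>undefined\<close> there gives a function of the observation alone.\<close>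
      then have g2y: "(\<lambda>y. g2 (w, (undefined, y))) \<in> borel_measurable borel" .
      have "(\<integral>\<^sup>+z. \<integral>\<^sup>+y. g1 (w, (z, y)) \<partial>\<Phi> z \<partial>predictor k w)
          = (\<integral>\<^sup>+y. \<integral>\<^sup>+z. g1 (w, (z, y)) \<partial>bayes \<Upsilon> y (predictor k w) \<partial>(predictor k w \<bind> \<Phi>))"
        using s(1) by (intro bayes_disintegration) (simp_all add: split_beta')
      also have "\<dots> = (\<integral>\<^sup>+y. g2 (w, (undefined, y)) \<partial>(predictor k w \<bind> \<Phi>))"
      proof (rule nn_integral_cong)
        fix y
        have "C \<in> sets (bayes \<Upsilon> y (predictor k w))" using C PA_D(2)[OF bayes_PA[OF predictor_PA]] by simp
        then show "(\<integral>\<^sup>+z. g1 (w, (z, y)) \<partial>bayes \<Upsilon> y (predictor k w)) = g2 (w, (undefined, y))"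
          by (simp add: g1_def g2_def nn_integral_cmult_indicator)
      qed
      also have "\<dots> = (\<integral>\<^sup>+z. \<integral>\<^sup>+y. g2 (w, (undefined, y)) \<partial>\<Phi> z \<partial>predictor k w)"
        by (rule nn_integral_bind_prob[OF predictor_PA \<Phi>_meas g2y])
      finally show "(\<integral>\<^sup>+z. \<integral>\<^sup>+y. g1 (w, (z, y)) \<partial>\<Phi> z \<partial>predictor k w) = (\<integral>\<^sup>+z. \<integral>\<^sup>+y. g2 (w, (z, y)) \<partial>\<Phi> z \<partial>predictor k w)"
        by (simp add: g2_def)
    qed
    also have "\<dots> = (\<integral>\<^sup>+w. g2 (w, (X k w, Y k w)) \<partial>M)" by (rule P[OF g2, symmetric])
    also have "\<dots> = (\<integral>\<^sup>+w. indicator e w * emeasure (filt k w) C \<partial>M)"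
      by (intro nn_integral_cong) (simp add: e bB g2_def indicator_def filt_predictor)
    finally show "(\<integral>\<^sup>+w. indicator e w * indicator C (X k w) \<partial>M) = (\<integral>\<^sup>+w. indicator e w * emeasure (filt k w) C \<partial>M)" .
  qed
qed

text \<open>An induction in which conditioning on the observation at time \<open>k\<close>
  (\<open>filter_update\<close>) alternates with one step of the signal
  (\<open>XY_transition\<close>). At time \<open>0\<close> the predictor is the initial law.\<close>

lemma XY_given_obs:
  assumes "g \<in> borel_measurable (obs k \<Otimes>\<^sub>M (borel \<Otimes>\<^sub>M borel))"
  shows "(\<integral>\<^sup>+w. g (w, (X k w, Y k w)) \<partial>M) = (\<integral>\<^sup>+w. \<integral>\<^sup>+z. \<integral>\<^sup>+y. g (w, (z, y)) \<partial>\<Phi> z \<partial>predictor k w \<partial>M)"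
  using assms
proof (induction k arbitrary: g)
  case 0
  from XY_transition[OF measurable_pair_subalgebra[OF sub_obs_past 0]]
  show ?case by (simp add: transition_def predictor_def)
next
  case (Suc k)
  note g = Suc.prems
  define q where "q p = (\<integral>\<^sup>+y. g (fst p, (snd p, y)) \<partial>\<Phi> (snd p))" for p
  have qm: "q \<in> borel_measurable (obs (Suc k) \<Otimes>\<^sub>M borel)"
    unfolding q_def
  proof (rule nn_integral_kernel_measurable[where R=borel])
    have "(\<lambda>r. (fst (fst r), (snd (fst r), snd r))) \<in> (obs (Suc k) \<Otimes>\<^sub>M borel) \<Otimes>\<^sub>M borel \<rightarrow>\<^sub>M obs (Suc k) \<Otimes>\<^sub>M (borel \<Otimes>\<^sub>M borel)"
      by measurable
    from measurable_compose[OF this g]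
    show "(\<lambda>(p, y). g (fst p, snd p, y)) \<in> borel_measurable ((obs (Suc k) \<Otimes>\<^sub>M borel) \<Otimes>\<^sub>M borel)"
      by (simp add: split_beta')
  qed (rule measurable_compose[OF measurable_snd \<Phi>_meas])
  define h where "h p = (\<integral>\<^sup>+z. q (fst p, z) \<partial>P (snd p))" for p
  have hm: "h \<in> borel_measurable (obs (Suc k) \<Otimes>\<^sub>M borel)"
    unfolding h_def
  proof (rule nn_integral_kernel_measurable[where R=borel])
    have "(\<lambda>r. (fst (fst r), snd r)) \<in> (obs (Suc k) \<Otimes>\<^sub>M (borel :: 'e measure)) \<Otimes>\<^sub>M borel \<rightarrow>\<^sub>M obs (Suc k) \<Otimes>\<^sub>M borel"
      by measurable
    from measurable_compose[OF this qm]
    show "(\<lambda>(p, z). q (fst p, z)) \<in> borel_measurable ((obs (Suc k) \<Otimes>\<^sub>M (borel :: 'e measure)) \<Otimes>\<^sub>M borel)"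
      by (simp add: split_beta')
  qed (rule measurable_compose[OF measurable_snd P_meas])
  have "(\<integral>\<^sup>+w. g (w, (X (Suc k) w, Y (Suc k) w)) \<partial>M) = (\<integral>\<^sup>+w. h (w, X k w) \<partial>M)"
    unfolding XY_transition[OF measurable_pair_subalgebra[OF sub_obs_past g]]
    by (simp add: transition_def h_def q_def)
  also have "\<dots> = (\<integral>\<^sup>+w. \<integral>\<^sup>+x. h (w, x) \<partial>filt k w \<partial>M)" by (rule filter_update[OF Suc.IH hm])
  also have "\<dots> = (\<integral>\<^sup>+w. \<integral>\<^sup>+z. q (w, z) \<partial>predictor (Suc k) w \<partial>M)"
  proof (rule nn_integral_cong)
    fix w assume "w \<in> space M"
    then have "(\<lambda>z. q (w, z)) \<in> borel_measurable borel"
      by (intro measurable_compose[OF measurable_Pair1' qm]) (simp add: space_measure_of_conv)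
    from nn_integral_bind_prob[OF filt_PA P_meas this]
    show "(\<integral>\<^sup>+x. h (w, x) \<partial>filt k w) = (\<integral>\<^sup>+z. q (w, z) \<partial>predictor (Suc k) w)"
      by (simp add: h_def predictor_def)
  qed
  finally show ?case by (simp add: q_def)
qed

lemmas X_given_obs = filter_update[OF XY_given_obs]

lemma Y_given_obs:
  assumes g: "g \<in> borel_measurable (obs k \<Otimes>\<^sub>M borel)"
  shows "(\<integral>\<^sup>+w. g (w, Y k w) \<partial>M) = (\<integral>\<^sup>+w. \<integral>\<^sup>+y. g (w, y) \<partial>(predictor k w \<bind> \<Phi>) \<partial>M)"
proof -
  have "(\<lambda>p. (fst p, snd (snd p))) \<in> obs k \<Otimes>\<^sub>M (borel \<Otimes>\<^sub>M borel :: ('e \<times> 'f) measure) \<rightarrow>\<^sub>M obs k \<Otimes>\<^sub>M borel" by measurable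
  from XY_given_obs[OF measurable_compose[OF this g]]
  have "(\<integral>\<^sup>+w. g (w, Y k w) \<partial>M) = (\<integral>\<^sup>+w. \<integral>\<^sup>+z. \<integral>\<^sup>+y. g (w, y) \<partial>\<Phi> z \<partial>predictor k w \<partial>M)" by simp
  also have "\<dots> = (\<integral>\<^sup>+w. \<integral>\<^sup>+y. g (w, y) \<partial>(predictor k w \<bind> \<Phi>) \<partial>M)"
  proof (rule nn_integral_cong)
    fix w assume "w \<in> space M"
    then have "(\<lambda>y. g (w, y)) \<in> borel_measurable borel"
      by (intro measurable_compose[OF measurable_Pair1' g]) (simp add: space_measure_of_conv)
    from nn_integral_bind_prob[OF predictor_PA \<Phi>_meas this]
    show "(\<integral>\<^sup>+z. \<integral>\<^sup>+y. g (w, y) \<partial>\<Phi> z \<partial>predictor k w) = (\<integral>\<^sup>+y. g (w, y) \<partial>(predictor k w \<bind> \<Phi>))" by simp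
  qed
  finally show ?thesis .
qed

lemma X_law:
  assumes f: "f \<in> borel_measurable borel"
  shows "(\<integral>\<^sup>+w. f (X k w) \<partial>M) = (\<integral>\<^sup>+z. f z \<partial>((\<lambda>m. m \<bind> P) ^^ k) \<mu>)"
  using f
proof (induction k arbitrary: f)
  case 0
  have "(\<integral>\<^sup>+w. f (X 0 w) \<partial>M) = (\<integral>\<^sup>+z. f z \<partial>distr M borel (X 0))"
    by (rule nn_integral_distr[symmetric]) (use 0 in auto)
  then show ?case using hmm by (simp add: hidden_markov_model_def markov_chain_def)
next
  case (Suc k)
  have "(\<lambda>p. f (snd p)) \<in> borel_measurable (SX {..<Suc k} \<Otimes>\<^sub>M borel)"
    by (rule measurable_compose[OF measurable_snd Suc.prems])
  from X_transition[OF this]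
  have "(\<integral>\<^sup>+w. f (X (Suc k) w) \<partial>M) = (\<integral>\<^sup>+w. \<integral>\<^sup>+z. f z \<partial>P (X k w) \<partial>M)" by (simp add: transition_def)
  also have "\<dots> = (\<integral>\<^sup>+x. \<integral>\<^sup>+z. f z \<partial>P x \<partial>((\<lambda>m. m \<bind> P) ^^ k) \<mu>)"
  proof (rule Suc.IH[of "\<lambda>x. \<integral>\<^sup>+z. f z \<partial>P x"])
    show "(\<lambda>x. \<integral>\<^sup>+z. f z \<partial>P x) \<in> borel_measurable borel"
      by (rule nn_integral_kernel_measurable[OF _ P_meas]) (use Suc.prems in simp)
  qed
  also have "\<dots> = (\<integral>\<^sup>+z. f z \<partial>((\<lambda>m. m \<bind> P) ^^ Suc k) \<mu>)"
    using nn_integral_bind_prob[OF iterates_PA[OF \<mu>_PA] P_meas Suc.prems] by simp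
  finally show ?case .
qed

lemma filt_mean:
  assumes A[measurable]: "A \<in> sets borel"
  shows "(\<integral>\<^sup>+w. emeasure (filt k w) A \<partial>M) = emeasure (((\<lambda>m. m \<bind> P) ^^ k) \<mu>) A"
proof -
  have "(\<lambda>p. indicator A (snd p) :: ennreal) \<in> borel_measurable (obs (Suc k) \<Otimes>\<^sub>M borel)" by measurable
  from X_given_obs[OF _ this]
  have "(\<integral>\<^sup>+w. indicator A (X k w) \<partial>M) = (\<integral>\<^sup>+w. emeasure (filt k w) A \<partial>M)"
    using PA_D(2)[OF filt_PA] by simp
  then show ?thesis using X_law[of "indicator A" k] PA_D(2)[OF iterates_PA[OF \<mu>_PA]] by simp
qed

text \<open>Only the inputs of steps before \<open>k\<close>, in contrast to \<open>obs k\<close>: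
  here the particles of step \<open>k\<close> are still random.\<close>

abbreviation old :: "nat \<Rightarrow> 'w measure" where "old k \<equiv> observed_past M Y \<xi> k k"

lemma sub_op: "subalgebra M (observed_past M Y \<xi> m k)"
  unfolding observed_past_def by (rule subalgebra_sigma) (use ev_Y ev_\<xi> in blast)

lemma old_Y: "i < k \<Longrightarrow> Y i \<in> old k \<rightarrow>\<^sub>M borel"
  unfolding observed_past_def by (rule sigma_events_measurable[where I="{..<k}"]; use ev_Pow in blast)

lemma x_op:
  assumes "1 \<le> N" "i < N" shows "x N k i \<in> observed_past M Y \<xi> k (Suc k) \<rightarrow>\<^sub>M borel"
  using particles assms unfolding bootstrap_particles_def by blast

lemma x_old:
  assumes "1 \<le> N" "i < N" "j < k" shows "x N j i \<in> old k \<rightarrow>\<^sub>M borel"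
proof -
  have "Defs.events M Y {..<j} \<subseteq> Defs.events M Y {..<k}" "Defs.events M \<xi> ({..<Suc j} \<times> UNIV) \<subseteq> Defs.events M \<xi> ({..<k} \<times> UNIV)"
    using assms(3) by (intro events_mono; auto)+
  then show ?thesis
    using x_op[OF assms(1,2), of j] ev_Pow unfolding observed_past_def
    by (elim measurable_sigma_mono[rotated 2]) (blast, simp)
qed

lemma x_obs:
  assumes "1 \<le> N" "i < N" shows "x N k i \<in> obs k \<rightarrow>\<^sub>M borel"
proof -
  have "Defs.events M \<xi> ({..<Suc k} \<times> UNIV) \<subseteq> Defs.events M \<xi> UNIV" by (intro events_mono) simp
  then show ?thesis
    using x_op[OF assms, of k] ev_Pow unfolding observed_past_def
    by (elim measurable_sigma_mono[rotated 2]) (blast, simp)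
qed

section \<open>Particle clouds and their conditional law\<close>

abbreviation law :: "nat \<Rightarrow> nat \<Rightarrow> 'w \<Rightarrow> 'e measure" where "law \<equiv> sampling_law \<mu> P \<Upsilon> Y x"
abbreviation pfilt :: "nat \<Rightarrow> nat \<Rightarrow> 'w \<Rightarrow> 'e measure" where "pfilt \<equiv> particle_filter \<Upsilon> Y x"

text \<open>Restricted to the index set, as elements of a product space are; the empirical measure
  looks at these coordinates only.\<close>

definition cloud :: "nat \<Rightarrow> nat \<Rightarrow> 'w \<Rightarrow> nat \<Rightarrow> 'e" where
  "cloud N k w = (\<lambda>i\<in>{..<N}. x N k i w)"

lemma empirical_cloud: "empirical N (\<lambda>i. x N k i w) = empirical N (cloud N k w)"
  unfolding empirical_def by (rule distr_cong) (simp_all add: cloud_def space_uniform_count_measure)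

lemma pfilt_cloud: "pfilt N k w = bayes \<Upsilon> (Y k w) (empirical N (cloud N k w))"
  unfolding particle_filter_def empirical_cloud ..

lemma cloud_meas: "(\<And>i. i < N \<Longrightarrow> x N k i \<in> H \<rightarrow>\<^sub>M borel) \<Longrightarrow> cloud N k \<in> H \<rightarrow>\<^sub>M ZS N"
  unfolding cloud_def[abs_def] by (intro measurable_restrict) auto

lemma pfilt_PA[simp]: "1 \<le> N \<Longrightarrow> pfilt N k w \<in> space PA"
  unfolding pfilt_cloud by (intro bayes_PA empirical_PA) simp

lemma law_PA[simp]: "1 \<le> N \<Longrightarrow> law N k w \<in> space PA"
  by (cases k) simp_all

lemma pfilt_meas:
  assumes "1 \<le> N" "Y k \<in> H \<rightarrow>\<^sub>M borel" "\<And>i. i < N \<Longrightarrow> x N k i \<in> H \<rightarrow>\<^sub>M borel"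
  shows "pfilt N k \<in> H \<rightarrow>\<^sub>M PA"
proof -
  have N: "0 < N" using assms(1) by simp
  have "(\<lambda>w. bayes \<Upsilon> (Y k w) (empirical N (cloud N k w))) \<in> H \<rightarrow>\<^sub>M PA"
    using assms by (intro bayes_measurable' measurable_compose[OF cloud_meas empirical_measurable[OF N]]) auto
  then show ?thesis by (simp add: pfilt_cloud[abs_def])
qed

lemma law_meas:
  assumes "1 \<le> N" "\<And>j. j < k \<Longrightarrow> Y j \<in> H \<rightarrow>\<^sub>M borel" "\<And>i j. j < k \<Longrightarrow> i < N \<Longrightarrow> x N j i \<in> H \<rightarrow>\<^sub>M borel"
  shows "law N k \<in> H \<rightarrow>\<^sub>M PA"
proof (cases k)
  case 0
  have "law N 0 = (\<lambda>_. \<mu>)" by (rule ext) simp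
  then show ?thesis by (simp add: 0)
next
  case (Suc n)
  have "(\<lambda>w. pfilt N n w \<bind> P) \<in> H \<rightarrow>\<^sub>M PA"
    using assms Suc by (intro measurable_bind_prob_space[OF _ P_meas] pfilt_meas) auto
  moreover have "law N (Suc n) = (\<lambda>w. pfilt N n w \<bind> P)" by (rule ext) simp
  ultimately show ?thesis by (simp only: Suc)
qed

lemma cloud_given_old:
  assumes N: "1 \<le> N" and g: "g \<in> borel_measurable (old k \<Otimes>\<^sub>M ZS N)"
  shows "(\<integral>\<^sup>+w. g (w, cloud N k w) \<partial>M) = (\<integral>\<^sup>+w. \<integral>\<^sup>+z. g (w, z) \<partial>samples N (law N k w) \<partial>M)"
proof -
  let ?R = "{Pi\<^sub>E {..<N} E | E. \<forall>i\<in>{..<N}. E i \<in> sets (borel :: 'e measure)}"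
  have sp: "space (ZS N :: (nat \<Rightarrow> 'e) measure) = Pi\<^sub>E {..<N} (\<lambda>_. UNIV)" by (simp add: space_PiM)
  have xM: "x N k i \<in> M \<rightarrow>\<^sub>M borel" if "i < N" for i
    by (rule measurable_from_subalg[OF sub_op x_op[OF N that]])
  have lm: "law N k \<in> old k \<rightarrow>\<^sub>M PA" by (intro law_meas N old_Y x_old)
  show ?thesis
  proof (rule disintegration_sets[OF M_prob sub_op _ _ Int_stable_boxes _ _ _ _ g])
    show "cloud N k \<in> M \<rightarrow>\<^sub>M ZS N" by (intro cloud_meas xM)
    show "sets (ZS N :: (nat \<Rightarrow> 'e) measure) = sigma_sets (space (ZS N)) ?R" unfolding sp by (rule sets_samples)
    show "space (ZS N :: (nat \<Rightarrow> 'e) measure) \<in> ?R" unfolding sp by (intro CollectI exI[of _ "\<lambda>_. UNIV"] conjI refl) auto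
    show "?R \<subseteq> Pow (space (ZS N))" unfolding sp by auto
    show "(\<lambda>w. samples N (law N k w)) \<in> old k \<rightarrow>\<^sub>M prob_algebra (ZS N)" by (rule samples_kernel[OF lm])
    fix a R assume a: "a \<in> sets (old k)" and "R \<in> ?R"
    then obtain E where R: "R = Pi\<^sub>E {..<N} E" and E: "\<And>i. i < N \<Longrightarrow> E i \<in> sets borel" by auto
    let ?B = "{w \<in> space M. \<forall>i<N. x N k i w \<in> E i}"
    have pl: "prob_space (law N k w)" for w by (rule PA_D[OF law_PA[OF N]])
    have AE: "AE w in M. cond_prob_given M (old k) ?B w = (\<Prod>i<N. measure (law N k w) (E i))"
      using particles N E unfolding bootstrap_particles_def by blast
    have "(\<integral>\<^sup>+w. indicator a w * indicator R (cloud N k w) \<partial>M) = (\<integral>\<^sup>+w. indicator a w * indicator ?B w \<partial>M)"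
      by (intro nn_integral_cong) (auto simp: R indicator_def cloud_def PiE_iff)
    also have "\<dots> = (\<integral>\<^sup>+w. indicator a w * ennreal (\<Prod>i<N. measure (law N k w) (E i)) \<partial>M)"
    proof (rule cond_prob_indicator[OF M_prob sub_op _ a _ _ _ AE])
      have "{w \<in> space M. \<forall>i\<in>{..<N}. x N k i w \<in> E i} \<in> sets M"
      proof (rule sets.sets_Collect_finite_All[OF _ finite_lessThan])
        show "{w \<in> space M. x N k i w \<in> E i} \<in> sets M" if "i \<in> {..<N}" for i
        proof -
          have "x N k i -` E i \<inter> space M \<in> sets M" using that by (intro measurable_sets[OF xM] E) simp_all
          moreover have "{w \<in> space M. x N k i w \<in> E i} = x N k i -` E i \<inter> space M" by blast
          ultimately show ?thesis by (simp only:)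
        qed
      qed
      then show "?B \<in> sets M" unfolding Ball_def lessThan_iff .
      have "(\<lambda>w. measure (law N k w) (E i)) \<in> borel_measurable M" if "i < N" for i
        using measurable_compose[OF measurable_from_subalg[OF sub_op lm] measurable_measure_prob_algebra[OF E[OF that]]] .
      then show "(\<lambda>w. \<Prod>i<N. measure (law N k w) (E i)) \<in> borel_measurable M"
        by (intro borel_measurable_prod) auto
      show "0 \<le> (\<Prod>i<N. measure (law N k w) (E i))" for w by (intro prod_nonneg) auto
      show "(\<Prod>i<N. measure (law N k w) (E i)) \<le> 1" for w
        by (intro prod_le_1) (auto intro: prob_space.prob_le_1 pl)
    qed
    also have "\<dots> = (\<integral>\<^sup>+w. indicator a w * emeasure (samples N (law N k w)) R \<partial>M)"
    proof (rule nn_integral_cong)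
      fix w
      interpret p: prob_space "law N k w" by (rule pl)
      interpret product_sigma_finite "\<lambda>_. law N k w" ..
      have "emeasure (samples N (law N k w)) R = (\<Prod>i<N. emeasure (law N k w) (E i))"
        unfolding R using E PA_D(2)[OF law_PA[OF N]] by (subst emeasure_PiM) auto
      then show "indicator a w * ennreal (\<Prod>i<N. measure (law N k w) (E i)) = indicator a w * emeasure (samples N (law N k w)) R"
        by (simp add: p.emeasure_eq_measure prod_ennreal)
    qed
    finally show "(\<integral>\<^sup>+w. indicator a w * indicator R (cloud N k w) \<partial>M) = (\<integral>\<^sup>+w. indicator a w * emeasure (samples N (law N k w)) R \<partial>M)" .
  qed
qed

text \<open>The order of conditioning matters: first the observation is integrated out given
  \<open>obs k\<close>, where the cloud is known, and then the cloud given \<open>old k\<close>,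
  where the predictor is known. Together they form one step of \<open>particle_evol\<close>.\<close>

lemma particle_step:
  assumes N: "1 \<le> N" and \<Psi>: "good \<Psi>"
  shows "(\<integral>\<^sup>+w. ennreal (\<Psi> (pfilt N k w) (filt k w)) \<partial>M) = (\<integral>\<^sup>+w. ennreal (particle_evol N \<Psi> (law N k w) (predictor k w)) \<partial>M)"
proof -
  have N0: "0 < N" using N by simp
  let ?e = "\<lambda>w. empirical N (cloud N k w)"
  have ePA: "empirical N z \<in> space PA" for z :: "nat \<Rightarrow> 'e" by (rule empirical_PA[OF N0])
  have em: "?e \<in> obs k \<rightarrow>\<^sub>M PA"
    by (intro measurable_compose[OF cloud_meas empirical_measurable[OF N0]] x_obs N)
  have pm: "predictor k \<in> obs k \<rightarrow>\<^sub>M PA" by (intro predictor_meas obs_meas)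
  have po: "predictor k \<in> old k \<rightarrow>\<^sub>M PA" by (intro predictor_meas old_Y)
  define g where "g p = ennreal (\<Psi> (bayes \<Upsilon> (snd p) (?e (fst p))) (bayes \<Upsilon> (snd p) (predictor k (fst p))))" for p
  have g: "g \<in> borel_measurable (obs k \<Otimes>\<^sub>M borel)"
    unfolding g_def
    by (intro measurable_compose[OF _ measurable_ennreal] good_meas[OF \<Psi>] bayes_measurable' measurable_snd
        measurable_compose[OF measurable_fst em] measurable_compose[OF measurable_fst pm])
  have "(\<lambda>p. evol \<Psi> (empirical N (snd p)) (predictor k (fst p))) \<in> borel_measurable (old k \<Otimes>\<^sub>M ZS N)"
    using measurable_compose[OF measurable_Pair[OF measurable_compose[OF measurable_snd empirical_measurable[OF N0]] measurable_compose[OF measurable_fst po]] evol_meas[OF \<Psi>]]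
    by simp
  then have g': "(\<lambda>p. ennreal (evol \<Psi> (empirical N (snd p)) (predictor k (fst p)))) \<in> borel_measurable (old k \<Otimes>\<^sub>M ZS N)" by simp
  have "(\<integral>\<^sup>+w. ennreal (\<Psi> (pfilt N k w) (filt k w)) \<partial>M) = (\<integral>\<^sup>+w. g (w, Y k w) \<partial>M)"
    by (simp add: g_def pfilt_cloud filt_predictor)
  also have "\<dots> = (\<integral>\<^sup>+w. \<integral>\<^sup>+y. g (w, y) \<partial>(predictor k w \<bind> \<Phi>) \<partial>M)" by (rule Y_given_obs[OF g])
  also have "\<dots> = (\<integral>\<^sup>+w. ennreal (evol \<Psi> (?e w) (predictor k w)) \<partial>M)"
  proof (rule nn_integral_cong)
    fix w
    have b: "0 \<le> \<Psi> (bayes \<Upsilon> y (?e w)) (bayes \<Upsilon> y (predictor k w))" "\<Psi> (bayes \<Upsilon> y (?e w)) (bayes \<Upsilon> y (predictor k w)) \<le> 2" for y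
      using good_bound[OF \<Psi>, of "bayes \<Upsilon> y (?e w)" "bayes \<Upsilon> y (predictor k w)"] ePA by simp_all
    show "(\<integral>\<^sup>+y. g (w, y) \<partial>(predictor k w \<bind> \<Phi>)) = ennreal (evol \<Psi> (?e w) (predictor k w))"
      unfolding g_def evol_def fst_conv snd_conv
      by (rule pa_integral01(3)[OF bind\<Phi>_PA[OF predictor_PA] evol_integrand_meas[OF \<Psi> ePA predictor_PA] b])
  qed
  also have "\<dots> = (\<integral>\<^sup>+w. \<integral>\<^sup>+z. ennreal (evol \<Psi> (empirical N z) (predictor k w)) \<partial>samples N (law N k w) \<partial>M)"
    using cloud_given_old[OF N g'] by simp
  also have "\<dots> = (\<integral>\<^sup>+w. ennreal (particle_evol N \<Psi> (law N k w) (predictor k w)) \<partial>M)"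
    unfolding particle_evol_def
    by (intro nn_integral_cong pa_integral01(3)[OF samples_prob[OF law_PA[OF N]] evol_empirical_meas[OF \<Psi> N0 predictor_PA], where B=2]
        evol_bound[OF \<Psi> ePA predictor_PA])
  finally show ?thesis .
qed

lemma filt_M: "filt k \<in> M \<rightarrow>\<^sub>M PA" and predictor_M: "predictor k \<in> M \<rightarrow>\<^sub>M PA"
  by (intro filt_meas predictor_meas Y_meas)+

lemma x_M: "1 \<le> N \<Longrightarrow> i < N \<Longrightarrow> x N k i \<in> M \<rightarrow>\<^sub>M borel"
  by (rule measurable_from_subalg[OF sub_op x_op])

lemma pfilt_M: "1 \<le> N \<Longrightarrow> pfilt N k \<in> M \<rightarrow>\<^sub>M PA" and law_M: "1 \<le> N \<Longrightarrow> law N k \<in> M \<rightarrow>\<^sub>M PA"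
  by (intro pfilt_meas law_meas Y_meas x_M; assumption)+

end

section \<open>Tightness and occupation measures\<close>

lemma tendsto_by_subsequences:
  fixes f :: "nat \<Rightarrow> 'a::metric_space"
  assumes sub: "\<And>r. strict_mono (r :: nat \<Rightarrow> nat) \<Longrightarrow> \<exists>s. strict_mono (s :: nat \<Rightarrow> nat) \<and> (\<lambda>n. f (r (s n))) \<longlonglongrightarrow> l"
  shows "f \<longlonglongrightarrow> l"
proof (rule ccontr)
  assume "\<not> f \<longlonglongrightarrow> l"
  then obtain e where e: "e > 0" "\<forall>N. \<exists>n\<ge>N. \<not> dist (f n) l < e" by (auto simp: lim_sequentially)
  then have "infinite {n. \<not> dist (f n) l < e}" unfolding infinite_nat_iff_unbounded_le by blast
  then obtain r :: "nat \<Rightarrow> nat" where r: "strict_mono r" "\<And>n. r n \<in> {n. \<not> dist (f n) l < e}"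
    using infinite_enumerate by blast
  obtain s where "(\<lambda>n. f (r (s n))) \<longlonglongrightarrow> l" using sub[OF r(1)] by blast
  then obtain n where "dist (f (r (s n))) l < e" using e(1) unfolding lim_sequentially by blast
  then show False using r(2)[of "s n"] by simp
qed

lemma measure_kernel_meas:
  "A \<in> sets B \<Longrightarrow> f \<in> H \<rightarrow>\<^sub>M prob_algebra B \<Longrightarrow> (\<lambda>x. measure (f x) A) \<in> borel_measurable H"
  by (rule measurable_compose[OF _ measurable_measure_prob_algebra])

lemma compact_compl_borel: "compact (C :: 'a::t2_space set) \<Longrightarrow> UNIV - C \<in> sets borel"
  by (intro borel_open open_Diff open_UNIV compact_imp_closed)

text \<open>Prescribing tails at every level \<open>i\<close> makes both coordinates tight, so for
  compact \<open>K i\<close> sequences in this set have weakly convergent subsequences. Membership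
  amounts to countably many conditions, hence the set is then measurable.\<close>

definition tight_pairs :: "(nat \<Rightarrow> 'e::polish_space set) \<Rightarrow> ('e measure \<times> 'e measure) set" where
  "tight_pairs K = {p \<in> space (PA \<Otimes>\<^sub>M PA). \<forall>i. measure (fst p) (UNIV - K i) + measure (snd p) (UNIV - K i) \<le> (1 / 2) ^ i}"

lemma tight_pairs_PA: "p \<in> tight_pairs K \<Longrightarrow> fst p \<in> space PA \<and> snd p \<in> space PA"
  by (auto simp: tight_pairs_def space_pair_measure)

lemma tight_pairs_seq:
  fixes K :: "nat \<Rightarrow> 'e::polish_space set"
  assumes K: "\<And>i. compact (K i)" and p: "\<And>n. p n \<in> tight_pairs K"
  obtains r l l' where "strict_mono (r :: nat \<Rightarrow> nat)" "l \<in> space PA" "l' \<in> space PA"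
    "wconv (\<lambda>n. fst (p (r n))) l" "wconv (\<lambda>n. snd (p (r n))) l'"
proof -
  have small: "\<exists>C. compact C \<and> (\<forall>n. measure (fst (p n)) (UNIV - C) \<le> e \<and> measure (snd (p n)) (UNIV - C) \<le> e)"
    if e: "e > 0" for e :: real
  proof -
    obtain i where i: "(1 / 2 :: real) ^ i < e" using real_arch_pow_inv[OF e, of "1 / 2"] by auto
    have "measure (fst (p n)) (UNIV - K i) \<le> e \<and> measure (snd (p n)) (UNIV - K i) \<le> e" for n
    proof -
      have "measure (fst (p n)) (UNIV - K i) + measure (snd (p n)) (UNIV - K i) \<le> (1 / 2) ^ i"
        using p[of n] by (auto simp: tight_pairs_def)
      then show ?thesis
        using i measure_nonneg[of "fst (p n)" "UNIV - K i"] measure_nonneg[of "snd (p n)" "UNIV - K i"] by linarith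
    qed
    then show ?thesis using K by blast
  qed
  have f: "fst (p n) \<in> space PA" "snd (p n) \<in> space PA" for n using tight_pairs_PA[OF p] by auto
  obtain r1 l where r1: "strict_mono (r1 :: nat \<Rightarrow> nat)" "l \<in> space PA" "wconv (\<lambda>n. fst (p (r1 n))) l"
  proof (rule tight_sequence_compact[of "\<lambda>n. fst (p n)"])
    show "\<exists>C. compact C \<and> (\<forall>j. measure (fst (p j)) (UNIV - C) \<le> e)" if "0 < e" for e using small[OF that] by blast
  qed (use f in auto)
  obtain r2 l' where r2: "strict_mono (r2 :: nat \<Rightarrow> nat)" "l' \<in> space PA" "wconv (\<lambda>n. snd (p (r1 (r2 n)))) l'"
  proof (rule tight_sequence_compact[of "\<lambda>n. snd (p (r1 n))"])
    show "\<exists>C. compact C \<and> (\<forall>j. measure (snd (p (r1 j))) (UNIV - C) \<le> e)" if "0 < e" for e using small[OF that] by blast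
  qed (use f in auto)
  show thesis
  proof (rule that[of "\<lambda>n. r1 (r2 n)" l l'])
    show "strict_mono (\<lambda>n. r1 (r2 n))" using strict_mono_o[OF r1(1) r2(1)] by (simp add: comp_def)
    show "wconv (\<lambda>n. fst (p (r1 (r2 n)))) l" by (rule wconv_subseq[OF r1(3) r2(1)])
  qed (use r1 r2 in auto)
qed

lemma tail_meas:
  fixes C :: "'e::polish_space set"
  assumes "compact C"
  shows "(\<lambda>p. measure (fst p) (UNIV - C) + measure (snd p) (UNIV - C)) \<in> borel_measurable (PA \<Otimes>\<^sub>M PA)"
proof -
  have "UNIV - C \<in> sets borel" by (rule compact_compl_borel[OF assms])
  then show ?thesis
    by (intro borel_measurable_add measure_kernel_meas[of _ borel] measurable_fst measurable_snd)
qed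

lemma tight_pairs_sets:
  assumes K: "\<And>i. compact (K i)" shows "tight_pairs K \<in> sets (PA \<Otimes>\<^sub>M PA)"
  unfolding tight_pairs_def
proof (rule sets.sets_Collect_countable_All)
  fix i
  note [measurable] = tail_meas[OF K[of i]]
  show "{p \<in> space (PA \<Otimes>\<^sub>M PA). measure (fst p) (UNIV - K i) + measure (snd p) (UNIV - K i) \<le> (1 / 2) ^ i} \<in> sets (PA \<Otimes>\<^sub>M PA)"
    by measurable
qed

lemma tail_bounds:
  assumes "p \<in> space (PA \<Otimes>\<^sub>M PA)"
  shows "0 \<le> measure (fst p) A + measure (snd p) A" "measure (fst p) A + measure (snd p) A \<le> 2"
proof -
  have "fst p \<in> space PA" "snd p \<in> space PA" using assms by (auto simp: space_pair_measure)
  then have "measure (fst p) A \<le> 1" "measure (snd p) A \<le> 1" by (auto dest: PA_D(1) intro: prob_space.prob_le_1)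
  then show "measure (fst p) A + measure (snd p) A \<le> 2" by simp
qed simp

lemma tight_pairs_prob:
  fixes K :: "nat \<Rightarrow> 'e::polish_space set"
  assumes Q: "Q \<in> space (prob_algebra (PA \<Otimes>\<^sub>M PA))" and K: "\<And>i. compact (K i)"
    and b: "\<And>i. (LINT p|Q. measure (fst p) (UNIV - K i) + measure (snd p) (UNIV - K i)) \<le> \<delta> / 4 ^ Suc i"
  shows "measure Q (space Q - tight_pairs K) \<le> \<delta>"
proof -
  interpret prob_space Q using Q by (simp add: space_prob_algebra)
  have sQ: "sets Q = sets (PA \<Otimes>\<^sub>M PA)" using Q by (simp add: space_prob_algebra)
  have sp: "space Q = space (PA \<Otimes>\<^sub>M PA)" by (rule sets_eq_imp_space_eq[OF sQ])
  define m where "m i p = measure (fst p) (UNIV - K i) + measure (snd p) (UNIV - K i)" for i and p :: "'e measure \<times> 'e measure"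
  have mm: "m i \<in> borel_measurable (PA \<Otimes>\<^sub>M PA)" for i unfolding m_def by (rule tail_meas[OF K])
  then have mQ[measurable]: "m i \<in> borel_measurable Q" for i using sQ by (simp cong: measurable_cong_sets)
  have mb: "0 \<le> m i p" "m i p \<le> 2" if "p \<in> space Q" for i p using tail_bounds[of p] that unfolding m_def sp by auto
  have mi: "integrable Q (m i)" for i
    by (rule pa_integrable[OF Q mm, of _ 2]) (use mb sp in auto)
  define B where "B i = {p \<in> space Q. (1 / 2) ^ i < m i p}" for i
  have B[measurable]: "B i \<in> sets Q" for i unfolding B_def by measurable
  \<comment> \<open>Markov's inequality: a mean of at most \<open>\<delta> / 4 ^ Suc i\<close>
    against the level \<open>(1 / 2) ^ i\<close>. These bounds sum to
    \<open>\<delta> / 2\<close>.\<close>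
  have "measure Q (B i) \<le> \<delta> / 4 * (1 / 2) ^ i" for i
  proof -
    have "(1 / 2) ^ i * measure Q (B i) = (LINT p|Q. (1 / 2) ^ i * indicator (B i) p)" by simp
    also have "\<dots> \<le> (LINT p|Q. m i p)"
    proof (rule integral_mono[OF _ mi])
      have "integrable Q (indicator (B i) :: _ \<Rightarrow> real)" by (simp add: emeasure_eq_measure)
      then show "integrable Q (\<lambda>p. (1 / 2) ^ i * indicator (B i) p :: real)" by simp
      show "(1 / 2) ^ i * indicator (B i) p \<le> m i p" if "p \<in> space Q" for p
        using mb(1)[OF that, of i] by (auto simp: B_def indicator_def)
    qed
    also have "\<dots> \<le> \<delta> / 4 ^ Suc i" unfolding m_def by (rule b)
    also have "\<dots> = (1 / 2) ^ i * (\<delta> / 4 * (1 / 2) ^ i)"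
    proof -
      have "(1 / 2 :: real) ^ i * (1 / 2) ^ i = (1 / 4) ^ i" by (simp flip: power_mult_distrib)
      then show ?thesis by (simp add: power_one_over field_simps)
    qed
    finally show ?thesis by (rule mult_left_le_imp_le) simp
  qed
  moreover have sum: "(\<lambda>i. \<delta> / 4 * (1 / 2) ^ i) sums (\<delta> / 4 * 2)"
    using sums_mult[OF geometric_sums[of "1 / 2 :: real"], of "\<delta> / 4"] by simp
  moreover have summ: "summable (\<lambda>i. measure Q (B i))"
    using calculation by (intro summable_comparison_test'[OF sums_summable[OF sum]]) auto
  ultimately have "(\<Sum>i. measure Q (B i)) \<le> \<delta> / 4 * 2"
    using suminf_le[OF _ summ sums_summable[OF sum]] sums_unique[OF sum] by simp
  moreover have "space Q - tight_pairs K = (\<Union>i. B i)"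
    by (auto simp: tight_pairs_def B_def m_def sp not_le) (metis not_le)
  moreover have "measure Q (\<Union>i. B i) \<le> (\<Sum>i. measure Q (B i))"
    using summ by (intro finite_measure_subadditive_countably) auto
  moreover have "0 \<le> \<delta>"
  proof -
    have "0 \<le> (LINT p|Q. m 0 p)" using mb by (intro integral_nonneg_AE AE_I2) auto
    also have "\<dots> \<le> \<delta> / 4 ^ Suc 0" unfolding m_def by (rule b)
    finally show ?thesis by simp
  qed
  ultimately show ?thesis by simp
qed

lemma tight_pairs_exist:
  fixes Q :: "nat \<Rightarrow> ('e::polish_space measure \<times> 'e measure) measure"
  assumes Q: "\<And>j. Q j \<in> space (prob_algebra (PA \<Otimes>\<^sub>M PA))" and \<delta>: "\<delta> > 0"
    and tight: "\<And>d. d > 0 \<Longrightarrow> \<exists>C. compact C \<and> (\<forall>j. (LINT p|Q j. measure (fst p) (UNIV - C) + measure (snd p) (UNIV - C)) \<le> d)"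
  obtains K where "\<And>i. compact (K i)" "\<And>j. measure (Q j) (space (Q j) - tight_pairs K) \<le> \<delta>"
proof -
  have "\<forall>i. \<exists>C. compact C \<and> (\<forall>j. (LINT p|Q j. measure (fst p) (UNIV - C) + measure (snd p) (UNIV - C)) \<le> \<delta> / 4 ^ Suc i)"
    by (rule allI, rule tight) (use \<delta> in simp)
  from choice[OF this] obtain K where
    "\<forall>i. compact (K i) \<and> (\<forall>j. (LINT p|Q j. measure (fst p) (UNIV - K i) + measure (snd p) (UNIV - K i)) \<le> \<delta> / 4 ^ Suc i)" ..
  then have K: "compact (K i)"
    "(LINT p|Q j. measure (fst p) (UNIV - K i) + measure (snd p) (UNIV - K i)) \<le> \<delta> / 4 ^ Suc i" for i j by blast+
  show thesis using that[of K] K(1) tight_pairs_prob[OF Q K] by blast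
qed

lemma compact_approx:
  fixes \<nu> :: "'e::polish_space measure"
  assumes \<nu>: "\<nu> \<in> space PA" and e: "e > 0"
  shows "\<exists>C. compact C \<and> measure \<nu> (UNIV - C) \<le> e"
proof -
  interpret prob_space \<nu> by (rule PA_D[OF \<nu>])
  have s: "sets \<nu> = sets borel" "space \<nu> = UNIV" using PA_D(2)[OF \<nu>] sets_eq_imp_space_eq[OF PA_D(2)[OF \<nu>]] by auto
  have "emeasure \<nu> UNIV = (SUP K \<in> {K. K \<subseteq> UNIV \<and> compact K}. emeasure \<nu> K)"
    by (rule inner_regular) (use s in auto)
  moreover have "emeasure \<nu> UNIV = 1" using emeasure_space_1 s by simp
  moreover have "ennreal (1 - min e (1 / 2)) < 1" using e by (simp add: ennreal_less_one_iff)
  ultimately have "ennreal (1 - min e (1 / 2)) < (SUP K \<in> {K. K \<subseteq> UNIV \<and> compact K}. emeasure \<nu> K)" by simp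
  then obtain K where K: "compact K" "ennreal (1 - min e (1 / 2)) < emeasure \<nu> K"
    unfolding less_SUP_iff by blast
  have KB: "K \<in> sets \<nu>" using K(1) s by (auto intro!: borel_closed compact_imp_closed)
  have "1 - min e (1 / 2) < measure \<nu> K" using K(2) by (subst (asm) emeasure_eq_measure, subst (asm) ennreal_less_iff) auto
  moreover have "measure \<nu> (UNIV - K) = 1 - measure \<nu> K" using prob_compl[OF KB] s by simp
  ultimately show ?thesis using K(1) by (intro exI[of _ K]) simp
qed

section \<open>Sampling error, uniformly on tight sets\<close>

context filter_model
begin

lemma Dist_meas: "(\<lambda>p. Dist r (fst p) (snd p)) \<in> borel_measurable (PA \<Otimes>\<^sub>M PA)"
  by (rule good_meas[OF good_Dist measurable_fst measurable_snd])

lemma Dist_pair_bounds: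
  assumes "p \<in> space (PA \<Otimes>\<^sub>M PA)" shows "0 \<le> Dist r (fst p) (snd p)" "Dist r (fst p) (snd p) \<le> 2"
  using good_bound[OF good_Dist, of "fst p" "snd p"] assms by (auto simp: space_pair_measure)

lemma particle_evol_meas:
  assumes g: "good \<Psi>" and N: "0 < N" and \<rho>: "\<rho> \<in> H \<rightarrow>\<^sub>M PA" and \<rho>': "\<rho>' \<in> H \<rightarrow>\<^sub>M PA"
  shows "(\<lambda>w. particle_evol N \<Psi> (\<rho> w) (\<rho>' w)) \<in> borel_measurable H"
  unfolding particle_evol_def
proof (rule integral_kernel_measurable[OF _ samples_kernel[OF \<rho>]])
  show "(\<lambda>(w, z). evol \<Psi> (empirical N z) (\<rho>' w)) \<in> borel_measurable (H \<Otimes>\<^sub>M ZS N)"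
    using measurable_compose[OF measurable_Pair[OF measurable_compose[OF measurable_snd empirical_measurable[OF N]] measurable_compose[OF measurable_fst \<rho>']] evol_meas[OF g]]
    by (simp add: split_beta')
qed

lemma particle_evol_pair:
  assumes N: "0 < N"
  shows "(\<lambda>p. particle_evol N (Dist r) (fst p \<bind> P) (snd p \<bind> P)) \<in> borel_measurable (PA \<Otimes>\<^sub>M PA)"
    and "p \<in> space (PA \<Otimes>\<^sub>M PA) \<Longrightarrow> 0 \<le> particle_evol N (Dist r) (fst p \<bind> P) (snd p \<bind> P)"
    and "p \<in> space (PA \<Otimes>\<^sub>M PA) \<Longrightarrow> particle_evol N (Dist r) (fst p \<bind> P) (snd p \<bind> P) \<le> 2"
  using particle_evol_bound[OF good_Dist N, of "fst p \<bind> P" "snd p \<bind> P" r]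
  by (auto simp: space_pair_measure intro!: particle_evol_meas[OF good_Dist N] measurable_bind_prob_space[OF _ P_meas])

text \<open>Pairs violating the bound for infinitely many \<open>j\<close> would have a weakly
  convergent subsequence, along which the sampled and the exact step tend to the same limit
  \<open>Dist (Suc r) l l'\<close>.\<close>

lemma particle_evol_uniform:
  fixes K :: "nat \<Rightarrow> 'e set"
  assumes K: "\<And>i. compact (K i)" and N0: "\<And>j. 0 < N j" and N: "filterlim N at_top sequentially" and e: "e > 0"
  shows "eventually (\<lambda>j. \<forall>p\<in>tight_pairs K. \<bar>particle_evol (N j) (Dist r) (fst p \<bind> P) (snd p \<bind> P) - Dist (Suc r) (fst p) (snd p)\<bar> \<le> e) sequentially"
proof (rule ccontr)
  let ?d = "\<lambda>j p. \<bar>particle_evol (N j) (Dist r) (fst p \<bind> P) (snd p \<bind> P) - Dist (Suc r) (fst p) (snd p)\<bar>"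
  assume "\<not> ?thesis"
  then have "infinite {j. \<exists>p\<in>tight_pairs K. \<not> ?d j p \<le> e}"
    unfolding eventually_sequentially infinite_nat_iff_unbounded_le by blast
  from infinite_enumerate[OF this] obtain a :: "nat \<Rightarrow> nat"
    where a: "strict_mono a" "\<forall>n. a n \<in> {j. \<exists>p\<in>tight_pairs K. \<not> ?d j p \<le> e}" by blast
  have "\<forall>n. \<exists>p. p \<in> tight_pairs K \<and> \<not> ?d (a n) p \<le> e" using a(2) unfolding mem_Collect_eq Bex_def .
  from choice[OF this] obtain p where "\<forall>n. p n \<in> tight_pairs K \<and> \<not> ?d (a n) (p n) \<le> e" ..
  then have p: "p n \<in> tight_pairs K" "\<not> ?d (a n) (p n) \<le> e" for n by blast+
  obtain t l l' where t: "strict_mono (t :: nat \<Rightarrow> nat)" "l \<in> space PA" "l' \<in> space PA"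
    "wconv (\<lambda>n. fst (p (t n))) l" "wconv (\<lambda>n. snd (p (t n))) l'"
    by (rule tight_pairs_seq[OF K p(1)])
  have f: "fst (p n) \<in> space PA" "snd (p n) \<in> space PA" for n using tight_pairs_PA[OF p(1)] by auto
  have at: "strict_mono (\<lambda>n. a (t n))" using strict_mono_o[OF a(1) t(1)] by (simp add: comp_def)
  have "(\<lambda>n. particle_evol (N (a (t n))) (Dist r) (fst (p (t n)) \<bind> P) (snd (p (t n)) \<bind> P)) \<longlonglongrightarrow> evol (Dist r) (l \<bind> P) (l' \<bind> P)"
    by (intro particle_evol_tendsto good_Dist bindP_PA f t wconv_bindP N0 filterlim_compose[OF N filterlim_subseq[OF at]])
  then have 1: "(\<lambda>n. particle_evol (N (a (t n))) (Dist r) (fst (p (t n)) \<bind> P) (snd (p (t n)) \<bind> P)) \<longlonglongrightarrow> Dist (Suc r) l l'"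
    by simp
  have 2: "(\<lambda>n. Dist (Suc r) (fst (p (t n))) (snd (p (t n)))) \<longlonglongrightarrow> Dist (Suc r) l l'"
    by (intro good_conv[OF good_Dist] f t)
  have "(\<lambda>n. ?d (a (t n)) (p (t n))) \<longlonglongrightarrow> \<bar>Dist (Suc r) l l' - Dist (Suc r) l l'\<bar>"
    by (intro tendsto_rabs tendsto_diff 1 2)
  then have "eventually (\<lambda>n. ?d (a (t n)) (p (t n)) < e) sequentially" using e by (intro order_tendstoD(2)) simp_all
  then obtain n where "?d (a (t n)) (p (t n)) < e" by (auto simp: eventually_sequentially)
  then show False using p(2)[of "t n"] by simp
qed

end

section \<open>Limits of occupation measures\<close>

context ergodic_model
begin

text \<open>Late iterates are close in total variation to \<open>l\<close>, a single and hence tight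
  law; the finitely many early ones are tight one by one.\<close>

lemma iterates_tight:
  assumes \<nu>: "\<nu> \<in> space PA" and e: "e > 0"
  shows "\<exists>C. compact C \<and> (\<forall>k. measure (((\<lambda>m. m \<bind> P) ^^ k) \<nu>) (UNIV - C) \<le> e)"
proof -
  let ?\<nu> = "\<lambda>k. ((\<lambda>m. m \<bind> P) ^^ k) \<nu>"
  have e2: "0 < e / 2" using e by simp
  obtain C where C: "compact C" "measure l (UNIV - C) \<le> e / 2" using compact_approx[OF l_PA e2] by blast
  obtain k0 where k0: "\<And>k A. k \<ge> k0 \<Longrightarrow> A \<in> sets borel \<Longrightarrow> \<bar>measure (?\<nu> k) A - measure l A\<bar> < e / 2"
    using Pn_tv[OF \<nu> e2] unfolding bind_Pn[OF \<nu>] by blast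
  have "\<forall>k. \<exists>D. compact D \<and> measure (?\<nu> k) (UNIV - D) \<le> e" using compact_approx[OF iterates_PA[OF \<nu>] e] by blast
  then obtain D where D: "\<And>k. compact (D k)" "\<And>k. measure (?\<nu> k) (UNIV - D k) \<le> e" by metis
  define E where "E = C \<union> (\<Union>k<k0. D k)"
  have E: "compact E" unfolding E_def using C D by (intro compact_Un compact_UN) auto
  note mono = PA_measure_mono[OF iterates_PA[OF \<nu>] compact_compl_borel]
  have "measure (?\<nu> k) (UNIV - E) \<le> e" for k
  proof (cases "k < k0")
    case True
    then have "UNIV - E \<subseteq> UNIV - D k" by (auto simp: E_def)
    from mono[OF D(1) this, of k] show ?thesis using D(2)[of k] by linarith
  next
    case False
    have "UNIV - E \<subseteq> UNIV - C" by (auto simp: E_def)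
    from mono[OF C(1) this, of k] show ?thesis
      using k0[OF _ compact_compl_borel[OF C(1)], of k] False C(2) by linarith
  qed
  then show ?thesis using E by blast
qed

text \<open>The values of all the functions \<open>Dist r\<close> embed pairs of measures into the compact space
  \<open>[0,2]\<^sup>\<nat>\<close>. Weak compactness there replaces weak compactness of laws on the space of pairs of measures.\<close>

lemma occupation_limit:
  fixes Q :: "nat \<Rightarrow> ('e measure \<times> 'e measure) measure"
  assumes Q: "\<And>j. Q j \<in> space (prob_algebra (PA \<Otimes>\<^sub>M PA))"
    and tight: "\<And>d. d > 0 \<Longrightarrow> \<exists>C. compact C \<and> (\<forall>j. (LINT p|Q j. measure (fst p) (UNIV - C) + measure (snd p) (UNIV - C)) \<le> d)"
    and step: "\<And>r. (\<lambda>j. (LINT p|Q j. Dist (Suc r) (fst p) (snd p)) - (LINT p|Q j. Dist r (fst p) (snd p))) \<longlonglongrightarrow> 0"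
    and e: "e > 0"
  shows "\<exists>j. (LINT p|Q j. bl_dist (fst p) (snd p)) \<le> e"
proof (rule ccontr)
  let ?I = "\<lambda>r j. LINT p|Q j. Dist r (fst p) (snd p)"
  assume "\<not> ?thesis"
  then have ge: "e < ?I 0 j" for j by (auto simp: not_le)
  have sQ: "sets (Q j) = sets (PA \<Otimes>\<^sub>M PA)" "space (Q j) = space (PA \<Otimes>\<^sub>M PA)" for j
  proof -
    show "sets (Q j) = sets (PA \<Otimes>\<^sub>M PA)" using Q[of j] by (simp add: space_prob_algebra)
    then show "space (Q j) = space (PA \<Otimes>\<^sub>M PA)" by (rule sets_eq_imp_space_eq)
  qed
  have pQ: "prob_space (Q j)" for j using Q[of j] by (simp add: space_prob_algebra)
  have I2: "?I r j \<le> 2" for r j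
  proof -
    have "\<bar>?I r j\<bar> \<le> 2" by (rule pa_integral_le[OF Q Dist_meas]) (subst abs_of_nonneg; rule Dist_pair_bounds)
    then show ?thesis by simp
  qed
  have e2: "e \<le> 2" using ge[of 0] I2[of 0 0] by linarith
  \<comment> \<open>At the end \<open>e\<close> turns out to be at most \<open>2 * \<delta>\<close>,
    which is \<open>e / 4\<close>.\<close>
  define \<delta> where "\<delta> = e / 8"
  have \<delta>: "\<delta> > 0" "\<delta> < 1" using e e2 by (auto simp: \<delta>_def)
  obtain K where K: "\<And>i. compact (K i)" "\<And>j. measure (Q j) (space (Q j) - tight_pairs K) \<le> \<delta>"
    using tight_pairs_exist[OF Q \<delta>(1) tight] by blast
  have tp: "1 - \<delta> \<le> measure (Q j) (tight_pairs K)" for j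
  proof -
    interpret prob_space "Q j" by (rule pQ)
    have "tight_pairs K \<in> sets (Q j)" unfolding sQ by (rule tight_pairs_sets[OF K(1)])
    from prob_compl[OF this] have "prob (tight_pairs K) = 1 - prob (space (Q j) - tight_pairs K)" by simp
    moreover have "prob (space (Q j) - tight_pairs K) \<le> \<delta>" by (rule K(2))
    ultimately show ?thesis by simp
  qed
  define V :: "'e measure \<times> 'e measure \<Rightarrow> nat \<Rightarrow> real" where "V p r = Dist r (fst p) (snd p)" for p r
  have Vm: "V \<in> borel_measurable (PA \<Otimes>\<^sub>M PA)"
    by (rule measurable_coordinatewise_then_product) (simp add: V_def Dist_meas)
  then have VQ: "V \<in> Q j \<rightarrow>\<^sub>M borel" for j using sQ by (simp cong: measurable_cong_sets)
  have Vb: "0 \<le> V p r" "V p r \<le> 2" if "p \<in> space (PA \<Otimes>\<^sub>M PA)" for p r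
    unfolding V_def using Dist_pair_bounds[OF that] by auto
  define L where "L j = distr (Q j) borel V" for j
  have L: "L j \<in> space PA" for j unfolding L_def by (intro PA_I prob_space.prob_space_distr pQ VQ) simp
  have iL: "(LINT v|L j. f v) = (LINT p|Q j. f (V p))" if "f \<in> borel_measurable borel" for f :: "(nat \<Rightarrow> real) \<Rightarrow> real" and j
    unfolding L_def by (rule integral_distr[OF VQ that])
  have coord: "continuous_on UNIV (\<lambda>v :: nat \<Rightarrow> real. v r)" for r
    by (rule continuous_on_product_then_coordinatewise[OF continuous_on_id])
  \<comment> \<open>All \<open>L j\<close> live on this cube, which is compact by Tychonoff's
    theorem, so they are tight.\<close>
  define B :: "(nat \<Rightarrow> real) set" where "B = Pi\<^sub>E UNIV (\<lambda>_. {0..2})"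
  have B: "compact B"
  proof -
    have "compactin (product_topology (\<lambda>_. euclidean) UNIV) B"
      unfolding B_def compactin_PiE by (auto simp: compactin_euclidean_iff)
    then show ?thesis by (simp add: euclidean_product_topology compactin_euclidean_iff)
  qed
  have LB: "measure (L j) (UNIV - B) = 0" for j
  proof -
    have "UNIV - B \<in> sets borel" by (rule compact_compl_borel[OF B])
    then have "measure (L j) (UNIV - B) = measure (Q j) (V -` (UNIV - B) \<inter> space (Q j))"
      unfolding L_def by (rule measure_distr[OF VQ])
    also have "V -` (UNIV - B) \<inter> space (Q j) = {}" using Vb unfolding sQ B_def by (auto simp: PiE_iff)
    finally show ?thesis by simp
  qed
  obtain s \<Lambda> where s: "strict_mono (s :: nat \<Rightarrow> nat)" and \<Lambda>: "\<Lambda> \<in> space PA" and w: "wconv (\<lambda>j. L (s j)) \<Lambda>"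
  proof (rule tight_sequence_compact[of L])
    show "\<exists>C. compact C \<and> (\<forall>j. measure (L j) (UNIV - C) \<le> d)" if "d > 0" for d using B LB that by (intro exI[of _ B]) simp
  qed (use L in auto)
  interpret \<Lambda>: prob_space \<Lambda> by (rule PA_D[OF \<Lambda>])
  have [measurable_cong]: "sets \<Lambda> = sets borel" by (rule PA_D[OF \<Lambda>])
  \<comment> \<open>Coordinates are truncated to \<open>[0,2]\<close> to become bounded continuous
    test functions; on the values of \<open>V\<close> nothing changes.\<close>
  define c where "c r v = max 0 (min 2 (v r))" for r and v :: "nat \<Rightarrow> real"
  have cc: "continuous_on UNIV (c r)" for r unfolding c_def by (intro continuous_intros coord)
  have cb: "0 \<le> c r v" "c r v \<le> 2" "\<bar>c r v\<bar> \<le> 2" for r v by (auto simp: c_def)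
  have cm[measurable]: "c r \<in> borel_measurable borel" for r by (rule borel_measurable_continuous_onI[OF cc])
  have cI: "(LINT v|L j. c r v) = ?I r j" for r j
    unfolding iL[OF cm] using Vb by (intro Bochner_Integration.integral_cong) (auto simp: sQ c_def V_def)
  have lim: "(\<lambda>j. ?I r (s j)) \<longlonglongrightarrow> (LINT v|\<Lambda>. c r v)" for r
    using wconv_D[OF w cc cb(3), of r] unfolding cI .
  have diff: "(\<lambda>j. ?I r j - ?I 0 j) \<longlonglongrightarrow> 0" for r
  proof (induction r)
    case (Suc r)
    have "(\<lambda>j. (?I (Suc r) j - ?I r j) + (?I r j - ?I 0 j)) \<longlonglongrightarrow> 0 + 0" by (rule tendsto_add[OF step Suc])
    then show ?case by simp
  qed simp
  \<comment> \<open>By the hypothesis \<open>step\<close> all coordinates have the same limiting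
    mean as coordinate \<open>0\<close>, which stays above \<open>e\<close>.\<close>
  have large: "e \<le> (LINT v|\<Lambda>. c r v)" for r
  proof -
    have "(\<lambda>j. ?I r (s j) - (?I r (s j) - ?I 0 (s j))) \<longlonglongrightarrow> (LINT v|\<Lambda>. c r v) - 0"
      using LIMSEQ_subseq_LIMSEQ[OF diff s, of r] by (intro tendsto_diff lim) (simp add: comp_def)
    then have "(\<lambda>j. ?I 0 (s j)) \<longlonglongrightarrow> (LINT v|\<Lambda>. c r v)" by simp
    then show ?thesis by (rule LIMSEQ_le_const) (use ge in \<open>auto intro!: less_imp_le\<close>)
  qed
  \<comment> \<open>The closure is taken so that weak limits keep mass on the set. A point of it is
    still a sequence of values \<open>Dist r \<nu> \<nu>'\<close>, since pairs from
    \<open>tight_pairs K\<close> have convergent subsequences, and filter stability makes this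
    sequence vanish.\<close>
  define F where "F = closure (V ` tight_pairs K)"
  have clF: "closed F" by (simp add: F_def)
  have Fm[measurable]: "F \<in> sets borel" by (rule borel_closed[OF clF])
  have "tight_pairs K \<noteq> {}" using tp[of 0] \<delta> by (auto simp del: not_le)
  then have neF: "F \<noteq> {}" by (simp add: F_def)
  have vanish: "(\<lambda>r. c r v) \<longlonglongrightarrow> 0" if "v \<in> F" for v
  proof -
    have "\<exists>y. (\<forall>n. y n \<in> V ` tight_pairs K) \<and> y \<longlonglongrightarrow> v" using that unfolding F_def closure_sequential .
    then obtain y where y: "\<forall>n. y n \<in> V ` tight_pairs K" "y \<longlonglongrightarrow> v" by (elim exE conjE)
    define p where "p n = inv_into (tight_pairs K) V (y n)" for n
    have p: "p n \<in> tight_pairs K" "y n = V (p n)" for n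
      unfolding p_def using y(1) by (simp_all add: inv_into_into f_inv_into_f)
    obtain t \<nu> \<nu>' where t: "strict_mono (t :: nat \<Rightarrow> nat)" "\<nu> \<in> space PA" "\<nu>' \<in> space PA"
      "wconv (\<lambda>n. fst (p (t n))) \<nu>" "wconv (\<lambda>n. snd (p (t n))) \<nu>'"
      by (rule tight_pairs_seq[OF K(1) p(1)])
    have "v r = Dist r \<nu> \<nu>'" for r
    proof (rule LIMSEQ_unique)
      have "(\<lambda>n. y (t n)) \<longlonglongrightarrow> v" using LIMSEQ_subseq_LIMSEQ[OF y(2) t(1)] by (simp add: comp_def)
      moreover have "isCont (\<lambda>v :: nat \<Rightarrow> real. v r) v"
        using coord[of r] continuous_on_eq_continuous_at[OF open_UNIV] by blast
      ultimately show "(\<lambda>n. y (t n) r) \<longlonglongrightarrow> v r" by (rule isCont_tendsto_compose[rotated])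
      have "(\<lambda>n. Dist r (fst (p (t n))) (snd (p (t n)))) \<longlonglongrightarrow> Dist r \<nu> \<nu>'"
        using tight_pairs_PA[OF p(1)] by (intro good_conv[OF good_Dist] t) auto
      then show "(\<lambda>n. y (t n) r) \<longlonglongrightarrow> Dist r \<nu> \<nu>'" by (simp add: p(2) V_def)
    qed
    moreover have "0 \<le> Dist r \<nu> \<nu>'" "Dist r \<nu> \<nu>' \<le> 2" for r using good_bound[OF good_Dist t(2,3)] by auto
    ultimately have "c r v = Dist r \<nu> \<nu>'" for r by (simp add: c_def)
    then show ?thesis using Dist_tendsto[OF t(2,3)] by simp
  qed
  \<comment> \<open>Continuous functions equal to \<open>1\<close> on \<open>F\<close> and
    decreasing to its indicator; through them the bound \<open>1 - \<delta>\<close> passes to the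
    weak limit.\<close>
  define f where "f m v = max 0 (1 - real m * infdist v F)" for m and v :: "nat \<Rightarrow> real"
  have fc: "continuous_on UNIV (f m)" for m unfolding f_def by (intro continuous_intros)
  have fb: "0 \<le> f m v" "f m v \<le> 1" "\<bar>f m v\<bar> \<le> 1" for m v by (auto simp: f_def infdist_nonneg)
  have fm[measurable]: "f m \<in> borel_measurable borel" for m by (rule borel_measurable_continuous_onI[OF fc])
  have fge: "1 - \<delta> \<le> (LINT v|\<Lambda>. f m v)" for m
  proof (rule LIMSEQ_le_const[OF wconv_D[OF w fc fb(3)]], intro exI allI impI)
    fix j
    interpret prob_space "Q (s j)" by (rule pQ)
    have T: "tight_pairs K \<in> sets (Q (s j))" unfolding sQ by (rule tight_pairs_sets[OF K(1)])
    have "1 - \<delta> \<le> measure (Q (s j)) (tight_pairs K)" by (rule tp)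
    also have "\<dots> = (LINT p|Q (s j). indicator (tight_pairs K) p)" using T by simp
    also have "\<dots> \<le> (LINT p|Q (s j). f m (V p))"
    proof (rule integral_mono)
      show "integrable (Q (s j)) (indicator (tight_pairs K) :: _ \<Rightarrow> real)" using T by (simp add: emeasure_eq_measure)
      show "integrable (Q (s j)) (\<lambda>p. f m (V p))"
        by (rule integrable_const_bound[where B=1]) (use fb(3) measurable_compose[OF VQ fm] in auto)
      show "indicator (tight_pairs K) p \<le> f m (V p)" for p
      proof (cases "p \<in> tight_pairs K")
        case True
        then have "V p \<in> F" unfolding F_def by (intro subsetD[OF closure_subset] imageI)
        then show ?thesis using True by (simp add: f_def)
      qed (simp add: fb)
    qed
    also have "\<dots> = (LINT v|L (s j). f m v)" by (rule iL[OF fm, symmetric])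
    finally show "1 - \<delta> \<le> (LINT v|L (s j). f m v)" .
  qed
  have flim: "(\<lambda>m. LINT v|\<Lambda>. f m v) \<longlonglongrightarrow> (LINT v|\<Lambda>. indicator F v)"
  proof (rule integral_dominated_convergence[where w="\<lambda>_. 1"])
    show "AE v in \<Lambda>. (\<lambda>m. f m v) \<longlonglongrightarrow> indicator F v"
    proof (rule AE_I2)
      fix v
      show "(\<lambda>m. f m v) \<longlonglongrightarrow> indicator F v"
      proof (cases "v \<in> F")
        case False
        then have i: "0 < infdist v F"
          using in_closed_iff_infdist_zero[OF clF neF, of v] infdist_nonneg[of v F] by linarith
        have "eventually (\<lambda>m. 1 / infdist v F < real m) sequentially"
          using filterlim_real_sequentially unfolding filterlim_at_top_dense by blast
        then have "eventually (\<lambda>m. f m v = 0) sequentially"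
          by eventually_elim (use i in \<open>simp add: f_def pos_divide_less_eq\<close>)
        then show ?thesis using False by (simp add: tendsto_eventually)
      qed (simp add: f_def)
    qed
  qed (use fb in auto)
  have "1 - \<delta> \<le> (LINT v|\<Lambda>. indicator F v)" by (rule LIMSEQ_le_const[OF flim]) (use fge in blast)
  then have F\<delta>: "1 - \<delta> \<le> measure \<Lambda> F" by simp
  have ci: "integrable \<Lambda> (\<lambda>v. c r v * indicator F v)" for r
    by (rule \<Lambda>.integrable_const_bound[where B=2]) (use cb in \<open>auto simp: indicator_def\<close>)
  have up: "(LINT v|\<Lambda>. c r v) \<le> (LINT v|\<Lambda>. c r v * indicator F v) + 2 * \<delta>" for r
  proof -
    have "(LINT v|\<Lambda>. c r v) \<le> (LINT v|\<Lambda>. c r v * indicator F v + 2 * (1 - indicator F v))"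
    proof (rule integral_mono)
      show "integrable \<Lambda> (c r)" by (rule \<Lambda>.integrable_const_bound[where B=2]) (use cb in auto)
      show "integrable \<Lambda> (\<lambda>v. c r v * indicator F v + 2 * (1 - indicator F v))"
        using ci by (simp add: \<Lambda>.emeasure_eq_measure)
      show "c r v \<le> c r v * indicator F v + 2 * (1 - indicator F v)" for v using cb[of r v] by (simp add: indicator_def)
    qed
    also have "\<dots> = (LINT v|\<Lambda>. c r v * indicator F v) + 2 * (1 - measure \<Lambda> F)"
      using ci by (simp add: \<Lambda>.emeasure_eq_measure \<Lambda>.prob_space)
    finally show ?thesis using F\<delta> by simp
  qed
  have "(\<lambda>r. LINT v|\<Lambda>. c r v * indicator F v) \<longlonglongrightarrow> (LINT v|\<Lambda>. 0)"
  proof (rule integral_dominated_convergence[where w="\<lambda>_. 2"])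
    show "AE v in \<Lambda>. (\<lambda>r. c r v * indicator F v) \<longlonglongrightarrow> 0"
    proof (rule AE_I2)
      fix v show "(\<lambda>r. c r v * indicator F v) \<longlonglongrightarrow> 0" using vanish[of v] by (cases "v \<in> F") auto
    qed
  qed (use cb in \<open>auto simp: indicator_def\<close>)
  then have clim: "(\<lambda>r. (LINT v|\<Lambda>. c r v * indicator F v) + 2 * \<delta>) \<longlonglongrightarrow> 0 + 2 * \<delta>" by (intro tendsto_add tendsto_const) simp
  have cge: "e \<le> (LINT v|\<Lambda>. c r v * indicator F v) + 2 * \<delta>" for r using large[of r] up[of r] by simp
  have "e \<le> 0 + 2 * \<delta>" by (rule LIMSEQ_le_const[OF clim]) (use cge in blast)
  then show False using e by (simp add: \<delta>_def)
qed

end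

section \<open>Time-uniform consistency\<close>

context hidden_markov
begin

definition cost :: "('e measure \<Rightarrow> 'e measure \<Rightarrow> real) \<Rightarrow> nat \<Rightarrow> nat \<Rightarrow> real" where
  "cost \<Psi> N k = (LINT w|M. \<Psi> (pfilt N k w) (filt k w))"

lemma M_PA: "M \<in> space (prob_algebra M)" using M_prob by (simp add: space_prob_algebra)

lemma cost_integrand:
  assumes "1 \<le> N" "good \<Psi>"
  shows "(\<lambda>w. \<Psi> (pfilt N k w) (filt k w)) \<in> borel_measurable M"
    and "0 \<le> \<Psi> (pfilt N k w) (filt k w)" and "\<Psi> (pfilt N k w) (filt k w) \<le> 2"
  using good_meas[OF assms(2) pfilt_M[OF assms(1)] filt_M] good_bound[OF assms(2) pfilt_PA[OF assms(1)] filt_PA] by auto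

lemma cost_bounds:
  assumes "1 \<le> N" "good \<Psi>" shows "0 \<le> cost \<Psi> N k" "cost \<Psi> N k \<le> 2"
    and cost_nn: "(\<integral>\<^sup>+w. ennreal (\<Psi> (pfilt N k w) (filt k w)) \<partial>M) = ennreal (cost \<Psi> N k)"
  unfolding cost_def using pa_integral01[OF M_PA cost_integrand[OF assms]] by simp_all

lemma cost_step:
  assumes N: "1 \<le> N" and \<Psi>: "good \<Psi>"
  shows "cost \<Psi> N k = (LINT w|M. particle_evol N \<Psi> (law N k w) (predictor k w))"
proof -
  have N0: "0 < N" using N by simp
  note p = particle_evol_meas[OF \<Psi> N0 law_M[OF N] predictor_M]
    and b = particle_evol_bound[OF \<Psi> N0 law_PA[OF N] predictor_PA]
  have "ennreal (cost \<Psi> N k) = ennreal (LINT w|M. particle_evol N \<Psi> (law N k w) (predictor k w))"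
    unfolding cost_nn[OF N \<Psi>, symmetric] particle_step[OF N \<Psi>] by (rule pa_integral01(3)[OF M_PA p b])
  then show ?thesis using cost_bounds(1)[OF N \<Psi>] pa_integral01(1)[OF M_PA p b] by simp
qed

text \<open>Convergence in mean gives almost sure convergence along subsequences, which is enough by
  \<open>tendsto_by_subsequences\<close>. \<open>F\<close> may depend on \<open>n\<close> because
  the sampling step does, hence \<open>conv\<close> speaks of an arbitrary subsequence
  \<open>s\<close>.\<close>

lemma mean_tendsto_zero:
  fixes a :: "nat \<Rightarrow> 'w \<Rightarrow> 'e measure" and b :: "'w \<Rightarrow> 'e measure"
  assumes a: "\<And>n. a n \<in> M \<rightarrow>\<^sub>M PA" "\<And>n w. a n w \<in> space PA"
    and b: "b \<in> M \<rightarrow>\<^sub>M PA" "\<And>w. b w \<in> space PA"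
    and L1: "(\<lambda>n. LINT w|M. bl_dist (a n w) (b w)) \<longlonglongrightarrow> 0"
    and F: "\<And>n. (\<lambda>w. F n (a n w) (b w)) \<in> borel_measurable M" "\<And>n w. \<bar>F n (a n w) (b w)\<bar> \<le> 2"
    and conv: "\<And>s u l. strict_mono (s :: nat \<Rightarrow> nat) \<Longrightarrow> (\<And>n. u n \<in> space PA) \<Longrightarrow> l \<in> space PA \<Longrightarrow> wconv u l \<Longrightarrow>
      (\<lambda>n. F (s n) (u n) l) \<longlonglongrightarrow> (0 :: real)"
  shows "(\<lambda>n. LINT w|M. F n (a n w) (b w)) \<longlonglongrightarrow> 0"
proof (rule tendsto_by_subsequences)
  fix r :: "nat \<Rightarrow> nat" assume r: "strict_mono r"
  have bl: "0 \<le> bl_dist (a n w) (b w)" "bl_dist (a n w) (b w) \<le> 2" for n w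
    using bl_dist_nonneg[OF a(2) b(2)] bl_dist_le2[OF a(2) b(2)] by auto
  have "\<exists>s. strict_mono (s :: nat \<Rightarrow> nat) \<and> (AE w in M. (\<lambda>n. bl_dist (a (r (s n)) w) (b w)) \<longlonglongrightarrow> 0)"
  proof (rule tendsto_L1_AE_subseq)
    show "integrable M (\<lambda>w. bl_dist (a (r n) w) (b w))" for n
      by (rule pa_integrable[OF M_PA good_meas[OF good_bl_dist a(1) b(1)], of _ 2]) (use bl in auto)
    show "(\<lambda>n. LINT w|M. norm (bl_dist (a (r n) w) (b w))) \<longlonglongrightarrow> 0"
      using LIMSEQ_subseq_LIMSEQ[OF L1 r] bl by (simp add: comp_def)
  qed
  then obtain s where s: "strict_mono (s :: nat \<Rightarrow> nat)" "AE w in M. (\<lambda>n. bl_dist (a (r (s n)) w) (b w)) \<longlonglongrightarrow> 0" by blast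
  have rs: "strict_mono (\<lambda>n. r (s n))" using strict_mono_o[OF r s(1)] by (simp add: comp_def)
  have "(\<lambda>n. LINT w|M. F (r (s n)) (a (r (s n)) w) (b w)) \<longlonglongrightarrow> (LINT w|M. 0)"
  proof (rule integral_dominated_convergence[where w="\<lambda>_. 2"])
    show "AE w in M. (\<lambda>n. F (r (s n)) (a (r (s n)) w) (b w)) \<longlonglongrightarrow> 0"
      using s(2) by eventually_elim (intro conv[OF rs] a b bl_dist_imp_wconv)
  qed (use F in auto)
  then show "\<exists>s. strict_mono (s :: nat \<Rightarrow> nat) \<and> (\<lambda>n. LINT w|M. F (r (s n)) (a (r (s n)) w) (b w)) \<longlonglongrightarrow> 0"
    using s(1) by auto
qed

text \<open>For fixed \<open>k\<close>, two half steps alternate: a consistent sampling law makes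
  the updated particle filter consistent by \<open>particle_evol_tendsto\<close>, and a consistent
  filter passes through \<open>P\<close> by the Feller property. The count \<open>Suc n\<close>
  avoids a system without particles.\<close>

lemma law_consistent: "(\<lambda>n. LINT w|M. bl_dist (law (Suc n) k w) (predictor k w)) \<longlonglongrightarrow> 0"
  and cost_tendsto: "(\<lambda>n. cost bl_dist (Suc n) k) \<longlonglongrightarrow> 0"
proof -
  have step: "(\<lambda>n. cost bl_dist (Suc n) k) \<longlonglongrightarrow> 0"
    if "(\<lambda>n. LINT w|M. bl_dist (law (Suc n) k w) (predictor k w)) \<longlonglongrightarrow> 0" for k
    unfolding cost_step[OF Suc_le_mono[THEN iffD2, OF le0, folded One_nat_def] good_bl_dist]
  proof (rule mean_tendsto_zero[OF _ _ predictor_M predictor_PA that])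
    fix n w
    show "law (Suc n) k \<in> M \<rightarrow>\<^sub>M PA" by (intro law_M) simp
    show "law (Suc n) k w \<in> space PA" by simp
    show "(\<lambda>w. particle_evol (Suc n) bl_dist (law (Suc n) k w) (predictor k w)) \<in> borel_measurable M"
      by (intro particle_evol_meas good_bl_dist law_M predictor_M) auto
    have "0 \<le> particle_evol (Suc n) bl_dist (law (Suc n) k w) (predictor k w)"
      "particle_evol (Suc n) bl_dist (law (Suc n) k w) (predictor k w) \<le> 2"
      by (intro particle_evol_bound good_bl_dist; simp)+
    then show "\<bar>particle_evol (Suc n) bl_dist (law (Suc n) k w) (predictor k w)\<bar> \<le> 2" by simp
  next
    fix s and u :: "nat \<Rightarrow> 'e measure" and l
    assume s: "strict_mono (s :: nat \<Rightarrow> nat)" and u: "\<And>n. u n \<in> space PA" "l \<in> space PA" "wconv u l"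
    have "filterlim (\<lambda>n. Suc (s n)) at_top sequentially"
      by (rule filterlim_subseq) (use s in \<open>simp add: strict_mono_def\<close>)
    then have "(\<lambda>n. particle_evol (Suc (s n)) bl_dist (u n) l) \<longlonglongrightarrow> evol bl_dist l l"
      by (intro particle_evol_tendsto good_bl_dist u) (auto simp: wconv_def u)
    then show "(\<lambda>n. particle_evol (Suc (s n)) bl_dist (u n) l) \<longlonglongrightarrow> 0" by (simp add: evol_def bl_dist_self)
  qed
  show law: "(\<lambda>n. LINT w|M. bl_dist (law (Suc n) k w) (predictor k w)) \<longlonglongrightarrow> 0"
  proof (induction k)
    case 0
    then show ?case by (simp add: predictor_def bl_dist_self)
  next
    case (Suc k)
    have bm: "bl_dist (m \<bind> P) (m' \<bind> P) \<ge> 0" "bl_dist (m \<bind> P) (m' \<bind> P) \<le> 2" if "m \<in> space PA" "m' \<in> space PA" for m m'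
      using bl_dist_nonneg bl_dist_le2 bindP_PA[OF that(1)] bindP_PA[OF that(2)] by blast+
    have "(\<lambda>n. LINT w|M. bl_dist (pfilt (Suc n) k w \<bind> P) (filt k w \<bind> P)) \<longlonglongrightarrow> 0"
    proof (rule mean_tendsto_zero[OF _ _ filt_M filt_PA step[OF Suc.IH, unfolded cost_def], where F="\<lambda>_ m m'. bl_dist (m \<bind> P) (m' \<bind> P)"])
      fix n w
      show pm: "pfilt (Suc n) k \<in> M \<rightarrow>\<^sub>M PA" by (intro pfilt_M) simp
      show "pfilt (Suc n) k w \<in> space PA" by simp
      show "(\<lambda>w. bl_dist (pfilt (Suc n) k w \<bind> P) (filt k w \<bind> P)) \<in> borel_measurable M"
        by (intro good_meas[OF good_bl_dist] measurable_bind_prob_space[OF _ P_meas] pm filt_M)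
      show "\<bar>bl_dist (pfilt (Suc n) k w \<bind> P) (filt k w \<bind> P)\<bar> \<le> 2" using bm[of "pfilt (Suc n) k w" "filt k w"] by simp
    next
      fix u :: "nat \<Rightarrow> 'e measure" and l
      assume "\<And>n. u n \<in> space PA" "l \<in> space PA" "wconv u l"
      then show "(\<lambda>n. bl_dist (u n \<bind> P) (l \<bind> P)) \<longlonglongrightarrow> 0" by (intro wconv_imp_bl_dist wconv_bindP bindP_PA)
    qed
    then show ?case by (simp add: predictor_def)
  qed
  show "(\<lambda>n. cost bl_dist (Suc n) k) \<longlonglongrightarrow> 0" by (rule step[OF law])
qed

text \<open>Law of the pair of filters at a uniformly chosen time, so that time averages of
  expectations become integrals and compactness can be applied to one measure for each
  \<open>N\<close> and \<open>T\<close>.\<close>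

definition occupation :: "nat \<Rightarrow> nat \<Rightarrow> ('e measure \<times> 'e measure) measure" where
  "occupation N T = distr (uniform_count_measure {1..T} \<Otimes>\<^sub>M M) (PA \<Otimes>\<^sub>M PA) (\<lambda>(k, w). (pfilt N k w, filt k w))"

lemma pair_meas:
  assumes "1 \<le> N"
  shows "(\<lambda>(k, w). (pfilt N k w, filt k w)) \<in> uniform_count_measure {1..T} \<Otimes>\<^sub>M M \<rightarrow>\<^sub>M PA \<Otimes>\<^sub>M PA"
proof -
  have "(\<lambda>p. (pfilt N (fst p) (snd p), filt (fst p) (snd p))) \<in> count_space {1..T} \<Otimes>\<^sub>M M \<rightarrow>\<^sub>M PA \<Otimes>\<^sub>M PA"
    using pfilt_M[OF assms] filt_M by (intro measurable_pair_measure_countable1) auto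
  then show ?thesis by (simp add: split_beta' uniform_count_measure_def point_measure_def cong: measurable_cong_sets sets_pair_measure_cong)
qed

lemma occupation_prob:
  assumes "1 \<le> N" "1 \<le> T" shows "occupation N T \<in> space (prob_algebra (PA \<Otimes>\<^sub>M PA))"
proof -
  interpret U: prob_space "uniform_count_measure {1..T}" using assms by (intro prob_space_uniform_count_measure) auto
  interpret pair_prob_space "uniform_count_measure {1..T}" M ..
  show ?thesis unfolding occupation_def space_prob_algebra
    using P.prob_space_distr[OF pair_meas[OF assms(1)]] by simp
qed

lemma integral_occupation:
  fixes f :: "'e measure \<times> 'e measure \<Rightarrow> real"
  assumes N: "1 \<le> N" and T: "1 \<le> T" and f: "f \<in> borel_measurable (PA \<Otimes>\<^sub>M PA)" "\<And>p. p \<in> space (PA \<Otimes>\<^sub>M PA) \<Longrightarrow> \<bar>f p\<bar> \<le> B"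
  shows "(LINT p|occupation N T. f p) = (\<Sum>k=1..T. LINT w|M. f (pfilt N k w, filt k w)) / real T"
proof -
  let ?U = "uniform_count_measure {1..T}"
  interpret U: prob_space ?U using T by (intro prob_space_uniform_count_measure) auto
  interpret pair_prob_space ?U M ..
  let ?g = "\<lambda>p. f (pfilt N (fst p) (snd p), filt (fst p) (snd p))"
  have gm: "?g \<in> borel_measurable (?U \<Otimes>\<^sub>M M)"
    using measurable_compose[OF pair_meas[OF N] f(1)] by (simp add: split_beta')
  have "integrable (?U \<Otimes>\<^sub>M M) ?g"
  proof (rule P.integrable_const_bound[OF _ gm, of B], rule AE_I2)
    show "norm (?g p) \<le> B" for p using f(2)[of "(pfilt N (fst p) (snd p), filt (fst p) (snd p))"] N by (simp add: space_pair_measure)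
  qed
  from integral_fst'[OF this]
  have "(LINT p|(?U \<Otimes>\<^sub>M M). ?g p) = (LINT k|?U. LINT w|M. f (pfilt N k w, filt k w))" by simp
  also have "\<dots> = (\<Sum>k=1..T. 1 / real T * (LINT w|M. f (pfilt N k w, filt k w)))"
    unfolding uniform_count_measure_def by (subst lebesgue_integral_point_measure_finite) auto
  finally show ?thesis
    unfolding occupation_def integral_distr[OF pair_meas[OF N] f(1)] by (simp add: split_beta' sum_divide_distrib)
qed

lemma integral_occupation_cost:
  assumes "1 \<le> N" "1 \<le> T"
  shows "(LINT p|occupation N T. Dist r (fst p) (snd p)) = (\<Sum>k=1..T. cost (Dist r) N k) / real T"
  using integral_occupation[OF assms Dist_meas[of r], of 2] Dist_pair_bounds by (simp add: cost_def)

text \<open>The sampled step from the pair at time \<open>k\<close> has as its mean the cost at time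
  \<open>Suc k\<close>, so the two averages telescope to a difference of two costs in
  \<open>[0,2]\<close>, divided by \<open>T\<close>.\<close>

lemma one_step_occupation:
  assumes N: "1 \<le> N" and T: "1 \<le> T"
  shows "\<bar>(LINT p|occupation N T. particle_evol N (Dist r) (fst p \<bind> P) (snd p \<bind> P)) - (LINT p|occupation N T. Dist r (fst p) (snd p))\<bar> \<le> 2 / real T"
proof -
  have N0: "0 < N" using N by simp
  have sb: "\<bar>particle_evol N (Dist r) (fst p \<bind> P) (snd p \<bind> P)\<bar> \<le> 2" if "p \<in> space (PA \<Otimes>\<^sub>M PA)" for p
    using particle_evol_pair(2,3)[OF N0 that] by simp
  have "(LINT w|M. particle_evol N (Dist r) (pfilt N k w \<bind> P) (filt k w \<bind> P)) = cost (Dist r) N (Suc k)" for k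
    by (simp add: cost_step[OF N good_Dist] predictor_def)
  then have "(LINT p|occupation N T. particle_evol N (Dist r) (fst p \<bind> P) (snd p \<bind> P)) = (\<Sum>k=1..T. cost (Dist r) N (Suc k)) / real T"
    using integral_occupation[OF N T particle_evol_pair(1)[OF N0] sb] by simp
  moreover have "(\<Sum>k=1..T. cost (Dist r) N (Suc k)) - (\<Sum>k=1..T. cost (Dist r) N k) = cost (Dist r) N (Suc T) - cost (Dist r) N 1"
    using sum_Suc_diff[of 1 T "cost (Dist r) N"] T by (simp add: sum_subtractf)
  ultimately have "(LINT p|occupation N T. particle_evol N (Dist r) (fst p \<bind> P) (snd p \<bind> P)) - (LINT p|occupation N T. Dist r (fst p) (snd p))
      = (cost (Dist r) N (Suc T) - cost (Dist r) N 1) / real T"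
    unfolding integral_occupation_cost[OF N T] by (simp flip: diff_divide_distrib)
  moreover have "\<bar>cost (Dist r) N (Suc T) - cost (Dist r) N 1\<bar> \<le> 2"
    using cost_bounds(1,2)[OF N good_Dist, of r "Suc T"] cost_bounds(1,2)[OF N good_Dist, of r 1] by linarith
  ultimately show ?thesis by (simp add: divide_right_mono)
qed

text \<open>The near invariance under the sampled step is combined with its uniform closeness to the
  exact step on tight pairs. The horizons have to tend to infinity because of the boundary term
  \<open>2 / T j\<close>.\<close>

lemma occupation_step:
  fixes K :: "nat \<Rightarrow> nat \<Rightarrow> 'e set"
  assumes N: "\<And>j. 1 \<le> N j" "filterlim N at_top sequentially" and T: "\<And>j. 1 \<le> T j" "filterlim T at_top sequentially"
    and tight: "\<And>d. d > 0 \<Longrightarrow> \<exists>C. compact C \<and> (\<forall>j. (LINT p|occupation (N j) (T j). measure (fst p) (UNIV - C) + measure (snd p) (UNIV - C)) \<le> d)"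
  shows "(\<lambda>j. (LINT p|occupation (N j) (T j). Dist (Suc r) (fst p) (snd p)) - (LINT p|occupation (N j) (T j). Dist r (fst p) (snd p))) \<longlonglongrightarrow> 0"
proof (rule LIMSEQ_I)
  fix e :: real assume e: "e > 0"
  let ?Q = "\<lambda>j. occupation (N j) (T j)"
  let ?S = "\<lambda>j p. particle_evol (N j) (Dist r) (fst p \<bind> P) (snd p \<bind> P)"
  let ?D = "\<lambda>r p. Dist r (fst p) (snd p)"
  note Q = occupation_prob[OF N(1) T(1)]
  have N0: "0 < N j" for j using N(1)[of j] by simp
  \<comment> \<open>The three contributions are \<open>e / 4\<close> on tight pairs,
    \<open>2 * \<delta> = e / 4\<close> off them, and less than \<open>e / 4\<close> from the
    boundary term.\<close>
  define \<delta> where "\<delta> = e / 8"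
  have \<delta>: "\<delta> > 0" using e by (simp add: \<delta>_def)
  obtain K where K: "\<And>i. compact (K i)" "\<And>j. measure (?Q j) (space (?Q j) - tight_pairs K) \<le> \<delta>"
    using tight_pairs_exist[OF Q \<delta> tight] by blast
  have "eventually (\<lambda>j. \<forall>p\<in>tight_pairs K. \<bar>?S j p - ?D (Suc r) p\<bar> \<le> e / 4) sequentially"
    by (rule particle_evol_uniform[OF K(1) N0 N(2)]) (use e in simp)
  moreover have "(\<lambda>j. 2 / real (T j)) \<longlonglongrightarrow> 0"
    by (rule tendsto_divide_0[OF tendsto_const filterlim_at_top_imp_at_infinity])
      (rule filterlim_compose[OF filterlim_real_sequentially T(2)])
  then have "eventually (\<lambda>j. 2 / real (T j) < e / 4) sequentially" by (rule order_tendstoD(2)) (use e in simp)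
  ultimately have "eventually (\<lambda>j. norm ((LINT p|?Q j. ?D (Suc r) p) - (LINT p|?Q j. ?D r p) - 0) < e) sequentially"
  proof eventually_elim
    case (elim j)
    interpret Qj: prob_space "?Q j" using Q[of j] by (simp add: space_prob_algebra)
    have sQ: "sets (?Q j) = sets (PA \<Otimes>\<^sub>M PA)" "space (?Q j) = space (PA \<Otimes>\<^sub>M PA)"
      by (simp_all add: occupation_def)
    note sb = particle_evol_pair(2,3)[OF N0[of j], where r=r]
    have si: "integrable (?Q j) (?S j)" by (rule pa_integrable[OF Q particle_evol_pair(1)[OF N0], where B=2]) (use sb in fastforce)
    have di: "integrable (?Q j) (?D (Suc r))"
      by (rule pa_integrable[OF Q Dist_meas[of "Suc r"], of 2]) (subst abs_of_nonneg; rule Dist_pair_bounds)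
    have ts: "tight_pairs K \<in> sets (?Q j)" unfolding sQ by (rule tight_pairs_sets[OF K(1)])
    have "\<bar>(LINT p|?Q j. ?D (Suc r) p) - (LINT p|?Q j. ?S j p)\<bar> = \<bar>LINT p|?Q j. ?D (Suc r) p - ?S j p\<bar>" using si di by simp
    also have "\<dots> \<le> (LINT p|?Q j. \<bar>?D (Suc r) p - ?S j p\<bar>)" by (rule integral_abs_bound)
    also have "\<dots> \<le> (LINT p|?Q j. e / 4 + 2 * indicator (space (?Q j) - tight_pairs K) p)"
    proof (rule integral_mono)
      show "integrable (?Q j) (\<lambda>p. \<bar>?D (Suc r) p - ?S j p\<bar>)" using si di by simp
      show "integrable (?Q j) (\<lambda>p. e / 4 + 2 * indicator (space (?Q j) - tight_pairs K) p)"
        using ts by (simp add: Qj.emeasure_eq_measure)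
      fix p assume p: "p \<in> space (?Q j)"
      show "\<bar>?D (Suc r) p - ?S j p\<bar> \<le> e / 4 + 2 * indicator (space (?Q j) - tight_pairs K) p"
      proof (cases "p \<in> tight_pairs K")
        case True
        then have "\<bar>?S j p - ?D (Suc r) p\<bar> \<le> e / 4" using elim(1) by blast
        then show ?thesis using True by (simp add: abs_minus_commute)
      next
        case False
        have "\<bar>?D (Suc r) p - ?S j p\<bar> \<le> 2"
          using sb[of p] Dist_pair_bounds[of p "Suc r"] p unfolding sQ by linarith
        then show ?thesis using False p e by simp
      qed
    qed
    also have "\<dots> = e / 4 + 2 * measure (?Q j) (space (?Q j) - tight_pairs K)"
      using ts by (simp add: Qj.emeasure_eq_measure Qj.prob_space)
    finally have "\<bar>(LINT p|?Q j. ?D (Suc r) p) - (LINT p|?Q j. ?S j p)\<bar> \<le> e / 4 + 2 * \<delta>" using K(2)[of j] by linarith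
    moreover have "\<bar>(LINT p|?Q j. ?S j p) - (LINT p|?Q j. ?D r p)\<bar> < e / 4"
      using one_step_occupation[OF N(1)[of j] T(1)[of j], of r] elim(2) by linarith
    ultimately show ?case using e unfolding \<delta>_def real_norm_def diff_zero by linarith
  qed
  then show "\<exists>no. \<forall>j\<ge>no. norm ((LINT p|?Q j. ?D (Suc r) p) - (LINT p|?Q j. ?D r p) - 0) < e"
    by (auto simp: eventually_sequentially)
qed

text \<open>Points of the occupation measure are pairs of measures, so binding with
  \<open>fst\<close> forms the barycentre of its first marginal. This turns tightness of the
  averaged laws into a bound on mean tails.\<close>

lemma averaged_law:
  assumes N: "1 \<le> N" and T: "1 \<le> T"
  shows "averaged_law M (pfilt N) T = occupation N T \<bind> fst"
proof -
  let ?U = "uniform_count_measure {1..T}"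
  have fm: "fst \<in> occupation N T \<rightarrow>\<^sub>M subprob_algebra borel"
    by (rule measurable_prob_algebraD) (simp add: occupation_def)
  have ne: "space (occupation N T) \<noteq> {}"
    by (rule prob_space.not_empty) (use occupation_prob[OF N T] in \<open>simp add: space_prob_algebra\<close>)
  have "emeasure (occupation N T \<bind> fst) A = (\<integral>\<^sup>+w. (\<Sum>k=1..T. emeasure (pfilt N k w) A) / of_nat T \<partial>M)"
    if A: "A \<in> sets borel" for A
  proof -
    have em: "(\<lambda>m. emeasure m A) \<in> borel_measurable PA"
      by (rule measurable_compose[OF measurable_prob_algebraD[OF measurable_ident] measurable_emeasure_subprob_algebra[OF A], unfolded id_def])
    have pm: "(\<lambda>w. emeasure (pfilt N k w) A) \<in> borel_measurable M" for k by (rule measurable_compose[OF pfilt_M[OF N] em])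
    have gm: "(\<lambda>p. emeasure (pfilt N (fst p) (snd p)) A) \<in> borel_measurable (?U \<Otimes>\<^sub>M M)"
      using measurable_compose[OF pair_meas[OF N] measurable_compose[OF measurable_fst em]] by (simp add: split_beta')
    have "emeasure (occupation N T \<bind> fst) A = (\<integral>\<^sup>+p. emeasure (fst p) A \<partial>occupation N T)"
      by (rule emeasure_bind[OF ne fm A])
    also have "\<dots> = (\<integral>\<^sup>+p. emeasure (pfilt N (fst p) (snd p)) A \<partial>(?U \<Otimes>\<^sub>M M))"
      unfolding occupation_def
      by (subst nn_integral_distr[OF pair_meas[OF N]]) (auto simp: split_beta' intro: measurable_compose[OF measurable_fst em])
    also have "\<dots> = (\<integral>\<^sup>+k. \<integral>\<^sup>+w. emeasure (pfilt N k w) A \<partial>M \<partial>?U)"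
      using nn_integral_fst[OF gm] by simp
    also have "\<dots> = (\<Sum>k=1..T. ennreal (1 / real T) * (\<integral>\<^sup>+w. emeasure (pfilt N k w) A \<partial>M))"
      unfolding uniform_count_measure_def by (subst nn_integral_point_measure_finite) auto
    also have "\<dots> = (\<Sum>k=1..T. \<integral>\<^sup>+w. emeasure (pfilt N k w) A \<partial>M) / of_nat T"
      using T by (simp add: sum_distrib_left divide_ennreal_def inverse_ennreal ennreal_of_nat_eq_real_of_nat inverse_eq_divide mult.commute sum_distrib_right)
    also have "\<dots> = (\<integral>\<^sup>+w. (\<Sum>k=1..T. emeasure (pfilt N k w) A) / of_nat T \<partial>M)"
      using pm by (simp add: nn_integral_divide nn_integral_sum)
    finally show ?thesis .
  qed
  moreover have s: "sets (occupation N T \<bind> fst) = sets borel"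
    by (rule sets_bind[OF _ ne]) (use measurable_space[OF fm] in \<open>auto simp: space_subprob_algebra\<close>)
  moreover have "occupation N T \<bind> fst = measure_of UNIV (sets borel) (emeasure (occupation N T \<bind> fst))"
    using measure_of_of_measure[of "occupation N T \<bind> fst"] sets_eq_imp_space_eq[OF s] s by simp
  ultimately show ?thesis
    unfolding averaged_law_def by (metis (no_types, lifting) measure_of_eq sets.space_closed sets.sigma_sets_eq space_borel)
qed

lemma measure_averaged_law:
  assumes N: "1 \<le> N" and T: "1 \<le> T" and A: "A \<in> sets borel"
  shows "(LINT p|occupation N T. measure (fst p) A) = measure (averaged_law M (pfilt N) T) A"
proof -
  note Q = occupation_prob[OF N T]
  have fm: "fst \<in> PA \<Otimes>\<^sub>M PA \<rightarrow>\<^sub>M (PA :: 'e measure measure)" by simp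
  have "ennreal (LINT p|occupation N T. measure (fst p) A) = (\<integral>\<^sup>+p. ennreal (measure (fst p) A) \<partial>occupation N T)"
  proof (rule nn_integral_eq_integral[symmetric])
    show "integrable (occupation N T) (\<lambda>p. measure (fst p) A)"
      by (rule pa_integrable[OF Q measure_kernel_meas[OF A fm], of 1])
        (auto simp: space_pair_measure dest!: PA_D(1) intro: prob_space.prob_le_1)
  qed simp
  also have "\<dots> = (\<integral>\<^sup>+p. emeasure (fst p) A \<partial>occupation N T)"
  proof (rule nn_integral_cong)
    fix p assume "p \<in> space (occupation N T)"
    then interpret q: prob_space "fst p" by (intro PA_D(1)) (auto simp: occupation_def space_pair_measure)
    show "ennreal (measure (fst p) A) = emeasure (fst p) A" by (simp add: q.emeasure_eq_measure)
  qed
  also have "\<dots> = emeasure (occupation N T \<bind> fst) A"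
    using prob_space.not_empty[of "occupation N T"] Q A
    by (intro emeasure_bind[symmetric]) (auto simp: space_prob_algebra occupation_def intro!: measurable_prob_algebraD)
  finally have "enn2real (ennreal (LINT p|occupation N T. measure (fst p) A)) = measure (occupation N T \<bind> fst) A"
    unfolding measure_def[of "occupation N T \<bind> fst"] by (rule arg_cong)
  moreover have "0 \<le> (LINT p|occupation N T. measure (fst p) A)" by (rule integral_nonneg_AE) simp
  ultimately show ?thesis unfolding averaged_law[OF N T] by simp
qed

lemma integral_filt:
  assumes A: "A \<in> sets borel"
  shows "(LINT w|M. measure (filt k w) A) = measure (((\<lambda>m. m \<bind> P) ^^ k) \<mu>) A"
proof -
  have it: "((\<lambda>m. m \<bind> P) ^^ k) \<mu> \<in> space PA" for k by (induction k) simp_all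
  interpret it: prob_space "((\<lambda>m. m \<bind> P) ^^ k) \<mu>" by (rule PA_D[OF it])
  have em: "emeasure (filt k w) A = ennreal (measure (filt k w) A)" for w
    by (intro finite_measure.emeasure_eq_measure prob_space.finite_measure PA_D(1) filt_PA)
  have mb: "0 \<le> measure (filt k w) A" "measure (filt k w) A \<le> 1" for w
    by (auto intro: prob_space.prob_le_1 PA_D(1) filt_PA)
  note p = pa_integral01[OF M_PA measure_kernel_meas[OF A filt_M] mb]
  have "ennreal (LINT w|M. measure (filt k w) A) = ennreal (measure (((\<lambda>m. m \<bind> P) ^^ k) \<mu>) A)"
    using filt_mean[OF A, of k] unfolding em p(3) it.emeasure_eq_measure .
  then show ?thesis using p(1) by simp
qed

lemma measure_filt_occupation:
  assumes N: "1 \<le> N" and T: "1 \<le> T" and A: "A \<in> sets borel"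
    and le: "\<And>k. measure (((\<lambda>m. m \<bind> P) ^^ k) \<mu>) A \<le> d"
  shows "(LINT p|occupation N T. measure (snd p) A) \<le> d"
proof -
  have "(\<lambda>p :: 'e measure \<times> 'e measure. measure (snd p) A) \<in> borel_measurable (PA \<Otimes>\<^sub>M PA)"
    by (rule measure_kernel_meas[OF A]) simp
  then have "(LINT p|occupation N T. measure (snd p) A) = (\<Sum>k=1..T. measure (((\<lambda>m. m \<bind> P) ^^ k) \<mu>) A) / real T"
    by (subst integral_occupation[OF N T, of _ 1])
      (auto simp: integral_filt[OF A] space_pair_measure intro!: prob_space.prob_le_1 PA_D(1))
  also have "\<dots> \<le> (\<Sum>k=1..T. d) / real T" by (intro divide_right_mono sum_mono le) simp
  finally show ?thesis using T by simp
qed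

end

section \<open>From tight averages to uniformity in the horizon\<close>

locale ergodic_hidden_markov = hidden_markov P \<Phi> \<phi> \<Upsilon> M X Y \<mu> \<xi> x + ergodic_model P \<Phi> \<phi> \<Upsilon> l
  for P :: "'e::polish_space \<Rightarrow> 'e measure" and \<Phi> :: "'e \<Rightarrow> 'f::polish_space measure" and \<phi> \<Upsilon>
    and M :: "'w measure" and X Y \<mu> \<xi> x l +
  assumes tightness: "\<And>T :: nat \<Rightarrow> nat. mono T \<Longrightarrow> (\<And>N. 1 \<le> T N) \<Longrightarrow> filterlim T at_top sequentially \<Longrightarrow>
        tight_family {averaged_law M (particle_filter \<Upsilon> Y x N) (T N) | N. 1 \<le> N}"
begin

text \<open>Tightness is assumed for horizons indexed by all particle numbers, whereas the bad
  horizons are given only at the numbers \<open>n j\<close>. The step function that takes at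
  \<open>N\<close> the largest horizon reached so far fills the gaps.\<close>

lemma horizon_interpolation:
  fixes n T :: "nat \<Rightarrow> nat"
  assumes n: "strict_mono n" and T: "strict_mono T" "\<And>j. 1 \<le> T j"
  obtains U where "mono U" "\<And>N. 1 \<le> U N" "filterlim U at_top sequentially" "\<And>j. U (n j) = T j"
proof -
  \<comment> \<open>The element \<open>1\<close> keeps the set nonempty when \<open>N\<close> lies
    below the first \<open>n j\<close>.\<close>
  define S where "S N = insert 1 (T ` {j. n j \<le> N})" for N
  have fin: "finite (S N)" for N
  proof -
    have "{j. n j \<le> N} \<subseteq> {..N}" using seq_suble[OF n] by (auto intro: order_trans)
    then show ?thesis unfolding S_def by (auto intro: finite_subset)
  qed
  show thesis
  proof (rule that[of "\<lambda>N. Max (S N)"])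
    show m: "mono (\<lambda>N. Max (S N))" by (intro monoI Max_mono fin) (auto simp: S_def)
    show "1 \<le> Max (S N)" for N using fin by (intro Max_ge) (auto simp: S_def)
    show e: "Max (S (n j)) = T j" for j
    proof (rule Max_eqI[OF fin])
      show "y \<le> T j" if "y \<in> S (n j)" for y
        using that T(2)[of j] strict_mono_less_eq[OF n] strict_mono_less_eq[OF T(1)] by (auto simp: S_def)
    qed (auto simp: S_def)
    show "filterlim (\<lambda>N. Max (S N)) at_top sequentially"
      unfolding filterlim_at_top eventually_sequentially
    proof (intro allI exI impI)
      fix Z N assume "n Z \<le> N"
      then have "T Z \<le> Max (S N)" using monoD[OF m, of "n Z" N] e[of Z] by simp
      then show "Z \<le> Max (S N)" using seq_suble[OF T(1), of Z] by simp
    qed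
  qed
qed

text \<open>The interpolated horizons make the particle filters tight in the mean; the exact filters
  are so because their mean laws are the iterates of \<open>\<mu>\<close>. Then
  \<open>occupation_limit\<close> excludes that all averages stay above \<open>e\<close>.\<close>

lemma no_bad_horizons:
  fixes n T :: "nat \<Rightarrow> nat"
  assumes n: "strict_mono n" "\<And>j. 1 \<le> n j" and T: "strict_mono T" "\<And>j. 1 \<le> T j" and e: "e > 0"
  shows "\<exists>j. (\<Sum>k=1..T j. cost bl_dist (n j) k) / real (T j) \<le> e"
proof -
  obtain U where U: "mono U" "\<And>N. 1 \<le> U N" "filterlim U at_top sequentially" "\<And>j. U (n j) = T j"
    using horizon_interpolation[OF n(1) T] by blast
  have tf: "tight_family {averaged_law M (pfilt N) (U N) | N. 1 \<le> N}" by (rule tightness[OF U(1-3)])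
  have tight: "\<exists>C. compact C \<and> (\<forall>j. (LINT p|occupation (n j) (T j). measure (fst p) (UNIV - C) + measure (snd p) (UNIV - C)) \<le> d)"
    if d: "d > 0" for d
  proof -
    obtain C where C: "compact C" "\<And>j. measure (averaged_law M (pfilt (n j)) (T j)) (UNIV - C) \<le> d / 2"
    proof -
      have "\<exists>C. compact C \<and> (\<forall>\<nu>\<in>{averaged_law M (pfilt N) (U N) | N. 1 \<le> N}. measure \<nu> (UNIV - C) \<le> d / 2)"
        using tf half_gt_zero[OF d] unfolding tight_family_def by blast
      then obtain C where C: "compact C" "\<And>N. 1 \<le> N \<Longrightarrow> measure (averaged_law M (pfilt N) (U N)) (UNIV - C) \<le> d / 2" by blast
      show thesis using C(2)[OF n(2)] by (intro that[OF C(1)]) (simp add: U(4))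
    qed
    obtain D where D: "compact D" "\<And>k. measure (((\<lambda>m. m \<bind> P) ^^ k) \<mu>) (UNIV - D) \<le> d / 2"
      using iterates_tight[OF \<mu>_PA, of "d / 2"] d by auto
    have CD: "compact (C \<union> D)" by (rule compact_Un[OF C(1) D(1)])
    note b = compact_compl_borel
    have "(LINT p|occupation (n j) (T j). measure (fst p) (UNIV - (C \<union> D)) + measure (snd p) (UNIV - (C \<union> D))) \<le> d" for j
    proof -
      let ?Q = "occupation (n j) (T j)"
      note Q = occupation_prob[OF n(2)[of j] T(2)[of j]]
      have i: "integrable ?Q (\<lambda>p. measure (fst p) S)" "integrable ?Q (\<lambda>p. measure (snd p) S)" if "S \<in> sets borel" for S
        by (rule pa_integrable[OF Q measure_kernel_meas[OF that], of _ 1];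
            auto simp: space_pair_measure dest!: PA_D(1) intro: prob_space.prob_le_1)+
      have mono: "measure (f p) (UNIV - (C \<union> D)) \<le> measure (f p) (UNIV - S)"
        if "f \<in> {fst, snd}" "p \<in> space ?Q" "S \<in> {C, D}" for f p S
        using that b[OF C(1)] b[OF D(1)] by (intro PA_measure_mono) (auto simp: occupation_def space_pair_measure)
      have "(LINT p|?Q. measure (fst p) (UNIV - (C \<union> D)) + measure (snd p) (UNIV - (C \<union> D)))
          \<le> (LINT p|?Q. measure (fst p) (UNIV - C) + measure (snd p) (UNIV - D))"
        by (intro integral_mono Bochner_Integration.integrable_add i b CD C D add_mono mono) auto
      also have "\<dots> = (LINT p|?Q. measure (fst p) (UNIV - C)) + (LINT p|?Q. measure (snd p) (UNIV - D))"
        by (intro Bochner_Integration.integral_add i b C D)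
      also have "\<dots> \<le> d / 2 + d / 2"
        unfolding measure_averaged_law[OF n(2) T(2) b[OF C(1)]]
        by (intro add_mono C measure_filt_occupation n T b D)
      finally show ?thesis by simp
    qed
    then show ?thesis using CD by blast
  qed
  have step: "(\<lambda>j. (LINT p|occupation (n j) (T j). Dist (Suc r) (fst p) (snd p)) - (LINT p|occupation (n j) (T j). Dist r (fst p) (snd p))) \<longlonglongrightarrow> 0" for r
    by (intro occupation_step n T filterlim_subseq tight)
  obtain j where "(LINT p|occupation (n j) (T j). bl_dist (fst p) (snd p)) \<le> e"
    using occupation_limit[OF occupation_prob[OF n(2) T(2)] tight step e] by blast
  then show ?thesis using integral_occupation_cost[OF n(2)[of j] T(2)[of j], of 0] by auto
qed

lemma uniform_consistency:
  assumes e: "e > 0"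
  shows "\<exists>N0. \<forall>N\<ge>N0. \<forall>T\<ge>1. (\<Sum>k=1..T. cost bl_dist N k) / real T \<le> e"
proof (rule ccontr)
  let ?A = "\<lambda>N T. (\<Sum>k=1..T. cost bl_dist N k) / real T"
  assume neg: "\<not> ?thesis"
  \<comment> \<open>Violations occur beyond any bounds: up to time \<open>t0\<close> every single
    cost is below \<open>e\<close> once \<open>N\<close> is large, so a violating horizon must
    exceed \<open>t0\<close>.\<close>
  have "\<exists>N T. n0 < N \<and> t0 < T \<and> e < ?A N T" for n0 t0
  proof -
    have "eventually (\<lambda>n. \<forall>k\<in>{1..t0}. cost bl_dist (Suc n) k < e) sequentially"
      by (intro eventually_ball_finite ballI order_tendstoD(2)[OF cost_tendsto e]) simp
    then obtain m where m: "n \<ge> m \<Longrightarrow> k \<in> {1..t0} \<Longrightarrow> cost bl_dist (Suc n) k < e" for n k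
      unfolding eventually_sequentially by blast
    obtain N T where N: "Suc (max m n0) \<le> N" "1 \<le> T" "e < ?A N T" using neg by (metis not_le)
    have "t0 < T"
    proof (rule ccontr)
      assume "\<not> t0 < T"
      then have "(\<Sum>k=1..T. cost bl_dist N k) \<le> (\<Sum>k=1..T. e)"
        using m[of "N - 1"] N(1) by (intro sum_mono less_imp_le) auto
      then show False using N(2,3) by (simp add: field_simps)
    qed
    then show ?thesis using N by (intro exI[of _ N] exI[of _ T]) auto
  qed
  then obtain f g where "\<forall>n t. n < f n t \<and> t < g n t \<and> e < ?A (f n t) (g n t)" by metis
  then have fg: "n < f n t" "t < g n t" "e < ?A (f n t) (g n t)" for n t by blast+
  \<comment> \<open>Iterating the choice functions makes particle number and horizon increase
    strictly at once, as \<open>no_bad_horizons\<close> demands.\<close>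
  define c where "c = rec_nat (f 0 0, g 0 0) (\<lambda>_ p. (f (fst p) (snd p), g (fst p) (snd p)))"
  have c: "c 0 = (f 0 0, g 0 0)" "c (Suc j) = (f (fst (c j)) (snd (c j)), g (fst (c j)) (snd (c j)))" for j
    by (simp_all add: c_def)
  have s: "strict_mono (\<lambda>j. fst (c j))" "strict_mono (\<lambda>j. snd (c j))" unfolding strict_mono_Suc_iff using fg by (auto simp: c)
  have ge: "1 \<le> fst (c j)" "1 \<le> snd (c j)" "e < ?A (fst (c j)) (snd (c j))" for j
  proof -
    have "0 < f n t" "0 < g n t" for n t using fg(1)[of n t] fg(2)[of t n] by simp_all
    then show "1 \<le> fst (c j)" "1 \<le> snd (c j)" by (cases j; simp add: c Suc_le_eq)+
    show "e < ?A (fst (c j)) (snd (c j))" using fg(3) by (cases j) (simp_all add: c)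
  qed
  show False using no_bad_horizons[OF s(1) ge(1) s(2) ge(2) e] ge(3) by (meson not_le)
qed

end

theorem corollary3p3:
  fixes M :: "'w measure"
    and X :: "nat \<Rightarrow> 'w \<Rightarrow> 'e::polish_space"
    and Y :: "nat \<Rightarrow> 'w \<Rightarrow> 'f::polish_space"
    and \<mu> :: "'e measure"
    and P :: "'e \<Rightarrow> 'e measure"
    and \<Phi> :: "'e \<Rightarrow> 'f measure"
    and \<phi> :: "'f measure"
    and \<Upsilon> :: "'e \<Rightarrow> 'f \<Rightarrow> real"
    and \<xi> :: "nat \<times> nat \<Rightarrow> 'w \<Rightarrow> real"
    and x :: "nat \<Rightarrow> nat \<Rightarrow> nat \<Rightarrow> 'w \<Rightarrow> 'e"
  assumes hmm: "hidden_markov_model M X Y \<mu> P \<Phi>"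
    and nondegeneracy: "nondegenerate \<Phi> \<phi> \<Upsilon>"
    and ergodicity: "ergodic_kernel P"
    and feller: "feller P"
    and likelihood_continuous: "\<And>y. continuous_on UNIV (\<lambda>z. \<Upsilon> z y)"
    and likelihood_bounded: "\<And>y. bounded (range (\<lambda>z. \<Upsilon> z y))"
    and inputs: "uniform_inputs M X Y \<xi>"
    and particles: "bootstrap_particles M Y \<mu> P \<Upsilon> \<xi> x"
    and tightness: "\<And>T :: nat \<Rightarrow> nat. mono T \<Longrightarrow> (\<And>N. 1 \<le> T N) \<Longrightarrow> filterlim T at_top sequentially \<Longrightarrow>
        tight_family {averaged_law M (particle_filter \<Upsilon> Y x N) (T N) | N. 1 \<le> N}"
  shows "(\<lambda>N. SUP T \<in> {1::nat..}. \<integral>\<^sup>+\<omega>. ennreal ((1 / real T) *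
        (\<Sum>k=1..T. bl_dist (particle_filter \<Upsilon> Y x N k \<omega>) (nonlinear_filter \<mu> P \<Upsilon> Y k \<omega>))) \<partial>M)
      \<longlonglongrightarrow> 0"
proof -
  obtain l where l: "l \<in> space PA" "\<And>\<nu>. \<nu> \<in> space PA \<Longrightarrow> (\<lambda>k. tv_dist (((\<lambda>m. m \<bind> P) ^^ k) \<nu>) l) \<longlonglongrightarrow> 0"
    using ergodicity unfolding ergodic_kernel_def by blast
  interpret ergodic_hidden_markov P \<Phi> \<phi> \<Upsilon> M X Y \<mu> \<xi> x l
    using hmm by unfold_locales
      (rule tightness hmm; assumption | simp add: hidden_markov_model_def nondegeneracy feller likelihood_continuous likelihood_bounded inputs particles l)+
  \<comment> \<open>The costs are real expectations and the claim is in extended reals; for positive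
    \<open>N\<close> and \<open>T\<close> the two agree.\<close>
  have mean: "(\<integral>\<^sup>+w. ennreal ((1 / real T) * (\<Sum>k=1..T. bl_dist (pfilt N k w) (filt k w))) \<partial>M)
      = ennreal ((\<Sum>k=1..T. cost bl_dist N k) / real T)" if "1 \<le> N" "1 \<le> T" for N T
  proof -
    note b = cost_integrand[OF that(1) good_bl_dist]
    have m: "ennreal (1 / real T * S) = ennreal (1 / real T) * ennreal S" for S by (rule ennreal_mult') simp
    have "(\<integral>\<^sup>+w. ennreal ((1 / real T) * (\<Sum>k=1..T. bl_dist (pfilt N k w) (filt k w))) \<partial>M)
      = ennreal (1 / real T) * (\<Sum>k=1..T. ennreal (cost bl_dist N k))"
      using b(1) unfolding m sum_ennreal[OF b(2), symmetric]
      by (simp add: nn_integral_cmult nn_integral_sum cost_nn[OF that(1) good_bl_dist])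
    also have "\<dots> = ennreal (1 / real T * (\<Sum>k=1..T. cost bl_dist N k))"
      unfolding m using cost_bounds(1)[OF that(1) good_bl_dist] by (simp only: sum_ennreal)
    finally show ?thesis by simp
  qed
  show ?thesis
  proof (rule order_tendstoI)
    fix a :: ennreal assume "0 < a"
    then obtain e where e: "0 < e" "e < a" using dense by blast
    then obtain r where r: "e = ennreal r" "0 < r" by (cases e) (auto simp: ennreal_less_zero_iff)
    obtain N0 where N0: "\<And>N T. N \<ge> N0 \<Longrightarrow> T \<ge> 1 \<Longrightarrow> (\<Sum>k=1..T. cost bl_dist N k) / real T \<le> r"
      using uniform_consistency[OF r(2)] by blast
    \<comment> \<open>Without particles the empirical measure is not a probability, so
      \<open>N\<close> is kept above \<open>1\<close> as well as above \<open>N0\<close>.\<close>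
    show "eventually (\<lambda>N. (SUP T \<in> {1::nat..}. \<integral>\<^sup>+w. ennreal ((1 / real T) *
        (\<Sum>k=1..T. bl_dist (pfilt N k w) (filt k w))) \<partial>M) < a) sequentially"
      using eventually_ge_at_top[of "max 1 N0"]
    proof eventually_elim
      case (elim N)
      have "(SUP T \<in> {1::nat..}. \<integral>\<^sup>+w. ennreal ((1 / real T) * (\<Sum>k=1..T. bl_dist (pfilt N k w) (filt k w))) \<partial>M) \<le> e"
        unfolding r(1) proof (rule SUP_least)
          fix T :: nat assume "T \<in> {1..}"
          then show "(\<integral>\<^sup>+w. ennreal ((1 / real T) * (\<Sum>k=1..T. bl_dist (pfilt N k w) (filt k w))) \<partial>M) \<le> ennreal r"
            using elim N0[of N T] by (subst mean) (auto intro: ennreal_leI)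
        qed
      then show ?case using e(2) by (rule le_less_trans)
    qed
  qed simp
qed

end
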